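(* Let $\rho:[0,T]\times L^2(\mathcal F_T)\to\mathbb R$, $(t,X)\mapsto\rho(t,X)$, be a collection of monotonic and translation invariant static risk measures (see context) which are continuous in time (for each fixed $X$, $t\mapsto\rho(t,X)$ is continuous on $[0,T]$) and Lipschitz in space: there is a constant $C$ such that $$|\rho(t,X)-\rho(t,X')|\le C\,\mathbb E[|X-X'|],\qquad 0\le t\le T,\quad X,X'\in L^2(\mathcal F_t).$$ Let $q:[0,T]\to\mathbb R$ be a continuous deterministic function, let $f$ satisfy $(H_f)$ (as written out in the context), and let $\xi\in L^2(\mathcal F_T)$ satisfy $\rho(T,\xi)\le q_T$. Then the BSDE with risk measure reflection $$Y_t=\xi+\int_t^T f(s,Y_s,Z_s)\,ds-\int_t^T Z_s\cdot dB_s+K_T-K_t,\qquad 0\le t\le T,$$ $$\rho(t,Y_t)\le q_t,\quad 0\le t\le T,\qquad \int_0^T[q_t-\rho(t,Y_t)]\,dK_t=0,$$ admits a unique deterministic flat solution, i.e. a unique solution $(Y,Z,K)\in\mathcal S^2\times\mathcal H^2\times\mathcal A^2_D$. Besides, if $f$ is of the form $f(t,y,z)=a_t\,y+h(t,z)$ with $a:[0,T]\to\mathbb R$ a deterministic and bounded measurable function, then the deterministic flat solution is minimal among all deterministic solutions: for every $(Y',Z',K')\in\mathcal S^2\times\mathcal H^2\times\mathcal A^2_D$ satisfying the first equation and $\rho(t,Y'_t)\le q_t$ for all $t\in[0,T]$, one has, $\mathbb P$-a.s., $Y_t\le Y'_t$ for all $t\in[0,T]$.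
   Context: $T>0$ is finite; $(\Omega,\mathcal F,\mathbb P)$ is a complete probability space carrying a $d$-dimensional standard Brownian motion $B=(B_t)_{0\le t\le T}$, with usual augmented filtration $\{\mathcal F_t\}_{0\le t\le T}$. $L^2(\mathcal F_t)$: real-valued $\mathcal F_t$-measurable square integrable random variables. $\mathcal S^2$: real-valued adapted continuous processes $Y$ with $\mathbb E[\sup_{0\le t\le T}|Y_t|^2]<\infty$. $\mathcal H^2$: predictable $\mathbb R^d$-valued processes $Z$ with $\mathbb E[\int_0^T|Z_s|^2ds]<\infty$. $\mathcal A^2$: nondecreasing processes $K\in\mathcal S^2$ with $K_0=0$; $\mathcal A^2_D$: the deterministic elements of $\mathcal A^2$. Uniqueness is understood in these spaces (indistinguishability for $Y$ and $K$, $d\mathbb P\otimes dt$-a.e. equality for $Z$). For fixed $t$, $\rho(t,\cdot)$ is a static risk measure if $\rho(t,0)=0$ and: (monotonicity) $X\le X'$ implies $\rho(t,X)\ge\rho(t,X')$ for $X,X'\in L^2(\mathcal F_t)$; (translation invariance) $\rho(t,X+m)=\rho(t,X)-m$ for $X\in L^2(\mathcal F_t)$ and $m\in\mathbb R$. $(H_f)$: $f:\Omega\times[0,T]\times\mathbb R\times\mathbb R^d\to\mathbb R$ is measurable with respect to $\mathcal P\otimes\mathcal B(\mathbb R)\otimes\mathcal B(\mathbb R^d)$, $\mathcal P$ being the progressive $\sigma$-algebra on $\Omega\times[0,T]$; there is $\lambda\ge0$ such that $\mathbb P$-a.s., for all $t\in[0,T]$ and all $y,p\in\mathbb R$, $z,q\in\mathbb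 R^d$, $|f(t,y,z)-f(t,p,q)|\le\lambda(|y-p|+|z-q|)$; and $\mathbb E[\int_0^T|f(t,0,0)|^2dt]<\infty$. *)

theory Defs
  imports "HOL-Probability.Probability"
begin

section \<open>Brownian motion and its augmented filtration\<close>

text \<open>
  Time is the real interval \<open>{0..T}\<close>; processes are functions of type
  \<open>real \<Rightarrow> 'a \<Rightarrow> _\<close>, and their values at times outside \<open>{0..T}\<close> never matter.
\<close>

definition path_events :: "'a measure \<Rightarrow> (real \<Rightarrow> 'a \<Rightarrow> real ^ 'd) \<Rightarrow> real \<Rightarrow> 'a set set" where
  "path_events M B t = {B s -` A \<inter> space M | s A. s \<in> {0..t} \<and> A \<in> sets borel}"

definition natural_filtration :: "'a measure \<Rightarrow> (real \<Rightarrow> 'a \<Rightarrow> real ^ 'd) \<Rightarrow> real \<Rightarrow> 'a measure" where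
  "natural_filtration M B t = sigma (space M) (path_events M B t)"

text \<open>
  The filtration generated by \<open>B\<close> and all null sets.  For a Brownian motion it is already
  right-continuous.  As usual for filtrations in the library, only the \<open>sets\<close>
  of these measures are relevant.
\<close>

definition augmented_filtration :: "'a measure \<Rightarrow> (real \<Rightarrow> 'a \<Rightarrow> real ^ 'd) \<Rightarrow> real \<Rightarrow> 'a measure" where
  "augmented_filtration M B t = sigma (space M) (path_events M B t \<union> null_sets M)"

text \<open>
  The increment over \<open>[s, t]\<close> has law \<open>N(0, (t - s) I)\<close>; the second parameter of
  \<^const>\<open>normal_density\<close> is the standard deviation.
\<close>

locale brownian_motion = prob_space M + complete_measure M
  for M :: "'a measure" and T :: real and B :: "real \<Rightarrow> 'a \<Rightarrow> real ^ 'd" +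
  assumes horizon_pos: "0 < T"
    and measurable_B: "\<And>t. t \<in> {0..T} \<Longrightarrow> B t \<in> borel_measurable M"
    and start_zero: "AE \<omega> in M. B 0 \<omega> = 0"
    and continuous_paths: "AE \<omega> in M. continuous_on {0..T} (\<lambda>t. B t \<omega>)"
    and independent_increments: "\<And>s t. 0 \<le> s \<Longrightarrow> s < t \<Longrightarrow> t \<le> T \<Longrightarrow>
      indep_set (sets (natural_filtration M B s))
        (sets (vimage_algebra (space M) (\<lambda>\<omega>. B t \<omega> - B s \<omega>) borel))"
    and gaussian_increments: "\<And>s t. 0 \<le> s \<Longrightarrow> s < t \<Longrightarrow> t \<le> T \<Longrightarrow>
      distributed M lborel (\<lambda>\<omega>. B t \<omega> - B s \<omega>)
        (\<lambda>x. ennreal (\<Prod>i\<in>UNIV. normal_density 0 (sqrt (t - s)) (x $ i)))"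

section \<open>Spaces of random variables and processes\<close>

definition L2 :: "'a measure \<Rightarrow> 'a measure \<Rightarrow> ('a \<Rightarrow> real) set" where
  "L2 M G = {X. X \<in> borel_measurable G \<and> integrable M (\<lambda>\<omega>. (X \<omega>)\<^sup>2)}"

definition adapted :: "real \<Rightarrow> (real \<Rightarrow> 'a measure) \<Rightarrow> (real \<Rightarrow> 'a \<Rightarrow> real) \<Rightarrow> bool" where
  "adapted T F Y \<longleftrightarrow> (\<forall>t\<in>{0..T}. Y t \<in> borel_measurable (F t))"

definition continuous_process :: "'a measure \<Rightarrow> real \<Rightarrow> (real \<Rightarrow> 'a \<Rightarrow> real) \<Rightarrow> bool" where
  "continuous_process M T Y \<longleftrightarrow> (AE \<omega> in M. continuous_on {0..T} (\<lambda>t. Y t \<omega>))"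

definition S2 :: "'a measure \<Rightarrow> real \<Rightarrow> (real \<Rightarrow> 'a measure) \<Rightarrow> (real \<Rightarrow> 'a \<Rightarrow> real) set" where
  "S2 M T F = {Y. adapted T F Y \<and> continuous_process M T Y \<and>
     (\<integral>\<^sup>+\<omega>. (SUP t\<in>{0..T}. ennreal \<bar>Y t \<omega>\<bar>)\<^sup>2 \<partial>M) < \<infinity>}"

definition A2 :: "'a measure \<Rightarrow> real \<Rightarrow> (real \<Rightarrow> 'a measure) \<Rightarrow> (real \<Rightarrow> 'a \<Rightarrow> real) set" where
  "A2 M T F = {K \<in> S2 M T F. AE \<omega> in M. K 0 \<omega> = 0 \<and> mono_on {0..T} (\<lambda>t. K t \<omega>)}"

text \<open>A deterministic process is represented by the function of time that it is.\<close>

definition A2D :: "'a measure \<Rightarrow> real \<Rightarrow> (real \<Rightarrow> 'a measure) \<Rightarrow> (real \<Rightarrow> real) set" where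
  "A2D M T F = {k. (\<lambda>t \<omega>. k t) \<in> A2 M T F}"

definition predictable_sigma :: "'a measure \<Rightarrow> real \<Rightarrow> (real \<Rightarrow> 'a measure) \<Rightarrow> ('a \<times> real) measure" where
  "predictable_sigma M T F = sigma (space M \<times> {0..T})
     ({A \<times> {0} | A. A \<in> sets (F 0)} \<union>
      {A \<times> {s<..t} | A s t. 0 \<le> s \<and> s < t \<and> t \<le> T \<and> A \<in> sets (F s)})"

definition H2 :: "'a measure \<Rightarrow> real \<Rightarrow> (real \<Rightarrow> 'a measure) \<Rightarrow> (real \<Rightarrow> 'a \<Rightarrow> real ^ 'd) set" where
  "H2 M T F = {Z. (\<lambda>(\<omega>, t). Z t \<omega>) \<in> borel_measurable (predictable_sigma M T F) \<and>
     (\<integral>\<^sup>+\<omega>. (\<integral>\<^sup>+s\<in>{0..T}. ennreal ((norm (Z s \<omega>))\<^sup>2) \<partial>lborel) \<partial>M) < \<infinity>}"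

text \<open>The generating family below is itself a sigma-algebra.\<close>

definition progressive_sigma :: "'a measure \<Rightarrow> real \<Rightarrow> (real \<Rightarrow> 'a measure) \<Rightarrow> ('a \<times> real) measure" where
  "progressive_sigma M T F = sigma (space M \<times> {0..T})
     {A. A \<subseteq> space M \<times> {0..T} \<and>
         (\<forall>t\<in>{0..T}. A \<inter> (space M \<times> {0..t}) \<in> sets (F t \<Otimes>\<^sub>M restrict_space borel {0..t}))}"

section \<open>The Ito integral\<close>

text \<open>
  Simple integrands \<open>\<Sum>i<n. h i * indicator {\<tau> i<..\<tau> (i + 1)}\<close> with \<open>h i\<close> bounded and
  \<open>F (\<tau> i)\<close>-measurable.
\<close>

definition simple_integrand ::
  "'a measure \<Rightarrow> real \<Rightarrow> (real \<Rightarrow> 'a measure) \<Rightarrow> nat \<Rightarrow> (nat \<Rightarrow> real) \<Rightarrow> (nat \<Rightarrow> 'a \<Rightarrow> real ^ 'd) \<Rightarrow> bool" where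
  "simple_integrand M T F n \<tau> h \<longleftrightarrow>
     (\<forall>i\<le>n. \<tau> i \<in> {0..T}) \<and> (\<forall>i<n. \<tau> i < \<tau> (Suc i)) \<and>
     (\<forall>i<n. h i \<in> borel_measurable (F (\<tau> i)) \<and> (\<exists>c. \<forall>\<omega>\<in>space M. norm (h i \<omega>) \<le> c))"

definition simple_process ::
  "nat \<Rightarrow> (nat \<Rightarrow> real) \<Rightarrow> (nat \<Rightarrow> 'a \<Rightarrow> real ^ 'd) \<Rightarrow> real \<Rightarrow> 'a \<Rightarrow> real ^ 'd" where
  "simple_process n \<tau> h s \<omega> = (\<Sum>i<n. if s \<in> {\<tau> i<..\<tau> (Suc i)} then h i \<omega> else 0)"

definition simple_integral ::
  "(real \<Rightarrow> 'a \<Rightarrow> real ^ 'd) \<Rightarrow> nat \<Rightarrow> (nat \<Rightarrow> real) \<Rightarrow> (nat \<Rightarrow> 'a \<Rightarrow> real ^ 'd) \<Rightarrow> real \<Rightarrow> 'a \<Rightarrow> real" where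
  "simple_integral B n \<tau> h t \<omega> =
     (\<Sum>i<n. h i \<omega> \<bullet> (B (min t (\<tau> (Suc i))) \<omega> - B (min t (\<tau> i)) \<omega>))"

text \<open>
  \<open>I\<close> is a continuous version of the process \<open>t \<mapsto> \<integral>\<^sub>0\<^sup>t Z\<^sub>s \<cdot> dB\<^sub>s\<close>, obtained as the limit in square mean
  of the integrals of simple integrands that approximate \<open>Z\<close> in \<open>L\<^sup>2(dP \<otimes> dt)\<close>.  For
  \<open>Z \<in> H2\<close> such a version exists and is unique up to indistinguishability.
\<close>

definition has_ito_integral ::
  "'a measure \<Rightarrow> real \<Rightarrow> (real \<Rightarrow> 'a \<Rightarrow> real ^ 'd) \<Rightarrow> (real \<Rightarrow> 'a \<Rightarrow> real ^ 'd) \<Rightarrow> (real \<Rightarrow> 'a \<Rightarrow> real) \<Rightarrow> bool" where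
  "has_ito_integral M T B Z I \<longleftrightarrow>
     adapted T (augmented_filtration M B) I \<and> continuous_process M T I \<and>
     (\<exists>n \<tau> h.
       (\<forall>k. simple_integrand M T (augmented_filtration M B) (n k) (\<tau> k) (h k)) \<and>
       (\<lambda>k. \<integral>\<^sup>+\<omega>. (\<integral>\<^sup>+s\<in>{0..T}.
          ennreal ((norm (Z s \<omega> - simple_process (n k) (\<tau> k) (h k) s \<omega>))\<^sup>2) \<partial>lborel) \<partial>M)
         \<longlonglongrightarrow> 0 \<and>
       (\<forall>t\<in>{0..T}. (\<lambda>k. \<integral>\<^sup>+\<omega>. ennreal ((I t \<omega> - simple_integral B (n k) (\<tau> k) (h k) t \<omega>)\<^sup>2) \<partial>M)
         \<longlonglongrightarrow> 0))"

definition ito_integral ::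
  "'a measure \<Rightarrow> real \<Rightarrow> (real \<Rightarrow> 'a \<Rightarrow> real ^ 'd) \<Rightarrow> (real \<Rightarrow> 'a \<Rightarrow> real ^ 'd) \<Rightarrow> real \<Rightarrow> 'a \<Rightarrow> real" where
  "ito_integral M T B Z = (SOME I. has_ito_integral M T B Z I)"

section \<open>Static risk measures and the standing assumption on the generator\<close>

definition static_risk_measure :: "'a measure \<Rightarrow> 'a measure \<Rightarrow> (('a \<Rightarrow> real) \<Rightarrow> real) \<Rightarrow> bool" where
  "static_risk_measure M G r \<longleftrightarrow>
     r (\<lambda>\<omega>. 0) = 0 \<and>
     (\<forall>X\<in>L2 M G. \<forall>X'\<in>L2 M G. (AE \<omega> in M. X \<omega> \<le> X' \<omega>) \<longrightarrow> r X' \<le> r X) \<and>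
     (\<forall>X\<in>L2 M G. \<forall>m. r (\<lambda>\<omega>. X \<omega> + m) = r X - m)"

definition generator_assumption ::
  "'a measure \<Rightarrow> real \<Rightarrow> (real \<Rightarrow> 'a measure) \<Rightarrow> ('a \<Rightarrow> real \<Rightarrow> real \<Rightarrow> real ^ 'd \<Rightarrow> real) \<Rightarrow> bool" where
  "generator_assumption M T F f \<longleftrightarrow>
     (\<lambda>((\<omega>, t), y, z). f \<omega> t y z)
       \<in> borel_measurable (progressive_sigma M T F \<Otimes>\<^sub>M (borel \<Otimes>\<^sub>M borel)) \<and>
     (\<exists>l\<ge>0. AE \<omega> in M. \<forall>t\<in>{0..T}. \<forall>y p z q.
        \<bar>f \<omega> t y z - f \<omega> t p q\<bar> \<le> l * (\<bar>y - p\<bar> + norm (z - q))) \<and>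
     (\<integral>\<^sup>+\<omega>. (\<integral>\<^sup>+t\<in>{0..T}. ennreal (\<bar>f \<omega> t 0 0\<bar>\<^sup>2) \<partial>lborel) \<partial>M) < \<infinity>"

section \<open>Solutions of the BSDE with risk measure reflection\<close>

definition deterministic_solution ::
  "'a measure \<Rightarrow> real \<Rightarrow> (real \<Rightarrow> 'a \<Rightarrow> real ^ 'd) \<Rightarrow> (real \<Rightarrow> ('a \<Rightarrow> real) \<Rightarrow> real) \<Rightarrow> (real \<Rightarrow> real) \<Rightarrow>
   ('a \<Rightarrow> real \<Rightarrow> real \<Rightarrow> real ^ 'd \<Rightarrow> real) \<Rightarrow> ('a \<Rightarrow> real) \<Rightarrow>
   (real \<Rightarrow> 'a \<Rightarrow> real) \<Rightarrow> (real \<Rightarrow> 'a \<Rightarrow> real ^ 'd) \<Rightarrow> (real \<Rightarrow> real) \<Rightarrow> bool" where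
  "deterministic_solution M T B \<rho> q f \<xi> Y Z K \<longleftrightarrow>
     Y \<in> S2 M T (augmented_filtration M B) \<and>
     Z \<in> H2 M T (augmented_filtration M B) \<and>
     K \<in> A2D M T (augmented_filtration M B) \<and>
     (AE \<omega> in M. \<forall>t\<in>{0..T}.
        Y t \<omega> = \<xi> \<omega> + (LBINT s:{t..T}. f \<omega> s (Y s \<omega>) (Z s \<omega>))
          - (ito_integral M T B Z T \<omega> - ito_integral M T B Z t \<omega>) + K T - K t) \<and>
     (\<forall>t\<in>{0..T}. \<rho> t (Y t) \<le> q t)"

text \<open>
  \<^const>\<open>interval_measure\<close> needs a distribution function on the whole line, so \<open>K\<close> is extended by
  its boundary values; the extension adds no mass outside \<open>{0..T}\<close>.
\<close>

definition stieltjes_measure :: "real \<Rightarrow> (real \<Rightarrow> real) \<Rightarrow> real measure" where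
  "stieltjes_measure T K = interval_measure (\<lambda>t. K (max 0 (min T t)))"

text \<open>
  Integrability is spelled out because the Bochner integral of a non-integrable function is
  \<open>0\<close> by convention.
\<close>

definition flat ::
  "real \<Rightarrow> (real \<Rightarrow> ('a \<Rightarrow> real) \<Rightarrow> real) \<Rightarrow> (real \<Rightarrow> real) \<Rightarrow> (real \<Rightarrow> 'a \<Rightarrow> real) \<Rightarrow> (real \<Rightarrow> real) \<Rightarrow> bool" where
  "flat T \<rho> q Y K \<longleftrightarrow>
     set_integrable (stieltjes_measure T K) {0..T} (\<lambda>t. q t - \<rho> t (Y t)) \<and>
     (LINT t:{0..T}|stieltjes_measure T K. q t - \<rho> t (Y t)) = 0"

definition deterministic_flat_solution ::
  "'a measure \<Rightarrow> real \<Rightarrow> (real \<Rightarrow> 'a \<Rightarrow> real ^ 'd) \<Rightarrow> (real \<Rightarrow> ('a \<Rightarrow> real) \<Rightarrow> real) \<Rightarrow> (real \<Rightarrow> real) \<Rightarrow>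
   ('a \<Rightarrow> real \<Rightarrow> real \<Rightarrow> real ^ 'd \<Rightarrow> real) \<Rightarrow> ('a \<Rightarrow> real) \<Rightarrow>
   (real \<Rightarrow> 'a \<Rightarrow> real) \<Rightarrow> (real \<Rightarrow> 'a \<Rightarrow> real ^ 'd) \<Rightarrow> (real \<Rightarrow> real) \<Rightarrow> bool" where
  "deterministic_flat_solution M T B \<rho> q f \<xi> Y Z K \<longleftrightarrow>
     deterministic_solution M T B \<rho> q f \<xi> Y Z K \<and> flat T \<rho> q Y K"

definition same_solution ::
  "'a measure \<Rightarrow> real \<Rightarrow>
   (real \<Rightarrow> 'a \<Rightarrow> real) \<Rightarrow> (real \<Rightarrow> 'a \<Rightarrow> real ^ 'd) \<Rightarrow> (real \<Rightarrow> real) \<Rightarrow>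
   (real \<Rightarrow> 'a \<Rightarrow> real) \<Rightarrow> (real \<Rightarrow> 'a \<Rightarrow> real ^ 'd) \<Rightarrow> (real \<Rightarrow> real) \<Rightarrow> bool" where
  "same_solution M T Y Z K Y' Z' K' \<longleftrightarrow>
     (AE \<omega> in M. \<forall>t\<in>{0..T}. Y t \<omega> = Y' t \<omega>) \<and>
     (AE (\<omega>, t) in M \<Otimes>\<^sub>M restrict_space lborel {0..T}. Z t \<omega> = Z' t \<omega>) \<and>
     (\<forall>t\<in>{0..T}. K t = K' t)"

end

theory Submission
  imports Defs
begin

text \<open>
  Write \<open>R\<^sub>t = K\<^sub>T - K\<^sub>t\<close> and \<open>X = Y - R\<close>.  Since \<open>R\<close> is deterministic, \<open>X\<close> solves the linear
  equation with driver \<open>g = f(\<cdot>, Y, Z)\<close>, and by translation invariance the constraint and the flatness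
  condition say that \<open>R\<close> solves the backward Skorokhod problem for the continuous function
  \<open>t \<mapsto> \<rho>(t, X\<^sub>t) - q\<^sub>t\<close>, i.e. \<open>R\<^sub>t = sup\<^bsub>s \<ge> t\<^esub> (\<rho>(s, X\<^sub>s) - q\<^sub>s)\<^sup>+\<close>.  Flat solutions therefore correspond to
  the fixed points of the map \<open>g \<mapsto> f(\<cdot>, X + R, Z)\<close> on the square-integrable drivers, where \<open>(X, Z)\<close> is
  given by the martingale representation theorem.  As \<open>\<rho>\<close> is Lipschitz, this map is a contraction for the
  \<open>L\<^sup>2\<close>-norm with weight \<open>exp (\<beta> t)\<close>, \<open>\<beta>\<close> large.  The estimates follow from the isometry alone, without
  Ito's formula.
\<close>

section \<open>Square-integrable functions\<close>

text \<open>The driver is taken as the unknown because it ranges over a complete L^2 space of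
  progressive functions, while X, Z, R and Y can all be recovered from it. The delicate term is R: a
  supremum over all later times of a functional that is Lipschitz only for E|.|, hence not
  controlled by an integral in time. The argument works on the whole interval at once because the
  linear estimate bounds E|X_t - X'_t|^2 by exp(-\<beta> t) W / \<beta>, with W the squared weighted
  distance of the drivers. This bound decreases in t, so the one at time t serves for all later
  times, and R costs only a constant factor. Continuity in time is assumed for \<rho>(t, X) with X
  fixed, so the continuity of t -> \<rho>(t, X_t) has to be proved as well. Stochastic integration
  and the representation theorem are built directly on Gaussian increments: approximations take
  place in L^2 closures of linear function spaces, and density is checked on indicators, by Dynkin
  systems or by polynomial approximation.\<close>

abbreviation pz :: "(real \<Rightarrow> 'x \<Rightarrow> 'b) \<Rightarrow> 'x \<times> real \<Rightarrow> 'b" where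
  "pz Z \<equiv> \<lambda>x. Z (snd x) (fst x)"

text \<open>With values in \<open>ennreal\<close> the squared norm makes sense for every function,
  square-integrability reads \<open>sqn N f < \<infinity>\<close>, and estimates can be written
  before finiteness is known. The same notation serves random variables and functions on the product
  space.\<close>

definition sqn :: "'x measure \<Rightarrow> ('x \<Rightarrow> 'b::real_normed_vector) \<Rightarrow> ennreal" where
  "sqn N f = (\<integral>\<^sup>+x. ennreal ((norm (f x))\<^sup>2) \<partial>N)"

lemma sqn_add:
  fixes f g :: "'x \<Rightarrow> 'b::{second_countable_topology, real_normed_vector}"
  assumes [measurable]: "f \<in> borel_measurable N" "g \<in> borel_measurable N"
  shows "sqn N (\<lambda>x. f x + g x) \<le> 2 * sqn N f + 2 * sqn N g"
proof -
  have sq: "(norm (a + b))\<^sup>2 \<le> 2 * (norm a)\<^sup>2 + 2 * (norm b)\<^sup>2" for a b :: 'b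
    using power_mono[OF norm_triangle_ineq[of a b], of 2] sum_squares_bound[of "norm a" "norm b"]
    by (simp add: power2_sum)
  have "ennreal ((norm (f x + g x))\<^sup>2) \<le> 2 * ennreal ((norm (f x))\<^sup>2) + 2 * ennreal ((norm (g x))\<^sup>2)" for x
    using ennreal_leI[OF sq[of "f x" "g x"]] by (simp add: ennreal_mult ennreal_plus)
  then have "sqn N (\<lambda>x. f x + g x) \<le> (\<integral>\<^sup>+x. 2 * ennreal ((norm (f x))\<^sup>2) + 2 * ennreal ((norm (g x))\<^sup>2) \<partial>N)"
    unfolding sqn_def by (intro nn_integral_mono)
  also have "\<dots> = 2 * sqn N f + 2 * sqn N g"
    unfolding sqn_def by (simp add: nn_integral_add nn_integral_cmult)
  finally show ?thesis .
qed

lemma sqn_uminus: "sqn N (\<lambda>x. - f x) = sqn N f"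
  by (simp add: sqn_def)

lemma sqn_commute: "sqn N (\<lambda>x. f x - g x) = sqn N (\<lambda>x. g x - f x)"
  by (simp add: sqn_def norm_minus_commute)

lemma sqn_diff:
  fixes f g :: "'x \<Rightarrow> 'b::{second_countable_topology, real_normed_vector}"
  assumes "f \<in> borel_measurable N" "g \<in> borel_measurable N"
  shows "sqn N (\<lambda>x. f x - g x) \<le> 2 * sqn N f + 2 * sqn N g"
  using sqn_add[of f N "\<lambda>x. - g x"] assms by (simp add: sqn_uminus)

lemma sqn_triangle:
  fixes f g h :: "'x \<Rightarrow> 'b::{second_countable_topology, real_normed_vector}"
  assumes "f \<in> borel_measurable N" "g \<in> borel_measurable N" "h \<in> borel_measurable N"
  shows "sqn N (\<lambda>x. f x - h x) \<le> 2 * sqn N (\<lambda>x. f x - g x) + 2 * sqn N (\<lambda>x. g x - h x)"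
  using sqn_add[of "\<lambda>x. f x - g x" N "\<lambda>x. g x - h x"] assms by simp

lemma sqn_scale: "f \<in> borel_measurable N \<Longrightarrow> sqn N (\<lambda>x. c *\<^sub>R f x) = ennreal (c\<^sup>2) * sqn N f"
  unfolding sqn_def by (subst nn_integral_cmult[symmetric])
    (auto simp: power_mult_distrib ennreal_mult)

lemma sqn_mono_AE: "AE x in N. norm (f x) \<le> norm (g x) \<Longrightarrow> sqn N f \<le> sqn N g"
  unfolding sqn_def by (intro nn_integral_mono_AE) (auto intro!: power_mono ennreal_leI)

lemma sqn_cong_AE: "AE x in N. f x = g x \<Longrightarrow> sqn N f = sqn N g"
  unfolding sqn_def by (intro nn_integral_cong_AE) auto

lemma sqn_zero_iff:
  fixes f :: "'x \<Rightarrow> 'b::{second_countable_topology, real_normed_vector}"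
  assumes [measurable]: "f \<in> borel_measurable N"
  shows "sqn N f = 0 \<longleftrightarrow> (AE x in N. f x = 0)"
  unfolding sqn_def by (subst nn_integral_0_iff_AE) auto

lemma sqn_zero [simp]: "sqn N (\<lambda>x. 0) = 0"
  by (simp add: sqn_def)

lemma sqn_real: "sqn N (f :: 'x \<Rightarrow> real) = (\<integral>\<^sup>+x. ennreal ((f x)\<^sup>2) \<partial>N)"
  by (simp add: sqn_def)

lemma sqn_integrable_iff:
  fixes f :: "'x \<Rightarrow> 'b::{second_countable_topology, real_normed_vector}"
  assumes [measurable]: "f \<in> borel_measurable N"
  shows "integrable N (\<lambda>x. (norm (f x))\<^sup>2) \<longleftrightarrow> sqn N f < \<infinity>"
  unfolding sqn_def by (subst integrable_iff_bounded) auto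

lemma sqn_eq_integral:
  assumes "integrable N (\<lambda>x. (norm (f x))\<^sup>2)"
  shows "sqn N f = ennreal (\<integral>x. (norm (f x))\<^sup>2 \<partial>N)"
  unfolding sqn_def using assms by (intro nn_integral_eq_integral) auto

lemma integrable_mult_L2:
  fixes f g :: "'x \<Rightarrow> real"
  assumes [measurable]: "f \<in> borel_measurable N" "g \<in> borel_measurable N"
    and "sqn N f < \<infinity>" "sqn N g < \<infinity>"
  shows "integrable N (\<lambda>x. f x * g x)"
proof (rule Bochner_Integration.integrable_bound)
  show "integrable N (\<lambda>x. (norm (f x))\<^sup>2 + (norm (g x))\<^sup>2)"
    using assms by (intro Bochner_Integration.integrable_add) (simp_all add: sqn_integrable_iff del: real_norm_def)
  have "\<bar>a * b\<bar> \<le> a\<^sup>2 + b\<^sup>2" for a b :: real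
  proof -
    have "2 * (\<bar>a\<bar> * \<bar>b\<bar>) \<le> a\<^sup>2 + b\<^sup>2"
      using sum_squares_bound[of "\<bar>a\<bar>" "\<bar>b\<bar>"] by simp
    moreover have "0 \<le> \<bar>a\<bar> * \<bar>b\<bar>" by simp
    ultimately have "\<bar>a\<bar> * \<bar>b\<bar> \<le> a\<^sup>2 + b\<^sup>2" by linarith
    then show ?thesis by (simp add: abs_mult)
  qed
  then show "AE x in N. norm (f x * g x) \<le> norm ((norm (f x))\<^sup>2 + (norm (g x))\<^sup>2)" by simp
qed simp

lemma (in finite_measure) integrable_L2:
  fixes f :: "'a \<Rightarrow> real"
  assumes "f \<in> borel_measurable M" "sqn M f < \<infinity>"
  shows "integrable M f"
  using integrable_mult_L2[of f M "\<lambda>_. 1"] assms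
  by (simp add: sqn_def emeasure_eq_measure)

lemma (in finite_measure) sqn_bounded:
  assumes "\<And>x. x \<in> space M \<Longrightarrow> norm (f x) \<le> c"
  shows "sqn M f < \<infinity>"
proof -
  have "sqn M f \<le> sqn M (\<lambda>_. c)"
    using assms by (intro sqn_mono_AE) (force intro!: AE_I2)
  also have "\<dots> < \<infinity>" by (simp add: sqn_def emeasure_eq_measure ennreal_mult[symmetric])
  finally show ?thesis .
qed

text \<open>An infinite squared norm gives the value 0 here, which is why the inequalities below
  assume finiteness.\<close>

definition l2 :: "'x measure \<Rightarrow> ('x \<Rightarrow> 'b::real_normed_vector) \<Rightarrow> real" where
  "l2 N f = sqrt (enn2real (sqn N f))"

lemma l2_nonneg [simp]: "0 \<le> l2 N f"
  by (simp add: l2_def)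

lemma sqn_eq_l2: "sqn N f < \<infinity> \<Longrightarrow> sqn N f = ennreal ((l2 N f)\<^sup>2)"
  by (simp add: l2_def)

lemma nn_integral_mult_le_l2:
  fixes f :: "'x \<Rightarrow> 'b::{second_countable_topology, real_normed_vector}"
    and g :: "'x \<Rightarrow> 'c::{second_countable_topology, real_normed_vector}"
  assumes [measurable]: "f \<in> borel_measurable N" "g \<in> borel_measurable N"
    and fin: "sqn N f < \<infinity>" "sqn N g < \<infinity>"
  shows "(\<integral>\<^sup>+x. ennreal (norm (f x) * norm (g x)) \<partial>N) \<le> ennreal (l2 N f * l2 N g)"
proof -
  let ?I = "\<integral>\<^sup>+x. ennreal (norm (f x)) * ennreal (norm (g x)) \<partial>N"
  have "?I\<^sup>2 \<le> (\<integral>\<^sup>+x. (ennreal (norm (f x)))\<^sup>2 \<partial>N) * (\<integral>\<^sup>+x. (ennreal (norm (g x)))\<^sup>2 \<partial>N)"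
    by (rule Cauchy_Schwarz_nn_integral) auto
  also have "\<dots> = sqn N f * sqn N g"
    by (simp add: sqn_def ennreal_power)
  also have "\<dots> = ennreal ((l2 N f * l2 N g)\<^sup>2)"
    by (simp add: sqn_eq_l2[OF fin(1)] sqn_eq_l2[OF fin(2)] ennreal_mult power_mult_distrib)
  finally have *: "?I\<^sup>2 \<le> ennreal ((l2 N f * l2 N g)\<^sup>2)" .
  have "?I \<le> ennreal (l2 N f * l2 N g)"
  proof (cases ?I)
    case (real r)
    with * have "r\<^sup>2 \<le> (l2 N f * l2 N g)\<^sup>2" by (simp add: ennreal_power)
    then have "r \<le> l2 N f * l2 N g" by (rule power2_le_imp_le) simp
    with real show ?thesis by (simp add: ennreal_leI)
  next
    case top
    with * show ?thesis by (simp add: power2_eq_square top_unique)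
  qed
  then show ?thesis by (simp add: ennreal_mult)
qed

lemma sqn_add_finite:
  fixes f g :: "'x \<Rightarrow> 'b::{second_countable_topology, real_normed_vector}"
  assumes "f \<in> borel_measurable N" "g \<in> borel_measurable N" "sqn N f < \<infinity>" "sqn N g < \<infinity>"
  shows "sqn N (\<lambda>x. f x + g x) < \<infinity>"
proof -
  have "2 * sqn N f + 2 * sqn N g < \<infinity>"
    using assms by (auto simp: ennreal_mult_less_top)
  with sqn_add[OF assms(1,2)] show ?thesis by (rule le_less_trans)
qed

lemma sqn_diff_finite:
  fixes f g :: "'x \<Rightarrow> 'b::{second_countable_topology, real_normed_vector}"
  assumes "f \<in> borel_measurable N" "g \<in> borel_measurable N" "sqn N f < \<infinity>" "sqn N g < \<infinity>"
  shows "sqn N (\<lambda>x. f x - g x) < \<infinity>"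
  using sqn_add_finite[of f N "\<lambda>x. - g x"] assms by (simp add: sqn_uminus)

lemma ennreal_square_sum:
  assumes "0 \<le> a" "0 \<le> b"
  shows "ennreal ((a + b)\<^sup>2) = ennreal (a\<^sup>2) + ennreal (b\<^sup>2) + 2 * ennreal (a * b)"
proof -
  have "(a + b)\<^sup>2 = a\<^sup>2 + b\<^sup>2 + 2 * (a * b)" by (simp add: power2_sum)
  then show ?thesis using assms by (simp add: ennreal_mult)
qed

text \<open>\<open>sqn_add\<close> costs a factor 2, which is harmless when everything tends to
  zero. Convergence of norms to a nonzero limit needs Minkowski's inequality itself: expand the
  square and apply Cauchy-Schwarz to the mixed term.\<close>

lemma l2_triangle:
  fixes f g :: "'x \<Rightarrow> 'b::{second_countable_topology, real_normed_vector}"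
  assumes [measurable]: "f \<in> borel_measurable N" "g \<in> borel_measurable N"
    and fin: "sqn N f < \<infinity>" "sqn N g < \<infinity>"
  shows "l2 N (\<lambda>x. f x + g x) \<le> l2 N f + l2 N g"
proof -
  have "sqn N (\<lambda>x. f x + g x) \<le> (\<integral>\<^sup>+x. ennreal ((norm (f x))\<^sup>2) + ennreal ((norm (g x))\<^sup>2)
      + 2 * ennreal (norm (f x) * norm (g x)) \<partial>N)"
    unfolding sqn_def
  proof (intro nn_integral_mono)
    fix x
    have "(norm (f x + g x))\<^sup>2 \<le> (norm (f x) + norm (g x))\<^sup>2"
      by (intro power_mono norm_triangle_ineq) auto
    then show "ennreal ((norm (f x + g x))\<^sup>2) \<le> ennreal ((norm (f x))\<^sup>2) + ennreal ((norm (g x))\<^sup>2)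
      + 2 * ennreal (norm (f x) * norm (g x))"
      by (metis ennreal_leI ennreal_square_sum norm_ge_zero)
  qed
  also have "\<dots> = sqn N f + sqn N g + 2 * (\<integral>\<^sup>+x. ennreal (norm (f x) * norm (g x)) \<partial>N)"
    unfolding sqn_def by (simp add: nn_integral_add nn_integral_cmult)
  also have "\<dots> \<le> sqn N f + sqn N g + 2 * ennreal (l2 N f * l2 N g)"
    using fin by (intro add_mono mult_left_mono nn_integral_mult_le_l2) auto
  also have "\<dots> = ennreal ((l2 N f + l2 N g)\<^sup>2)"
    by (simp add: sqn_eq_l2[OF fin(1)] sqn_eq_l2[OF fin(2)] ennreal_square_sum)
  finally have "ennreal ((l2 N (\<lambda>x. f x + g x))\<^sup>2) \<le> ennreal ((l2 N f + l2 N g)\<^sup>2)"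
    using sqn_eq_l2[OF sqn_add_finite[of f N g]] fin by simp
  then show ?thesis
    by (simp add: power2_le_iff_abs_le)
qed

lemma l2_commute: "l2 N (\<lambda>x. f x - g x) = l2 N (\<lambda>x. g x - f x)"
  by (simp add: l2_def sqn_commute[of N f])

lemma l2_diff_le:
  fixes f g :: "'x \<Rightarrow> 'b::{second_countable_topology, real_normed_vector}"
  assumes [measurable]: "f \<in> borel_measurable N" "g \<in> borel_measurable N"
    and fin: "sqn N f < \<infinity>" "sqn N g < \<infinity>"
  shows "\<bar>l2 N f - l2 N g\<bar> \<le> l2 N (\<lambda>x. f x - g x)"
  using l2_triangle[of g N "\<lambda>x. f x - g x"] l2_triangle[of f N "\<lambda>x. g x - f x"]
    sqn_diff_finite[of f N g] sqn_diff_finite[of g N f] fin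
  by (simp add: l2_commute[of N g f])

lemma l2_tendsto_0:
  assumes "(\<lambda>n. sqn N (h n)) \<longlonglongrightarrow> 0"
  shows "(\<lambda>n. l2 N (h n)) \<longlonglongrightarrow> 0"
proof -
  have "(\<lambda>n. enn2real (sqn N (h n))) \<longlonglongrightarrow> 0"
    using assms by (intro tendsto_enn2real) auto
  then show ?thesis unfolding l2_def using tendsto_real_sqrt by fastforce
qed

lemma eventually_sqn_finite:
  assumes "(\<lambda>n. sqn N (h n)) \<longlonglongrightarrow> 0"
  shows "eventually (\<lambda>n. sqn N (h n) < \<infinity>) sequentially"
  using order_tendstoD(2)[OF assms, of \<infinity>] by simp

lemma sqn_tendsto:
  fixes f :: "'x \<Rightarrow> 'b::{second_countable_topology, real_normed_vector}"
  assumes [measurable]: "\<And>n. h n \<in> borel_measurable N" "f \<in> borel_measurable N"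
    and lim: "(\<lambda>n. sqn N (\<lambda>x. h n x - f x)) \<longlonglongrightarrow> 0" and fin: "sqn N f < \<infinity>"
  shows "(\<lambda>n. sqn N (h n)) \<longlonglongrightarrow> sqn N f"
proof -
  have ev: "eventually (\<lambda>n. sqn N (h n) < \<infinity>) sequentially"
    using eventually_sqn_finite[OF lim]
  proof eventually_elim
    case (elim n)
    then show ?case using sqn_add_finite[of "\<lambda>x. h n x - f x" N f] fin by simp
  qed
  have "(\<lambda>n. l2 N (h n)) \<longlonglongrightarrow> l2 N f"
  proof (rule LIM_zero_cancel, rule Lim_null_comparison[rotated])
    show "(\<lambda>n. l2 N (\<lambda>x. h n x - f x)) \<longlonglongrightarrow> 0" by (rule l2_tendsto_0[OF lim])
    show "eventually (\<lambda>n. norm (l2 N (h n) - l2 N f) \<le> l2 N (\<lambda>x. h n x - f x)) sequentially"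
      using ev
    proof eventually_elim
      case (elim n)
      then show ?case using l2_diff_le[of "h n" N f] fin by simp
    qed
  qed
  then have "(\<lambda>n. ennreal ((l2 N (h n))\<^sup>2)) \<longlonglongrightarrow> ennreal ((l2 N f)\<^sup>2)"
    by (intro tendsto_ennrealI tendsto_power)
  moreover have "eventually (\<lambda>n. ennreal ((l2 N (h n))\<^sup>2) = sqn N (h n)) sequentially"
    using ev by eventually_elim (rule sqn_eq_l2[symmetric])
  ultimately show ?thesis
    by (subst sqn_eq_l2[OF fin]) (rule Lim_transform_eventually)
qed

lemma integral_mult_tendsto:
  fixes f g :: "'x \<Rightarrow> real"
  assumes [measurable]: "\<And>n. h n \<in> borel_measurable N" "f \<in> borel_measurable N" "g \<in> borel_measurable N"
    and lim: "(\<lambda>n. sqn N (\<lambda>x. h n x - f x)) \<longlonglongrightarrow> 0" and fin: "sqn N f < \<infinity>" "sqn N g < \<infinity>"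
  shows "(\<lambda>n. \<integral>x. h n x * g x \<partial>N) \<longlonglongrightarrow> (\<integral>x. f x * g x \<partial>N)"
proof (rule LIM_zero_cancel, rule Lim_null_comparison[rotated])
  show "(\<lambda>n. l2 N (\<lambda>x. h n x - f x) * l2 N g) \<longlonglongrightarrow> 0"
    using tendsto_mult[OF l2_tendsto_0[OF lim] tendsto_const[of "l2 N g"]] by simp
  show "eventually (\<lambda>n. norm ((\<integral>x. h n x * g x \<partial>N) - (\<integral>x. f x * g x \<partial>N))
      \<le> l2 N (\<lambda>x. h n x - f x) * l2 N g) sequentially"
    using eventually_sqn_finite[OF lim]
  proof eventually_elim
    case (elim n)
    have "sqn N (h n) < \<infinity>"
      using sqn_add_finite[of "\<lambda>x. h n x - f x" N f] fin elim by simp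
    then have "(\<integral>x. h n x * g x \<partial>N) - (\<integral>x. f x * g x \<partial>N) = (\<integral>x. (h n x - f x) * g x \<partial>N)"
      using fin by (subst Bochner_Integration.integral_diff[symmetric])
        (auto intro!: integrable_mult_L2 simp: algebra_simps)
    moreover have "ennreal (norm (\<integral>x. (h n x - f x) * g x \<partial>N))
        \<le> ennreal (l2 N (\<lambda>x. h n x - f x) * l2 N g)"
    proof -
      have "ennreal (norm (\<integral>x. (h n x - f x) * g x \<partial>N)) \<le> (\<integral>\<^sup>+x. ennreal (norm ((h n x - f x) * g x)) \<partial>N)"
        using elim fin by (intro integral_norm_bound_ennreal integrable_mult_L2) auto
      also have "\<dots> = (\<integral>\<^sup>+x. ennreal (norm (h n x - f x) * norm (g x)) \<partial>N)"
        by (simp add: abs_mult)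
      also have "\<dots> \<le> ennreal (l2 N (\<lambda>x. h n x - f x) * l2 N g)"
        using elim fin by (intro nn_integral_mult_le_l2) auto
      finally show ?thesis .
    qed
    ultimately show ?case by (simp add: ennreal_le_iff)
  qed
qed

text \<open>Fatou's lemma turns a bound on distances within a Cauchy sequence into a bound on the
  distance to its pointwise limit.\<close>

lemma sqn_Fatou:
  fixes f :: "'x \<Rightarrow> 'b::{second_countable_topology, real_normed_vector}"
  assumes [measurable]: "\<And>n. h n \<in> borel_measurable N" "f \<in> borel_measurable N" "k \<in> borel_measurable N"
    and lim: "AE x in N. (\<lambda>n. h n x) \<longlonglongrightarrow> f x"
    and bound: "eventually (\<lambda>n. sqn N (\<lambda>x. k x - h n x) \<le> c) sequentially"
  shows "sqn N (\<lambda>x. k x - f x) \<le> c"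
proof -
  have "sqn N (\<lambda>x. k x - f x) = (\<integral>\<^sup>+x. liminf (\<lambda>n. ennreal ((norm (k x - h n x))\<^sup>2)) \<partial>N)"
    unfolding sqn_def
  proof (intro nn_integral_cong_AE, use lim in eventually_elim)
    case (elim x)
    then have "(\<lambda>n. ennreal ((norm (k x - h n x))\<^sup>2)) \<longlonglongrightarrow> ennreal ((norm (k x - f x))\<^sup>2)"
      by (intro tendsto_ennrealI tendsto_power tendsto_norm tendsto_diff tendsto_const)
    then show ?case by (intro lim_imp_Liminf[symmetric]) auto
  qed
  also have "\<dots> \<le> liminf (\<lambda>n. sqn N (\<lambda>x. k x - h n x))"
    unfolding sqn_def by (rule nn_integral_liminf) simp
  also have "\<dots> \<le> liminf (\<lambda>n. c)"
    using bound by (rule Liminf_mono)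
  finally show ?thesis by (simp add: Liminf_const)
qed

lemma ennreal_double_add: "0 \<le> a \<Longrightarrow> 0 \<le> b \<Longrightarrow> 2 * ennreal a + 2 * ennreal b = ennreal (2 * a + 2 * b)"
  by (simp add: ennreal_mult)

text \<open>A sequence with geometrically small steps converges almost everywhere as well as in L^2.
  As the limit is taken pointwise, it stays measurable for the smaller sigma-algebra
  \<open>G\<close>; this is what keeps limits predictable or progressive.\<close>

theorem L2_complete:
  fixes f :: "nat \<Rightarrow> 'x \<Rightarrow> 'b::{second_countable_topology, banach}"
  assumes sub: "subalgebra N G" and meas: "\<And>n. f n \<in> borel_measurable G"
    and step: "\<And>n. sqn N (\<lambda>x. f n x - f (Suc n) x) \<le> ennreal (c * (1/4)^n)" and c: "0 \<le> c"
  obtains g where "g \<in> borel_measurable G"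
    and "\<And>n. sqn N (\<lambda>x. f n x - g x) \<le> ennreal (4 * c * (1/4)^n)"
    and "AE x in N. (\<lambda>n. f n x) \<longlonglongrightarrow> g x"
proof -
  have fN [measurable]: "f n \<in> borel_measurable N" for n
    using measurable_from_subalg[OF sub meas] .
  let ?d = "\<lambda>n x. norm (f n x - f (Suc n) x)"
  have "(\<integral>\<^sup>+x. (\<Sum>n. ennreal (2^n * (?d n x)\<^sup>2)) \<partial>N) = (\<Sum>n. ennreal (2^n) * sqn N (\<lambda>x. f n x - f (Suc n) x))"
    unfolding sqn_def
    by (subst nn_integral_suminf) (auto simp: ennreal_mult nn_integral_cmult intro!: suminf_cong)
  also have "\<dots> \<le> (\<Sum>n. ennreal (2^n) * ennreal (c * (1/4)^n))"
    by (intro suminf_le mult_left_mono step) auto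
  also have "\<dots> = (\<Sum>n. ennreal (c * (1/2)^n))"
  proof -
    have "ennreal (2^n) * ennreal (c * (1/4)^n) = ennreal (c * (1/2)^n)" for n
    proof -
      have "2^n * (c * (1/4)^n) = c * (1/2::real)^n"
        using power_mult_distrib[of 2 "1/4::real" n] by simp
      with c show ?thesis by (subst ennreal_mult[symmetric]) auto
    qed
    then show ?thesis by simp
  qed
  also have "\<dots> < \<infinity>"
  proof -
    have "summable (\<lambda>n. c * (1/2::real)^n)" by (intro summable_mult summable_geometric) auto
    then have "(\<Sum>n. ennreal (c * (1/2)^n)) = ennreal (\<Sum>n. c * (1/2)^n)"
      using c by (intro suminf_ennreal2) auto
    then show ?thesis by simp
  qed
  finally have "AE x in N. (\<Sum>n. ennreal (2^n * (?d n x)\<^sup>2)) \<noteq> \<infinity>"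
    by (intro nn_integral_PInf_AE) (auto simp: less_top[symmetric])
  then have conv: "AE x in N. convergent (\<lambda>n. f n x)"
  proof eventually_elim
    case (elim x)
    have s2: "summable (\<lambda>n. 2^n * (?d n x)\<^sup>2)"
      using elim by (intro summable_suminf_not_top) auto
    have "summable (\<lambda>n. ?d n x)"
    proof (rule summable_comparison_test')
      show "summable (\<lambda>n. (1/2)^n + 2^n * (?d n x)\<^sup>2)"
        by (intro summable_add s2 summable_geometric) auto
      fix n :: nat
      \<comment> \<open>The weighted inequality 2ab \<le> a^2 + b^2 trades squared steps for
        summable ones. The weight 2^n is affordable because the squared norms of the steps decay
        like 4^-n.\<close>
      have "2 * (sqrt (2^n) * ?d n x) * (1 / sqrt (2^n)) \<le> (sqrt (2^n) * ?d n x)\<^sup>2 + (1 / sqrt (2^n))\<^sup>2"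
        by (rule sum_squares_bound)
      then have "2 * ?d n x \<le> 2^n * (?d n x)\<^sup>2 + (1/2)^n"
        by (simp add: power_mult_distrib power_divide)
      moreover have "0 \<le> ?d n x" by simp
      ultimately have "?d n x \<le> (1/2)^n + 2^n * (?d n x)\<^sup>2" by linarith
      then show "norm (?d n x) \<le> (1/2)^n + 2^n * (?d n x)\<^sup>2" by simp
    qed
    then have "summable (\<lambda>n. f (Suc n) x - f n x)"
      by (intro summable_norm_cancel[of "\<lambda>n. f (Suc n) x - f n x"]) (simp add: norm_minus_commute)
    then show ?case
      using convergent_diff_const_right_iff[of "\<lambda>n. f n x" "f 0 x"]
      by (simp add: summable_iff_convergent sum_lessThan_telescope[of "\<lambda>n. f n x"])
  qed
  define g where "g x = lim (\<lambda>n. f n x)" for x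
  have g: "g \<in> borel_measurable G" unfolding g_def using meas by (intro borel_measurable_lim_metric)
  have gN [measurable]: "g \<in> borel_measurable N" by (rule measurable_from_subalg[OF sub g])
  have lim: "AE x in N. (\<lambda>n. f n x) \<longlonglongrightarrow> g x"
    using conv unfolding g_def by eventually_elim (rule iffD1[OF convergent_LIMSEQ_iff])
  \<comment> \<open>The constant 4c reproduces itself under the doubled triangle inequality: 2c + 2
    (4c) / 4 = 4c.\<close>
  have bd: "sqn N (\<lambda>x. f n x - f (n + j) x) \<le> ennreal (4 * c * (1/4)^n)" for n j
  proof (induction j arbitrary: n)
    case 0
    then show ?case by simp
  next
    case (Suc j)
    have "sqn N (\<lambda>x. f n x - f (n + Suc j) x) \<le>
        2 * sqn N (\<lambda>x. f n x - f (Suc n) x) + 2 * sqn N (\<lambda>x. f (Suc n) x - f (Suc n + j) x)"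
      by (rule order_trans[OF sqn_triangle[of "f n" N "f (Suc n)"]]) auto
    also have "\<dots> \<le> 2 * ennreal (c * (1/4)^n) + 2 * ennreal (4 * c * (1/4)^Suc n)"
      by (intro add_mono mult_left_mono step Suc.IH) auto
    also have "\<dots> = ennreal (2 * (c * (1/4)^n) + 2 * (4 * c * (1/4)^Suc n))"
      using c by (intro ennreal_double_add) auto
    also have "2 * (c * (1/4)^n) + 2 * (4 * c * (1/4)^Suc n) = 4 * c * (1/4)^n" by simp
    finally show ?case .
  qed
  have "sqn N (\<lambda>x. f n x - g x) \<le> ennreal (4 * c * (1/4)^n)" for n
  proof (rule sqn_Fatou[where h = f, OF _ _ _ lim])
    show "f n \<in> borel_measurable N" "g \<in> borel_measurable N" "\<And>n. f n \<in> borel_measurable N"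
      by (fact fN gN)+
    have "sqn N (\<lambda>x. f n x - f m x) \<le> ennreal (4 * c * (1/4)^n)" if nm: "n \<le> m" for m
    proof -
      obtain j where "m = n + j" using le_Suc_ex[OF nm] by auto
      then show ?thesis by (rule ssubst) (rule bd)
    qed
    then show "eventually (\<lambda>m. sqn N (\<lambda>x. f n x - f m x) \<le> ennreal (4 * c * (1/4)^n)) sequentially"
      by (rule eventually_sequentiallyI)
  qed
  from that[OF g this lim] show thesis .
qed

section \<open>L^2 closures of linear function spaces\<close>

definition cl :: "'x measure \<Rightarrow> ('x \<Rightarrow> 'b::{second_countable_topology, real_normed_vector}) set \<Rightarrow> ('x \<Rightarrow> 'b) set" where
  "cl N E = {f \<in> borel_measurable N. \<forall>\<epsilon>>0. \<exists>e\<in>E. sqn N (\<lambda>x. f x - e x) < ennreal \<epsilon>}"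

definition lin_space :: "'x measure \<Rightarrow> ('x \<Rightarrow> 'b::{second_countable_topology, real_normed_vector}) set \<Rightarrow> bool" where
  "lin_space N E \<longleftrightarrow> E \<subseteq> borel_measurable N \<and> (\<lambda>x. 0) \<in> E \<and> (\<forall>f\<in>E. \<forall>g\<in>E. (\<lambda>x. f x + g x) \<in> E)
     \<and> (\<forall>f\<in>E. \<forall>c. (\<lambda>x. c *\<^sub>R f x) \<in> E)"

lemma cl_incl: "lin_space N E \<Longrightarrow> e \<in> E \<Longrightarrow> e \<in> cl N E"
  unfolding cl_def lin_space_def by (intro CollectI conjI allI impI bexI[of _ e]) auto

lemma cl_approx:
  assumes "f \<in> cl N E" "0 < \<epsilon>"
  obtains e where "e \<in> E" "sqn N (\<lambda>x. f x - e x) < ennreal \<epsilon>"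
  using assms by (auto simp: cl_def)

lemma cl_measurable: "f \<in> cl N E \<Longrightarrow> f \<in> borel_measurable N"
  by (simp add: cl_def)

lemma cl_closed:
  assumes E: "lin_space N E" and f: "f \<in> borel_measurable N"
    and ap: "\<And>\<epsilon>. 0 < \<epsilon> \<Longrightarrow> \<exists>g\<in>cl N E. sqn N (\<lambda>x. f x - g x) < ennreal \<epsilon>"
  shows "f \<in> cl N E"
  unfolding cl_def
proof (intro CollectI conjI f allI impI)
  fix \<epsilon> :: real assume "0 < \<epsilon>"
  then have e4: "0 < \<epsilon> / 4" by simp
  from ap[OF this] obtain g where g: "g \<in> cl N E" "sqn N (\<lambda>x. f x - g x) < ennreal (\<epsilon> / 4)" by auto
  from g(1) e4 obtain e where e: "e \<in> E" "sqn N (\<lambda>x. g x - e x) < ennreal (\<epsilon> / 4)" by (rule cl_approx)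
  have "sqn N (\<lambda>x. f x - e x) \<le> 2 * sqn N (\<lambda>x. f x - g x) + 2 * sqn N (\<lambda>x. g x - e x)"
    using f g(1) e(1) E by (intro sqn_triangle) (auto simp: cl_def lin_space_def)
  also have "\<dots> < 2 * ennreal (\<epsilon> / 4) + 2 * ennreal (\<epsilon> / 4)"
    using g(2) e(2) by (intro add_strict_mono ennreal_mult_strict_left_mono) auto
  also have "\<dots> = ennreal \<epsilon>"
    using \<open>0 < \<epsilon>\<close> by (simp add: ennreal_mult[symmetric] ennreal_plus[symmetric] flip: ennreal_numeral del: ennreal_plus)
  finally show "\<exists>e\<in>E. sqn N (\<lambda>x. f x - e x) < ennreal \<epsilon>" using e(1) by blast
qed

lemma cl_limit:
  assumes E: "lin_space N E" and f: "f \<in> borel_measurable N" and g: "\<And>n. g n \<in> cl N E"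
    and lim: "(\<lambda>n. sqn N (\<lambda>x. f x - g n x)) \<longlonglongrightarrow> 0"
  shows "f \<in> cl N E"
proof (rule cl_closed[OF E f])
  fix \<epsilon> :: real assume "0 < \<epsilon>"
  then have "eventually (\<lambda>n. sqn N (\<lambda>x. f x - g n x) < ennreal \<epsilon>) sequentially"
    by (intro order_tendstoD(2)[OF lim]) simp
  then obtain n where "sqn N (\<lambda>x. f x - g n x) < ennreal \<epsilon>"
    using eventually_happens' sequentially_bot by blast
  then show "\<exists>h\<in>cl N E. sqn N (\<lambda>x. f x - h x) < ennreal \<epsilon>" using g by (rule bexI)
qed

lemma cl_cong_AE:
  assumes E: "lin_space N E" and f: "f \<in> borel_measurable N" and g: "g \<in> cl N E"
    and ae: "AE x in N. f x = g x"
  shows "f \<in> cl N E"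
proof (rule cl_limit[OF E f, of "\<lambda>_. g"])
  have "sqn N (\<lambda>x. f x - g x) = 0"
    using ae f cl_measurable[OF g] by (subst sqn_zero_iff) auto
  then show "(\<lambda>n. sqn N (\<lambda>x. f x - g x)) \<longlonglongrightarrow> 0" by simp
qed (rule g)

lemma cl_add:
  assumes E: "lin_space N E" and f: "f \<in> cl N E" and g: "g \<in> cl N E"
  shows "(\<lambda>x. f x + g x) \<in> cl N E"
  unfolding cl_def
proof (intro CollectI conjI allI impI)
  show "(\<lambda>x. f x + g x) \<in> borel_measurable N"
    using f g by (auto dest!: cl_measurable)
  fix \<epsilon> :: real assume "0 < \<epsilon>"
  then have e4: "0 < \<epsilon> / 4" by simp
  from f e4 obtain a where a: "a \<in> E" "sqn N (\<lambda>x. f x - a x) < ennreal (\<epsilon> / 4)" by (rule cl_approx)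
  from g e4 obtain e where e: "e \<in> E" "sqn N (\<lambda>x. g x - e x) < ennreal (\<epsilon> / 4)" by (rule cl_approx)
  have "sqn N (\<lambda>x. (f x - a x) + (g x - e x)) \<le> 2 * sqn N (\<lambda>x. f x - a x) + 2 * sqn N (\<lambda>x. g x - e x)"
    using f g a e E by (intro sqn_add) (auto simp: cl_def lin_space_def)
  also have "\<dots> < 2 * ennreal (\<epsilon> / 4) + 2 * ennreal (\<epsilon> / 4)"
    using a(2) e(2) by (intro add_strict_mono ennreal_mult_strict_left_mono) auto
  also have "\<dots> = ennreal \<epsilon>"
    using \<open>0 < \<epsilon>\<close> by (simp add: ennreal_mult[symmetric] ennreal_plus[symmetric] flip: ennreal_numeral del: ennreal_plus)
  finally show "\<exists>e\<in>E. sqn N (\<lambda>x. f x + g x - e x) < ennreal \<epsilon>"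
    using a(1) e(1) E by (intro bexI[of _ "\<lambda>x. a x + e x"]) (auto simp: lin_space_def algebra_simps)
qed

lemma cl_scale:
  assumes E: "lin_space N E" and f: "f \<in> cl N E"
  shows "(\<lambda>x. c *\<^sub>R f x) \<in> cl N E"
  unfolding cl_def
proof (intro CollectI conjI allI impI)
  show "(\<lambda>x. c *\<^sub>R f x) \<in> borel_measurable N"
    using f by (auto dest!: cl_measurable)
  fix \<epsilon> :: real assume e: "0 < \<epsilon>"
  then have "0 < \<epsilon> / (c\<^sup>2 + 1)" by (simp add: add_nonneg_pos)
  with f obtain a where a: "a \<in> E" "sqn N (\<lambda>x. f x - a x) < ennreal (\<epsilon> / (c\<^sup>2 + 1))" by (rule cl_approx)
  have "sqn N (\<lambda>x. c *\<^sub>R (f x - a x)) = ennreal (c\<^sup>2) * sqn N (\<lambda>x. f x - a x)"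
    using f a E by (intro sqn_scale) (auto simp: cl_def lin_space_def)
  also have "\<dots> \<le> ennreal (c\<^sup>2) * ennreal (\<epsilon> / (c\<^sup>2 + 1))"
    using a(2) by (intro mult_left_mono) auto
  also have "\<dots> = ennreal (c\<^sup>2 * (\<epsilon> / (c\<^sup>2 + 1)))"
    using e by (subst ennreal_mult) auto
  also have "\<dots> < ennreal \<epsilon>"
    using e by (intro ennreal_lessI) (auto simp: field_simps add_pos_nonneg)
  finally show "\<exists>e\<in>E. sqn N (\<lambda>x. c *\<^sub>R f x - e x) < ennreal \<epsilon>"
    using a(1) E by (intro bexI[of _ "\<lambda>x. c *\<^sub>R a x"]) (auto simp: lin_space_def algebra_simps)
qed

lemma lin_space_cl: "lin_space N E \<Longrightarrow> lin_space N (cl N E)"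
  unfolding lin_space_def[of N "cl N E"]
proof (intro conjI ballI allI subsetI)
  assume E: "lin_space N E"
  show "(\<lambda>x. 0) \<in> cl N E" using E by (intro cl_incl) (auto simp: lin_space_def)
qed (auto intro: cl_measurable cl_add cl_scale)

lemma lin_space_sum:
  assumes E: "lin_space N E" and "\<And>i. i \<in> I \<Longrightarrow> f i \<in> E"
  shows "(\<lambda>x. \<Sum>i\<in>I. f i x) \<in> E"
  using assms(2) by (induction I rule: infinite_finite_induct) (use E in \<open>auto simp: lin_space_def\<close>)

lemma lin_space_diff:
  assumes E: "lin_space N E" and "f \<in> E" "g \<in> E"
  shows "(\<lambda>x. f x - g x) \<in> E"
proof -
  have "(\<lambda>x. f x + (-1) *\<^sub>R g x) \<in> E" using assms unfolding lin_space_def by fast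
  then show ?thesis by simp
qed

text \<open>Simple functions for \<open>G\<close> that stay below 2 |f| are finite sums of
  indicators and converge to f in L^2 by domination, so the closure only has to be tested on
  indicators. The bound |f - F n| \<le> 3 |f| is the origin of the factor 9.\<close>

lemma cl_indicator_imp_L2:
  fixes f :: "'x \<Rightarrow> 'b::{second_countable_topology, banach}"
  assumes E: "lin_space N E" and sub: "subalgebra N G"
    and ind: "\<And>A c. A \<in> sets G \<Longrightarrow> (\<lambda>x. indicat_real A x *\<^sub>R c) \<in> cl N E"
    and f: "f \<in> borel_measurable G" and fin: "sqn N f < \<infinity>"
  shows "f \<in> cl N E"
proof -
  obtain F where
    F: "\<And>i. simple_function G (F i)" "\<And>x. x \<in> space G \<Longrightarrow> (\<lambda>i. F i x) \<longlonglongrightarrow> f x"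
      "\<And>i x. x \<in> space G \<Longrightarrow> norm (F i x) \<le> 2 * norm (f x)"
    using borel_measurable_implies_sequence_metric[OF f, of 0] unfolding norm_conv_dist[symmetric] by blast
  have sp: "space G = space N" using sub by (simp add: subalgebra_def)
  have [measurable]: "f \<in> borel_measurable N" by (rule measurable_from_subalg[OF sub f])
  have FG: "F i \<in> borel_measurable G" for i by (rule borel_measurable_simple_function[OF F(1)])
  have FN [measurable]: "F i \<in> borel_measurable N" for i by (rule measurable_from_subalg[OF sub FG])
  show ?thesis
  proof (rule cl_limit[OF E, of _ F])
    show "F n \<in> cl N E" for n
    proof (rule cl_cong_AE[OF E])
      show "(\<lambda>x. \<Sum>y\<in>F n ` space G. indicat_real (F n -` {y} \<inter> space G) x *\<^sub>R y) \<in> cl N E"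
        by (intro lin_space_sum[OF lin_space_cl[OF E]] ind) (use F(1)[of n] in \<open>auto simp: simple_function_def\<close>)
      show "AE x in N. F n x = (\<Sum>y\<in>F n ` space G. indicat_real (F n -` {y} \<inter> space G) x *\<^sub>R y)"
        unfolding sp[symmetric] by (rule AE_I2) (rule simple_function_indicator_representation_banach[OF F(1)], simp only: sp)
    qed simp
    have "(\<lambda>n. \<integral>\<^sup>+x. ennreal ((norm (f x - F n x))\<^sup>2) \<partial>N) \<longlonglongrightarrow> (\<integral>\<^sup>+x. 0 \<partial>N)"
    proof (rule nn_integral_dominated_convergence[where w = "\<lambda>x. ennreal (9 * (norm (f x))\<^sup>2)"])
      show "AE x in N. ennreal ((norm (f x - F n x))\<^sup>2) \<le> ennreal (9 * (norm (f x))\<^sup>2)" for n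
      proof (rule AE_I2)
        fix x assume "x \<in> space N"
        then have "norm (f x - F n x) \<le> 3 * norm (f x)"
          using F(3)[of x n] norm_triangle_ineq4[of "f x" "F n x"] by (simp add: sp)
        then have "(norm (f x - F n x))\<^sup>2 \<le> (3 * norm (f x))\<^sup>2" by (intro power_mono) auto
        then show "ennreal ((norm (f x - F n x))\<^sup>2) \<le> ennreal (9 * (norm (f x))\<^sup>2)"
          by (intro ennreal_leI) (simp add: power_mult_distrib)
      qed
      have "(\<integral>\<^sup>+x. ennreal (9 * (norm (f x))\<^sup>2) \<partial>N) = 9 * sqn N f"
        unfolding sqn_def by (subst nn_integral_cmult[symmetric]) (auto simp: ennreal_mult)
      then show "(\<integral>\<^sup>+x. ennreal (9 * (norm (f x))\<^sup>2) \<partial>N) < \<infinity>"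
        using fin by (simp add: ennreal_mult_less_top)
      show "AE x in N. (\<lambda>n. ennreal ((norm (f x - F n x))\<^sup>2)) \<longlonglongrightarrow> 0"
      proof (rule AE_I2)
        fix x assume "x \<in> space N"
        then have "(\<lambda>n. ennreal ((norm (f x - F n x))\<^sup>2)) \<longlonglongrightarrow> ennreal ((norm (f x - f x))\<^sup>2)"
          using F(2)[of x] by (intro tendsto_intros) (auto simp: sp)
        then show "(\<lambda>n. ennreal ((norm (f x - F n x))\<^sup>2)) \<longlonglongrightarrow> 0" by simp
      qed
    qed auto
    then show "(\<lambda>n. sqn N (\<lambda>x. f x - F n x)) \<longlonglongrightarrow> 0" by (simp add: sqn_def)
  qed simp
qed

text \<open>Bounded convergence: it lets the Dynkin and polynomial arguments below pass to limits
  inside a closure.\<close>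

lemma (in finite_measure) cl_bounded_limit:
  fixes f :: "'a \<Rightarrow> 'b::{second_countable_topology, real_normed_vector}"
  assumes E: "lin_space M E" and g: "\<And>n. g n \<in> cl M E" and [measurable]: "f \<in> borel_measurable M"
    and lim: "\<And>x. x \<in> space M \<Longrightarrow> (\<lambda>n. g n x) \<longlonglongrightarrow> f x"
    and bd: "\<And>n x. x \<in> space M \<Longrightarrow> norm (g n x) \<le> c"
  shows "f \<in> cl M E"
proof (rule cl_limit[OF E _ g])
  have [measurable]: "g n \<in> borel_measurable M" for n using cl_measurable[OF g] .
  have "(\<lambda>n. \<integral>\<^sup>+x. ennreal ((norm (f x - g n x))\<^sup>2) \<partial>M) \<longlonglongrightarrow> (\<integral>\<^sup>+x. 0 \<partial>M)"
  proof (rule nn_integral_dominated_convergence[where w = "\<lambda>x. ennreal ((2 * c)\<^sup>2)"])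
    show "AE x in M. ennreal ((norm (f x - g n x))\<^sup>2) \<le> ennreal ((2 * c)\<^sup>2)" for n
    proof (rule AE_I2)
      fix x assume x: "x \<in> space M"
      have "norm (f x) \<le> c"
        by (rule LIMSEQ_le_const2[OF tendsto_norm[OF lim[OF x]]]) (use bd[OF x] in auto)
      then have "norm (f x - g n x) \<le> 2 * c"
        using bd[OF x, of n] norm_triangle_ineq4[of "f x" "g n x"] by simp
      then show "ennreal ((norm (f x - g n x))\<^sup>2) \<le> ennreal ((2 * c)\<^sup>2)"
        by (intro ennreal_leI power_mono) auto
    qed
    show "(\<integral>\<^sup>+x. ennreal ((2 * c)\<^sup>2) \<partial>M) < \<infinity>"
      by (simp add: emeasure_eq_measure ennreal_mult[symmetric])
    show "AE x in M. (\<lambda>n. ennreal ((norm (f x - g n x))\<^sup>2)) \<longlonglongrightarrow> 0"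
    proof (rule AE_I2)
      fix x assume "x \<in> space M"
      then have "(\<lambda>n. ennreal ((norm (f x - g n x))\<^sup>2)) \<longlonglongrightarrow> ennreal ((norm (f x - f x))\<^sup>2)"
        using lim[of x] by (intro tendsto_intros) auto
      then show "(\<lambda>n. ennreal ((norm (f x - g n x))\<^sup>2)) \<longlonglongrightarrow> 0" by simp
    qed
  qed auto
  then show "(\<lambda>n. sqn M (\<lambda>x. f x - g n x)) \<longlonglongrightarrow> 0" by (simp add: sqn_def)
qed simp

text \<open>The sets whose indicators lie in the closure form a Dynkin system: complements come from
  the constants, disjoint unions from bounded limits of partial sums.\<close>

lemma (in finite_measure) cl_indicator_Dynkin:
  fixes E :: "('a \<Rightarrow> 'b::{second_countable_topology, real_normed_vector}) set"
  assumes E: "lin_space M E" and P: "Int_stable P" "P \<subseteq> sets M"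
    and ind: "\<And>A c. A \<in> P \<Longrightarrow> (\<lambda>x. indicat_real A x *\<^sub>R c) \<in> cl M E"
    and const: "\<And>c. (\<lambda>x. c) \<in> cl M E"
    and A: "A \<in> sigma_sets (space M) P"
  shows "(\<lambda>x. indicat_real A x *\<^sub>R c) \<in> cl M E"
proof -
  have Pow: "P \<subseteq> Pow (space M)" using P(2) sets.space_closed by blast
  have sub: "sigma_sets (space M) P \<subseteq> sets M" by (rule sets.sigma_sets_subset[OF P(2)])
  from P(1) Pow A show ?thesis
  proof (induction rule: sigma_sets_induct_disjoint)
    case (basic A)
    then show ?case by (rule ind)
  next
    case empty
    then show ?case using E lin_space_cl[OF E] by (simp add: lin_space_def)
  next
    case (compl A)
    show ?case
    proof (rule cl_cong_AE[OF E _ lin_space_diff[OF lin_space_cl[OF E] const[of c] compl(2)]])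
      have "space M - A \<in> sets M" using compl(1) sub by auto
      then show "(\<lambda>x. indicat_real (space M - A) x *\<^sub>R c) \<in> borel_measurable M" by measurable
      show "AE x in M. indicat_real (space M - A) x *\<^sub>R c = c - indicat_real A x *\<^sub>R c"
        by (intro AE_I2) (auto simp: indicator_def)
    qed
  next
    case (union A)
    have [measurable]: "A i \<in> sets M" for i using union(2) sub by auto
    have eq: "indicat_real (\<Union>i<n. A i) x = (\<Sum>i<n. indicat_real (A i) x)" for n x
      using union(1) by (intro indicator_UN_disjoint) (auto simp: disjoint_family_on_def)
    have eq2: "indicat_real (\<Union>i<n. A i) x *\<^sub>R c = (\<Sum>i<n. indicat_real (A i) x *\<^sub>R c)" for n x
      by (simp add: eq scaleR_sum_left)
    show ?case
    proof (rule cl_bounded_limit[OF E, where g = "\<lambda>n x. indicat_real (\<Union>i<n. A i) x *\<^sub>R c" and c = "norm c"])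
      show "(\<lambda>x. indicat_real (\<Union>i<n. A i) x *\<^sub>R c) \<in> cl M E" for n
        unfolding eq2 by (intro lin_space_sum[OF lin_space_cl[OF E]] union(3))
      show "(\<lambda>n. indicat_real (\<Union>i<n. A i) x *\<^sub>R c) \<longlonglongrightarrow> indicat_real (\<Union> (range A)) x *\<^sub>R c" for x
        by (intro tendsto_scaleR tendsto_const LIMSEQ_indicator_UN)
    qed (auto simp: indicator_def)
  qed
qed

section \<open>Bounded algebras and the functional monotone class theorem\<close>

definition bounded_algebra :: "'x set \<Rightarrow> ('x \<Rightarrow> real) set \<Rightarrow> bool" where
  "bounded_algebra X A \<longleftrightarrow> (\<forall>c. (\<lambda>x. c) \<in> A) \<and> (\<forall>f\<in>A. \<forall>g\<in>A. (\<lambda>x. f x + g x) \<in> A)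
     \<and> (\<forall>f\<in>A. \<forall>g\<in>A. (\<lambda>x. f x * g x) \<in> A) \<and> (\<forall>f\<in>A. \<exists>c. \<forall>x\<in>X. \<bar>f x\<bar> \<le> c)"

lemma bounded_algebra_polynomial:
  assumes A: "bounded_algebra X A" and f: "f \<in> A" and p: "real_polynomial_function p"
  shows "(\<lambda>x. p (f x)) \<in> A"
  using p
proof induction
  case (linear h)
  then obtain c where "h = (\<lambda>x. x * c)" using real_bounded_linear by blast
  with A f show ?case by (auto simp: bounded_algebra_def)
qed (use A in \<open>auto simp: bounded_algebra_def\<close>)

text \<open>Finite intersections of strict superlevel sets, generated one factor at a time. They are
  the pi-system of the Dynkin argument, and an induction over them adjoins a single indicator in
  each step.\<close>

inductive_set level_sets :: "'x set \<Rightarrow> ('x \<Rightarrow> real) set \<Rightarrow> 'x set set" for X A where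
  space: "X \<in> level_sets X A"
| level: "S \<in> level_sets X A \<Longrightarrow> f \<in> A \<Longrightarrow> S \<inter> {x. c < f x} \<in> level_sets X A"

lemma level_sets_Int:
  assumes "S \<in> level_sets X A" "S' \<in> level_sets X A"
  shows "S \<inter> S' \<in> level_sets X A"
  using assms(2)
proof induction
  case space
  have "S \<subseteq> X" using assms(1) by induction auto
  with assms(1) show ?case by (simp add: Int_absorb2)
next
  case (level S' f c)
  then have "(S \<inter> S') \<inter> {x. c < f x} \<in> level_sets X A" by (intro level_sets.level)
  then show ?case by (simp add: Int_assoc)
qed

text \<open>
  By the Weierstrass theorem the indicator of \<open>{c < f}\<close> is a bounded limit of polynomials in \<open>f\<close>.
\<close>

lemma (in finite_measure) level_sets_cl:
  assumes E: "lin_space M E" and A: "bounded_algebra (space M) A" and sub: "A \<subseteq> cl M E"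
    and S: "S \<in> level_sets (space M) A"
  shows "S \<in> sets M \<and> (\<forall>a\<in>A. (\<lambda>x. a x * indicat_real S x) \<in> cl M E)"
  using S
proof induction
  case space
  show ?case
  proof (intro conjI ballI sets.top)
    fix a assume "a \<in> A"
    then have a: "a \<in> cl M E" using sub by auto
    have [measurable]: "a \<in> borel_measurable M" by (rule cl_measurable[OF a])
    show "(\<lambda>x. a x * indicat_real (space M) x) \<in> cl M E"
      by (rule cl_cong_AE[OF E _ a]) auto
  qed
next
  case (level S f c)
  then have [measurable]: "S \<in> sets M" and *: "\<And>a. a \<in> A \<Longrightarrow> (\<lambda>x. a x * indicat_real S x) \<in> cl M E" by auto
  have [measurable]: "f \<in> borel_measurable M" using level(2) sub cl_measurable by blast
  have S': "S \<inter> {x. c < f x} \<in> sets M"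
  proof -
    have "S \<inter> {x. c < f x} = S \<inter> {x \<in> space M. c < f x}"
      using sets.sets_into_space[OF \<open>S \<in> sets M\<close>] by auto
    then show ?thesis by simp
  qed
  obtain b where b: "\<And>x. x \<in> space M \<Longrightarrow> \<bar>f x\<bar> \<le> b"
    using A level(2) unfolding bounded_algebra_def by meson
  \<comment> \<open>Continuous ramps converging to the indicator of the half-line above
    \<open>c\<close>; each is approximated by a polynomial on an interval containing the range of f,
    to within 1 / (m + 1).\<close>
  define \<phi> where "\<phi> m t = min 1 (max 0 (real m * (t - c)))" for m t
  have "\<exists>p. real_polynomial_function p \<and> (\<forall>t\<in>{-b..b}. \<bar>\<phi> m t - p t\<bar> < 1 / real (Suc m))" for m
  proof (rule Stone_Weierstrass_real_polynomial_function[of "{-b..b}" "\<phi> m" "1 / real (Suc m)"])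
    show "continuous_on {-b..b} (\<phi> m)" unfolding \<phi>_def by (intro continuous_intros)
  qed auto
  then obtain p where p: "\<And>m. real_polynomial_function (p m)"
    "\<And>m t. t \<in> {-b..b} \<Longrightarrow> \<bar>\<phi> m t - p m t\<bar> < 1 / real (Suc m)" by metis
  have lim_\<phi>: "(\<lambda>m. \<phi> m t) \<longlonglongrightarrow> (if c < t then 1 else 0)" for t
  proof (cases "c < t")
    case True
    obtain k where k: "1 / (t - c) \<le> real k" using real_arch_simple by blast
    have "eventually (\<lambda>m. \<phi> m t = 1) sequentially"
    proof (rule eventually_sequentiallyI[of k])
      fix m assume "k \<le> m"
      then have "1 / (t - c) \<le> real m" using k by simp
      then have "1 \<le> real m * (t - c)" using True by (simp add: field_simps)
      then show "\<phi> m t = 1" by (simp add: \<phi>_def)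
    qed
    then show ?thesis using True by (simp add: tendsto_eventually)
  next
    case False
    then have "real m * (t - c) \<le> 0" for m by (simp add: mult_nonneg_nonpos)
    then have "\<phi> m t = 0" for m by (simp add: \<phi>_def max_absorb1)
    with False show ?thesis by simp
  qed
  show ?case
  proof (intro conjI ballI S')
    fix a assume a: "a \<in> A"
    then obtain d where d: "\<And>x. x \<in> space M \<Longrightarrow> \<bar>a x\<bar> \<le> d"
      using A unfolding bounded_algebra_def by meson
    have [measurable]: "a \<in> borel_measurable M" using a sub cl_measurable by blast
    show "(\<lambda>x. a x * indicat_real (S \<inter> {x. c < f x}) x) \<in> cl M E"
    proof (rule cl_bounded_limit[OF E, where g = "\<lambda>m x. (a x * p m (f x)) * indicat_real S x" and c = "d * 2"])
      \<comment> \<open>Here the induction hypothesis has to cover products of the indicator with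
        every element of the algebra: a times a polynomial in f is again such an element.\<close>
      show "(\<lambda>x. (a x * p m (f x)) * indicat_real S x) \<in> cl M E" for m
        using A a bounded_algebra_polynomial[OF A level(2) p(1)]
        by (intro *) (auto simp: bounded_algebra_def)
      show "(\<lambda>x. a x * indicat_real (S \<inter> {x. c < f x}) x) \<in> borel_measurable M"
        using S' by measurable
      fix x assume x: "x \<in> space M"
      then have fx: "f x \<in> {-b..b}" using b[of x] by auto
      have "(\<lambda>m. \<phi> m (f x) - p m (f x)) \<longlonglongrightarrow> 0"
        by (rule Lim_null_comparison[OF _ LIMSEQ_Suc[OF lim_1_over_n]])
           (use p(2)[OF fx] in \<open>auto intro!: always_eventually less_imp_le\<close>)
      from tendsto_diff[OF lim_\<phi>[of "f x"] this]
      have "(\<lambda>m. p m (f x)) \<longlonglongrightarrow> (if c < f x then 1 else 0)" by simp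
      then have "(\<lambda>m. (a x * p m (f x)) * indicat_real S x) \<longlonglongrightarrow> (a x * (if c < f x then 1 else 0)) * indicat_real S x"
        by (intro tendsto_mult tendsto_const)
      then show "(\<lambda>m. (a x * p m (f x)) * indicat_real S x) \<longlonglongrightarrow> a x * indicat_real (S \<inter> {x. c < f x}) x"
        by (auto simp: indicator_def split: if_splits)
      fix m
      have "\<bar>\<phi> m (f x)\<bar> \<le> 1" by (auto simp: \<phi>_def)
      moreover have "1 / real (Suc m) \<le> 1" by simp
      ultimately have "\<bar>p m (f x)\<bar> \<le> 2" using p(2)[OF fx, of m] by linarith
      moreover have "0 \<le> d" using d[OF x] by linarith
      ultimately have "\<bar>a x\<bar> * \<bar>p m (f x)\<bar> \<le> d * 2" using d[OF x] by (intro mult_mono) auto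
      then show "norm ((a x * p m (f x)) * indicat_real S x) \<le> d * 2"
        using \<open>0 \<le> d\<close> by (auto simp: indicator_def abs_mult)
    qed
  qed
qed

text \<open>The functional monotone class theorem. It is applied to trigonometric functions of the
  Brownian path, which generate the natural filtration.\<close>

theorem (in finite_measure) algebra_cl_indicator:
  fixes E :: "('a \<Rightarrow> real) set"
  assumes E: "lin_space M E" and A: "bounded_algebra (space M) A" and sub: "A \<subseteq> cl M E"
    and S: "S \<in> sigma_sets (space M) {{x \<in> space M. c < f x} | f c. f \<in> A}"
  shows "(\<lambda>x. indicat_real S x *\<^sub>R c) \<in> cl M E"
proof (rule cl_indicator_Dynkin[OF E, of "level_sets (space M) A"])
  note * = level_sets_cl[OF E A sub]
  show "Int_stable (level_sets (space M) A)"
    by (auto simp: Int_stable_def level_sets_Int)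
  show "level_sets (space M) A \<subseteq> sets M" using * by auto
  have cA: "(\<lambda>x. c) \<in> A" for c using A by (simp add: bounded_algebra_def)
  then show "(\<lambda>x. c) \<in> cl M E" for c using sub by blast
  show "(\<lambda>x. indicat_real S x *\<^sub>R c) \<in> cl M E" if "S \<in> level_sets (space M) A" for S c
  proof -
    have "(\<lambda>x. c * indicat_real S x) \<in> cl M E" using *[OF that] cA by fast
    then show ?thesis by (simp add: mult.commute)
  qed
  have "{{x \<in> space M. c < f x} | f c. f \<in> A} \<subseteq> level_sets (space M) A"
    using level_sets.level[OF level_sets.space] by (auto simp: Collect_conj_eq)
  with S show "S \<in> sigma_sets (space M) (level_sets (space M) A)"
    using sigma_sets_mono' by blast
qed

section \<open>The augmented Brownian filtration\<close>

context brownian_motion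
begin

abbreviation "F \<equiv> augmented_filtration M B"

lemma path_events_sets: "t \<le> T \<Longrightarrow> path_events M B t \<subseteq> sets M"
  unfolding path_events_def using measurable_B by (auto intro: measurable_sets)

lemma space_F [simp]: "space (F t) = space M"
  by (simp add: augmented_filtration_def space_measure_of_conv)

lemma gen_F_Pow: "path_events M B t \<union> null_sets M \<subseteq> Pow (space M)"
  using sets.space_closed by (auto simp: path_events_def dest: null_setsD2 sets.sets_into_space)

lemma sets_F: "sets (F t) = sigma_sets (space M) (path_events M B t \<union> null_sets M)"
  unfolding augmented_filtration_def by (rule sets_measure_of[OF gen_F_Pow])

lemma sets_natural: "sets (natural_filtration M B t) = sigma_sets (space M) (path_events M B t)"
  unfolding natural_filtration_def using gen_F_Pow by (intro sets_measure_of) auto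

lemma path_events_mono: "s \<le> t \<Longrightarrow> path_events M B s \<subseteq> path_events M B t"
  unfolding path_events_def by fastforce

lemma sets_F_mono: "s \<le> t \<Longrightarrow> sets (F s) \<subseteq> sets (F t)"
  unfolding sets_F by (intro sigma_sets_mono' Un_mono path_events_mono order_refl)

lemma sets_F_subset: "t \<le> T \<Longrightarrow> sets (F t) \<subseteq> sets M"
  unfolding sets_F using path_events_sets by (intro sets.sigma_sets_subset) auto

lemma subalgebra_F: "t \<le> T \<Longrightarrow> subalgebra M (F t)"
  by (simp add: subalgebra_def sets_F_subset)

lemma measurable_F_M: "X \<in> borel_measurable (F t) \<Longrightarrow> t \<le> T \<Longrightarrow> X \<in> borel_measurable M"
  using measurable_from_subalg[OF subalgebra_F] by blast

lemma measurable_F_mono: "X \<in> borel_measurable (F s) \<Longrightarrow> s \<le> t \<Longrightarrow> X \<in> borel_measurable (F t)"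
  using sets_F_mono by (auto simp: measurable_def)

lemma null_sets_F: "N \<in> null_sets M \<Longrightarrow> N \<in> sets (F t)"
  unfolding sets_F by (intro sigma_sets.Basic) auto

text \<open>Completeness puts every subset of a null set into \<open>F t\<close>, so a change on a
  null set does not affect adaptedness.\<close>

lemma measurable_F_AE:
  fixes X Y :: "'a \<Rightarrow> 'b::topological_space"
  assumes X: "X \<in> borel_measurable (F t)" and eq: "AE w in M. X w = Y w"
  shows "Y \<in> borel_measurable (F t)"
proof (rule measurableI)
  fix A assume A: "A \<in> sets (borel :: 'b measure)"
  from eq obtain N where N: "N \<in> null_sets M" "{w \<in> space M. X w \<noteq> Y w} \<subseteq> N"
    by (auto elim!: AE_E intro: null_setsI)
  have null: "N' \<in> sets (F t)" if "N' \<subseteq> N" for N'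
    using complete[OF that N(1)] N(1) that by (intro null_sets_F) (auto intro: complete2)
  have "Y -` A \<inter> space M = ((X -` A \<inter> space M) - (N \<inter> space M)) \<union> (Y -` A \<inter> space M \<inter> N)"
    using N(2) by auto
  also have "\<dots> \<in> sets (F t)"
    using measurable_sets[OF X A] null by (intro sets.Un sets.Diff) auto
  finally show "Y -` A \<inter> space (F t) \<in> sets (F t)" by simp
qed simp

lemma measurable_B_F: "s \<in> {0..t} \<Longrightarrow> B s \<in> borel_measurable (F t)"
  unfolding measurable_def sets_F by (auto simp: path_events_def intro!: sigma_sets.Basic)

text \<open>The sets that agree with a set of the natural filtration up to a null set form a
  sigma-algebra. This transfers independence, which is assumed for the natural filtration, to the
  augmented one.\<close>

lemma F_modulo_null:
  assumes "A \<in> sets (F t)" and t: "t \<le> T"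
  obtains A' where "A' \<in> sets (natural_filtration M B t)" "A' \<in> sets M" "AE w in M. w \<in> A \<longleftrightarrow> w \<in> A'"
proof -
  have sub: "sigma_sets (space M) (path_events M B t) \<subseteq> sets M"
    by (intro sets.sigma_sets_subset path_events_sets t)
  have "A \<in> sigma_sets (space M) (path_events M B t \<union> null_sets M)" using assms by (simp add: sets_F)
  then have "\<exists>A'\<in>sigma_sets (space M) (path_events M B t). AE w in M. w \<in> A \<longleftrightarrow> w \<in> A'"
  proof induction
    case (Basic a)
    then show ?case
    proof
      assume "a \<in> path_events M B t"
      then show ?thesis by (intro bexI[of _ a]) (auto intro: sigma_sets.Basic)
    next
      assume "a \<in> null_sets M"
      then have "AE w in M. w \<notin> a" by (rule AE_not_in)
      then show ?thesis by (intro bexI[of _ "{}"]) (auto intro: sigma_sets.Empty)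
    qed
  next
    case Empty
    then show ?case by (intro bexI[of _ "{}"]) (auto intro: sigma_sets.Empty)
  next
    case (Compl a)
    then obtain a' where "a' \<in> sigma_sets (space M) (path_events M B t)" "AE w in M. w \<in> a \<longleftrightarrow> w \<in> a'" by auto
    then show ?case by (intro bexI[of _ "space M - a'"]) (auto intro: sigma_sets.Compl)
  next
    case (Union a)
    then have "\<forall>i. \<exists>a'. a' \<in> sigma_sets (space M) (path_events M B t) \<and> (AE w in M. w \<in> a i \<longleftrightarrow> w \<in> a')" by blast
    then obtain a' where a': "\<And>i. a' i \<in> sigma_sets (space M) (path_events M B t)"
      "\<And>i. AE w in M. w \<in> a i \<longleftrightarrow> w \<in> a' i" by metis
    have "AE w in M. \<forall>i. w \<in> a i \<longleftrightarrow> w \<in> a' i" using a'(2) by (simp add: AE_all_countable)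
    then have "AE w in M. w \<in> \<Union>(range a) \<longleftrightarrow> w \<in> \<Union>(range a')" by eventually_elim auto
    with a'(1) show ?case by (intro bexI[of _ "\<Union>(range a')"]) (auto intro: sigma_sets.Union)
  qed
  then obtain A' where "A' \<in> sigma_sets (space M) (path_events M B t)" "AE w in M. w \<in> A \<longleftrightarrow> w \<in> A'" by auto
  with that[of A'] sub show thesis by (auto simp: sets_natural)
qed

lemma measurable_increment: "s \<in> {0..T} \<Longrightarrow> t \<in> {0..T} \<Longrightarrow> (\<lambda>w. B t w - B s w) \<in> borel_measurable M"
  using measurable_B by (intro borel_measurable_diff) auto

lemma indep_F_increment:
  assumes st: "0 \<le> s" "s < t" "t \<le> T" and X: "X \<in> borel_measurable (F s)" and \<phi>: "\<phi> \<in> borel_measurable borel"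
  shows "indep_var borel X borel (\<lambda>w. \<phi> (B t w - B s w))"
proof -
  let ?D = "\<lambda>w. B t w - B s w" and ?V = "vimage_algebra (space M) (\<lambda>w. B t w - B s w) borel"
  have D: "?D \<in> borel_measurable M" using st by (intro measurable_increment) auto
  have XM: "X \<in> borel_measurable M" using X st by (intro measurable_F_M[OF X]) auto
  have \<phi>D: "(\<lambda>w. \<phi> (?D w)) \<in> borel_measurable M" by (rule measurable_compose[OF D \<phi>])
  have VM: "sets ?V \<subseteq> sets M"
    unfolding sets_vimage_algebra using D by (intro sets.sigma_sets_subset) (auto intro: measurable_sets)
  have ind: "indep_set (sets (F s)) (sets ?V)"
  proof (rule indep_setI)
    show "sets (F s) \<subseteq> events" using st by (intro sets_F_subset) auto
    show "sets ?V \<subseteq> events" by (rule VM)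
    fix a b assume a: "a \<in> sets (F s)" and b: "b \<in> sets ?V"
    obtain a' where a': "a' \<in> sets (natural_filtration M B s)" "a' \<in> sets M" "AE w in M. w \<in> a \<longleftrightarrow> w \<in> a'"
      using F_modulo_null[OF a] st by auto
    have aM: "a \<in> sets M" "b \<in> sets M" using a b VM sets_F_subset[of s] st by auto
    have "prob (a \<inter> b) = prob (a' \<inter> b)" using a'(2,3) aM by (intro measure_eq_AE) auto
    also have "\<dots> = prob a' * prob b" by (rule indep_setD[OF independent_increments[OF st] a'(1) b])
    also have "prob a' = prob a" using a'(2,3) aM by (intro measure_eq_AE) auto
    finally show "prob (a \<inter> b) = prob a * prob b" .
  qed
  have s1: "sigma_sets (space M) {X -` A \<inter> space M | A. A \<in> sets borel} \<subseteq> sets (F s)"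
    using sets.sigma_sets_subset[of "{X -` A \<inter> space M | A. A \<in> sets borel}" "F s"] measurable_sets[OF X] by auto
  have "(\<lambda>w. \<phi> (?D w)) -` A \<inter> space M \<in> sets ?V" if "A \<in> sets borel" for A
  proof -
    have "(\<lambda>w. \<phi> (?D w)) -` A \<inter> space M = ?D -` (\<phi> -` A) \<inter> space M" by auto
    also have "\<dots> \<in> sets ?V" using measurable_sets[OF \<phi> that] by (intro in_vimage_algebra) simp
    finally show ?thesis .
  qed
  then have s2: "sigma_sets (space M) {(\<lambda>w. \<phi> (?D w)) -` A \<inter> space M | A. A \<in> sets borel} \<subseteq> sets ?V"
    using sets.sigma_sets_subset[of "{(\<lambda>w. \<phi> (?D w)) -` A \<inter> space M | A. A \<in> sets borel}" ?V] by auto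
  show ?thesis
    unfolding indep_var_eq
  proof (intro conjI XM \<phi>D indep_setI)
    show "sigma_sets (space M) {X -` A \<inter> space M | A. A \<in> sets borel} \<subseteq> events"
      using s1 sets_F_subset[of s] st by auto
    show "sigma_sets (space M) {(\<lambda>w. \<phi> (?D w)) -` A \<inter> space M | A. A \<in> sets borel} \<subseteq> events"
      using s2 VM by auto
  qed (use s1 s2 in \<open>auto intro!: indep_setD[OF ind]\<close>)
qed

lemma expectation_F_increment:
  fixes X :: "'a \<Rightarrow> real" and \<phi> :: "real ^ 'd \<Rightarrow> real"
  assumes st: "0 \<le> s" "s < t" "t \<le> T" and X: "X \<in> borel_measurable (F s)" "integrable M X"
    and \<phi>: "\<phi> \<in> borel_measurable borel" "integrable M (\<lambda>w. \<phi> (B t w - B s w))"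
  shows "integrable M (\<lambda>w. X w * \<phi> (B t w - B s w))"
    and "expectation (\<lambda>w. X w * \<phi> (B t w - B s w)) = expectation X * expectation (\<lambda>w. \<phi> (B t w - B s w))"
  using indep_var_integrable[OF indep_F_increment[OF st X(1) \<phi>(1)] X(2) \<phi>(2)]
    indep_var_lebesgue_integral[OF indep_F_increment[OF st X(1) \<phi>(1)] X(2) \<phi>(2)] by auto

text \<open>The density factorises, so an integral over R^d becomes a product of one-dimensional
  ones. Values in a general normed field cover two applications: real ones give moments, complex
  ones the characteristic function.\<close>

lemma increment_prod:
  fixes g :: "'d \<Rightarrow> real \<Rightarrow> 'b::{real_normed_field, banach, second_countable_topology}"
  assumes st: "0 \<le> s" "s < t" "t \<le> T" and g [measurable]: "\<And>i. g i \<in> borel_measurable borel"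
    and int: "\<And>i. integrable lborel (\<lambda>x. normal_density 0 (sqrt (t - s)) x *\<^sub>R g i x)"
  shows "integrable M (\<lambda>w. \<Prod>i\<in>UNIV. g i ((B t w - B s w) $ i))"
    and "(\<integral>w. (\<Prod>i\<in>UNIV. g i ((B t w - B s w) $ i)) \<partial>M)
      = (\<Prod>i\<in>UNIV. \<integral>x. normal_density 0 (sqrt (t - s)) x *\<^sub>R g i x \<partial>lborel)"
proof -
  let ?D = "\<lambda>w. B t w - B s w" and ?n = "normal_density 0 (sqrt (t - s))"
  let ?f = "\<lambda>x::real^'d. \<Prod>i\<in>UNIV. ?n (x $ i)" and ?g = "\<lambda>x::real^'d. \<Prod>i\<in>UNIV. g i (x $ i)"
  let ?h = "\<lambda>(b::real^'d) x. ?n x *\<^sub>R g (axis_index b) x"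
  have D: "?D \<in> borel_measurable M" using st by (intro measurable_increment) auto
  have nn: "0 \<le> ?f x" for x by (intro prod_nonneg) auto
  have dist: "distr M lborel ?D = density lborel (\<lambda>x. ennreal (?f x))"
    using gaussian_increments[OF st] by (simp add: distributed_def)
  \<comment> \<open>Lebesgue measure on a Euclidean space is a product over basis vectors, the
    density a product over coordinates; the two are matched by \<open>axis i 1\<close>.\<close>
  have prod_eq: "?f x *\<^sub>R ?g x = (\<Prod>b\<in>Basis. ?h b (x \<bullet> b))" for x
  proof -
    have "(\<Prod>b\<in>Basis. ?h b (x \<bullet> b)) = (\<Prod>b\<in>range (\<lambda>i::'d. axis i (1::real)). ?h b (x \<bullet> b))"
      by (rule prod.cong) (auto simp: Basis_vec_def)
    also have "\<dots> = (\<Prod>i\<in>UNIV. ?h (axis i 1) (x \<bullet> axis i 1))"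
      by (subst prod.reindex) (auto simp: inj_on_def axis_eq_axis)
    also have "\<dots> = (\<Prod>i\<in>UNIV. ?n (x $ i) *\<^sub>R g i (x $ i))" by (simp add: inner_axis)
    also have "\<dots> = ?f x *\<^sub>R ?g x" by (simp add: scaleR_conv_of_real prod.distrib of_real_prod)
    finally show ?thesis by simp
  qed
  interpret P: product_sigma_finite "\<lambda>_::real^'d. lborel :: real measure"
    by (rule product_sigma_finite.intro) (rule sigma_finite_lborel)
  have hint: "integrable lborel (?h b)" for b by (rule int)
  have vec: "(\<lambda>f. \<Sum>b\<in>Basis. f b *\<^sub>R b) \<in> measurable (\<Pi>\<^sub>M b\<in>Basis. lborel) (borel :: (real^'d) measure)"
    by measurable
  have coord: "(\<Sum>b\<in>Basis. f b *\<^sub>R b) \<bullet> b' = f b'" if "b' \<in> Basis" for f and b' :: "real^'d"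
    using that by (simp add: inner_sum_left inner_Basis if_distrib cong: if_cong)
  have meas: "(\<lambda>x::real^'d. \<Prod>b\<in>Basis. ?h b (x \<bullet> b)) \<in> borel_measurable borel" by measurable
  have i1: "integrable lborel (\<lambda>x. ?f x *\<^sub>R ?g x)"
    unfolding prod_eq lborel_eq[where 'a = "real^'d"]
    by (subst integrable_distr_eq[OF vec meas])
       (simp add: coord P.product_integrable_prod[OF finite_Basis hint] cong: prod.cong)
  have i2: "(\<integral>x. ?f x *\<^sub>R ?g x \<partial>lborel) = (\<Prod>i\<in>UNIV. \<integral>x. ?n x *\<^sub>R g i x \<partial>lborel)"
  proof -
    have "(\<integral>x. ?f x *\<^sub>R ?g x \<partial>lborel) = (\<Prod>b\<in>Basis. \<integral>x. ?h b x \<partial>lborel)"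
      unfolding prod_eq lborel_eq[where 'a = "real^'d"]
      by (subst integral_distr[OF vec meas])
         (simp add: coord P.product_integral_prod[OF finite_Basis hint] cong: prod.cong)
    also have "\<dots> = (\<Prod>b\<in>range (\<lambda>i::'d. axis i (1::real)). \<integral>x. ?h b x \<partial>lborel)"
      by (rule prod.cong) (auto simp: Basis_vec_def)
    also have "\<dots> = (\<Prod>i\<in>UNIV. \<integral>x. ?n x *\<^sub>R g i x \<partial>lborel)"
      by (subst prod.reindex) (auto simp: inj_on_def axis_eq_axis)
    finally show ?thesis .
  qed
  have gm: "?g \<in> borel_measurable lborel" and fm: "?f \<in> borel_measurable lborel" by measurable
  have "integrable (distr M lborel ?D) ?g"
    unfolding dist by (subst integrable_density[OF gm fm]) (use nn i1 in auto)
  then show "integrable M (\<lambda>w. \<Prod>i\<in>UNIV. g i (?D w $ i))"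
    using D gm by (subst (asm) integrable_distr_eq) auto
  have "(\<integral>w. ?g (?D w) \<partial>M) = (\<integral>x. ?g x \<partial>distr M lborel ?D)"
    using D gm by (subst integral_distr) auto
  also have "\<dots> = (\<integral>x. ?f x *\<^sub>R ?g x \<partial>lborel)"
    unfolding dist by (subst integral_density[OF gm fm]) (use nn in auto)
  finally show "(\<integral>w. (\<Prod>i\<in>UNIV. g i (?D w $ i)) \<partial>M) = (\<Prod>i\<in>UNIV. \<integral>x. ?n x *\<^sub>R g i x \<partial>lborel)"
    by (simp add: i2)
qed

end

lemma normal_density_scale: "0 < \<sigma> \<Longrightarrow> \<sigma> * normal_density 0 \<sigma> (\<sigma> * x) = std_normal_density x"
  by (simp add: normal_density_def power_mult_distrib real_sqrt_mult field_simps)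

lemma integral_normal_cis:
  assumes "0 < \<sigma>"
  shows "(\<integral>x. normal_density 0 \<sigma> x *\<^sub>R cis (a * x) \<partial>lborel) = complex_of_real (exp (- (a * \<sigma>)\<^sup>2 / 2))"
proof -
  have "(\<integral>x. normal_density 0 \<sigma> x *\<^sub>R cis (a * x) \<partial>lborel)
      = \<sigma> *\<^sub>R (\<integral>x. normal_density 0 \<sigma> (\<sigma> * x) *\<^sub>R cis (a * (\<sigma> * x)) \<partial>lborel)"
    using lborel_integral_real_affine[of \<sigma> "\<lambda>x. normal_density 0 \<sigma> x *\<^sub>R cis (a * x)" 0] assms by simp
  also have "\<dots> = (\<integral>x. std_normal_density x *\<^sub>R cis (a * \<sigma> * x) \<partial>lborel)"
    by (simp add: normal_density_scale[OF assms, symmetric] mult.assoc del: std_normal_density_def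
        flip: integral_scaleR_right scaleR_scaleR)
  also have "\<dots> = char std_normal_distribution (a * \<sigma>)"
    unfolding char_def by (subst integral_density) (auto simp: cis_conv_exp)
  finally show ?thesis by (simp add: char_std_normal_distribution)
qed

lemma integral_normal_pow:
  assumes "0 < \<sigma>"
  shows "(\<integral>x. normal_density 0 \<sigma> x * x \<partial>lborel) = 0"
    "(\<integral>x. normal_density 0 \<sigma> x * x\<^sup>2 \<partial>lborel) = \<sigma>\<^sup>2"
    "(\<integral>x. normal_density 0 \<sigma> x * x ^ 4 \<partial>lborel) = 3 * \<sigma> ^ 4"
  using integral_normal_moment_odd[OF assms, of 0 0] integral_normal_moment_even[OF assms, of 0 1]
    integral_normal_moment_even[OF assms, of 0 2] assms
  by (simp_all add: fact_numeral power_divide flip: power_mult)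

lemma norm_vec_square: "(norm (x :: real ^ 'n))\<^sup>2 = (\<Sum>i\<in>UNIV. (x $ i)\<^sup>2)"
  by (simp add: norm_vec_def L2_set_def sum_nonneg)

lemma borel_measurable_vec_component:
  fixes h :: "'x \<Rightarrow> real ^ 'n"
  shows "h \<in> borel_measurable N \<Longrightarrow> (\<lambda>w. h w $ i) \<in> borel_measurable N"
  by (erule measurable_compose) (intro borel_measurable_continuous_onI continuous_intros)

text \<open>By the mean value theorem the difference of cosines is - n sin z with z within |n| of
  \<theta>, and sin is 1-Lipschitz. The square of the error is thus bounded by a fourth power, whose
  expectation for a Brownian increment is quadratic in time.\<close>

lemma cos_taylor_le: "\<bar>cos (\<theta> + n) - cos \<theta> + sin \<theta> * n\<bar> \<le> (n :: real)\<^sup>2"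
proof -
  have sin_lip: "\<bar>sin a - sin b\<bar> \<le> \<bar>a - b\<bar>" for a b :: real
  proof -
    have "\<bar>sin a - sin b\<bar> = 2 * (\<bar>sin ((a - b) / 2)\<bar> * \<bar>cos ((a + b) / 2)\<bar>)"
      by (simp add: sin_diff_sin abs_mult)
    also have "\<dots> \<le> 2 * (\<bar>(a - b) / 2\<bar> * 1)"
      by (intro mult_left_mono mult_mono abs_sin_x_le_abs_x abs_cos_le_one) auto
    finally show ?thesis by simp
  qed
  consider "n = 0" | "n > 0" | "n < 0" by linarith
  then obtain z where z: "cos (\<theta> + n) - cos \<theta> = n * - sin z" "\<bar>\<theta> - z\<bar> \<le> \<bar>n\<bar>"
  proof cases
    case 1
    then show thesis using that[of \<theta>] by simp
  next
    case 2
    have "\<exists>z>\<theta>. z < \<theta> + n \<and> cos (\<theta> + n) - cos \<theta> = (\<theta> + n - \<theta>) * - sin z"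
      using 2 by (intro MVT2) (auto intro!: derivative_eq_intros)
    then obtain z where "\<theta> < z" "z < \<theta> + n" "cos (\<theta> + n) - cos \<theta> = n * - sin z" by auto
    then show thesis using that[of z] by simp
  next
    case 3
    have "\<exists>z>\<theta> + n. z < \<theta> \<and> cos \<theta> - cos (\<theta> + n) = (\<theta> - (\<theta> + n)) * - sin z"
      using 3 by (intro MVT2) (auto intro!: derivative_eq_intros)
    then obtain z where "\<theta> + n < z" "z < \<theta>" "cos \<theta> - cos (\<theta> + n) = - n * - sin z" by auto
    then show thesis using that[of z] by simp
  qed
  have "\<bar>cos (\<theta> + n) - cos \<theta> + sin \<theta> * n\<bar> = \<bar>n\<bar> * \<bar>sin \<theta> - sin z\<bar>"
    by (simp add: z(1) abs_mult[symmetric] algebra_simps)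
  also have "\<dots> \<le> \<bar>n\<bar> * \<bar>n\<bar>"
    using sin_lip[of \<theta> z] z(2) by (intro mult_left_mono) auto
  finally show ?thesis by (simp add: power2_eq_square)
qed

context brownian_motion
begin

section \<open>Moments and characteristic function of Brownian increments\<close>

lemma increment_moments:
  fixes e :: "'d \<Rightarrow> nat"
  assumes st: "0 \<le> s" "s < t" "t \<le> T"
  shows "integrable M (\<lambda>w. \<Prod>i\<in>UNIV. ((B t w - B s w) $ i) ^ e i)"
    and "expectation (\<lambda>w. \<Prod>i\<in>UNIV. ((B t w - B s w) $ i) ^ e i)
      = (\<Prod>i\<in>UNIV. \<integral>x. normal_density 0 (sqrt (t - s)) x * x ^ e i \<partial>lborel)"
  using increment_prod[OF st, of "\<lambda>i x. x ^ e i"] integrable_normal_moment[of "sqrt (t - s)" 0] st by auto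

lemma increment_first:
  assumes st: "0 \<le> s" "s < t" "t \<le> T"
  shows "integrable M (\<lambda>w. (B t w - B s w) $ i)" "expectation (\<lambda>w. (B t w - B s w) $ i) = 0"
proof -
  have *: "(\<Prod>k\<in>UNIV. x k ^ (if k = i then 1 else 0)) = x i" for x :: "'d \<Rightarrow> real"
    by (simp add: if_distrib cong: if_cong)
  have "\<exists>k\<in>UNIV. (\<integral>x. normal_density 0 (sqrt (t - s)) x * x ^ (if k = i then 1 else 0) \<partial>lborel) = 0"
    using integral_normal_pow(1)[of "sqrt (t - s)"] st by (intro bexI[of _ i]) auto
  then show "integrable M (\<lambda>w. (B t w - B s w) $ i)" "expectation (\<lambda>w. (B t w - B s w) $ i) = 0"
    using increment_moments[OF st, of "\<lambda>k. if k = i then 1 else 0"] unfolding * by (auto simp: prod_zero_iff)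
qed

lemma increment_second:
  assumes st: "0 \<le> s" "s < t" "t \<le> T"
  shows "integrable M (\<lambda>w. (B t w - B s w) $ i * (B t w - B s w) $ j)"
    "expectation (\<lambda>w. (B t w - B s w) $ i * (B t w - B s w) $ j) = (if i = j then t - s else 0)"
proof -
  \<comment> \<open>The exponents of the monomial x_i x_j. For i = j they add up to 2 in that
    coordinate; otherwise a first moment appears and makes the product vanish.\<close>
  let ?e = "\<lambda>k. (if k = i then 1 else 0) + (if k = j then 1 else 0) :: nat"
  have "(\<Prod>k\<in>UNIV. x k ^ (if k = i then 1 else 0)) = x i" for x :: "'d \<Rightarrow> real" and i
    by (simp add: if_distrib cong: if_cong)
  then have *: "(\<Prod>k\<in>UNIV. x k ^ ?e k) = x i * x j" for x :: "'d \<Rightarrow> real"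
    by (simp only: power_add prod.distrib)
  let ?m = "\<lambda>k. \<integral>x. normal_density 0 (sqrt (t - s)) x * x ^ ?e k \<partial>lborel"
  have "(\<Prod>k\<in>UNIV. ?m k) = (if i = j then t - s else 0)"
  proof (cases "i = j")
    case True
    have "?m k = (if k = i then t - s else 1)" for k
      using integral_normal_pow(2)[of "sqrt (t - s)"] st True by (simp add: numeral_2_eq_2)
    then show ?thesis using True by simp
  next
    case False
    then have "?m i = 0" using integral_normal_pow(1)[of "sqrt (t - s)"] st by simp
    then show ?thesis using False by (auto simp: prod_zero_iff)
  qed
  then show "integrable M (\<lambda>w. (B t w - B s w) $ i * (B t w - B s w) $ j)"
    "expectation (\<lambda>w. (B t w - B s w) $ i * (B t w - B s w) $ j) = (if i = j then t - s else 0)"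
    using increment_moments[OF st, of ?e] unfolding * by auto
qed

lemma increment_fourth:
  assumes st: "0 \<le> s" "s < t" "t \<le> T"
  shows "integrable M (\<lambda>w. ((B t w - B s w) $ i) ^ 4)"
    "expectation (\<lambda>w. ((B t w - B s w) $ i) ^ 4) = 3 * (t - s)\<^sup>2"
proof -
  let ?e = "\<lambda>k. (if k = i then 4 else 0) :: nat"
  have *: "(\<Prod>k\<in>UNIV. x k ^ ?e k) = x i ^ 4" for x :: "'d \<Rightarrow> real"
    by (simp add: if_distrib cong: if_cong)
  have "(\<integral>x. normal_density 0 (sqrt (t - s)) x * x ^ ?e k \<partial>lborel) = (if k = i then 3 * (t - s)\<^sup>2 else 1)" for k
  proof -
    have "sqrt (t - s) ^ 4 = (t - s)\<^sup>2" using st power_mult[of "sqrt (t - s)" 2 2] by simp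
    then show ?thesis using integral_normal_pow(3)[of "sqrt (t - s)"] st by simp
  qed
  then show "integrable M (\<lambda>w. ((B t w - B s w) $ i) ^ 4)"
    "expectation (\<lambda>w. ((B t w - B s w) $ i) ^ 4) = 3 * (t - s)\<^sup>2"
    using increment_moments[OF st, of ?e] unfolding * by auto
qed

text \<open>Cauchy-Schwarz, once for the inner product and once for the sum of squares, reduces to
  the fourth moments of the coordinates. The constant is crude; what counts is the order (t -
  s)^2.\<close>

lemma increment_inner_fourth:
  assumes st: "0 \<le> s" "s < t" "t \<le> T"
  shows "integrable M (\<lambda>w. (l \<bullet> (B t w - B s w)) ^ 4)"
    "expectation (\<lambda>w. (l \<bullet> (B t w - B s w)) ^ 4) \<le> norm l ^ 4 * (real CARD('d))\<^sup>2 * 3 * (t - s)\<^sup>2"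
proof -
  let ?D = "\<lambda>w. B t w - B s w" and ?b = "\<lambda>w. norm l ^ 4 * real CARD('d) * (\<Sum>i\<in>UNIV. ((B t w - B s w) $ i) ^ 4)"
  have le: "(l \<bullet> x) ^ 4 \<le> norm l ^ 4 * real CARD('d) * (\<Sum>i\<in>UNIV. (x $ i) ^ 4)" for x :: "real^'d"
  proof -
    have "(l \<bullet> x) ^ 4 = \<bar>l \<bullet> x\<bar> ^ 4" by simp
    also have "\<dots> \<le> (norm l * norm x) ^ 4" by (intro power_mono Cauchy_Schwarz_ineq2) auto
    also have "\<dots> = norm l ^ 4 * ((norm x)\<^sup>2)\<^sup>2" by (simp add: power_mult_distrib flip: power_mult)
    also have "(norm x)\<^sup>2 = (\<Sum>i\<in>UNIV. (x $ i)\<^sup>2 * 1)"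
      by (simp add: norm_vec_square)
    also have "\<dots>\<^sup>2 \<le> (\<Sum>i\<in>UNIV. ((x $ i)\<^sup>2)\<^sup>2) * (\<Sum>i\<in>(UNIV::'d set). 1\<^sup>2)"
      by (rule Cauchy_Schwarz_ineq_sum)
    also have "\<dots> = real CARD('d) * (\<Sum>i\<in>UNIV. (x $ i) ^ 4)" by (simp flip: power_mult)
    finally show ?thesis by (simp add: mult_left_mono mult.assoc)
  qed
  have D: "?D \<in> borel_measurable M" using st by (intro measurable_increment) auto
  have bint: "integrable M ?b"
    using increment_fourth[OF st] by (intro Bochner_Integration.integrable_mult_right Bochner_Integration.integrable_sum) auto
  show int: "integrable M (\<lambda>w. (l \<bullet> ?D w) ^ 4)"
  proof (rule Bochner_Integration.integrable_bound[OF bint])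
    show "AE w in M. norm ((l \<bullet> ?D w) ^ 4) \<le> norm (?b w)"
    proof (rule AE_I2)
      fix w
      have "norm ((l \<bullet> ?D w) ^ 4) = (l \<bullet> ?D w) ^ 4" by simp
      also have "\<dots> \<le> ?b w" by (rule le)
      also have "\<dots> \<le> norm (?b w)" by simp
      finally show "norm ((l \<bullet> ?D w) ^ 4) \<le> norm (?b w)" .
    qed
  qed (use D in measurable)
  have "expectation (\<lambda>w. (l \<bullet> ?D w) ^ 4) \<le> expectation ?b"
    by (intro integral_mono int bint le)
  also have "\<dots> = norm l ^ 4 * (real CARD('d))\<^sup>2 * 3 * (t - s)\<^sup>2"
    using increment_fourth[OF st] by (simp add: Bochner_Integration.integral_sum power2_eq_square)
  finally show "expectation (\<lambda>w. (l \<bullet> ?D w) ^ 4) \<le> norm l ^ 4 * (real CARD('d))\<^sup>2 * 3 * (t - s)\<^sup>2" .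
qed

text \<open>Real and imaginary part of the product of the one-dimensional characteristic
  functions.\<close>

lemma increment_cos_sin:
  assumes st: "0 \<le> s" "s < t" "t \<le> T"
  shows "expectation (\<lambda>w. cos (l \<bullet> (B t w - B s w))) = exp (- (norm l)\<^sup>2 * (t - s) / 2)"
    "expectation (\<lambda>w. sin (l \<bullet> (B t w - B s w))) = 0"
proof -
  let ?D = "\<lambda>w. B t w - B s w"
  have D [measurable]: "?D \<in> borel_measurable M" using st by (intro measurable_increment) auto
  have g: "(\<lambda>x. cis (a * x)) \<in> borel_measurable borel" for a
    by (intro borel_measurable_continuous_onI continuous_intros)
  have int: "integrable lborel (\<lambda>x. normal_density 0 (sqrt (t - s)) x *\<^sub>R cis (a * x))" for a
    by (rule Bochner_Integration.integrable_bound[of lborel "normal_density 0 (sqrt (t - s))"])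
       (use g st in \<open>auto\<close>)
  have eq: "(\<Prod>i\<in>UNIV. cis (l $ i * x $ i)) = cis (l \<bullet> x)" for x :: "real^'d"
  proof -
    have "(\<Prod>i\<in>I. cis (l $ i * x $ i)) = cis (\<Sum>i\<in>I. l $ i * x $ i)" if "finite I" for I
      using that by induction (auto simp: cis_mult)
    then show ?thesis by (simp add: inner_vec_def)
  qed
  have v: "(\<Prod>i\<in>UNIV. complex_of_real (exp (- (l $ i * sqrt (t - s))\<^sup>2 / 2)))
      = complex_of_real (exp (- (norm l)\<^sup>2 * (t - s) / 2))"
  proof -
    have "(\<Prod>i\<in>UNIV. exp (- (l $ i * sqrt (t - s))\<^sup>2 / 2)) = exp (\<Sum>i\<in>UNIV. - (l $ i * sqrt (t - s))\<^sup>2 / 2)"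
      by (simp add: exp_sum)
    also have "(\<Sum>i\<in>UNIV. - (l $ i * sqrt (t - s))\<^sup>2 / 2) = (\<Sum>i\<in>UNIV. - (l $ i)\<^sup>2) * (t - s) / 2"
      using st by (simp add: power_mult_distrib sum_distrib_right sum_divide_distrib)
    also have "(\<Sum>i\<in>UNIV. - (l $ i)\<^sup>2) = - (norm l)\<^sup>2"
      by (simp add: norm_vec_square sum_negf)
    finally show ?thesis by (simp flip: of_real_prod)
  qed
  have "(\<integral>w. cis (l \<bullet> ?D w) \<partial>M) = complex_of_real (exp (- (norm l)\<^sup>2 * (t - s) / 2))"
    using increment_prod(2)[OF st g int, of "\<lambda>i. l $ i"] st 
    by (simp only: eq integral_normal_cis[of "sqrt (t - s)", unfolded real_sqrt_gt_0_iff diff_gt_0_iff_gt, OF st(2)] v)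
  moreover have ci: "integrable M (\<lambda>w. cis (l \<bullet> ?D w))"
    using increment_prod(1)[OF st g int, of "\<lambda>i. l $ i"] by (simp only: eq)
  ultimately show "expectation (\<lambda>w. cos (l \<bullet> ?D w)) = exp (- (norm l)\<^sup>2 * (t - s) / 2)"
    "expectation (\<lambda>w. sin (l \<bullet> ?D w)) = 0"
    using integral_Re[OF ci] integral_Im[OF ci] by auto
qed

text \<open>Expand the square into coordinates: the products h_i h_j belong to the past, while the
  increments are independent of it and have covariance (t - s) times the identity.\<close>

lemma increment_inner_isometry:
  fixes h :: "'a \<Rightarrow> real ^ 'd"
  assumes st: "0 \<le> s" "s < t" "t \<le> T" and h: "h \<in> borel_measurable (F s)"
    and bd: "\<And>w. w \<in> space M \<Longrightarrow> norm (h w) \<le> c"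
  shows "integrable M (\<lambda>w. (h w \<bullet> (B t w - B s w))\<^sup>2)"
    "expectation (\<lambda>w. (h w \<bullet> (B t w - B s w))\<^sup>2) = expectation (\<lambda>w. (norm (h w))\<^sup>2) * (t - s)"
proof -
  let ?D = "\<lambda>w. B t w - B s w"
  have hM [measurable]: "h \<in> borel_measurable M" using h st by (intro measurable_F_M[OF h]) auto
  have hi: "(\<lambda>w. h w $ i * h w $ j) \<in> borel_measurable (F s)" for i j
    using borel_measurable_vec_component[OF h] by (intro borel_measurable_times)
  have hint: "integrable M (\<lambda>w. h w $ i * h w $ j)" for i j
  proof (rule integrable_const_bound[of _ "c * c"])
    show "AE w in M. norm (h w $ i * h w $ j) \<le> c * c"
    proof (rule AE_I2)
      fix w assume "w \<in> space M"
      from bd[OF this] component_le_norm_cart[of "h w"]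
      have "\<bar>h w $ i\<bar> \<le> c" "\<bar>h w $ j\<bar> \<le> c" by (meson order_trans)+
      then show "norm (h w $ i * h w $ j) \<le> c * c" by (simp add: abs_mult mult_mono')
    qed
  qed (intro borel_measurable_times borel_measurable_vec_component hM)
  have sq: "(h w \<bullet> ?D w)\<^sup>2 = (\<Sum>i\<in>UNIV. \<Sum>j\<in>UNIV. (h w $ i * h w $ j) * (?D w $ i * ?D w $ j))" for w
    unfolding inner_vec_def power2_eq_square by (simp add: sum_product algebra_simps)
  note * = expectation_F_increment[OF st hi hint, of "\<lambda>x. x $ _ * x $ _"]
  have int: "integrable M (\<lambda>w. (h w $ i * h w $ j) * (?D w $ i * ?D w $ j))" for i j
    by (rule *(1)) (use increment_second[OF st] in auto)
  show "integrable M (\<lambda>w. (h w \<bullet> ?D w)\<^sup>2)"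
    unfolding sq by (intro Bochner_Integration.integrable_sum int)
  have "expectation (\<lambda>w. (h w \<bullet> ?D w)\<^sup>2)
      = (\<Sum>i\<in>UNIV. \<Sum>j\<in>UNIV. expectation (\<lambda>w. (h w $ i * h w $ j) * (?D w $ i * ?D w $ j)))"
    unfolding sq by (simp only: Bochner_Integration.integral_sum Bochner_Integration.integrable_sum int)
  also have "\<dots> = (\<Sum>i\<in>UNIV. \<Sum>j\<in>UNIV. expectation (\<lambda>w. h w $ i * h w $ j) * (if i = j then t - s else 0))"
    by (intro sum.cong refl) (subst *(2), use increment_second[OF st] in auto)
  also have "\<dots> = (\<Sum>i\<in>UNIV. expectation (\<lambda>w. h w $ i * h w $ i) * (t - s))"
    by (simp add: if_distrib cong: if_cong)
  also have "\<dots> = expectation (\<lambda>w. \<Sum>i\<in>UNIV. h w $ i * h w $ i) * (t - s)"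
    by (simp add: Bochner_Integration.integral_sum hint sum_distrib_right)
  also have "(\<lambda>w. \<Sum>i\<in>UNIV. h w $ i * h w $ i) = (\<lambda>w. (norm (h w))\<^sup>2)"
    by (simp add: norm_vec_square) (simp add: power2_eq_square)
  finally show "expectation (\<lambda>w. (h w \<bullet> ?D w)\<^sup>2) = expectation (\<lambda>w. (norm (h w))\<^sup>2) * (t - s)" .
qed

lemma increment_inner_orthogonal:
  fixes h :: "'a \<Rightarrow> real ^ 'd"
  assumes st: "0 \<le> s" "s < t" "t \<le> T" and h: "h \<in> borel_measurable (F s)"
    and int: "\<And>i. integrable M (\<lambda>w. h w $ i)"
  shows "integrable M (\<lambda>w. h w \<bullet> (B t w - B s w))" "expectation (\<lambda>w. h w \<bullet> (B t w - B s w)) = 0"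
proof -
  have hi: "(\<lambda>w. h w $ i) \<in> borel_measurable (F s)" for i
    by (rule borel_measurable_vec_component[OF h])
  have *: "integrable M (\<lambda>w. h w $ i * (B t w - B s w) $ i)"
    "expectation (\<lambda>w. h w $ i * (B t w - B s w) $ i) = 0" for i
    using expectation_F_increment[OF st hi int, of "\<lambda>x. x $ i"] increment_first[OF st] by auto
  show "integrable M (\<lambda>w. h w \<bullet> (B t w - B s w))" "expectation (\<lambda>w. h w \<bullet> (B t w - B s w)) = 0"
    unfolding inner_vec_def inner_real_def using * by (auto simp: Bochner_Integration.integral_sum)
qed

end

section \<open>The Ito integral\<close>

lemma sum_indicator_telescope:
  fixes \<tau> :: "nat \<Rightarrow> real" and x :: "'b::comm_monoid_add"
  assumes "a \<le> b" "\<And>i. a \<le> i \<Longrightarrow> i < b \<Longrightarrow> \<tau> i < \<tau> (Suc i)"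
  shows "(\<Sum>i\<in>{a..<b}. if \<tau> i < r \<and> r \<le> \<tau> (Suc i) then x else 0) = (if \<tau> a < r \<and> r \<le> \<tau> b then x else 0)
    \<and> \<tau> a \<le> \<tau> b"
  using assms
proof (induction b rule: dec_induct)
  case (step b)
  then have "(\<Sum>i\<in>{a..<b}. if \<tau> i < r \<and> r \<le> \<tau> (Suc i) then x else 0) = (if \<tau> a < r \<and> r \<le> \<tau> b then x else 0)"
    "\<tau> a \<le> \<tau> b" "\<tau> b < \<tau> (Suc b)" by auto
  then show ?case using step(1) by (auto simp: sum.atLeastLessThan_Suc)
qed auto

context brownian_motion
begin

text \<open>Elementary integrands paired with their integrals. Generating them from single
  rectangles makes addition a constructor, so that inductions need no common refinement of
  partitions; the explicit partitions of \<open>simple_integrand\<close> are recovered in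
  \<open>elem_simple\<close>. The case u = v is allowed, which spares a case distinction when an
  interval is cut.\<close>

inductive elem :: "(real \<Rightarrow> 'a \<Rightarrow> real ^ 'd) \<Rightarrow> (real \<Rightarrow> 'a \<Rightarrow> real) \<Rightarrow> bool" where
  zero: "elem (\<lambda>r w. 0) (\<lambda>r w. 0)"
| rect: "0 \<le> u \<Longrightarrow> u \<le> v \<Longrightarrow> v \<le> T \<Longrightarrow> h \<in> borel_measurable (F u) \<Longrightarrow> (\<forall>w\<in>space M. norm (h w) \<le> c) \<Longrightarrow>
    elem (\<lambda>r w. if u < r \<and> r \<le> v then h w else 0) (\<lambda>r w. h w \<bullet> (B (min r v) w - B (min r u) w))"
| add: "elem Z I \<Longrightarrow> elem Z' I' \<Longrightarrow> elem (\<lambda>r w. Z r w + Z' r w) (\<lambda>r w. I r w + I' r w)"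

lemma elem_scale:
  assumes "elem Z I" shows "elem (\<lambda>r w. c *\<^sub>R Z r w) (\<lambda>r w. c * I r w)"
  using assms
proof induction
  case zero
  then show ?case using elem.zero by simp
next
  case (rect u v h b)
  have "elem (\<lambda>r w. if u < r \<and> r \<le> v then c *\<^sub>R h w else 0) (\<lambda>r w. (c *\<^sub>R h w) \<bullet> (B (min r v) w - B (min r u) w))"
    by (rule elem.rect[where c = "\<bar>c\<bar> * b"]) (use rect in \<open>auto intro!: mult_left_mono borel_measurable_scaleR\<close>)
  then show ?case by (simp add: if_distrib cong: if_cong)
next
  case (add Z I Z' I')
  then show ?case using elem.add[OF add.IH] by (simp add: algebra_simps)
qed

lemma elem_diff: "elem Z I \<Longrightarrow> elem Z' I' \<Longrightarrow> elem (\<lambda>r w. Z r w - Z' r w) (\<lambda>r w. I r w - I' r w)"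
  using elem.add[OF _ elem_scale[of Z' I' "-1"], of Z I] by simp

text \<open>Cutting the integrand at t stops the integral at t; facts about the terminal value
  thereby become facts about every time.\<close>

lemma elem_stop:
  assumes "elem Z I" "0 \<le> t"
  shows "elem (\<lambda>r w. if r \<le> t then Z r w else 0) (\<lambda>r w. I (min r t) w)"
  using assms
proof induction
  case zero
  then show ?case using elem.zero by simp
next
  case (rect u v h c)
  show ?case
  proof (cases "u \<le> t")
    case True
    have "elem (\<lambda>r w. if u < r \<and> r \<le> min v t then h w else 0) (\<lambda>r w. h w \<bullet> (B (min r (min v t)) w - B (min r u) w))"
      by (rule elem.rect) (use rect True in auto)
    moreover have "(if u < r \<and> r \<le> min v t then h w else 0) = (if r \<le> t then if u < r \<and> r \<le> v then h w else 0 else 0)" for r w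
      by auto
    moreover have "min r (min v t) = min (min r t) v" "min r u = min (min r t) u" for r using True by auto
    ultimately show ?thesis by simp
  next
    case False
    then have "(if r \<le> t then if u < r \<and> r \<le> v then h w else 0 else 0) = 0" for r w by auto
    moreover have "min (min r t) v = min (min r t) u" for r using False rect by auto
    ultimately show ?thesis using elem.zero by simp
  qed
next
  case (add Z I Z' I')
  then show ?case using elem.add[OF add.IH] by (simp add: if_distrib cong: if_cong)
qed

text \<open>A finite set \<open>Q\<close> of times stands for the partition given by its sorted
  enumeration, which has \<open>card Q - 1\<close> intervals.\<close>

definition grid_rep :: "real set \<Rightarrow> (real \<Rightarrow> 'a \<Rightarrow> real ^ 'd) \<Rightarrow> (real \<Rightarrow> 'a \<Rightarrow> real) \<Rightarrow> bool" where
  "grid_rep Q Z I \<longleftrightarrow> (\<exists>h. simple_integrand M T F (card Q - 1) ((!) (sorted_list_of_set Q)) h \<and>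
     Z = simple_process (card Q - 1) ((!) (sorted_list_of_set Q)) h \<and>
     I = simple_integral B (card Q - 1) ((!) (sorted_list_of_set Q)) h)"

text \<open>The representation is claimed on every grid that refines \<open>P\<close>, so that two
  elementary integrands can be written on the union of their grids and added coefficientwise. A
  rectangle contributes its two end points.\<close>

lemma elem_grid:
  assumes "elem Z I"
  shows "\<exists>P. finite P \<and> P \<subseteq> {0..T} \<and> (\<forall>Q. finite Q \<longrightarrow> Q \<subseteq> {0..T} \<longrightarrow> P \<subseteq> Q \<longrightarrow> Q \<noteq> {} \<longrightarrow> grid_rep Q Z I)"
  using assms
proof induction
  case zero
  have "grid_rep Q (\<lambda>r w. 0) (\<lambda>r w. 0)" if Q: "finite Q" "Q \<subseteq> {0..T}" "Q \<noteq> {}" for Q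
  proof -
    have c: "0 < card Q" using Q by (simp add: card_gt_0_iff)
    let ?xs = "sorted_list_of_set Q"
    have "?xs ! i \<in> {0..T}" if "i \<le> card Q - 1" for i
    proof -
      have "?xs ! i \<in> set ?xs" using that c by (intro nth_mem) auto
      then show ?thesis using Q by auto
    qed
    moreover have "?xs ! i < ?xs ! Suc i" if "i < card Q - 1" for i
      using strict_sorted_list_of_set[of Q] that by (intro sorted_wrt_nth_less[of "(<)"]) auto
    ultimately show ?thesis unfolding grid_rep_def
      by (intro exI[of _ "\<lambda>_ _. 0"]) (auto simp: simple_integrand_def simple_process_def simple_integral_def fun_eq_iff)
  qed
  then show ?case by (intro exI[of _ "{}"]) auto
next
  case (rect u v h c)
  have "grid_rep Q (\<lambda>r w. if u < r \<and> r \<le> v then h w else 0) (\<lambda>r w. h w \<bullet> (B (min r v) w - B (min r u) w))"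
    if Q: "finite Q" "Q \<subseteq> {0..T}" "{u, v} \<subseteq> Q" for Q
  proof -
    have c: "0 < card Q" using Q by (auto simp: card_gt_0_iff)
    let ?xs = "sorted_list_of_set Q" and ?n = "card Q - 1"
    have mem: "?xs ! i \<in> {0..T}" if "i \<le> ?n" for i
    proof -
      have "?xs ! i \<in> set ?xs" using that c by (intro nth_mem) auto
      then show ?thesis using Q by auto
    qed
    have inc: "?xs ! i < ?xs ! Suc i" if "i < ?n" for i
      using strict_sorted_list_of_set[of Q] that by (intro sorted_wrt_nth_less[of "(<)"]) auto
    obtain a where a: "a < card Q" "?xs ! a = u"
      using Q in_set_conv_nth[of u ?xs] by auto
    obtain b where b: "b < card Q" "?xs ! b = v"
      using Q in_set_conv_nth[of v ?xs] by auto
    have ab: "a \<le> b"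
    proof (rule ccontr)
      assume "\<not> a \<le> b"
      then have "?xs ! b < ?xs ! a"
        using strict_sorted_list_of_set[of Q] a by (intro sorted_wrt_nth_less[of "(<)"]) auto
      then show False using a b \<open>u \<le> v\<close> by simp
    qed
    \<comment> \<open>On a finer grid the single coefficient h is repeated on all intervals between
      u and v; it remains measurable because these start at or after u.\<close>
    define k where "k i w = (if a \<le> i \<and> i < b then h w else 0)" for i w
    have au: "u \<le> ?xs ! i" if "a \<le> i" "i < card Q" for i
    proof (cases "a = i")
      case False
      then have "?xs ! a < ?xs ! i"
        using that strict_sorted_list_of_set[of Q] by (intro sorted_wrt_nth_less[of "(<)"]) auto
      then show ?thesis using a by simp
    qed (use a in simp)
    have simp: "simple_integrand M T F ?n ((!) ?xs) k"
      unfolding simple_integrand_def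
    proof (intro conjI allI impI)
      fix i assume i: "i < ?n"
      show "k i \<in> borel_measurable (F (?xs ! i))"
      proof (cases "a \<le> i \<and> i < b")
        case True
        then have "k i = h" by (auto simp: k_def fun_eq_iff)
        then show ?thesis using measurable_F_mono[OF rect(4) au[of i]] True i by simp
      next
        case False
        then have "k i = (\<lambda>_. 0)" by (auto simp: k_def fun_eq_iff)
        then show ?thesis by simp
      qed
      show "\<exists>c. \<forall>w\<in>space M. norm (k i w) \<le> c"
      proof (intro exI ballI)
        fix w assume "w \<in> space M"
        then have "norm (h w) \<le> c" using rect(5) by simp
        then show "norm (k i w) \<le> max 0 c" by (auto simp: k_def)
      qed
    qed (use mem inc in auto)
    have split: "(\<Sum>i<?n. if a \<le> i \<and> i < b then g i else 0) = (\<Sum>i\<in>{a..<b}. g i)"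
      for g :: "nat \<Rightarrow> 'z::comm_monoid_add"
      by (rule sum.mono_neutral_cong_right) (use b(1) in auto)
    have Z: "(\<lambda>r w. if u < r \<and> r \<le> v then h w else 0) = simple_process ?n ((!) ?xs) k"
    proof (intro ext)
      fix r w
      have "simple_process ?n ((!) ?xs) k r w
          = (\<Sum>i<?n. if a \<le> i \<and> i < b then if ?xs ! i < r \<and> r \<le> ?xs ! Suc i then h w else 0 else 0)"
        unfolding simple_process_def by (rule sum.cong) (auto simp: k_def)
      also have "\<dots> = (if u < r \<and> r \<le> v then h w else 0)"
        unfolding split using sum_indicator_telescope[OF ab, of "(!) ?xs" r "h w"] inc a b by auto
      finally show "(if u < r \<and> r \<le> v then h w else 0) = simple_process ?n ((!) ?xs) k r w" ..
    qed
    have I: "(\<lambda>r w. h w \<bullet> (B (min r v) w - B (min r u) w)) = simple_integral B ?n ((!) ?xs) k"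
    proof (intro ext)
      fix r w
      have "simple_integral B ?n ((!) ?xs) k r w
          = (\<Sum>i<?n. if a \<le> i \<and> i < b then h w \<bullet> B (min r (?xs ! Suc i)) w - h w \<bullet> B (min r (?xs ! i)) w else 0)"
        unfolding simple_integral_def by (rule sum.cong) (auto simp: k_def inner_diff_right)
      also have "\<dots> = h w \<bullet> (B (min r v) w - B (min r u) w)"
        unfolding split using ab a b by (subst sum_Suc_diff') (auto simp: inner_diff_right)
      finally show "h w \<bullet> (B (min r v) w - B (min r u) w) = simple_integral B ?n ((!) ?xs) k r w" ..
    qed
    show ?thesis unfolding grid_rep_def using simp Z I by blast
  qed
  then show ?case using rect by (intro exI[of _ "{u, v}"]) auto
next
  case (add Z I Z' I')
  from add.IH(1) obtain P where P: "finite P \<and> P \<subseteq> {0..T} \<and> (\<forall>Q. finite Q \<longrightarrow> Q \<subseteq> {0..T} \<longrightarrow> P \<subseteq> Q \<longrightarrow> Q \<noteq> {} \<longrightarrow> grid_rep Q Z I)" by (rule exE)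
  from add.IH(2) obtain P' where P': "finite P' \<and> P' \<subseteq> {0..T} \<and>
      (\<forall>Q. finite Q \<longrightarrow> Q \<subseteq> {0..T} \<longrightarrow> P' \<subseteq> Q \<longrightarrow> Q \<noteq> {} \<longrightarrow> grid_rep Q Z' I')" by (rule exE)
  have "grid_rep Q (\<lambda>r w. Z r w + Z' r w) (\<lambda>r w. I r w + I' r w)"
    if Q: "finite Q" "Q \<subseteq> {0..T}" "P \<union> P' \<subseteq> Q" "Q \<noteq> {}" for Q
  proof -
    let ?xs = "sorted_list_of_set Q" and ?n = "card Q - 1"
    obtain h where h: "simple_integrand M T F ?n ((!) ?xs) h" "Z = simple_process ?n ((!) ?xs) h" "I = simple_integral B ?n ((!) ?xs) h"
      using P[THEN conjunct2, THEN conjunct2, rule_format, of Q] Q unfolding grid_rep_def Un_subset_iff by iprover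
    obtain h' where h': "simple_integrand M T F ?n ((!) ?xs) h'" "Z' = simple_process ?n ((!) ?xs) h'" "I' = simple_integral B ?n ((!) ?xs) h'"
      using P'[THEN conjunct2, THEN conjunct2, rule_format, of Q] Q unfolding grid_rep_def Un_subset_iff by iprover
    have "\<exists>c. \<forall>w\<in>space M. norm (h i w + h' i w) \<le> c" if "i < ?n" for i
    proof -
      have "\<exists>c. \<forall>w\<in>space M. norm (h i w) \<le> c" "\<exists>c. \<forall>w\<in>space M. norm (h' i w) \<le> c"
        using h(1) h'(1) that unfolding simple_integrand_def by simp_all
      then obtain c c' where "\<forall>w\<in>space M. norm (h i w) \<le> c" "\<forall>w\<in>space M. norm (h' i w) \<le> c'"
        by (elim exE)
      then show ?thesis by (intro exI[of _ "c + c'"]) (auto intro!: norm_triangle_mono)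
    qed
    then have "simple_integrand M T F ?n ((!) ?xs) (\<lambda>i w. h i w + h' i w)"
      using h(1) h'(1) unfolding simple_integrand_def by (auto intro!: borel_measurable_add)
    then show ?thesis unfolding grid_rep_def h h'
      by (intro exI[of _ "\<lambda>i w. h i w + h' i w"])
         (auto simp: simple_process_def simple_integral_def fun_eq_iff sum.distrib[symmetric] inner_add_left intro!: sum.cong)
  qed
  then show ?case using P P' by (intro exI[of _ "P \<union> P'"]) auto
qed

lemma elem_simple:
  assumes "elem Z I"
  obtains n \<tau> h where "simple_integrand M T F n \<tau> h" "Z = simple_process n \<tau> h" "I = simple_integral B n \<tau> h"
proof -
  from elem_grid[OF assms] obtain P where P: "finite P \<and> P \<subseteq> {0..T} \<and>
    (\<forall>Q. finite Q \<longrightarrow> Q \<subseteq> {0..T} \<longrightarrow> P \<subseteq> Q \<longrightarrow> Q \<noteq> {} \<longrightarrow> grid_rep Q Z I)" by (rule exE)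
  \<comment> \<open>The point 0 guards against an empty grid.\<close>
  have "finite (insert 0 P)" "insert 0 P \<subseteq> {0..T}" "P \<subseteq> insert 0 P" "insert 0 P \<noteq> {}"
    using P horizon_pos by auto
  with P have "grid_rep (insert 0 P) Z I" by simp
  then show thesis unfolding grid_rep_def by (elim exE conjE) (rule that)
qed

lemma simple_elem:
  assumes si: "simple_integrand M T F n \<tau> h"
  shows "elem (simple_process n \<tau> h) (simple_integral B n \<tau> h)"
proof -
  have "m \<le> n \<Longrightarrow> elem (simple_process m \<tau> h) (simple_integral B m \<tau> h)" for m
  proof (induction m)
    case 0
    then show ?case using elem.zero by (simp add: simple_process_def simple_integral_def)
  next
    case (Suc m)
    obtain c where c: "\<forall>w\<in>space M. norm (h m w) \<le> c" using si Suc.prems unfolding simple_integrand_def by fastforce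
    have "\<tau> m \<in> {0..T}" "\<tau> (Suc m) \<in> {0..T}" "\<tau> m < \<tau> (Suc m)" "h m \<in> borel_measurable (F (\<tau> m))"
      using si Suc.prems by (auto simp: simple_integrand_def)
    then have "elem (\<lambda>r w. if \<tau> m < r \<and> r \<le> \<tau> (Suc m) then h m w else 0)
        (\<lambda>r w. h m w \<bullet> (B (min r (\<tau> (Suc m))) w - B (min r (\<tau> m)) w))"
      using c by (intro elem.rect) auto
    from elem.add[OF Suc.IH this] Suc.prems show ?case
      by (simp add: simple_process_def simple_integral_def)
  qed
  then show ?thesis by simp
qed

lemma elem_adapted:
  assumes "elem Z I" "t \<in> {0..T}" shows "I t \<in> borel_measurable (F t)"
  using assms
proof induction
  case (rect u v h c)
  show ?case
  proof (cases "u \<le> t")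
    case True
    then show ?thesis using rect
      by (intro borel_measurable_inner borel_measurable_diff measurable_B_F measurable_F_mono[OF rect(4)]) auto
  next
    case False
    then have "min t v = min t u" using rect by auto
    then show ?thesis by simp
  qed
qed auto

lemma elem_continuous:
  assumes "elem Z I" shows "continuous_process M T I"
  using assms unfolding continuous_process_def
proof induction
  case (rect u v h c)
  from continuous_paths show ?case
  proof eventually_elim
    case (elim w)
    have "continuous_on {0..T} (\<lambda>t. B (min t W) w)" if "W \<in> {0..T}" for W
      by (rule continuous_on_compose2[OF elim]) (use that in \<open>auto intro!: continuous_intros\<close>)
    then show ?case using rect by (intro continuous_intros) auto
  qed
next
  case (add Z I Z' I')
  from add.IH show ?case by eventually_elim (intro continuous_intros)
qed auto

text \<open>The martingale property, tested against an integrable variable X of the past; on each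
  rectangle X h is again a coefficient known before the increment.\<close>

lemma elem_orthogonal:
  assumes "elem Z I" and st: "0 \<le> s" "s \<le> t" "t \<le> T" and X: "X \<in> borel_measurable (F s)" "integrable M X"
  shows "integrable M (\<lambda>w. X w * (I t w - I s w)) \<and> expectation (\<lambda>w. X w * (I t w - I s w)) = 0"
  using assms(1)
proof induction
  case zero
  then show ?case by simp
next
  case (rect u v h c)
  \<comment> \<open>The end points of [s, t] are clipped to [u, v]. Either p = r and the
    contribution vanishes, or p lies at or after both s and u, so that X and h are known at time
    p.\<close>
  define p where "p = max u (min s v)"
  define r where "r = max u (min t v)"
  have eq: "X w * (h w \<bullet> (B (min t v) w - B (min t u) w) - h w \<bullet> (B (min s v) w - B (min s u) w))
      = (X w *\<^sub>R h w) \<bullet> (B r w - B p w)" for w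
    using st rect(1-3) unfolding p_def r_def by (auto simp: min_def max_def algebra_simps inner_diff_right)
  have pr: "p \<le> r" "0 \<le> p" "r \<le> T" using st rect(1-3) by (auto simp: p_def r_def)
  show ?case
  proof (cases "p = r")
    case True
    then show ?thesis unfolding eq by simp
  next
    case False
    then have "s \<le> p" "u \<le> p" using st rect(1-3) by (auto simp: p_def r_def min_def max_def split: if_splits)
    then have m: "(\<lambda>w. X w *\<^sub>R h w) \<in> borel_measurable (F p)"
      by (intro borel_measurable_scaleR measurable_F_mono[OF X(1)] measurable_F_mono[OF rect(4)])
    have "integrable M (\<lambda>w. (X w *\<^sub>R h w) $ i)" for i
    proof (rule Bochner_Integration.integrable_bound)
      show "integrable M (\<lambda>w. c * X w)" using X by simp
      show "(\<lambda>w. (X w *\<^sub>R h w) $ i) \<in> borel_measurable M"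
        using m pr by (intro borel_measurable_vec_component measurable_F_M[OF m]) auto
      show "AE w in M. norm ((X w *\<^sub>R h w) $ i) \<le> norm (c * X w)"
      proof (rule AE_I2)
        fix w assume "w \<in> space M"
        then have "\<bar>h w $ i\<bar> \<le> \<bar>c\<bar>" using rect(5) component_le_norm_cart[of "h w" i] by force
        then show "norm ((X w *\<^sub>R h w) $ i) \<le> norm (c * X w)"
          by (simp add: abs_mult mult.commute[of _ "\<bar>X w\<bar>"] mult_left_mono)
      qed
    qed
    from increment_inner_orthogonal[OF _ _ _ m this, of r] pr False show ?thesis unfolding eq by auto
  qed
next
  case (add Z I Z' I')
  have eq: "X w * (I t w + I' t w - (I s w + I' s w)) = X w * (I t w - I s w) + X w * (I' t w - I' s w)" for w
    by (simp add: algebra_simps)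
  from add.IH show ?case unfolding eq by simp
qed

end

lemma chain_le:
  fixes \<tau> :: "nat \<Rightarrow> real"
  assumes "\<And>i. i < n \<Longrightarrow> \<tau> i < \<tau> (Suc i)" "i \<le> j" "j \<le> n"
  shows "\<tau> i \<le> \<tau> j"
  using assms(2,3)
proof (induction j rule: dec_induct)
  case (step j)
  then show ?case using assms(1)[of j] by simp
qed simp

lemma norm_square_disjoint_sum:
  fixes x :: "nat \<Rightarrow> 'b::real_normed_vector" and \<tau> :: "nat \<Rightarrow> real"
  assumes "\<And>i. i < n \<Longrightarrow> \<tau> i < \<tau> (Suc i)"
  shows "(norm (\<Sum>i<n. if s \<in> {\<tau> i<..\<tau> (Suc i)} then x i else 0))\<^sup>2
      = (\<Sum>i<n. if s \<in> {\<tau> i<..\<tau> (Suc i)} then (norm (x i))\<^sup>2 else 0)"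
  using assms
proof (induction n)
  case (Suc n)
  show ?case
  proof (cases "s \<in> {\<tau> n<..\<tau> (Suc n)}")
    case True
    have "\<tau> (Suc i) \<le> \<tau> n" if "i < n" for i
      using that Suc.prems by (intro chain_le[of n]) auto
    then have "i < n \<Longrightarrow> s \<notin> {\<tau> i<..\<tau> (Suc i)}" for i using True by force
    then have "(\<Sum>i<n. if s \<in> {\<tau> i<..\<tau> (Suc i)} then x i else 0) = 0"
      "(\<Sum>i<n. if s \<in> {\<tau> i<..\<tau> (Suc i)} then (norm (x i))\<^sup>2 else 0) = 0" by (auto intro!: sum.neutral)
    with True show ?thesis by simp
  next
    case False
    have "(norm (\<Sum>i<n. if s \<in> {\<tau> i<..\<tau> (Suc i)} then x i else 0))\<^sup>2
      = (\<Sum>i<n. if s \<in> {\<tau> i<..\<tau> (Suc i)} then (norm (x i))\<^sup>2 else 0)"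
      by (rule Suc.IH) (rule Suc.prems, simp)
    then show ?thesis unfolding sum.lessThan_Suc if_not_P[OF False] add_0_right .
  qed
qed simp

section \<open>A maximal inequality along a single path\<close>

fun run_max :: "(nat \<Rightarrow> real) \<Rightarrow> nat \<Rightarrow> real" where
  "run_max x 0 = x 0"
| "run_max x (Suc n) = max (run_max x n) (x (Suc n))"

lemma run_max_ge: "k \<le> n \<Longrightarrow> x k \<le> run_max x n"
  by (induction n) (auto simp: le_Suc_eq intro: max.coboundedI1)

lemma run_max_nonneg: "(\<And>k. 0 \<le> x k) \<Longrightarrow> 0 \<le> run_max x n"
  by (induction n) (auto intro: max.coboundedI1)

text \<open>
  A pathwise form of Doob's inequality: its last sum has nonnegative expectation when \<open>x\<close> is the
  absolute value of a martingale.
\<close>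

lemma run_max_pathwise:
  assumes "\<And>k. 0 \<le> x k"
  shows "(run_max x n)\<^sup>2 \<le> 4 * (x n)\<^sup>2 - 4 * (\<Sum>k<n. run_max x k * (x (Suc k) - x k))"
proof -
  \<comment> \<open>Discrete integration by parts: the maximum moves only at steps where x attains
    it, so the part paired with its increments is at least half the increment of its square.\<close>
  have "(\<Sum>k<n. run_max x k * (x (Suc k) - x k)) \<le> run_max x n * x n - (run_max x n)\<^sup>2 / 2"
  proof (induction n)
    case 0
    then show ?case by (simp add: power2_eq_square)
  next
    case (Suc n)
    let ?m = "run_max x n" and ?y = "x (Suc n)"
    have "(\<Sum>k<Suc n. run_max x k * (x (Suc k) - x k)) \<le> ?m * ?y - ?m\<^sup>2 / 2"
      using Suc by (simp add: algebra_simps)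
    also have "\<dots> \<le> max ?m ?y * ?y - (max ?m ?y)\<^sup>2 / 2"
    proof (cases "?y \<le> ?m")
      case False
      have "0 \<le> (?y - ?m)\<^sup>2" by simp
      with False show ?thesis by (simp add: power2_diff) (simp add: power2_eq_square algebra_simps)
    qed simp
    finally show ?case by simp
  qed
  moreover have "run_max x n * x n \<le> (run_max x n)\<^sup>2 / 4 + (x n)\<^sup>2"
    using zero_le_power2[of "run_max x n / 2 - x n"] by (simp add: power2_diff power_divide)
  ultimately show ?thesis by simp
qed

context brownian_motion
begin

section \<open>The product space, predictable sets and the isometry for simple integrands\<close>

abbreviation "L \<equiv> restrict_space lborel {0..T}"
abbreviation "\<mu> \<equiv> M \<Otimes>\<^sub>M L"
abbreviation "pred \<equiv> predictable_sigma M T F"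

sublocale L: finite_measure L
  by (rule finite_measureI) (simp add: emeasure_restrict_space space_restrict_space emeasure_lborel_Icc_eq)

sublocale PL: finite_measure \<mu>
  by (rule finite_measure_pair_measure) unfold_locales

lemma space_L [simp]: "space L = {0..T}" by (simp add: space_restrict_space)

lemma space_mu [simp]: "space \<mu> = space M \<times> {0..T}" by (simp add: space_pair_measure)

lemma sets_L: "A \<in> sets borel \<Longrightarrow> A \<subseteq> {0..T} \<Longrightarrow> A \<in> sets L"
  by (auto simp: sets_restrict_space)

lemma nn_integral_mu:
  assumes [measurable]: "f \<in> borel_measurable \<mu>"
  shows "(\<integral>\<^sup>+x. f x \<partial>\<mu>) = (\<integral>\<^sup>+w. (\<integral>\<^sup>+s\<in>{0..T}. f (w, s) \<partial>lborel) \<partial>M)"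
proof -
  have "(\<integral>\<^sup>+x. f x \<partial>\<mu>) = (\<integral>\<^sup>+w. (\<integral>\<^sup>+s. f (w, s) \<partial>L) \<partial>M)"
    by (rule L.nn_integral_fst[symmetric]) simp
  also have "\<dots> = (\<integral>\<^sup>+w. (\<integral>\<^sup>+s\<in>{0..T}. f (w, s) \<partial>lborel) \<partial>M)"
    by (intro nn_integral_cong nn_integral_restrict_space) auto
  finally show ?thesis .
qed

lemma sqn_mu:
  fixes Z :: "real \<Rightarrow> 'a \<Rightarrow> 'b::{second_countable_topology, real_normed_vector}"
  assumes "(\<lambda>(w, s). Z s w) \<in> borel_measurable \<mu>"
  shows "sqn \<mu> (\<lambda>(w, s). Z s w) = (\<integral>\<^sup>+w. (\<integral>\<^sup>+s\<in>{0..T}. ennreal ((norm (Z s w))\<^sup>2) \<partial>lborel) \<partial>M)"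
  unfolding sqn_def using assms by (subst nn_integral_mu) (auto simp: split_beta')

lemma predictable_gen_sets:
  "{A \<times> {0} | A. A \<in> sets (F 0)} \<union> {A \<times> {s<..t} | A s t. 0 \<le> s \<and> s < t \<and> t \<le> T \<and> A \<in> sets (F s)} \<subseteq> sets \<mu>"
proof -
  have "A \<times> {0} \<in> sets \<mu>" if "A \<in> sets (F 0)" for A
    using that sets_F_subset[of 0] horizon_pos by (intro pair_measureI sets_L) auto
  moreover have "A \<times> {s<..t} \<in> sets \<mu>" if "0 \<le> s" "s < t" "t \<le> T" "A \<in> sets (F s)" for A s t
    using that sets_F_subset[of s] by (intro pair_measureI sets_L) auto
  ultimately show ?thesis by auto
qed

lemma predictable_gen_Pow:
  "{A \<times> {0} | A. A \<in> sets (F 0)} \<union> {A \<times> {s<..t} | A s t. 0 \<le> s \<and> s < t \<and> t \<le> T \<and> A \<in> sets (F s)} \<subseteq> Pow (space M \<times> {0..T})"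
  using order_trans[OF predictable_gen_sets sets.space_closed] unfolding space_mu .

lemma space_pred [simp]: "space pred = space M \<times> {0..T}"
  unfolding predictable_sigma_def by (rule space_measure_of[OF predictable_gen_Pow])

lemma sets_pred: "sets pred = sigma_sets (space M \<times> {0..T})
    ({A \<times> {0} | A. A \<in> sets (F 0)} \<union> {A \<times> {s<..t} | A s t. 0 \<le> s \<and> s < t \<and> t \<le> T \<and> A \<in> sets (F s)})"
  unfolding predictable_sigma_def by (rule sets_measure_of[OF predictable_gen_Pow])

lemma subalgebra_pred: "subalgebra \<mu> pred"
proof -
  have "sigma_sets (space \<mu>) ({A \<times> {0} | A. A \<in> sets (F 0)} \<union>
      {A \<times> {s<..t} | A s t. 0 \<le> s \<and> s < t \<and> t \<le> T \<and> A \<in> sets (F s)}) \<subseteq> sets \<mu>"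
    by (rule sets.sigma_sets_subset[OF predictable_gen_sets])
  then show ?thesis unfolding subalgebra_def sets_pred space_mu space_pred by (intro conjI refl)
qed

lemma pred_mu: "f \<in> borel_measurable pred \<Longrightarrow> f \<in> borel_measurable \<mu>"
  by (rule measurable_from_subalg[OF subalgebra_pred])

lemma elem_predictable:
  assumes "elem Z I" shows "(\<lambda>(w, s). Z s w) \<in> borel_measurable pred"
  using assms
proof induction
  case (rect u v h c)
  show ?case
  proof (cases "u = v")
    case True
    then have "(\<lambda>(w, s). if u < s \<and> s \<le> v then h w else 0) = (\<lambda>_. 0)" by (auto simp: fun_eq_iff)
    then show ?thesis by simp
  next
    case False
    have G: "C \<times> {u<..v} \<in> sets pred" if "C \<in> sets (F u)" for C
      unfolding sets_pred using rect False that by (intro sigma_sets.Basic) auto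
    have eq: "(\<lambda>(w, s). if u < s \<and> s \<le> v then h w else 0) -` C \<inter> space pred =
        (h -` C \<inter> space M) \<times> {u<..v} \<union> (if 0 \<in> C then space pred - space M \<times> {u<..v} else {})" for C
      using rect by (auto split: if_splits)
    show ?thesis
    proof (rule measurableI)
      fix C :: "(real ^ 'd) set" assume C: "C \<in> sets borel"
      have "h -` C \<inter> space M \<in> sets (F u)" using measurable_sets[OF rect(4) C] by simp
      then show "(\<lambda>(w, s). if u < s \<and> s \<le> v then h w else 0) -` C \<inter> space pred \<in> sets pred"
        unfolding eq using G[of "space M"] G[of "h -` C \<inter> space M"] sets.top[of "F u"] sets.top[of pred]
        unfolding space_F by (cases "0 \<in> C") (auto simp del: space_pred intro!: sets.Un sets.Diff)
    qed simp
  qed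
next
  case (add Z I Z' I')
  have eq: "(\<lambda>(w, s). Z s w + Z' s w) = (\<lambda>x. (case x of (w, s) \<Rightarrow> Z s w) + (case x of (w, s) \<Rightarrow> Z' s w))"
    by (simp add: fun_eq_iff)
  show ?case unfolding eq using add.IH by (rule borel_measurable_add)
qed simp

text \<open>Both sides equal the sum of E|h_i|^2 times the length of the i-th interval: on the left
  because increments over different intervals are orthogonal, on the right because the intervals are
  disjoint.\<close>

lemma simple_isometry:
  assumes si: "simple_integrand M T F n \<tau> h"
  shows "sqn M (simple_integral B n \<tau> h T) = sqn \<mu> (\<lambda>(w, s). simple_process n \<tau> h s w)"
proof -
  define D where "D i w = h i w \<bullet> (B (\<tau> (Suc i)) w - B (\<tau> i) w)" for i w
  have \<tau>: "\<tau> i \<in> {0..T}" if "i \<le> n" for i using si that by (simp add: simple_integrand_def)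
  have inc: "\<tau> i < \<tau> (Suc i)" if "i < n" for i using si that by (simp add: simple_integrand_def)
  have h: "h i \<in> borel_measurable (F (\<tau> i))" if "i < n" for i using si that by (simp add: simple_integrand_def)
  have "\<forall>i. \<exists>c. i < n \<longrightarrow> (\<forall>w\<in>space M. norm (h i w) \<le> c)" using si by (auto simp: simple_integrand_def)
  then obtain c where c: "\<And>i w. i < n \<Longrightarrow> w \<in> space M \<Longrightarrow> norm (h i w) \<le> c i" by metis
  have st: "0 \<le> \<tau> i" "\<tau> i < \<tau> (Suc i)" "\<tau> (Suc i) \<le> T" if "i < n" for i
    using \<tau>[of i] \<tau>[of "Suc i"] inc[OF that] that by auto
  have mono: "\<tau> i \<le> \<tau> j" if "i \<le> j" "j \<le> n" for i j
    using chain_le[of n \<tau>, OF inc] that by auto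
  have hM: "h i \<in> borel_measurable M" if "i < n" for i
    using h[OF that] st[OF that] by (intro measurable_F_M[OF h[OF that]]) auto
  have DF: "D i \<in> borel_measurable (F (\<tau> (Suc i)))" if "i < n" for i
    unfolding D_def using st[OF that]
    by (intro borel_measurable_inner borel_measurable_diff measurable_B_F measurable_F_mono[OF h[OF that]]) auto
  have DM [measurable]: "D i \<in> borel_measurable M" if "i < n" for i
    using st[OF that] by (intro measurable_F_M[OF DF[OF that]]) auto
  have iso: "integrable M (\<lambda>w. (D i w)\<^sup>2)"
    "expectation (\<lambda>w. (D i w)\<^sup>2) = expectation (\<lambda>w. (norm (h i w))\<^sup>2) * (\<tau> (Suc i) - \<tau> i)" if "i < n" for i
    unfolding D_def using increment_inner_isometry[OF st[OF that] h[OF that] c[OF that]] by auto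
  have Dfin: "sqn M (D i) < \<infinity>" if "i < n" for i
    using iso(1)[OF that] that by (subst sqn_integrable_iff[symmetric]) auto
  have Dij: "integrable M (\<lambda>w. D i w * D j w)" if "i < n" "j < n" for i j
    using that by (intro integrable_mult_L2 Dfin) auto
  \<comment> \<open>For i < j the earlier summand D i times the coefficient h j is known at time
    \<tau> j, so the increment that follows is orthogonal to it.\<close>
  have orth: "expectation (\<lambda>w. D i w * D j w) = 0" if ij: "i < j" "j < n" for i j
  proof -
    have i: "i < n" using ij by simp
    have m: "(\<lambda>w. D i w *\<^sub>R h j w) \<in> borel_measurable (F (\<tau> j))"
      using mono[of "Suc i" j] ij by (intro borel_measurable_scaleR h measurable_F_mono[OF DF[OF i]]) auto
    have Di: "integrable M (D i)" by (rule integrable_L2[OF DM[OF i] Dfin[OF i]])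
    have "integrable M (\<lambda>w. (D i w *\<^sub>R h j w) $ k)" for k
    proof (rule Bochner_Integration.integrable_bound)
      show "integrable M (\<lambda>w. c j * D i w)" using Di by simp
      show "(\<lambda>w. (D i w *\<^sub>R h j w) $ k) \<in> borel_measurable M"
        using DM[OF i] hM[OF ij(2)] by (intro borel_measurable_vec_component borel_measurable_scaleR)
      show "AE w in M. norm ((D i w *\<^sub>R h j w) $ k) \<le> norm (c j * D i w)"
      proof (rule AE_I2)
        fix w assume "w \<in> space M"
        then have "\<bar>h j w $ k\<bar> \<le> \<bar>c j\<bar>" using c[OF ij(2)] component_le_norm_cart[of "h j w" k] by force
        then show "norm ((D i w *\<^sub>R h j w) $ k) \<le> norm (c j * D i w)"
          by (simp add: abs_mult mult.commute[of _ "\<bar>D i w\<bar>"] mult_left_mono)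
      qed
    qed
    from increment_inner_orthogonal(2)[OF st[OF ij(2)] m this] show ?thesis by (simp add: D_def)
  qed
  have orth': "expectation (\<lambda>w. D i w * D j w) = (if i = j then expectation (\<lambda>w. (D i w)\<^sup>2) else 0)"
    if "i < n" "j < n" for i j
    using orth[of i j] orth[of j i] that by (cases i j rule: linorder_cases) (auto simp: power2_eq_square mult.commute)
  have I: "simple_integral B n \<tau> h T = (\<lambda>w. \<Sum>i<n. D i w)"
    unfolding simple_integral_def D_def using \<tau> by (intro ext sum.cong refl) (auto simp: min_absorb2)
  have sq: "(\<Sum>i<n. D i w)\<^sup>2 = (\<Sum>i<n. \<Sum>j<n. D i w * D j w)" for w
    by (simp add: power2_eq_square sum_product)
  have int: "integrable M (\<lambda>w. (\<Sum>i<n. D i w)\<^sup>2)"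
    unfolding sq using Dij by (intro Bochner_Integration.integrable_sum) auto
  have e: "expectation (\<lambda>w. (\<Sum>i<n. D i w)\<^sup>2) = (\<Sum>i<n. expectation (\<lambda>w. (norm (h i w))\<^sup>2) * (\<tau> (Suc i) - \<tau> i))"
  proof -
    have "expectation (\<lambda>w. (\<Sum>i<n. D i w)\<^sup>2) = (\<Sum>i<n. \<Sum>j<n. expectation (\<lambda>w. D i w * D j w))"
      unfolding sq using Dij by (subst Bochner_Integration.integral_sum, force intro: Bochner_Integration.integrable_sum)
        (auto intro!: sum.cong Bochner_Integration.integral_sum)
    also have "\<dots> = (\<Sum>i<n. \<Sum>j<n. if i = j then expectation (\<lambda>w. (D i w)\<^sup>2) else 0)"
      by (intro sum.cong refl orth') auto
    also have "\<dots> = (\<Sum>i<n. expectation (\<lambda>w. (D i w)\<^sup>2))" by simp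
    finally show ?thesis using iso(2) by simp
  qed
  have hint: "integrable M (\<lambda>w. (norm (h i w))\<^sup>2)" if "i < n" for i
    using hM[OF that] c[OF that] by (intro integrable_const_bound[of _ "(c i)\<^sup>2"]) (auto intro!: AE_I2 power_mono)
  have left: "sqn M (simple_integral B n \<tau> h T) = ennreal (\<Sum>i<n. expectation (\<lambda>w. (norm (h i w))\<^sup>2) * (\<tau> (Suc i) - \<tau> i))"
    unfolding I using int e by (subst sqn_eq_integral) simp_all
  have "(\<integral>\<^sup>+s\<in>{0..T}. ennreal ((norm (simple_process n \<tau> h s w))\<^sup>2) \<partial>lborel)
      = (\<Sum>i<n. ennreal ((norm (h i w))\<^sup>2 * (\<tau> (Suc i) - \<tau> i)))" for w
  proof -
    have "(\<integral>\<^sup>+s\<in>{0..T}. ennreal ((norm (simple_process n \<tau> h s w))\<^sup>2) \<partial>lborel)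
        = (\<integral>\<^sup>+s. (\<Sum>i<n. ennreal ((norm (h i w))\<^sup>2) * indicator {\<tau> i<..\<tau> (Suc i)} s) \<partial>lborel)"
    proof (intro nn_integral_cong)
      fix s
      have "ennreal ((norm (simple_process n \<tau> h s w))\<^sup>2)
          = (\<Sum>i<n. ennreal ((norm (h i w))\<^sup>2) * indicator {\<tau> i<..\<tau> (Suc i)} s)"
      proof -
        have "ennreal ((norm (simple_process n \<tau> h s w))\<^sup>2)
            = ennreal (\<Sum>i<n. if s \<in> {\<tau> i<..\<tau> (Suc i)} then (norm (h i w))\<^sup>2 else 0)"
          unfolding simple_process_def by (rule arg_cong[where f = ennreal]) (rule norm_square_disjoint_sum, rule inc)
        also have "\<dots> = (\<Sum>i<n. ennreal (if s \<in> {\<tau> i<..\<tau> (Suc i)} then (norm (h i w))\<^sup>2 else 0))"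
          by (intro sum_ennreal[symmetric]) simp
        also have "\<dots> = (\<Sum>i<n. ennreal ((norm (h i w))\<^sup>2) * indicator {\<tau> i<..\<tau> (Suc i)} s)"
          by (intro sum.cong refl) (simp add: indicator_def)
        finally show ?thesis .
      qed
      moreover have "(\<Sum>i<n. ennreal ((norm (h i w))\<^sup>2) * indicator {\<tau> i<..\<tau> (Suc i)} s) = 0" if "s \<notin> {0..T}"
      proof (intro sum.neutral ballI)
        fix i assume "i \<in> {..<n}"
        then have "s \<notin> {\<tau> i<..\<tau> (Suc i)}" using st[of i] that by auto
        then show "ennreal ((norm (h i w))\<^sup>2) * indicator {\<tau> i<..\<tau> (Suc i)} s = 0" by simp
      qed
      ultimately show "ennreal ((norm (simple_process n \<tau> h s w))\<^sup>2) * indicator {0..T} s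
          = (\<Sum>i<n. ennreal ((norm (h i w))\<^sup>2) * indicator {\<tau> i<..\<tau> (Suc i)} s)"
        by (cases "s \<in> {0..T}") auto
    qed
    also have "\<dots> = (\<Sum>i<n. ennreal ((norm (h i w))\<^sup>2) * emeasure lborel {\<tau> i<..\<tau> (Suc i)})"
      by (subst nn_integral_sum) (measurable, intro sum.cong refl nn_integral_cmult_indicator, simp)
    also have "\<dots> = (\<Sum>i<n. ennreal ((norm (h i w))\<^sup>2 * (\<tau> (Suc i) - \<tau> i)))"
    proof (intro sum.cong refl)
      fix i assume "i \<in> {..<n}"
      then have "\<tau> i \<le> \<tau> (Suc i)" using inc[of i] by simp
      then show "ennreal ((norm (h i w))\<^sup>2) * emeasure lborel {\<tau> i<..\<tau> (Suc i)}
          = ennreal ((norm (h i w))\<^sup>2 * (\<tau> (Suc i) - \<tau> i))" by (simp add: ennreal_mult)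
    qed
    finally show ?thesis .
  qed
  then have "sqn \<mu> (\<lambda>(w, s). simple_process n \<tau> h s w)
      = (\<integral>\<^sup>+w. (\<Sum>i<n. ennreal ((norm (h i w))\<^sup>2 * (\<tau> (Suc i) - \<tau> i))) \<partial>M)"
    by (subst sqn_mu[OF pred_mu[OF elem_predictable[OF simple_elem[OF si]]]]) simp
  also have "\<dots> = (\<Sum>i<n. \<integral>\<^sup>+w. ennreal ((norm (h i w))\<^sup>2 * (\<tau> (Suc i) - \<tau> i)) \<partial>M)"
    using hM by (intro nn_integral_sum) simp
  also have "\<dots> = (\<Sum>i<n. ennreal (expectation (\<lambda>w. (norm (h i w))\<^sup>2) * (\<tau> (Suc i) - \<tau> i)))"
  proof (intro sum.cong refl)
    fix i assume "i \<in> {..<n}"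
    then have "\<tau> i \<le> \<tau> (Suc i)" "integrable M (\<lambda>w. (norm (h i w))\<^sup>2)" using inc[of i] hint[of i] by auto
    then show "(\<integral>\<^sup>+w. ennreal ((norm (h i w))\<^sup>2 * (\<tau> (Suc i) - \<tau> i)) \<partial>M)
        = ennreal (expectation (\<lambda>w. (norm (h i w))\<^sup>2) * (\<tau> (Suc i) - \<tau> i))"
      by (subst nn_integral_eq_integral) auto
  qed
  also have "\<dots> = ennreal (\<Sum>i<n. expectation (\<lambda>w. (norm (h i w))\<^sup>2) * (\<tau> (Suc i) - \<tau> i))"
    using inc by (intro sum_ennreal) (auto simp: less_imp_le)
  finally show ?thesis using left by simp
qed

lemma elem_isometry: "elem Z I \<Longrightarrow> sqn M (I T) = sqn \<mu> (\<lambda>(w, s). Z s w)"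
  by (erule elem_simple) (simp add: simple_isometry)

lemma simple_sqn_finite:
  assumes "simple_integrand M T F n \<tau> h" shows "sqn \<mu> (\<lambda>(w, s). simple_process n \<tau> h s w) < \<infinity>"
proof -
  have "\<forall>i. \<exists>c. i < n \<longrightarrow> (\<forall>w\<in>space M. norm (h i w) \<le> c)" using assms by (auto simp: simple_integrand_def)
  then obtain c where c: "\<And>i w. i < n \<Longrightarrow> w \<in> space M \<Longrightarrow> norm (h i w) \<le> c i" by metis
  have "norm (simple_process n \<tau> h s w) \<le> (\<Sum>i<n. \<bar>c i\<bar>)" if "w \<in> space M" for s w
    unfolding simple_process_def using c[OF _ that] by (intro sum_norm_le) (force intro: order_trans)
  then show ?thesis by (intro PL.sqn_bounded) auto
qed

lemma elem_sqn_finite: "elem Z I \<Longrightarrow> sqn \<mu> (\<lambda>(w, s). Z s w) < \<infinity>"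
  by (erule elem_simple) (simp only: simple_sqn_finite)

lemma elem_L2:
  assumes "elem Z I" "t \<in> {0..T}" shows "sqn M (I t) < \<infinity>"
proof -
  have "elem (\<lambda>r w. if r \<le> t then Z r w else 0) (\<lambda>r w. I (min r t) w)" using assms by (intro elem_stop) auto
  from elem_isometry[OF this] elem_sqn_finite[OF this] assms(2) show ?thesis by (simp add: min_absorb2)
qed

end

lemma SUP_power2_ennreal:
  fixes S :: "nat \<Rightarrow> ennreal"
  assumes "incseq S"
  shows "(SUP n. S n)\<^sup>2 = (SUP n. (S n)\<^sup>2)"
proof -
  have "(SUP n. S n)\<^sup>2 = (SUP n. SUP m. S m * S n)"
    by (simp add: power2_eq_square SUP_mult_left_ennreal SUP_mult_right_ennreal)
  also have "\<dots> = (SUP n. (S n)\<^sup>2)"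
  proof (rule antisym)
    show "(SUP n. SUP m. S m * S n) \<le> (SUP n. (S n)\<^sup>2)"
    proof (intro SUP_least)
      fix n m
      have "S m * S n \<le> (S (max n m))\<^sup>2"
        unfolding power2_eq_square using incseqD[OF assms] by (intro mult_mono) auto
      also have "\<dots> \<le> (SUP n. (S n)\<^sup>2)" by (rule SUP_upper) simp
      finally show "S m * S n \<le> (SUP n. (S n)\<^sup>2)" .
    qed
    show "(SUP n. (S n)\<^sup>2) \<le> (SUP n. SUP m. S m * S n)"
    proof (rule SUP_least)
      fix n
      have "(S n)\<^sup>2 \<le> (SUP m. S m * S n)" unfolding power2_eq_square by (rule SUP_upper) simp
      also have "\<dots> \<le> (SUP n. SUP m. S m * S n)" by (rule SUP_upper) simp
      finally show "(S n)\<^sup>2 \<le> (SUP n. SUP m. S m * S n)" .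
    qed
  qed
  finally show ?thesis .
qed

context brownian_motion
begin

text \<open>In place of conditional expectations, increments are required to be orthogonal to all
  square-integrable variables of the past. This form is stable under L^2 limits and feeds directly
  into computations with squares.\<close>

definition l2_martingale :: "(real \<Rightarrow> 'a \<Rightarrow> real) \<Rightarrow> bool" where
  "l2_martingale N \<longleftrightarrow> (\<forall>t\<in>{0..T}. N t \<in> borel_measurable (F t) \<and> sqn M (N t) < \<infinity>) \<and>
    (\<forall>s t X. 0 \<le> s \<longrightarrow> s \<le> t \<longrightarrow> t \<le> T \<longrightarrow> X \<in> borel_measurable (F s) \<longrightarrow> sqn M X < \<infinity> \<longrightarrow>
      expectation (\<lambda>w. X w * (N t w - N s w)) = 0)"

lemma l2_martingaleD:
  assumes "l2_martingale N" "t \<in> {0..T}"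
  shows "N t \<in> borel_measurable (F t)" "N t \<in> borel_measurable M" "sqn M (N t) < \<infinity>"
proof -
  show F: "N t \<in> borel_measurable (F t)" and "sqn M (N t) < \<infinity>" using assms by (auto simp: l2_martingale_def)
  show "N t \<in> borel_measurable M" using assms(2) by (intro measurable_F_M[OF F]) auto
qed

lemma l2_martingale_orth:
  assumes "l2_martingale N" "0 \<le> s" "s \<le> t" "t \<le> T" "X \<in> borel_measurable (F s)" "sqn M X < \<infinity>"
  shows "expectation (\<lambda>w. X w * (N t w - N s w)) = 0"
  using assms by (simp add: l2_martingale_def)

lemma elem_l2_martingale:
  assumes "elem Z I" shows "l2_martingale I"
  unfolding l2_martingale_def
proof (intro conjI ballI allI impI)
  fix t assume "t \<in> {0..T}"
  with assms show "I t \<in> borel_measurable (F t)" by (rule elem_adapted)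
  show "sqn M (I t) < \<infinity>" using assms \<open>t \<in> {0..T}\<close> by (rule elem_L2)
next
  fix s t and X :: "'a \<Rightarrow> real" assume *: "0 \<le> s" "s \<le> t" "t \<le> T" "X \<in> borel_measurable (F s)" "sqn M X < \<infinity>"
  then have "X \<in> borel_measurable M" by (intro measurable_F_M[OF *(4)]) auto
  then have "integrable M X" using *(5) by (rule integrable_L2)
  with elem_orthogonal[OF assms *(1-4)] show "expectation (\<lambda>w. X w * (I t w - I s w)) = 0" by simp
qed

lemma l2_martingale_pythagoras:
  assumes N: "l2_martingale N" and st: "0 \<le> s" "s \<le> t" "t \<le> T"
  shows "sqn M (N t) = sqn M (N s) + sqn M (\<lambda>w. N t w - N s w)"
proof -
  have s: "s \<in> {0..T}" and t: "t \<in> {0..T}" using st by auto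
  note Ns = l2_martingaleD[OF N s] and Nt = l2_martingaleD[OF N t]
  let ?D = "\<lambda>w. N t w - N s w"
  have D: "?D \<in> borel_measurable M" "sqn M ?D < \<infinity>"
    by (rule borel_measurable_diff[OF Nt(2) Ns(2)]) (rule sqn_diff_finite[OF Nt(2) Ns(2) Nt(3) Ns(3)])
  have i: "integrable M (\<lambda>w. (N t w)\<^sup>2)" "integrable M (\<lambda>w. (N s w)\<^sup>2)" "integrable M (\<lambda>w. (?D w)\<^sup>2)"
    using sqn_integrable_iff[of "N t" M] sqn_integrable_iff[of "N s" M] sqn_integrable_iff[of ?D M] Ns Nt D by auto
  have "expectation (\<lambda>w. (N t w)\<^sup>2) = expectation (\<lambda>w. (N s w)\<^sup>2 + (?D w)\<^sup>2 + 2 * (N s w * ?D w))"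
    by (rule Bochner_Integration.integral_cong) (auto simp: power2_eq_square algebra_simps)
  also have "\<dots> = expectation (\<lambda>w. (N s w)\<^sup>2) + expectation (\<lambda>w. (?D w)\<^sup>2) + 2 * expectation (\<lambda>w. N s w * ?D w)"
    using i integrable_mult_L2[of "N s" M ?D] Ns D by simp
  also have "expectation (\<lambda>w. N s w * ?D w) = 0"
    by (rule l2_martingale_orth[OF N st Ns(1,3)])
  finally have "expectation (\<lambda>w. (N t w)\<^sup>2) = expectation (\<lambda>w. (N s w)\<^sup>2) + expectation (\<lambda>w. (?D w)\<^sup>2)" by simp
  then have "ennreal (expectation (\<lambda>w. (N t w)\<^sup>2)) = ennreal (expectation (\<lambda>w. (N s w)\<^sup>2)) + ennreal (expectation (\<lambda>w. (?D w)\<^sup>2))"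
    by (simp add: ennreal_plus)
  then show ?thesis using i by (simp add: sqn_eq_integral)
qed

lemma l2_martingale_sqn_le:
  assumes "l2_martingale N" "t \<in> {0..T}" shows "sqn M (N t) \<le> sqn M (N T)"
  using l2_martingale_pythagoras[of N t T] assms by simp

lemma Doob_discrete:
  assumes N: "l2_martingale N" and t: "\<And>k. t k \<in> {0..T}" and mono: "\<And>k. t k \<le> t (Suc k)"
  shows "sqn M (\<lambda>w. run_max (\<lambda>k. \<bar>N (t k) w\<bar>) n) \<le> 4 * sqn M (N (t n))"
proof -
  let ?x = "\<lambda>w k. \<bar>N (t k) w\<bar>"
  let ?m = "\<lambda>k w. run_max (?x w) k"
  note Nt = l2_martingaleD[OF N t]
  have xF: "(\<lambda>w. ?x w k) \<in> borel_measurable (F (t k))" for k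
    by (intro borel_measurable_abs Nt(1))
  have mF: "?m k \<in> borel_measurable (F (t k))" for k
  proof (induction k)
    case (Suc k)
    then show ?case using measurable_F_mono[OF Suc mono] xF[of "Suc k"] by (simp add: borel_measurable_max)
  qed (use xF[of 0] in simp)
  have mM [measurable]: "?m k \<in> borel_measurable M" for k using t[of k] by (intro measurable_F_M[OF mF]) auto
  have NM [measurable]: "N (t k) \<in> borel_measurable M" for k by (rule Nt(2))
  have xsq: "sqn M (\<lambda>w. ?x w k) = sqn M (N (t k))" for k by (simp add: sqn_def)
  have msq: "sqn M (?m k) < \<infinity>" for k
  proof (induction k)
    case (Suc k)
    have "sqn M (?m (Suc k)) \<le> sqn M (\<lambda>w. ?m k w + ?x w (Suc k))"
      using run_max_nonneg[of "?x _" k] by (intro sqn_mono_AE AE_I2) (auto simp: max_def)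
    also have "\<dots> < \<infinity>"
      using Suc Nt(3)[of "Suc k"] by (intro sqn_add_finite) (auto simp: xsq)
    finally show ?case .
  qed (use Nt(3) in \<open>simp add: xsq\<close>)
  have xfin: "sqn M (\<lambda>w. ?x w k) < \<infinity>" for k using Nt(3) by (simp add: xsq)
  have "0 \<le> expectation (\<lambda>w. ?m k w * (?x w (Suc k) - ?x w k))" for k
  proof -
    \<comment> \<open>Since sgn(a) (b - a) \<le> |b| - |a|, testing the martingale property against
      the running maximum times the sign bounds each term of the sum from below by 0 in
      expectation.\<close>
    let ?W = "\<lambda>w. ?m k w * sgn (N (t k) w)"
    have wF: "?W \<in> borel_measurable (F (t k))"
      by (intro borel_measurable_times mF measurable_compose[OF Nt(1) borel_measurable_sgn])
    have wM [measurable]: "?W \<in> borel_measurable M" by measurable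
    have wfin: "sqn M ?W < \<infinity>"
    proof -
      have "sqn M ?W \<le> sqn M (?m k)" by (intro sqn_mono_AE AE_I2) (auto simp: abs_mult sgn_if)
      then show ?thesis using msq[of k] by (rule le_less_trans)
    qed
    have "0 = expectation (\<lambda>w. ?W w * (N (t (Suc k)) w - N (t k) w))"
      using t[of k] t[of "Suc k"] by (intro l2_martingale_orth[OF N _ mono _ wF wfin, symmetric]) auto
    also have "\<dots> \<le> expectation (\<lambda>w. ?m k w * (?x w (Suc k) - ?x w k))"
    proof (rule integral_mono)
      show "integrable M (\<lambda>w. ?W w * (N (t (Suc k)) w - N (t k) w))"
        by (intro integrable_mult_L2 wfin sqn_diff_finite Nt(3)) auto
      show "integrable M (\<lambda>w. ?m k w * (?x w (Suc k) - ?x w k))"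
        by (intro integrable_mult_L2 msq sqn_diff_finite xfin) auto
      fix w
      have "sgn a * (b - a) \<le> \<bar>b\<bar> - \<bar>a\<bar>" for a b :: real by (auto simp: sgn_if)
      then show "?W w * (N (t (Suc k)) w - N (t k) w) \<le> ?m k w * (?x w (Suc k) - ?x w k)"
        unfolding mult.assoc by (intro mult_left_mono run_max_nonneg) auto
    qed
    finally show ?thesis .
  qed
  note pos = this
  have im: "integrable M (\<lambda>w. (?m n w)\<^sup>2)" using msq[of n] sqn_integrable_iff[of "?m n" M] by simp
  have ix: "integrable M (\<lambda>w. (?x w n)\<^sup>2)" using xfin[of n] sqn_integrable_iff[of "\<lambda>w. ?x w n" M] by simp
  have ip: "integrable M (\<lambda>w. ?m k w * (?x w (Suc k) - ?x w k))" for k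
    by (intro integrable_mult_L2 msq sqn_diff_finite xfin) auto
  have "expectation (\<lambda>w. (?m n w)\<^sup>2) \<le> expectation (\<lambda>w. 4 * (?x w n)\<^sup>2 - 4 * (\<Sum>k<n. ?m k w * (?x w (Suc k) - ?x w k)))"
    using im ix ip by (intro integral_mono Bochner_Integration.integrable_diff integrable_mult_right
        Bochner_Integration.integrable_sum run_max_pathwise) auto
  also have "\<dots> = 4 * expectation (\<lambda>w. (?x w n)\<^sup>2) - 4 * (\<Sum>k<n. expectation (\<lambda>w. ?m k w * (?x w (Suc k) - ?x w k)))"
    using ix ip by (subst Bochner_Integration.integral_diff)
      (auto intro!: integrable_mult_right Bochner_Integration.integrable_sum simp: Bochner_Integration.integral_sum)
  also have "\<dots> \<le> 4 * expectation (\<lambda>w. (?x w n)\<^sup>2)"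
    using pos by (simp add: sum_nonneg)
  finally have "ennreal (expectation (\<lambda>w. (?m n w)\<^sup>2)) \<le> 4 * ennreal (expectation (\<lambda>w. (?x w n)\<^sup>2))"
    by (simp add: ennreal_mult''[symmetric] flip: ennreal_numeral) 
  then show ?thesis
    unfolding xsq[symmetric] using im ix by (simp add: sqn_eq_integral)
qed

lemma Doob_finite:
  assumes N: "l2_martingale N" and P: "finite P" "P \<subseteq> {0..T}"
  shows "(\<integral>\<^sup>+w. (SUP t\<in>P. ennreal \<bar>N t w\<bar>)\<^sup>2 \<partial>M) \<le> 4 * sqn M (N T)"
proof (cases "P = {}")
  case True
  then show ?thesis by (simp add: bot_ennreal)
next
  case False
  let ?xs = "sorted_list_of_set P"
  define n where "n = card P - 1"
  \<comment> \<open>The enumeration is frozen at its last element, which makes it a nondecreasing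
    sequence indexed by all naturals.\<close>
  define t where "t k = ?xs ! (min k n)" for k
  have c: "0 < card P" using P False by (simp add: card_gt_0_iff)
  have tP: "t k \<in> P" for k
  proof -
    have "t k \<in> set ?xs" unfolding t_def using c by (intro nth_mem) (auto simp: n_def)
    then show ?thesis using P by simp
  qed
  have mono: "t k \<le> t (Suc k)" for k
    unfolding t_def using c by (intro sorted_nth_mono) (auto simp: n_def)
  have cover: "\<exists>k\<le>n. s = t k" if "s \<in> P" for s
  proof -
    have "s \<in> set ?xs" using that P by simp
    then obtain k where "k < card P" "?xs ! k = s" unfolding in_set_conv_nth by auto
    then show ?thesis by (intro exI[of _ k]) (auto simp: t_def n_def)
  qed
  have "(\<integral>\<^sup>+w. (SUP t\<in>P. ennreal \<bar>N t w\<bar>)\<^sup>2 \<partial>M) \<le> sqn M (\<lambda>w. run_max (\<lambda>k. \<bar>N (t k) w\<bar>) n)"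
    unfolding sqn_def
  proof (rule nn_integral_mono)
    fix w
    let ?r = "run_max (\<lambda>k. \<bar>N (t k) w\<bar>) n"
    have r: "0 \<le> ?r" by (rule run_max_nonneg) simp
    have "(SUP t\<in>P. ennreal \<bar>N t w\<bar>) \<le> ennreal ?r"
    proof (rule SUP_least)
      fix s assume "s \<in> P"
      then obtain k where "k \<le> n" "s = t k" using cover by auto
      then show "ennreal \<bar>N s w\<bar> \<le> ennreal ?r"
        using run_max_ge[of k n "\<lambda>k. \<bar>N (t k) w\<bar>"] by (intro ennreal_leI) simp
    qed
    then have "(SUP t\<in>P. ennreal \<bar>N t w\<bar>)\<^sup>2 \<le> (ennreal ?r)\<^sup>2" by (intro power_mono) auto
    also have "\<dots> = ennreal ((norm ?r)\<^sup>2)" using r by (simp add: ennreal_power)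
    finally show "(SUP t\<in>P. ennreal \<bar>N t w\<bar>)\<^sup>2 \<le> ennreal ((norm ?r)\<^sup>2)" .
  qed
  also have "\<dots> \<le> 4 * sqn M (N (t n))"
    using subsetD[OF P(2) tP] mono by (rule Doob_discrete[OF N])
  also have "\<dots> \<le> 4 * sqn M (N T)"
    by (intro mult_left_mono l2_martingale_sqn_le[OF N] subsetD[OF P(2) tP]) simp
  finally show ?thesis .
qed

text \<open>Monotone convergence along an enumeration of \<open>P\<close>. Countably many times keep
  the supremum measurable; continuity of paths extends the bound to the whole interval in
  \<open>l2_martingale_sup\<close>.\<close>

theorem Doob_countable:
  assumes N: "l2_martingale N" and P: "countable P" "P \<subseteq> {0..T}"
  shows "(\<integral>\<^sup>+w. (SUP t\<in>P. ennreal \<bar>N t w\<bar>)\<^sup>2 \<partial>M) \<le> 4 * sqn M (N T)"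
proof (cases "P = {}")
  case True
  then show ?thesis by (simp add: bot_ennreal)
next
  case False
  let ?d = "from_nat_into P"
  have dP: "?d k \<in> P" for k by (rule from_nat_into[OF False])
  have dT: "?d k \<in> {0..T}" for k by (rule subsetD[OF P(2) dP])
  have [measurable]: "N (?d k) \<in> borel_measurable M" for k using l2_martingaleD(2)[OF N dT] .
  let ?S = "\<lambda>n w. SUP k\<in>{..n}. ennreal \<bar>N (?d k) w\<bar>"
  have inc: "incseq (\<lambda>n. (?S n w)\<^sup>2)" for w
    by (intro incseq_SucI power_mono SUP_subset_mono) auto
  have eq: "(SUP t\<in>P. ennreal \<bar>N t w\<bar>)\<^sup>2 = (SUP n. (?S n w)\<^sup>2)" for w
  proof -
    have "(SUP n. ?S n w)\<^sup>2 = (SUP n. (?S n w)\<^sup>2)"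
      by (intro SUP_power2_ennreal incseq_SucI SUP_subset_mono) auto
    moreover have "(SUP n. ?S n w) = (SUP t\<in>P. ennreal \<bar>N t w\<bar>)"
    proof (rule antisym)
      show "(SUP n. ?S n w) \<le> (SUP t\<in>P. ennreal \<bar>N t w\<bar>)"
        using dP by (intro SUP_least SUP_upper) auto
      show "(SUP t\<in>P. ennreal \<bar>N t w\<bar>) \<le> (SUP n. ?S n w)"
      proof (rule SUP_least)
        fix s assume "s \<in> P"
        then obtain k where k: "s = ?d k" using from_nat_into_surj[OF P(1)] by metis
        have "ennreal \<bar>N s w\<bar> \<le> ?S k w" unfolding k by (rule SUP_upper) simp
        also have "\<dots> \<le> (SUP n. ?S n w)" by (rule SUP_upper) simp
        finally show "ennreal \<bar>N s w\<bar> \<le> (SUP n. ?S n w)" .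
      qed
    qed
    ultimately show ?thesis by simp
  qed
  have "(\<integral>\<^sup>+w. (SUP t\<in>P. ennreal \<bar>N t w\<bar>)\<^sup>2 \<partial>M) = (SUP n. \<integral>\<^sup>+w. (?S n w)\<^sup>2 \<partial>M)"
    unfolding eq
  proof (rule nn_integral_monotone_convergence_SUP)
    show "incseq (\<lambda>n w. (?S n w)\<^sup>2)" using inc by (auto simp: incseq_def le_fun_def)
    show "(\<lambda>w. (?S n w)\<^sup>2) \<in> borel_measurable M" for n by measurable
  qed
  also have "\<dots> \<le> 4 * sqn M (N T)"
  proof (rule SUP_least)
    fix n
    have "?S n w = (SUP t\<in>?d ` {..n}. ennreal \<bar>N t w\<bar>)" for w by (simp add: image_comp)
    then show "(\<integral>\<^sup>+w. (?S n w)\<^sup>2 \<partial>M) \<le> 4 * sqn M (N T)"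
      using Doob_finite[OF N, of "?d ` {..n}"] image_subsetI[of "{..n}" ?d "{0..T}", OF dT] by simp
  qed
  finally show ?thesis .
qed

section \<open>Density of elementary integrands among predictable ones\<close>

lemma elem_pred: "elem Z I \<Longrightarrow> (pz Z) \<in> borel_measurable pred"
  using elem_predictable[of Z I] by (simp add: case_prod_unfold)

lemma elem_mu: "elem Z I \<Longrightarrow> (pz Z) \<in> borel_measurable \<mu>"
  by (rule pred_mu[OF elem_pred])

lemma elem_iso: "elem Z I \<Longrightarrow> sqn M (I T) = sqn \<mu> (pz Z)"
  using elem_isometry[of Z I] by (simp add: case_prod_unfold)

lemma elem_iso_at:
  assumes "elem Z I" "t \<in> {0..T}"
  shows "sqn M (I t) = sqn \<mu> (\<lambda>x. if snd x \<le> t then pz Z x else 0)"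
proof -
  have "elem (\<lambda>r w. if r \<le> t then Z r w else 0) (\<lambda>r w. I (min r t) w)" using assms by (intro elem_stop) auto
  from elem_iso[OF this] assms(2) show ?thesis by (simp add: min_absorb2)
qed

lemma elem_fin: "elem Z I \<Longrightarrow> sqn \<mu> (pz Z) < \<infinity>"
  using elem_sqn_finite[of Z I] by (simp add: case_prod_unfold)

definition elem_space :: "('a \<times> real \<Rightarrow> real ^ 'd) set" where
  "elem_space = {\<lambda>x. pz Z x | Z I. elem Z I}"

lemma elem_spaceI: "elem Z I \<Longrightarrow> (pz Z) \<in> elem_space"
  unfolding elem_space_def by blast

lemma lin_space_elem: "lin_space \<mu> elem_space"
  unfolding lin_space_def
proof (intro conjI ballI allI subsetI)
  show "f \<in> borel_measurable \<mu>" if "f \<in> elem_space" for f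
    using that elem_mu unfolding elem_space_def by auto
  show "(\<lambda>x. 0) \<in> elem_space" using elem_spaceI[OF elem.zero] .
  show "(\<lambda>x. f x + g x) \<in> elem_space" if fg: "f \<in> elem_space" "g \<in> elem_space" for f g
  proof -
    obtain Z I where Z: "elem Z I" "f = (pz Z)" using fg unfolding elem_space_def by blast
    obtain Z' I' where Z': "elem Z' I'" "g = (pz Z')" using fg unfolding elem_space_def by blast
    show ?thesis unfolding Z Z' by (rule elem_spaceI[OF elem.add[OF Z(1) Z'(1)]])
  qed
  show "(\<lambda>x. c *\<^sub>R f x) \<in> elem_space" if f: "f \<in> elem_space" for f and c :: real
  proof -
    obtain Z I where Z: "elem Z I" "f = (pz Z)" using f unfolding elem_space_def by blast
    show ?thesis unfolding Z by (rule elem_spaceI[OF elem_scale[OF Z(1)]])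
  qed
qed

lemma AE_mu_time: "AE x in \<mu>. snd x \<noteq> 0"
proof -
  have "{0} \<in> sets L" using horizon_pos by (intro sets_L) auto
  moreover have "emeasure L {0} = 0" using horizon_pos by (subst emeasure_restrict_space) auto
  ultimately have "space M \<times> {0} \<in> null_sets \<mu>"
    by (intro null_setsI) (auto simp: L.emeasure_pair_measure_Times)
  from AE_not_in[OF this] AE_space[of \<mu>] show ?thesis
    by eventually_elim (auto simp: space_pair_measure)
qed

text \<open>The generators of the predictable sigma-algebra form a pi-system: rectangles over (s, t]
  are elementary integrands, those at time 0 are null for the product measure. Indicators of
  predictable sets follow by the Dynkin argument, general integrands from indicators.\<close>

lemma predictable_approx:
  fixes f :: "'a \<times> real \<Rightarrow> real ^ 'd"
  assumes "f \<in> borel_measurable pred" "sqn \<mu> f < \<infinity>"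
  shows "f \<in> cl \<mu> elem_space"
proof (rule cl_indicator_imp_L2[OF lin_space_elem subalgebra_pred _ assms])
  fix A and c :: "real ^ 'd" assume A: "A \<in> sets pred"
  define P where "P = {A \<times> {0::real} | A. A \<in> sets (F 0)} \<union> {A \<times> {s<..t} | A s t. 0 \<le> s \<and> s < t \<and> t \<le> T \<and> A \<in> sets (F s)}"
  have PE: "(\<exists>A. a = A \<times> {0::real} \<and> A \<in> sets (F 0)) \<or> (\<exists>A s t. a = A \<times> {s<..t} \<and> 0 \<le> s \<and> s < t \<and> t \<le> T \<and> A \<in> sets (F s))"
    if "a \<in> P" for a
    using that unfolding P_def Un_iff mem_Collect_eq .
  have PI: "A \<times> {s<..t} \<in> P" if "0 \<le> s" "s < t" "t \<le> T" "A \<in> sets (F s)" for A s t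
    unfolding P_def using that by blast
  have PI0: "A \<times> {0} \<in> P" if "A \<in> sets (F 0)" for A
    unfolding P_def using that by blast
  have P\<mu>: "P \<subseteq> sets \<mu>" unfolding P_def by (rule predictable_gen_sets)
  have rect: "(\<lambda>x. indicat_real (A \<times> {s<..t}) x *\<^sub>R c) \<in> cl \<mu> elem_space"
    if "0 \<le> s" "s < t" "t \<le> T" "A \<in> sets (F s)" for A s t c
  proof -
    have "elem (\<lambda>r w. if s < r \<and> r \<le> t then indicat_real A w *\<^sub>R c else 0)
        (\<lambda>r w. (indicat_real A w *\<^sub>R c) \<bullet> (B (min r t) w - B (min r s) w))"
      using that by (intro elem.rect[where c = "norm c"]) (auto intro!: borel_measurable_scaleR simp: indicator_def)
    from elem_spaceI[OF this] have "(\<lambda>x. if s < snd x \<and> snd x \<le> t then indicat_real A (fst x) *\<^sub>R c else 0) \<in> elem_space" .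
    moreover have "(if s < snd x \<and> snd x \<le> t then indicat_real A (fst x) *\<^sub>R c else 0) = indicat_real (A \<times> {s<..t}) x *\<^sub>R c" for x :: "'a \<times> real"
      by (cases x) (auto simp: indicator_def)
    ultimately show ?thesis by (intro cl_incl[OF lin_space_elem]) simp
  qed
  show "(\<lambda>x. indicat_real A x *\<^sub>R c) \<in> cl \<mu> elem_space"
  proof (rule PL.cl_indicator_Dynkin[OF lin_space_elem _ P\<mu>])
    \<comment> \<open>Disjoint generators intersect in the empty set, which belongs to
      \<open>P\<close> in the shape of a rectangle with empty base.\<close>
    have F0: "{} \<times> {0<..T} \<in> P" using horizon_pos by (intro PI) auto
    have R: "(A \<times> {s<..t}) \<inter> (A' \<times> {s'<..t'}) \<in> P"
      if "0 \<le> s" "s < t" "t \<le> T" "A \<in> sets (F s)" "0 \<le> s'" "s' < t'" "t' \<le> T" "A' \<in> sets (F s')" for A A' s t s' t'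
    proof (cases "max s s' < min t t'")
      case True
      have "A \<inter> A' \<in> sets (F (max s s'))"
        using that sets_F_mono[of s "max s s'"] sets_F_mono[of s' "max s s'"] by auto
      moreover have "(A \<times> {s<..t}) \<inter> (A' \<times> {s'<..t'}) = (A \<inter> A') \<times> {max s s'<..min t t'}" by auto
      ultimately show ?thesis using True that by (simp add: PI)
    next
      case False
      then have "(A \<times> {s<..t}) \<inter> (A' \<times> {s'<..t'}) = {} \<times> {0<..T}" by auto
      with F0 show ?thesis by simp
    qed
    have Z: "(A \<times> {0}) \<inter> (A' \<times> {0}) \<in> P" if "A \<in> sets (F 0)" "A' \<in> sets (F 0)" for A A'
    proof -
      have "(A \<times> {0::real}) \<inter> (A' \<times> {0}) = (A \<inter> A') \<times> {0}" by auto
      with that show ?thesis by (simp add: PI0)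
    qed
    have ZR: "(A \<times> {0}) \<inter> (A' \<times> {s<..t}) \<in> P" "(A' \<times> {s<..t}) \<inter> (A \<times> {0}) \<in> P" if "0 \<le> s" for A A' :: "'a set" and s t :: real
    proof -
      have "(A \<times> {0}) \<inter> (A' \<times> {s<..t}) = {} \<times> {0<..T}" "(A' \<times> {s<..t}) \<inter> (A \<times> {0}) = {} \<times> {0<..T}" using that by auto
      with F0 show "(A \<times> {0}) \<inter> (A' \<times> {s<..t}) \<in> P" "(A' \<times> {s<..t}) \<inter> (A \<times> {0}) \<in> P" by simp_all
    qed
    show "Int_stable P"
    proof (rule Int_stableI)
      fix a b assume "a \<in> P" "b \<in> P"
      note ab = PE[OF this(1)] PE[OF this(2)]
      from ab(1) show "a \<inter> b \<in> P"
      proof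
        assume "\<exists>A. a = A \<times> {0::real} \<and> A \<in> sets (F 0)"
        then obtain A where A: "a = A \<times> {0}" "A \<in> sets (F 0)" by (elim exE conjE)
        from ab(2) show ?thesis
        proof
          assume "\<exists>A. b = A \<times> {0::real} \<and> A \<in> sets (F 0)"
          then obtain A' where A': "b = A' \<times> {0}" "A' \<in> sets (F 0)" by (elim exE conjE)
          show ?thesis unfolding A A' by (rule Z[OF A(2) A'(2)])
        next
          assume "\<exists>A s t. b = A \<times> {s<..t} \<and> 0 \<le> s \<and> s < t \<and> t \<le> T \<and> A \<in> sets (F s)"
          then obtain A' s t where A': "b = A' \<times> {s<..t}" "0 \<le> s" by (elim exE conjE)
          show ?thesis unfolding A A' by (rule ZR(1)[OF A'(2)])
        qed
      next
        assume "\<exists>A s t. a = A \<times> {s<..t} \<and> 0 \<le> s \<and> s < t \<and> t \<le> T \<and> A \<in> sets (F s)"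
        then obtain A s t where A: "a = A \<times> {s<..t}" "0 \<le> s" "s < t" "t \<le> T" "A \<in> sets (F s)" by (elim exE conjE)
        from ab(2) show ?thesis
        proof
          assume "\<exists>A. b = A \<times> {0::real} \<and> A \<in> sets (F 0)"
          then obtain A' where A': "b = A' \<times> {0}" by (elim exE conjE)
          show ?thesis unfolding A A' by (rule ZR(2)[OF A(2)])
        next
          assume "\<exists>A s t. b = A \<times> {s<..t} \<and> 0 \<le> s \<and> s < t \<and> t \<le> T \<and> A \<in> sets (F s)"
          then obtain A' s' t' where A': "b = A' \<times> {s'<..t'}" "0 \<le> s'" "s' < t'" "t' \<le> T" "A' \<in> sets (F s')"
            by (elim exE conjE)
          show ?thesis unfolding A(1) A'(1) by (rule R[OF A(2-) A'(2-)])
        qed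
      qed
    qed
    have null: "f \<in> cl \<mu> elem_space" if "f \<in> borel_measurable \<mu>" "g \<in> cl \<mu> elem_space"
      "\<And>w s. w \<in> space M \<Longrightarrow> s \<in> {0..T} \<Longrightarrow> s \<noteq> 0 \<Longrightarrow> f (w, s) = g (w, s)" for f g
    proof (rule cl_cong_AE[OF lin_space_elem that(1,2)])
      show "AE x in \<mu>. f x = g x"
        using AE_mu_time AE_space[of \<mu>]
      proof eventually_elim
        case (elim x)
        then show ?case using that(3)[of "fst x" "snd x"] by (cases x) (auto simp: space_pair_measure)
      qed
    qed
    show "(\<lambda>x. indicat_real a x *\<^sub>R c) \<in> cl \<mu> elem_space" if "a \<in> P" for a c
      using PE[OF that]
    proof
      assume "\<exists>A. a = A \<times> {0::real} \<and> A \<in> sets (F 0)"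
      then obtain A where a: "a = A \<times> {0}" by auto
      have am: "a \<in> sets \<mu>" using that P\<mu> by blast
      show ?thesis
      proof (rule null)
        show "(\<lambda>x. 0) \<in> cl \<mu> elem_space" using elem_spaceI[OF elem.zero] by (rule cl_incl[OF lin_space_elem])
        show "(\<lambda>x. indicat_real a x *\<^sub>R c) \<in> borel_measurable \<mu>" using am by measurable
      qed (simp add: a)
    next
      assume "\<exists>A s t. a = A \<times> {s<..t} \<and> 0 \<le> s \<and> s < t \<and> t \<le> T \<and> A \<in> sets (F s)"
      then show ?thesis using rect by auto
    qed
    show "(\<lambda>x. c) \<in> cl \<mu> elem_space" for c
    proof (rule null[OF _ rect[of 0 T "space M"]])
      show "space M \<in> sets (F 0)" using sets.top[of "F 0"] by simp
    qed (use horizon_pos in \<open>auto simp: indicator_def\<close>)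
    show "A \<in> sigma_sets (space \<mu>) P" using A unfolding sets_pred P_def by simp
  qed
qed

text \<open>The relation \<open>has_ito_integral\<close> with \<open>elem\<close> in place of
  explicit partitions and norms on the product space in place of iterated integrals; for predictable
  integrands the two agree by \<open>has_ito_integral_iff\<close>.\<close>

definition ito :: "(real \<Rightarrow> 'a \<Rightarrow> real ^ 'd) \<Rightarrow> (real \<Rightarrow> 'a \<Rightarrow> real) \<Rightarrow> bool" where
  "ito Z I \<longleftrightarrow> adapted T F I \<and> continuous_process M T I \<and>
     (\<exists>Zk Ik. (\<forall>k::nat. elem (Zk k) (Ik k)) \<and>
       (\<lambda>k. sqn \<mu> (\<lambda>x. pz Z x - pz (Zk k) x)) \<longlonglongrightarrow> 0 \<and>
       (\<forall>t\<in>{0..T}. (\<lambda>k. sqn M (\<lambda>w. I t w - Ik k t w)) \<longlonglongrightarrow> 0))"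

lemma itoE:
  assumes "ito Z I"
  obtains Zk Ik where "adapted T F I" "continuous_process M T I" "\<forall>k::nat. elem (Zk k) (Ik k)"
    "(\<lambda>k. sqn \<mu> (\<lambda>x. pz Z x - pz (Zk k) x)) \<longlonglongrightarrow> 0"
    "\<forall>t\<in>{0..T}. (\<lambda>k. sqn M (\<lambda>w. I t w - Ik k t w)) \<longlonglongrightarrow> 0"
  using assms unfolding ito_def by (elim conjE exE) (rule that; assumption)

lemma has_ito_integral_iff:
  assumes Z: "(pz Z) \<in> borel_measurable pred"
  shows "has_ito_integral M T B Z I \<longleftrightarrow> ito Z I"
proof -
  have eq: "(\<integral>\<^sup>+w. (\<integral>\<^sup>+s\<in>{0..T}. ennreal ((norm (Z s w - Z' s w))\<^sup>2) \<partial>lborel) \<partial>M)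
      = sqn \<mu> (\<lambda>x. pz Z x - pz Z' x)" if "elem Z' I'" for Z' I'
    using sqn_mu[of "\<lambda>s w. Z s w - Z' s w"] borel_measurable_diff[OF pred_mu[OF Z] elem_mu[OF that]]
    by (simp add: case_prod_unfold)
  show ?thesis
  proof
    assume "has_ito_integral M T B Z I"
    then obtain n \<tau> h where d: "adapted T F I" "continuous_process M T I"
      "\<And>k. simple_integrand M T F (n k) (\<tau> k) (h k)"
      "(\<lambda>k. \<integral>\<^sup>+w. (\<integral>\<^sup>+s\<in>{0..T}. ennreal ((norm (Z s w - simple_process (n k) (\<tau> k) (h k) s w))\<^sup>2) \<partial>lborel) \<partial>M) \<longlonglongrightarrow> 0"
      "\<forall>t\<in>{0..T}. (\<lambda>k. \<integral>\<^sup>+w. ennreal ((I t w - simple_integral B (n k) (\<tau> k) (h k) t w)\<^sup>2) \<partial>M) \<longlonglongrightarrow> 0"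
      unfolding has_ito_integral_def by (elim conjE exE) (rule that; (assumption | erule spec))
    note el = simple_elem[OF d(3)]
    show "ito Z I"
      unfolding ito_def
      by (intro conjI d(1,2) exI[of _ "\<lambda>k. simple_process (n k) (\<tau> k) (h k)"] exI[of _ "\<lambda>k. simple_integral B (n k) (\<tau> k) (h k)"] allI el)
         (use d(4,5) in \<open>simp_all add: eq[OF el] sqn_real\<close>)
  next
    assume "ito Z I"
    then obtain Zk Ik where d: "adapted T F I" "continuous_process M T I" "\<forall>k::nat. elem (Zk k) (Ik k)"
      "(\<lambda>k. sqn \<mu> (\<lambda>x. pz Z x - pz (Zk k) x)) \<longlonglongrightarrow> 0"
      "\<forall>t\<in>{0..T}. (\<lambda>k. sqn M (\<lambda>w. I t w - Ik k t w)) \<longlonglongrightarrow> 0"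
      by (rule itoE)
    have "\<exists>n \<tau> h. simple_integrand M T F n \<tau> h \<and> Zk k = simple_process n \<tau> h \<and> Ik k = simple_integral B n \<tau> h" for k
      by (rule elem_simple[OF d(3)[THEN spec, of k]]) blast
    then obtain n \<tau> h where s: "\<And>k. simple_integrand M T F (n k) (\<tau> k) (h k)"
      "\<And>k. Zk k = simple_process (n k) (\<tau> k) (h k)" "\<And>k. Ik k = simple_integral B (n k) (\<tau> k) (h k)" by metis
    show "has_ito_integral M T B Z I"
      unfolding has_ito_integral_def
      by (intro conjI d(1,2) exI[of _ n] exI[of _ \<tau>] exI[of _ h] allI s)
         (use d(4,5) in \<open>simp_all only: s(2,3)[symmetric] eq[OF d(3)[THEN spec]] sqn_real\<close>)
  qed
qed

lemma ito_diff:
  assumes Zm: "(pz Z) \<in> borel_measurable \<mu>" "(pz Z') \<in> borel_measurable \<mu>"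
    and "ito Z I" "ito Z' I'"
  shows "ito (\<lambda>s w. Z s w - Z' s w) (\<lambda>s w. I s w - I' s w)"
proof -
  from assms(3) obtain Zk Ik where d: "adapted T F I" "continuous_process M T I" "\<forall>k::nat. elem (Zk k) (Ik k)"
    "(\<lambda>k. sqn \<mu> (\<lambda>x. pz Z x - pz (Zk k) x)) \<longlonglongrightarrow> 0"
    "\<forall>t\<in>{0..T}. (\<lambda>k. sqn M (\<lambda>w. I t w - Ik k t w)) \<longlonglongrightarrow> 0"
    by (rule itoE)
  from assms(4) obtain Zk' Ik' where d': "adapted T F I'" "continuous_process M T I'" "\<forall>k::nat. elem (Zk' k) (Ik' k)"
    "(\<lambda>k. sqn \<mu> (\<lambda>x. pz Z' x - pz (Zk' k) x)) \<longlonglongrightarrow> 0"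
    "\<forall>t\<in>{0..T}. (\<lambda>k. sqn M (\<lambda>w. I' t w - Ik' k t w)) \<longlonglongrightarrow> 0"
    by (rule itoE)
  have lim0: "(\<lambda>k. 2 * a k + 2 * b k :: ennreal) \<longlonglongrightarrow> 0" if "a \<longlonglongrightarrow> 0" "b \<longlonglongrightarrow> 0" for a b
    using tendsto_add[OF ennreal_tendsto_cmult[OF _ that(1), of 2] ennreal_tendsto_cmult[OF _ that(2), of 2]] by simp
  show ?thesis
    unfolding ito_def
  proof (intro conjI exI[of _ "\<lambda>k r w. Zk k r w - Zk' k r w"] exI[of _ "\<lambda>k r w. Ik k r w - Ik' k r w"] allI ballI)
    show "adapted T F (\<lambda>s w. I s w - I' s w)"
      using d(1) d'(1) unfolding adapted_def by (auto intro!: borel_measurable_diff)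
    show "continuous_process M T (\<lambda>s w. I s w - I' s w)"
      using d(2) d'(2) unfolding continuous_process_def by eventually_elim (intro continuous_intros)
    show "elem (\<lambda>r w. Zk k r w - Zk' k r w) (\<lambda>r w. Ik k r w - Ik' k r w)" for k
      by (rule elem_diff[OF d(3)[THEN spec] d'(3)[THEN spec]])
    show "(\<lambda>k. sqn \<mu> (\<lambda>x. pz Z x - pz Z' x - (pz (Zk k) x - pz (Zk' k) x))) \<longlonglongrightarrow> 0"
    proof (rule tendsto_sandwich[OF always_eventually always_eventually tendsto_const lim0[OF d(4) d'(4)]]; intro allI)
      fix k
      have "sqn \<mu> (\<lambda>x. (pz Z x - pz (Zk k) x) - (pz Z' x - pz (Zk' k) x))
        \<le> 2 * sqn \<mu> (\<lambda>x. pz Z x - pz (Zk k) x) + 2 * sqn \<mu> (\<lambda>x. pz Z' x - pz (Zk' k) x)"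
        by (intro sqn_diff borel_measurable_diff Zm elem_mu[OF d(3)[THEN spec]] elem_mu[OF d'(3)[THEN spec]])
      then show "sqn \<mu> (\<lambda>x. pz Z x - pz Z' x - (pz (Zk k) x - pz (Zk' k) x))
        \<le> 2 * sqn \<mu> (\<lambda>x. pz Z x - pz (Zk k) x) + 2 * sqn \<mu> (\<lambda>x. pz Z' x - pz (Zk' k) x)"
        by (simp add: algebra_simps)
    qed simp
    fix t assume t: "t \<in> {0..T}"
    have tT: "t \<le> T" using t by simp
    have IF: "I t \<in> borel_measurable (F t)" "I' t \<in> borel_measurable (F t)"
      using t d(1) d'(1) by (auto simp: adapted_def)
    note m = measurable_F_M[OF IF(1) tT] measurable_F_M[OF IF(2) tT]
      measurable_F_M[OF elem_adapted[OF d(3)[THEN spec] t] tT] measurable_F_M[OF elem_adapted[OF d'(3)[THEN spec] t] tT]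
    show "(\<lambda>k. sqn M (\<lambda>w. I t w - I' t w - (Ik k t w - Ik' k t w))) \<longlonglongrightarrow> 0"
    proof (rule tendsto_sandwich[OF always_eventually always_eventually tendsto_const lim0[OF bspec[OF d(5) t] bspec[OF d'(5) t]]]; intro allI)
      fix k
      have "sqn M (\<lambda>w. (I t w - Ik k t w) - (I' t w - Ik' k t w))
        \<le> 2 * sqn M (\<lambda>w. I t w - Ik k t w) + 2 * sqn M (\<lambda>w. I' t w - Ik' k t w)"
        by (intro sqn_diff borel_measurable_diff m)
      then show "sqn M (\<lambda>w. I t w - I' t w - (Ik k t w - Ik' k t w))
        \<le> 2 * sqn M (\<lambda>w. I t w - Ik k t w) + 2 * sqn M (\<lambda>w. I' t w - Ik' k t w)"
        by (simp add: algebra_simps)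
    qed simp
  qed
qed

text \<open>Orthogonality to the past and the isometry hold for the elementary approximations and
  are preserved by L^2 limits. Cutting the integrand at t does not increase distances, so the cut
  approximations converge too.\<close>

lemma ito_properties:
  assumes Zm: "(pz Z) \<in> borel_measurable \<mu>" and fin: "sqn \<mu> (pz Z) < \<infinity>"
    and I: "ito Z I"
  shows "l2_martingale I"
    and "\<And>t. t \<in> {0..T} \<Longrightarrow> sqn M (I t) = sqn \<mu> (\<lambda>x. if snd x \<le> t then pz Z x else 0)"
proof -
  from I obtain Zk Ik where d: "adapted T F I" "continuous_process M T I" "\<forall>k::nat. elem (Zk k) (Ik k)"
    "(\<lambda>k. sqn \<mu> (\<lambda>x. pz Z x - pz (Zk k) x)) \<longlonglongrightarrow> 0"
    "\<forall>t\<in>{0..T}. (\<lambda>k. sqn M (\<lambda>w. I t w - Ik k t w)) \<longlonglongrightarrow> 0"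
    by (rule itoE)
  note mart = elem_l2_martingale[OF d(3)[THEN spec]]
  have lim: "(\<lambda>k. sqn M (\<lambda>w. Ik k t w - I t w)) \<longlonglongrightarrow> 0" if "t \<in> {0..T}" for t
    using d(5) that by (subst sqn_commute) auto
  have F: "I t \<in> borel_measurable (F t)" if "t \<in> {0..T}" for t using d(1) that by (simp add: adapted_def)
  have m: "I t \<in> borel_measurable M" if "t \<in> {0..T}" for t using that by (intro measurable_F_M[OF F]) auto
  have km: "Ik k t \<in> borel_measurable M" if "t \<in> {0..T}" for k t using l2_martingaleD(2)[OF mart that] .
  have L2: "sqn M (I t) < \<infinity>" if t: "t \<in> {0..T}" for t
  proof -
    obtain k where k: "sqn M (\<lambda>w. I t w - Ik k t w) < \<infinity>"
      using eventually_happens'[OF sequentially_bot eventually_sqn_finite[OF bspec[OF d(5) t]]] by auto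
    have "sqn M (\<lambda>w. (I t w - Ik k t w) + Ik k t w) < \<infinity>"
      using k l2_martingaleD(3)[OF mart t] m[OF t] km[OF t] by (intro sqn_add_finite borel_measurable_diff)
    then show ?thesis by simp
  qed
  show "l2_martingale I"
    unfolding l2_martingale_def
  proof (intro conjI ballI allI impI F L2)
    fix s t and X :: "'a \<Rightarrow> real" assume st: "0 \<le> s" "s \<le> t" "t \<le> T" and X: "X \<in> borel_measurable (F s)" "sqn M X < \<infinity>"
    have s: "s \<in> {0..T}" and t: "t \<in> {0..T}" using st by auto
    have XM: "X \<in> borel_measurable M" using st by (intro measurable_F_M[OF X(1)]) auto
    have kL: "sqn M (Ik k r) < \<infinity>" if "r \<in> {0..T}" for k r by (rule l2_martingaleD(3)[OF mart that])
    have "(\<lambda>k. expectation (\<lambda>w. Ik k t w * X w) - expectation (\<lambda>w. Ik k s w * X w))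
      \<longlonglongrightarrow> expectation (\<lambda>w. I t w * X w) - expectation (\<lambda>w. I s w * X w)"
      by (intro tendsto_diff integral_mult_tendsto km m lim L2 XM s t X(2))
    moreover have "expectation (\<lambda>w. Ik k t w * X w) - expectation (\<lambda>w. Ik k s w * X w) = 0" for k
    proof -
      have "expectation (\<lambda>w. Ik k t w * X w) - expectation (\<lambda>w. Ik k s w * X w)
          = expectation (\<lambda>w. Ik k t w * X w - Ik k s w * X w)"
        by (intro Bochner_Integration.integral_diff[symmetric] integrable_mult_L2 km XM kL s t X(2))
      also have "\<dots> = expectation (\<lambda>w. X w * (Ik k t w - Ik k s w))"
        by (simp add: algebra_simps)
      also have "\<dots> = 0" by (rule l2_martingale_orth[OF mart st X])
      finally show ?thesis .
    qed
    ultimately have "expectation (\<lambda>w. I t w * X w) - expectation (\<lambda>w. I s w * X w) = 0"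
      by (simp add: LIMSEQ_const_iff)
    also have "expectation (\<lambda>w. I t w * X w) - expectation (\<lambda>w. I s w * X w)
        = expectation (\<lambda>w. I t w * X w - I s w * X w)"
      by (intro Bochner_Integration.integral_diff[symmetric] integrable_mult_L2 m XM L2 s t X(2))
    finally show "expectation (\<lambda>w. X w * (I t w - I s w)) = 0" by (simp add: algebra_simps)
  qed
  fix t assume t: "t \<in> {0..T}"
  let ?c = "\<lambda>(Z :: real \<Rightarrow> 'a \<Rightarrow> real ^ 'd) x. if snd x \<le> t then pz Z x else 0"
  have snd: "snd \<in> borel_measurable \<mu>"
    by (rule measurable_compose[OF measurable_snd]) (simp add: measurable_restrict_space1)
  have cm: "?c Z \<in> borel_measurable \<mu>" if "(pz Z) \<in> borel_measurable \<mu>" for Z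
    using that snd by measurable
  have "(\<lambda>k. sqn M (Ik k t)) \<longlonglongrightarrow> sqn M (I t)"
    by (rule sqn_tendsto[OF km[OF t] m[OF t] lim[OF t] L2[OF t]])
  moreover have "(\<lambda>k. sqn \<mu> (?c (Zk k))) \<longlonglongrightarrow> sqn \<mu> (?c Z)"
  proof (rule sqn_tendsto[OF cm[OF elem_mu[OF d(3)[THEN spec]]] cm[OF Zm]])
    show "sqn \<mu> (?c Z) < \<infinity>"
      by (rule le_less_trans[OF sqn_mono_AE fin]) auto
    show "(\<lambda>k. sqn \<mu> (\<lambda>x. ?c (Zk k) x - ?c Z x)) \<longlonglongrightarrow> 0"
    proof (rule tendsto_sandwich[OF always_eventually always_eventually tendsto_const d(4)]; intro allI)
      show "sqn \<mu> (\<lambda>x. ?c (Zk k) x - ?c Z x) \<le> sqn \<mu> (\<lambda>x. pz Z x - pz (Zk k) x)" for k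
        by (intro sqn_mono_AE AE_I2) (simp add: norm_minus_commute)
    qed simp
  qed
  moreover have "sqn M (Ik k t) = sqn \<mu> (?c (Zk k))" for k by (rule elem_iso_at[OF d(3)[THEN spec] t])
  ultimately show "sqn M (I t) = sqn \<mu> (?c Z)" using LIMSEQ_unique by simp
qed

end

lemma choice_pair: "(\<And>k. \<exists>x y. P k x y) \<Longrightarrow> \<exists>f g. \<forall>k. P k (f k) (g k)"
  by metis

lemma dense_bound:
  fixes g :: "real \<Rightarrow> real"
  assumes g: "continuous_on {a..b} g" and D: "D \<subseteq> {a..b}" "{a..b} \<subseteq> closure D"
    and bd: "\<And>t. t \<in> D \<Longrightarrow> \<bar>g t\<bar> \<le> c" and t: "t \<in> {a..b}"
  shows "\<bar>g t\<bar> \<le> c"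
proof -
  have "closed ({a..b} \<inter> (\<lambda>t. \<bar>g t\<bar>) -` {..c})"
    using g by (intro continuous_closed_preimage continuous_intros) auto
  moreover have "{a..b} \<inter> (\<lambda>t. \<bar>g t\<bar>) -` {..c} = {t \<in> {a..b}. \<bar>g t\<bar> \<le> c}" by auto
  ultimately have "closed {t \<in> {a..b}. \<bar>g t\<bar> \<le> c}" by simp
  moreover have "D \<subseteq> {t \<in> {a..b}. \<bar>g t\<bar> \<le> c}" using D bd by auto
  ultimately have "closure D \<subseteq> {t \<in> {a..b}. \<bar>g t\<bar> \<le> c}" by (rule closure_minimal[rotated])
  then show ?thesis using t D(2) by auto
qed

text \<open>Bounds on a dense set of times extend to the interval by continuity, and the Weierstrass
  test gives a uniform, hence continuous, limit. It is written with \<open>lim\<close> because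
  adaptedness of the limit process is read off from that form.\<close>

lemma path_limit:
  fixes f :: "nat \<Rightarrow> real \<Rightarrow> real"
  assumes cont: "\<And>k. continuous_on {a..b} (f k)" and D: "D \<subseteq> {a..b}" "{a..b} \<subseteq> closure D"
    and ev: "eventually (\<lambda>k. \<forall>t\<in>D. \<bar>f (Suc k) t - f k t\<bar> \<le> (1/2)^k) sequentially"
  shows "continuous_on {a..b} (\<lambda>t. lim (\<lambda>k. f k t))"
    and "t \<in> {a..b} \<Longrightarrow> (\<lambda>k. f k t) \<longlonglongrightarrow> lim (\<lambda>k. f k t)"
proof -
  let ?h = "\<lambda>t. \<Sum>k. f (Suc k) t - f k t"
  have "uniform_limit {a..b} (\<lambda>n t. \<Sum>k<n. f (Suc k) t - f k t) ?h sequentially"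
  proof (rule Weierstrass_m_test_ev[where M = "\<lambda>k. (1/2)^k"])
    show "eventually (\<lambda>k. \<forall>t\<in>{a..b}. norm (f (Suc k) t - f k t) \<le> (1/2)^k) sequentially"
      using ev
    proof eventually_elim
      case (elim k)
      have "continuous_on {a..b} (\<lambda>t. f (Suc k) t - f k t)" by (intro continuous_on_diff cont)
      from dense_bound[OF this D] elim show ?case by simp
    qed
  qed (simp add: summable_geometric)
  then have u: "uniform_limit {a..b} (\<lambda>n t. f n t - f 0 t) ?h sequentially"
    unfolding sum_lessThan_telescope[of "\<lambda>k. f k _"] .
  have "continuous_on {a..b} ?h"
    by (rule uniform_limit_theorem[OF _ u]) (auto intro!: always_eventually continuous_on_diff cont)
  then have c: "continuous_on {a..b} (\<lambda>t. f 0 t + ?h t)" by (intro continuous_on_add cont)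
  have l: "(\<lambda>k. f k t) \<longlonglongrightarrow> f 0 t + ?h t" if "t \<in> {a..b}" for t
    using tendsto_add[OF tendsto_const[of "f 0 t"] tendsto_uniform_limitI[OF u that]] by simp
  then have e: "lim (\<lambda>k. f k t) = f 0 t + ?h t" if "t \<in> {a..b}" for t
    using that by (intro limI)
  show "continuous_on {a..b} (\<lambda>t. lim (\<lambda>k. f k t))"
    using c by (rule continuous_on_eq) (simp add: e)
  show "t \<in> {a..b} \<Longrightarrow> (\<lambda>k. f k t) \<longlonglongrightarrow> lim (\<lambda>k. f k t)"
    using l e by simp
qed

context brownian_motion
begin

definition dense_times :: "real set" where
  "dense_times = (SOME D. countable D \<and> D \<subseteq> {0..T} \<and> {0..T} \<subseteq> closure D)"

lemma dense_times: "countable dense_times" "dense_times \<subseteq> {0..T}" "{0..T} \<subseteq> closure dense_times"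
proof -
  obtain D where "countable D" "D \<subseteq> {0..T}" "{0..T} \<subseteq> closure D" using separable[of "{0..T}"] by blast
  then have "\<exists>D. countable D \<and> D \<subseteq> {0..T} \<and> {0..T} \<subseteq> closure D" by blast
  from someI_ex[OF this] show "countable dense_times" "dense_times \<subseteq> {0..T}" "{0..T} \<subseteq> closure dense_times"
    unfolding dense_times_def by auto
qed

text \<open>Turns the pathwise supremum of a continuous process into a supremum of countably many
  random variables.\<close>

lemma SUP_dense_times:
  fixes g :: "real \<Rightarrow> real"
  assumes g: "continuous_on {0..T} g"
  shows "(SUP t\<in>{0..T}. ennreal \<bar>g t\<bar>) = (SUP t\<in>dense_times. ennreal \<bar>g t\<bar>)"
proof (rule antisym)
  show "(SUP t\<in>dense_times. ennreal \<bar>g t\<bar>) \<le> (SUP t\<in>{0..T}. ennreal \<bar>g t\<bar>)"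
    by (rule SUP_subset_mono[OF dense_times(2)]) simp
  show "(SUP t\<in>{0..T}. ennreal \<bar>g t\<bar>) \<le> (SUP t\<in>dense_times. ennreal \<bar>g t\<bar>)"
  proof (cases "SUP t\<in>dense_times. ennreal \<bar>g t\<bar>")
    case (real c)
    have "\<bar>g t\<bar> \<le> c" if "t \<in> dense_times" for t
      using SUP_upper[OF that, of "\<lambda>t. ennreal \<bar>g t\<bar>"] real by simp
    from dense_bound[OF g dense_times(2,3) this] real show ?thesis
      by (auto intro!: SUP_least)
  next
    case top
    show ?thesis unfolding top by (rule top_greatest)
  qed
qed

lemma l2_martingale_sup:
  assumes N: "l2_martingale N" and c: "continuous_process M T N"
  shows "(\<integral>\<^sup>+w. (SUP t\<in>{0..T}. ennreal \<bar>N t w\<bar>)\<^sup>2 \<partial>M) \<le> 4 * sqn M (N T)"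
proof -
  have "(\<integral>\<^sup>+w. (SUP t\<in>{0..T}. ennreal \<bar>N t w\<bar>)\<^sup>2 \<partial>M) = (\<integral>\<^sup>+w. (SUP t\<in>dense_times. ennreal \<bar>N t w\<bar>)\<^sup>2 \<partial>M)"
    using c unfolding continuous_process_def
    by (intro nn_integral_cong_AE) (auto elim!: eventually_mono simp: SUP_dense_times)
  also have "\<dots> \<le> 4 * sqn M (N T)"
    by (rule Doob_countable[OF N dense_times(1,2)])
  finally show ?thesis .
qed

lemma elem_at_0: "elem Z I \<Longrightarrow> I 0 w = 0"
  by (induction rule: elem.induct) (auto simp: min_absorb1)

lemma elem_ito:
  assumes "elem Z I" shows "ito Z I"
  unfolding ito_def adapted_def
  using elem_adapted[OF assms] elem_continuous[OF assms] assms
  by (intro conjI ballI exI[of _ "\<lambda>_. Z"] exI[of _ "\<lambda>_. I"]) auto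

text \<open>Approximations are chosen with squared error below 16^-k / 4 exactly so that the doubled
  triangle inequality leaves steps of at most 16^-k.\<close>

lemma ennreal_geometric_step:
  "2 * ennreal (1/4 * (1/16)^k) + 2 * ennreal (1/4 * (1/16)^m) \<le> ennreal ((1/16)^k)" if "k \<le> m" for k m :: nat
proof -
  have "(1/16::real)^m \<le> (1/16)^k" using that by (intro power_decreasing) auto
  then have "2 * (1/4 * (1/16)^k) + 2 * (1/4 * (1/16)^m) \<le> (1/16::real)^k" by linarith
  then have "ennreal (2 * (1/4 * (1/16)^k) + 2 * (1/4 * (1/16)^m)) \<le> ennreal ((1/16)^k)"
    by (rule ennreal_leI)
  moreover have "2 * ennreal (1/4 * (1/16)^k) + 2 * ennreal (1/4 * (1/16)^m) = ennreal (2 * (1/4 * (1/16)^k) + 2 * (1/4 * (1/16)^m))"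
    by (rule ennreal_double_add) auto
  ultimately show ?thesis by (simp only:)
qed

text \<open>Elementary approximations converging at rate 16^-k have integrals whose successive
  differences are, by Doob's inequality, small at the same rate uniformly in time. Almost every path
  then converges uniformly, which yields a continuous version.\<close>

theorem ito_exists:
  assumes Z: "(pz Z) \<in> borel_measurable pred" and fin: "sqn \<mu> (pz Z) < \<infinity>"
  shows "\<exists>I. ito Z I"
proof -
  note Zm = pred_mu[OF Z]
  have "\<exists>Zk Ik. elem Zk Ik \<and> sqn \<mu> (\<lambda>x. pz Z x - pz Zk x) < ennreal (1/4 * (1/16)^k)" for k :: nat
  proof -
    have "0 < 1/4 * (1/16::real)^k" by simp
    from cl_approx[OF predictable_approx[OF Z fin] this] obtain e where
      e: "e \<in> elem_space" "sqn \<mu> (\<lambda>x. pz Z x - e x) < ennreal (1/4 * (1/16)^k)" by blast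
    from e(1) obtain Zk Ik where zi: "e = (pz Zk)" "elem Zk Ik"
      unfolding elem_space_def mem_Collect_eq by (elim exE conjE)
    show ?thesis using zi(2) e(2)[unfolded zi(1)] by (intro exI conjI)
  qed
  from choice_pair[of "\<lambda>k Zk Ik. elem Zk Ik \<and>
    sqn \<mu> (\<lambda>x. pz Z x - pz Zk x) < ennreal (1/4 * (1/16)^k)", OF this] obtain Zk Ik where "\<forall>k. elem (Zk k) (Ik k) \<and>
    sqn \<mu> (\<lambda>x. pz Z x - pz (Zk k) x) < ennreal (1/4 * (1/16)^k)" by (elim exE)
  then have el: "\<And>k. elem (Zk k) (Ik k)"
    and ap: "\<And>k. sqn \<mu> (\<lambda>x. pz Z x - pz (Zk k) x) < ennreal (1/4 * (1/16)^k)" by simp_all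
  have step: "sqn \<mu> (\<lambda>x. pz (Zk k) x - pz (Zk m) x) \<le> ennreal ((1/16)^k)" if "k \<le> m" for k m
  proof -
    have "sqn \<mu> (\<lambda>x. pz (Zk k) x - pz (Zk m) x)
      \<le> 2 * sqn \<mu> (\<lambda>x. pz (Zk k) x - pz Z x) + 2 * sqn \<mu> (\<lambda>x. pz Z x - pz (Zk m) x)"
      by (intro sqn_triangle elem_mu[OF el] Zm)
    also have "\<dots> \<le> 2 * ennreal (1/4 * (1/16)^k) + 2 * ennreal (1/4 * (1/16)^m)"
      using ap[of k] ap[of m] by (intro add_mono mult_left_mono) (auto simp: sqn_commute[of \<mu> "\<lambda>x. pz Z x"] less_imp_le)
    also have "\<dots> \<le> ennreal ((1/16)^k)" by (rule ennreal_geometric_step[OF that])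
    finally show ?thesis .
  qed
  note eld = elem_diff[OF el el]
  have isoT: "sqn M (\<lambda>w. Ik k T w - Ik m T w) \<le> ennreal ((1/16)^k)" if "k \<le> m" for k m
    using elem_iso[OF eld, of k m] step[OF that] by simp
  have iso: "sqn M (\<lambda>w. Ik k t w - Ik m t w) \<le> ennreal ((1/16)^k)" if "k \<le> m" "t \<in> {0..T}" for k m t
    using l2_martingale_sqn_le[OF elem_l2_martingale[OF eld[of k m]] that(2)] isoT[OF that(1)] by (rule order_trans)
  define S where "S k w = (SUP t\<in>dense_times. ennreal \<bar>Ik k t w - Ik (Suc k) t w\<bar>)" for k w
  have Im [measurable]: "Ik k t \<in> borel_measurable M" if "t \<in> {0..T}" for k t
    using l2_martingaleD(2)[OF elem_l2_martingale[OF el] that] .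
  have Sm [measurable]: "S k \<in> borel_measurable M" for k
    unfolding S_def
  proof (rule borel_measurable_SUP[OF dense_times(1)])
    fix t assume "t \<in> dense_times"
    then have "t \<in> {0..T}" using dense_times(2) by auto
    then show "(\<lambda>w. ennreal \<bar>Ik k t w - Ik (Suc k) t w\<bar>) \<in> borel_measurable M" by measurable
  qed
  have S2: "(\<integral>\<^sup>+w. (S k w)\<^sup>2 \<partial>M) \<le> 4 * ennreal ((1/16)^k)" for k
  proof -
    have "(\<integral>\<^sup>+w. (S k w)\<^sup>2 \<partial>M) \<le> 4 * sqn M (\<lambda>w. Ik k T w - Ik (Suc k) T w)"
      unfolding S_def by (rule Doob_countable[OF elem_l2_martingale[OF eld[of k "Suc k"]] dense_times(1,2)])
    also have "\<dots> \<le> 4 * ennreal ((1/16)^k)" by (intro mult_left_mono isoT) auto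
    finally show ?thesis .
  qed
  have "(\<integral>\<^sup>+w. (\<Sum>k. ennreal (4^k) * (S k w)\<^sup>2) \<partial>M) = (\<Sum>k. ennreal (4^k) * (\<integral>\<^sup>+w. (S k w)\<^sup>2 \<partial>M))"
    by (subst nn_integral_suminf) (auto simp: nn_integral_cmult)
  also have "\<dots> \<le> (\<Sum>k. ennreal (4 * (1/4)^k))"
  proof (rule suminf_le)
    fix k
    have "ennreal (4^k) * (\<integral>\<^sup>+w. (S k w)\<^sup>2 \<partial>M) \<le> ennreal (4^k) * (4 * ennreal ((1/16)^k))"
      by (intro mult_left_mono S2) simp
    also have "\<dots> = ennreal (4^k * (4 * (1/16)^k))" by (simp add: ennreal_mult)
    also have "4^k * (4 * (1/16)^k) = 4 * (1/4::real)^k"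
      using power_mult_distrib[of 4 "1/16::real" k] by simp
    finally show "ennreal (4^k) * (\<integral>\<^sup>+w. (S k w)\<^sup>2 \<partial>M) \<le> ennreal (4 * (1/4)^k)" .
  qed auto
  also have "\<dots> = ennreal (\<Sum>k. 4 * (1/4)^k)"
    by (intro suminf_ennreal2 summable_mult summable_geometric) auto
  also have "\<dots> < \<infinity>" by simp
  finally have "AE w in M. (\<Sum>k. ennreal (4^k) * (S k w)\<^sup>2) \<noteq> \<infinity>"
    by (intro nn_integral_PInf_AE) auto
  \<comment> \<open>A Borel-Cantelli argument by integration: with weights 4^k the sum of the
    squared suprema is still almost surely finite, so eventually 4^k S_k^2 < 1, that is S_k <
    2^-k.\<close>
  then have ev: "AE w in M. eventually (\<lambda>k. \<forall>t\<in>dense_times. \<bar>Ik (Suc k) t w - Ik k t w\<bar> \<le> (1/2)^k) sequentially"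
  proof eventually_elim
    case (elim w)
    define c where "c k = ennreal (4^k) * (S k w)\<^sup>2" for k
    have "(\<Sum>k. c k) < top" using elim by (simp add: c_def less_top)
    then have "c k < top" for k by (rule ennreal_suminf_lessD)
    then have c: "c k = ennreal (enn2real (c k))" for k by simp
    have "(\<Sum>k. ennreal (enn2real (c k))) \<noteq> top" using elim c by (simp add: c_def)
    then have "summable (\<lambda>k. enn2real (c k))" by (intro summable_suminf_not_top) auto
    then have "(\<lambda>k. enn2real (c k)) \<longlonglongrightarrow> 0" by (rule summable_LIMSEQ_zero)
    then have "eventually (\<lambda>k. enn2real (c k) < 1) sequentially" by (rule order_tendstoD) simp
    then show ?case
    proof eventually_elim
      case (elim k)
      show ?case
      proof
        fix t assume t: "t \<in> dense_times"
        have four: "(2^k)\<^sup>2 = (4::real)^k" using power_mult_distrib[of 2 "2::real" k] by (simp add: power2_eq_square)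
        let ?y = "\<bar>Ik k t w - Ik (Suc k) t w\<bar>"
        have "ennreal ?y \<le> S k w" unfolding S_def by (rule SUP_upper[OF t])
        then have "ennreal (4^k) * (ennreal ?y)\<^sup>2 \<le> c k"
          unfolding c_def by (intro mult_left_mono power_mono) auto
        also have "\<dots> \<le> ennreal 1" by (subst c) (use elim in \<open>auto intro: ennreal_leI\<close>)
        finally have "4^k * ?y\<^sup>2 \<le> 1" by (simp add: ennreal_power ennreal_mult[symmetric])
        then have "?y\<^sup>2 \<le> ((1/2)^k)\<^sup>2"
          using four by (simp add: power_divide field_simps)
        then have "?y \<le> (1/2)^k" by (rule power2_le_imp_le) simp
        then show "\<bar>Ik (Suc k) t w - Ik k t w\<bar> \<le> (1/2)^k" by (simp add: abs_minus_commute)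
      qed
    qed
  qed
  have "AE w in M. \<forall>k. continuous_on {0..T} (\<lambda>t. Ik k t w)"
    using elem_continuous[OF el] unfolding continuous_process_def by (simp add: AE_all_countable)
  with ev have good: "AE w in M. continuous_on {0..T} (\<lambda>t. lim (\<lambda>k. Ik k t w)) \<and>
      (\<forall>t\<in>{0..T}. (\<lambda>k. Ik k t w) \<longlonglongrightarrow> lim (\<lambda>k. Ik k t w))"
  proof eventually_elim
    case (elim w)
    from path_limit[of 0 T "\<lambda>k t. Ik k t w", OF _ dense_times(2,3) elim(1)] elim(2) show ?case by auto
  qed
  \<comment> \<open>The limit is formed at every \<omega>, not only at the good ones: a limit of
    \<open>F t\<close>-measurable functions in this form is \<open>F t\<close>-measurable.\<close>
  define I where "I t w = lim (\<lambda>k. Ik k t w)" for t w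
  have IF: "I t \<in> borel_measurable (F t)" if "t \<in> {0..T}" for t
    unfolding I_def using elem_adapted[OF el that] by (intro borel_measurable_lim_metric)
  have "ito Z I"
    unfolding ito_def
  proof (intro conjI exI[of _ Zk] exI[of _ Ik] allI el ballI)
    show "adapted T F I" using IF by (simp add: adapted_def)
    show "continuous_process M T I"
      using good unfolding continuous_process_def I_def by eventually_elim simp
    have z: "(\<lambda>k. ennreal ((1/16)^k)) \<longlonglongrightarrow> 0"
      using tendsto_ennrealI[OF LIMSEQ_power_zero[of "1/16::real"]] by simp
    show "(\<lambda>k. sqn \<mu> (\<lambda>x. pz Z x - pz (Zk k) x)) \<longlonglongrightarrow> 0"
    proof (rule tendsto_sandwich[OF always_eventually always_eventually tendsto_const z]; intro allI)
      fix k
      have "ennreal (1/4 * (1/16)^k) \<le> ennreal ((1/16)^k)" by (intro ennreal_leI) simp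
      with ap[of k] show "sqn \<mu> (\<lambda>x. pz Z x - pz (Zk k) x) \<le> ennreal ((1/16)^k)"
        by (meson less_imp_le order_trans)
    qed simp
    fix t assume t: "t \<in> {0..T}"
    have ItM: "I t \<in> borel_measurable M" using t by (intro measurable_F_M[OF IF]) auto
    have ae: "AE w in M. (\<lambda>k. Ik k t w) \<longlonglongrightarrow> I t w"
      using good by eventually_elim (use t in \<open>simp add: I_def\<close>)
    have "sqn M (\<lambda>w. Ik k t w - I t w) \<le> ennreal ((1/16)^k)" for k
    proof (rule sqn_Fatou[where h = "\<lambda>m. Ik m t", OF Im[OF t] ItM Im[OF t] ae])
      show "eventually (\<lambda>m. sqn M (\<lambda>w. Ik k t w - Ik m t w) \<le> ennreal ((1/16)^k)) sequentially"
        by (rule eventually_sequentiallyI[of k]) (rule iso[OF _ t])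
    qed
    then show "(\<lambda>k. sqn M (\<lambda>w. I t w - Ik k t w)) \<longlonglongrightarrow> 0"
      by (intro tendsto_sandwich[OF always_eventually always_eventually tendsto_const z])
         (auto simp: sqn_commute[of M "I t"])
  qed
  then show ?thesis by blast
qed

text \<open>The isometry makes the terminal value of the difference vanish, Doob's inequality then
  the whole path. Versions of the integral can therefore be exchanged, in particular for the one
  selected in \<open>ito_integral\<close>.\<close>

lemma ito_AE_eq:
  assumes Zm: "(pz Z) \<in> borel_measurable \<mu>" "(pz Z') \<in> borel_measurable \<mu>"
    and I: "ito Z I" "ito Z' I'" and eq: "AE x in \<mu>. pz Z x = pz Z' x"
  shows "AE w in M. \<forall>t\<in>{0..T}. I t w = I' t w"
proof -
  have zm: "(\<lambda>x. pz Z x - pz Z' x) \<in> borel_measurable \<mu>"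
    using Zm by (rule borel_measurable_diff)
  have z: "sqn \<mu> (\<lambda>x. pz Z x - pz Z' x) = 0"
    unfolding sqn_zero_iff[OF zm] using eq by eventually_elim simp
  note d = ito_diff[OF Zm I]
  note p = ito_properties[OF zm _ d]
  have z0: "sqn \<mu> (\<lambda>x. pz Z x - pz Z' x) < \<infinity>" using z by simp
  have mart: "l2_martingale (\<lambda>s w. I s w - I' s w)" by (rule p(1)[OF z0])
  have T: "T \<in> {0..T}" using horizon_pos by simp
  have "sqn M (\<lambda>w. I T w - I' T w) \<le> sqn \<mu> (\<lambda>x. pz Z x - pz Z' x)"
    unfolding p(2)[OF z0 T] by (intro sqn_mono_AE AE_I2) simp
  then have "sqn M (\<lambda>w. I T w - I' T w) = 0" using z by simp
  then have sup0: "(\<integral>\<^sup>+w. (SUP t\<in>dense_times. ennreal \<bar>I t w - I' t w\<bar>)\<^sup>2 \<partial>M) = 0"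
    using Doob_countable[OF mart dense_times(1,2)] by simp
  have "(\<lambda>w. (SUP t\<in>dense_times. ennreal \<bar>I t w - I' t w\<bar>)\<^sup>2) \<in> borel_measurable M"
  proof -
    have "(\<lambda>w. SUP t\<in>dense_times. ennreal \<bar>I t w - I' t w\<bar>) \<in> borel_measurable M"
    proof (rule borel_measurable_SUP[OF dense_times(1)])
      fix t assume "t \<in> dense_times"
      then have "t \<in> {0..T}" using dense_times(2) by auto
      from l2_martingaleD(2)[OF mart this] show "(\<lambda>w. ennreal \<bar>I t w - I' t w\<bar>) \<in> borel_measurable M" by measurable
    qed
    then show ?thesis by measurable
  qed
  from iffD1[OF nn_integral_0_iff_AE[OF this] sup0]
  have "AE w in M. (SUP t\<in>dense_times. ennreal \<bar>I t w - I' t w\<bar>) = 0" by simp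
  moreover have "AE w in M. continuous_on {0..T} (\<lambda>t. I t w - I' t w)"
    using d unfolding ito_def continuous_process_def by simp
  ultimately show ?thesis
  proof eventually_elim
    case (elim w)
    have "(SUP t\<in>{0..T}. ennreal \<bar>I t w - I' t w\<bar>) = 0" using SUP_dense_times[OF elim(2)] elim(1) by simp
    then have "ennreal \<bar>I t w - I' t w\<bar> \<le> 0" if "t \<in> {0..T}" for t
      using SUP_upper[OF that, of "\<lambda>t. ennreal \<bar>I t w - I' t w\<bar>"] by simp
    then show ?case by (auto simp: ennreal_eq_0_iff)
  qed
qed

lemma ito_integral_ito:
  assumes Z: "(pz Z) \<in> borel_measurable pred" and fin: "sqn \<mu> (pz Z) < \<infinity>"
  shows "ito Z (ito_integral M T B Z)"
proof -
  have "\<exists>I. has_ito_integral M T B Z I"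
    using ito_exists[OF assms] by (simp add: has_ito_integral_iff[OF Z])
  from someI_ex[OF this] show ?thesis
    unfolding ito_integral_def[symmetric] by (simp add: has_ito_integral_iff[OF Z])
qed

section \<open>Martingale representation\<close>

lemma sqn_orthogonal_sum:
  fixes D :: "nat \<Rightarrow> 'a \<Rightarrow> real"
  assumes m: "\<And>i. i < n \<Longrightarrow> D i \<in> borel_measurable M" and fin: "\<And>i. i < n \<Longrightarrow> sqn M (D i) < \<infinity>"
    and orth: "\<And>i j. i < j \<Longrightarrow> j < n \<Longrightarrow> expectation (\<lambda>w. D i w * D j w) = 0"
  shows "sqn M (\<lambda>w. \<Sum>i<n. D i w) = (\<Sum>i<n. sqn M (D i)) \<and> sqn M (\<lambda>w. \<Sum>i<n. D i w) < \<infinity>"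
  using assms
proof (induction n)
  case (Suc n)
  let ?S = "\<lambda>w. \<Sum>i<n. D i w"
  have IH: "sqn M ?S = (\<Sum>i<n. sqn M (D i))" "sqn M ?S < \<infinity>"
    using Suc.IH Suc.prems by (meson less_SucI)+
  have Sm: "?S \<in> borel_measurable M" using Suc.prems(1) by (intro borel_measurable_sum) auto
  have Dm: "D n \<in> borel_measurable M" and Df: "sqn M (D n) < \<infinity>" using Suc.prems by auto
  have i: "integrable M (\<lambda>w. (?S w)\<^sup>2)" "integrable M (\<lambda>w. (D n w)\<^sup>2)"
    using sqn_integrable_iff[OF Sm] sqn_integrable_iff[OF Dm] IH(2) Df by auto
  have ij: "integrable M (\<lambda>w. D i w * D n w)" if "i < n" for i
    using that Suc.prems by (intro integrable_mult_L2) auto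
  have x: "integrable M (\<lambda>w. ?S w * D n w)" by (rule integrable_mult_L2[OF Sm Dm IH(2) Df])
  have "expectation (\<lambda>w. ?S w * D n w) = (\<Sum>i<n. expectation (\<lambda>w. D i w * D n w))"
    unfolding sum_distrib_right using ij by (intro Bochner_Integration.integral_sum) auto
  also have "\<dots> = 0" using Suc.prems(3) by (intro sum.neutral) auto
  finally have x0: "expectation (\<lambda>w. ?S w * D n w) = 0" .
  have "expectation (\<lambda>w. (?S w + D n w)\<^sup>2) = expectation (\<lambda>w. (?S w)\<^sup>2 + (D n w)\<^sup>2 + 2 * (?S w * D n w))"
    by (simp add: power2_sum mult.assoc)
  also have "\<dots> = expectation (\<lambda>w. (?S w)\<^sup>2) + expectation (\<lambda>w. (D n w)\<^sup>2)"
    using i x x0 by simp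
  finally have e: "expectation (\<lambda>w. (?S w + D n w)\<^sup>2) = expectation (\<lambda>w. (?S w)\<^sup>2) + expectation (\<lambda>w. (D n w)\<^sup>2)" .
  have f: "sqn M (\<lambda>w. ?S w + D n w) < \<infinity>" by (rule sqn_add_finite[OF Sm Dm IH(2) Df])
  have ii: "integrable M (\<lambda>w. (?S w + D n w)\<^sup>2)"
    using sqn_integrable_iff[OF borel_measurable_add[OF Sm Dm]] f by simp
  have "sqn M (\<lambda>w. ?S w + D n w) = ennreal (expectation (\<lambda>w. (?S w + D n w)\<^sup>2))"
    using sqn_eq_integral[of M "\<lambda>w. ?S w + D n w"] ii by simp
  also have "\<dots> = sqn M ?S + sqn M (D n)"
    unfolding e using sqn_eq_integral[of M ?S] sqn_eq_integral[of M "D n"] i by simp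
  finally show ?case using IH(1) f by simp
qed simp

text \<open>One-step error: the increment of the exponential martingale over [p, r], started from
  cos \<theta>, minus the stochastic integral whose integrand - sin \<theta> l is frozen at
  p.\<close>

definition exp_defect :: "real ^ 'd \<Rightarrow> real \<Rightarrow> real \<Rightarrow> ('a \<Rightarrow> real) \<Rightarrow> 'a \<Rightarrow> real" where
  "exp_defect l p r \<theta> w = exp ((norm l)\<^sup>2 * (r - p) / 2) * cos (\<theta> w + l \<bullet> (B r w - B p w)) - cos (\<theta> w)
      + sin (\<theta> w) * (l \<bullet> (B r w - B p w))"

text \<open>The exponential factor is the reciprocal of the expected cosine of the increment, and
  the sine and linear terms have mean zero. Hence a defect is orthogonal to the past, and in
  particular to earlier defects.\<close>

lemma exp_defect_orthogonal:
  assumes st: "0 \<le> p" "p < r" "r \<le> T" and \<theta>: "\<theta> \<in> borel_measurable (F p)"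
    and X: "X \<in> borel_measurable (F p)" "integrable M X"
  shows "expectation (\<lambda>w. X w * exp_defect l p r \<theta> w) = 0"
proof -
  let ?D = "\<lambda>w. B r w - B p w" and ?e = "exp ((norm l)\<^sup>2 * (r - p) / 2)"
  have \<theta>M [measurable]: "\<theta> \<in> borel_measurable M" using st by (intro measurable_F_M[OF \<theta>]) auto
  have XM [measurable]: "X \<in> borel_measurable M" using X by auto
  have D [measurable]: "?D \<in> borel_measurable M" using st by (intro measurable_increment) auto
  have c: "(\<lambda>w. X w * cos (\<theta> w)) \<in> borel_measurable (F p)" and s: "(\<lambda>w. X w * sin (\<theta> w)) \<in> borel_measurable (F p)"
    using X(1) \<theta> by (auto intro!: borel_measurable_times measurable_compose[OF \<theta>] borel_measurable_continuous_onI continuous_intros)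
  have ci: "integrable M (\<lambda>w. X w * cos (\<theta> w))" and si: "integrable M (\<lambda>w. X w * sin (\<theta> w))"
    by (rule Bochner_Integration.integrable_bound[OF X(2)]; simp add: abs_mult mult_left_le)+
  have dc: "integrable M (\<lambda>w. cos (l \<bullet> ?D w))" "integrable M (\<lambda>w. sin (l \<bullet> ?D w))"
    by (rule integrable_const_bound[of _ 1]; simp)+
  have dl: "integrable M (\<lambda>w. l \<bullet> ?D w)" "expectation (\<lambda>w. l \<bullet> ?D w) = 0"
    using increment_inner_orthogonal[OF st, of "\<lambda>_. l"] by auto
  have m: "(\<lambda>x. cos (l \<bullet> x)) \<in> borel_measurable borel" "(\<lambda>x. sin (l \<bullet> x)) \<in> borel_measurable borel" "(\<lambda>x. l \<bullet> x) \<in> borel_measurable borel"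
    by measurable
  note E1 = expectation_F_increment[OF st c ci m(1) dc(1)] and E2 = expectation_F_increment[OF st s si m(2) dc(2)]
    and E3 = expectation_F_increment[OF st s si m(3) dl(1)]
  have eq: "X w * exp_defect l p r \<theta> w = ?e * (X w * cos (\<theta> w) * cos (l \<bullet> ?D w)) - ?e * (X w * sin (\<theta> w) * sin (l \<bullet> ?D w))
      - X w * cos (\<theta> w) + X w * sin (\<theta> w) * (l \<bullet> ?D w)" for w
    unfolding exp_defect_def by (simp only: cos_add) (simp add: algebra_simps)
  have "expectation (\<lambda>w. X w * exp_defect l p r \<theta> w)
     = ?e * expectation (\<lambda>w. X w * cos (\<theta> w) * cos (l \<bullet> ?D w)) - ?e * expectation (\<lambda>w. X w * sin (\<theta> w) * sin (l \<bullet> ?D w))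
      - expectation (\<lambda>w. X w * cos (\<theta> w)) + expectation (\<lambda>w. X w * sin (\<theta> w) * (l \<bullet> ?D w))"
    unfolding eq using E1(1) E2(1) E3(1) ci by simp
  also have "\<dots> = (?e * exp (- (norm l)\<^sup>2 * (r - p) / 2) - 1) * expectation (\<lambda>w. X w * cos (\<theta> w))"
    unfolding E1(2) E2(2) E3(2) dl(2) increment_cos_sin[OF st] by (simp add: algebra_simps)
  also have "?e * exp (- (norm l)\<^sup>2 * (r - p) / 2) = 1"
    by (simp add: exp_minus_inverse flip: exp_add)
  finally show ?thesis by simp
qed

text \<open>The first summand stems from the growth of the exponential factor, bounded over the
  horizon T, the second from the fourth moment in the Taylor remainder.\<close>

definition defect_const :: "real ^ 'd \<Rightarrow> real" where
  "defect_const l = 2 * ((norm l)\<^sup>2 / 2 * exp ((norm l)\<^sup>2 * T / 2))\<^sup>2 + 2 * (norm l ^ 4 * (real CARD('d))\<^sup>2 * 3)"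

text \<open>The defect is (exp \<delta> - 1) cos(...) plus the Taylor remainder of the cosine. The
  first factor is linear in r - p because exp \<delta> - 1 \<le> \<delta> exp \<delta>, so both
  parts have squares of order (r - p)^2 in mean.\<close>

lemma exp_defect_sqn:
  assumes st: "0 \<le> p" "p < r" "r \<le> T" and \<theta>: "\<theta> \<in> borel_measurable (F p)"
  shows "sqn M (exp_defect l p r \<theta>) \<le> ennreal (defect_const l * (r - p)\<^sup>2)"
proof -
  let ?n = "\<lambda>w. l \<bullet> (B r w - B p w)"
  define \<delta> where "\<delta> = (norm l)\<^sup>2 * (r - p) / 2"
  have \<delta>0: "0 \<le> \<delta>" using st by (simp add: \<delta>_def)
  have "exp \<delta> - 1 \<le> \<delta> * exp \<delta>"
  proof -
    have "(1 - \<delta>) * exp \<delta> \<le> exp (-\<delta>) * exp \<delta>"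
      using exp_ge_add_one_self[of "-\<delta>"] by (intro mult_right_mono) auto
    then show ?thesis by (simp add: algebra_simps flip: exp_add)
  qed
  also have "\<dots> \<le> \<delta> * exp ((norm l)\<^sup>2 * T / 2)"
    using st \<delta>0 by (intro mult_left_mono) (auto simp: \<delta>_def intro!: mult_left_mono)
  finally have e: "(exp \<delta> - 1)\<^sup>2 \<le> (\<delta> * exp ((norm l)\<^sup>2 * T / 2))\<^sup>2"
    using \<delta>0 by (intro power_mono) auto
  have pw: "(exp_defect l p r \<theta> w)\<^sup>2 \<le> 2 * (exp \<delta> - 1)\<^sup>2 + 2 * (?n w) ^ 4" for w
  proof -
    let ?a = "(exp \<delta> - 1) * cos (\<theta> w + ?n w)" and ?b = "cos (\<theta> w + ?n w) - cos (\<theta> w) + sin (\<theta> w) * ?n w"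
    have "exp_defect l p r \<theta> w = ?a + ?b" by (simp add: exp_defect_def \<delta>_def algebra_simps)
    moreover have "(?a + ?b)\<^sup>2 \<le> 2 * ?a\<^sup>2 + 2 * ?b\<^sup>2"
    proof -
      have "(a + b)\<^sup>2 \<le> 2 * a\<^sup>2 + 2 * b\<^sup>2" for a b :: real
        using sum_squares_bound[of a b] by (simp add: power2_sum)
      then show ?thesis .
    qed
    moreover have "?a\<^sup>2 \<le> (exp \<delta> - 1)\<^sup>2"
      using abs_cos_le_one[of "\<theta> w + ?n w"] by (simp add: power_mult_distrib mult_left_le abs_square_le_1)
    moreover have "?b\<^sup>2 \<le> ((?n w)\<^sup>2)\<^sup>2"
      using power_mono[OF cos_taylor_le[of "\<theta> w" "?n w"], of 2] by (simp only: power2_abs abs_ge_zero simp_thms)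
    ultimately show ?thesis by (simp flip: power_mult)
  qed
  note f4 = increment_inner_fourth[OF st, of l]
  have "sqn M (exp_defect l p r \<theta>) \<le> (\<integral>\<^sup>+w. ennreal (2 * (exp \<delta> - 1)\<^sup>2 + 2 * (?n w) ^ 4) \<partial>M)"
    unfolding sqn_def by (intro nn_integral_mono ennreal_leI) (simp add: pw)
  also have "\<dots> = ennreal (expectation (\<lambda>w. 2 * (exp \<delta> - 1)\<^sup>2 + 2 * (?n w) ^ 4))"
    using f4(1) by (intro nn_integral_eq_integral) auto
  also have "expectation (\<lambda>w. 2 * (exp \<delta> - 1)\<^sup>2 + 2 * (?n w) ^ 4) = 2 * (exp \<delta> - 1)\<^sup>2 + 2 * expectation (\<lambda>w. (?n w) ^ 4)"
    using f4(1) by (simp add: prob_space)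
  also have "ennreal \<dots> \<le> ennreal (2 * (\<delta> * exp ((norm l)\<^sup>2 * T / 2))\<^sup>2 + 2 * (norm l ^ 4 * (real CARD('d))\<^sup>2 * 3 * (r - p)\<^sup>2))"
    using e f4(2) by (intro ennreal_leI add_mono mult_left_mono) auto
  also have "2 * (\<delta> * exp ((norm l)\<^sup>2 * T / 2))\<^sup>2 + 2 * (norm l ^ 4 * (real CARD('d))\<^sup>2 * 3 * (r - p)\<^sup>2) = defect_const l * (r - p)\<^sup>2"
  proof -
    have "(\<delta> * exp ((norm l)\<^sup>2 * T / 2))\<^sup>2 = ((norm l)\<^sup>2 / 2 * exp ((norm l)\<^sup>2 * T / 2))\<^sup>2 * (r - p)\<^sup>2"
      by (simp add: \<delta>_def power_mult_distrib power_divide)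
    then show ?thesis by (simp only: defect_const_def distrib_right mult.assoc)
  qed
  finally show ?thesis .
qed

text \<open>Variables with an exact elementary representation. By \<open>L2_rep\<close> its L^2
  closure contains every square-integrable \<open>F T\<close>-measurable variable.\<close>

definition rep_space :: "('a \<Rightarrow> real) set" where
  "rep_space = {\<lambda>w. c + I T w | c Z I. elem Z I}"

lemma rep_spaceI: "elem Z I \<Longrightarrow> (\<lambda>w. c + I T w) \<in> rep_space"
  unfolding rep_space_def by blast

lemma rep_spaceE:
  assumes "f \<in> rep_space" obtains c Z I where "elem Z I" "f = (\<lambda>w. c + I T w)"
  using assms unfolding rep_space_def mem_Collect_eq by (elim exE conjE) (rule that)

lemma T_mem: "T \<in> {0..T}" using horizon_pos by simp

lemma elem_T_measurable: "elem Z I \<Longrightarrow> I T \<in> borel_measurable M"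
  using l2_martingaleD(2)[OF elem_l2_martingale T_mem] .

lemma lin_space_rep: "lin_space M rep_space"
  unfolding lin_space_def
proof (intro conjI ballI allI subsetI)
  show "f \<in> borel_measurable M" if f: "f \<in> rep_space" for f
  proof -
    obtain c Z I where Z: "elem Z I" "f = (\<lambda>w. c + I T w)" using f by (rule rep_spaceE)
    show ?thesis unfolding Z(2) by (intro borel_measurable_add borel_measurable_const elem_T_measurable[OF Z(1)])
  qed
  show "(\<lambda>x. 0) \<in> rep_space" using rep_spaceI[OF elem.zero, of 0] by simp
  show "(\<lambda>x. f x + g x) \<in> rep_space" if f: "f \<in> rep_space" and g: "g \<in> rep_space" for f g
  proof -
    obtain c Z I where Z: "elem Z I" "f = (\<lambda>w. c + I T w)" using f by (rule rep_spaceE)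
    obtain c' Z' I' where Z': "elem Z' I'" "g = (\<lambda>w. c' + I' T w)" using g by (rule rep_spaceE)
    have "(\<lambda>x. f x + g x) = (\<lambda>w. (c + c') + (I T w + I' T w))" unfolding Z(2) Z'(2) by (simp add: algebra_simps)
    then show ?thesis using rep_spaceI[OF elem.add[OF Z(1) Z'(1)], of "c + c'"] by simp
  qed
  show "(\<lambda>x. c *\<^sub>R f x) \<in> rep_space" if f: "f \<in> rep_space" for f and c :: real
  proof -
    obtain d Z I where Z: "elem Z I" "f = (\<lambda>w. d + I T w)" using f by (rule rep_spaceE)
    have "(\<lambda>x. c *\<^sub>R f x) = (\<lambda>w. (c * d) + c * I T w)" unfolding Z(2) by (simp add: algebra_simps)
    then show ?thesis using rep_spaceI[OF elem_scale[OF Z(1)], of "c * d"] by simp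
  qed
qed

lemma const_rep: "(\<lambda>w. c) \<in> cl M rep_space"
  using rep_spaceI[OF elem.zero, of c] by (intro cl_incl[OF lin_space_rep]) simp

text \<open>
  The Doleans exponential \<open>exp (|l|\<^sup>2 (t - s) / 2) cos (\<theta> + l \<bullet> (B t - B s))\<close> has the integrand
  \<open>- exp (\<dots>) sin (\<dots>) l\<close>.  Instead of Ito's formula we use that the error of the Riemann sum over a
  partition of mesh \<open>\<Delta>\<close> is a sum of orthogonal defects, each of variance \<open>O(\<Delta>\<^sup>2)\<close>.
\<close>

lemma cos_increment_rep:
  assumes st: "0 \<le> s" "s < t" "t \<le> T" and \<theta>: "\<theta> \<in> borel_measurable (F s)"
    and rep: "(\<lambda>w. cos (\<theta> w)) \<in> cl M rep_space"
  shows "(\<lambda>w. cos (\<theta> w + l \<bullet> (B t w - B s w))) \<in> cl M rep_space"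
proof -
  define V where "V = (norm l)\<^sup>2 * (t - s) / 2"
  \<comment> \<open>N defects, each with squared norm at most exp(V)^2 \<open>defect_const l\<close>
    ((t - s) / N)^2, add up to K / N by orthogonality.\<close>
  define K where "K = exp V * exp V * (defect_const l * (t - s)\<^sup>2)"
  let ?G = "\<lambda>w. exp V * cos (\<theta> w + l \<bullet> (B t w - B s w))"
  have dc: "0 \<le> defect_const l" unfolding defect_const_def by simp
  have \<theta>M: "\<theta> \<in> borel_measurable M" using st by (intro measurable_F_M[OF \<theta>]) auto
  have D: "(\<lambda>w. B t w - B s w) \<in> borel_measurable M" using st by (intro measurable_increment) auto
  have GM: "?G \<in> borel_measurable M" using \<theta>M D by measurable
  have "\<exists>g\<in>cl M rep_space. sqn M (\<lambda>w. ?G w - g w) \<le> ennreal (K / real (Suc n))" for n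
  proof -
    define N where "N = Suc n"
    define \<Delta> where "\<Delta> = (t - s) / real N"
    define r where "r k = s + real k * \<Delta>" for k
    define \<phi> where "\<phi> k w = \<theta> w + l \<bullet> (B (r k) w - B s w)" for k w
    define v where "v k = (norm l)\<^sup>2 * (r k - s) / 2" for k
    \<comment> \<open>\<open>J k\<close> is the elementary integral with integrand frozen at the
      left end point, \<open>E k\<close> the weighted defect; the differences \<open>E k\<close> -
      \<open>J k\<close> telescope.\<close>
    define J where "J k w = ((exp (v k) * sin (\<phi> k w)) *\<^sub>R l) \<bullet> (B (r (Suc k)) w - B (r k) w)" for k w
    define E where "E k w = exp (v k) * exp_defect l (r k) (r (Suc k)) (\<phi> k) w" for k w
    have \<Delta>: "0 < \<Delta>" using st by (simp add: \<Delta>_def N_def)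
    have rN: "r N = t" "r 0 = s" by (simp_all add: r_def \<Delta>_def N_def)
    have rmono: "r i \<le> r j" if "i \<le> j" for i j using that \<Delta> by (simp add: r_def)
    have rS: "r (Suc k) - r k = \<Delta>" for k by (simp add: r_def algebra_simps)
    have rk: "0 \<le> r k" "r k < r (Suc k)" "r (Suc k) \<le> T" if "k < N" for k
      using rmono[of "Suc k" N] rmono[of 0 k] that st rN rS[of k] \<Delta> by auto
    have \<phi>F: "\<phi> k \<in> borel_measurable (F (r k))" for k
      unfolding \<phi>_def using rmono[of 0 k] st rN
      by (intro borel_measurable_add borel_measurable_inner borel_measurable_diff measurable_B_F borel_measurable_const
          measurable_F_mono[OF \<theta>]) auto
    have tel: "E k w = exp (v (Suc k)) * cos (\<phi> (Suc k) w) - exp (v k) * cos (\<phi> k w) + J k w" for k w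
    proof -
      have "\<phi> k w + l \<bullet> (B (r (Suc k)) w - B (r k) w) = \<phi> (Suc k) w" by (simp add: \<phi>_def inner_diff_right)
      moreover have "exp (v k) * exp ((norm l)\<^sup>2 * (r (Suc k) - r k) / 2) = exp (v (Suc k))"
        by (simp add: v_def flip: exp_add) (simp add: algebra_simps add_divide_distrib[symmetric] flip: diff_divide_distrib)
      ultimately show ?thesis
        by (simp add: E_def J_def exp_defect_def algebra_simps)
    qed
    have sumE: "(\<Sum>k<N. E k w) = ?G w - (cos (\<theta> w) - (\<Sum>k<N. J k w))" for w
    proof -
      have "(\<Sum>k<N. E k w) = (\<Sum>k<N. exp (v (Suc k)) * cos (\<phi> (Suc k) w) - exp (v k) * cos (\<phi> k w)) + (\<Sum>k<N. J k w)"
        by (simp add: tel sum.distrib)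
      also have "(\<Sum>k<N. exp (v (Suc k)) * cos (\<phi> (Suc k) w) - exp (v k) * cos (\<phi> k w))
        = exp (v N) * cos (\<phi> N w) - exp (v 0) * cos (\<phi> 0 w)" by (rule sum_lessThan_telescope)
      finally show ?thesis by (simp add: v_def \<phi>_def rN V_def)
    qed
    have JR: "J k \<in> cl M rep_space" if "k < N" for k
    proof -
      let ?h = "\<lambda>w. (exp (v k) * sin (\<phi> k w)) *\<^sub>R l"
      have "elem (\<lambda>u w. if r k < u \<and> u \<le> r (Suc k) then ?h w else 0)
          (\<lambda>u w. ?h w \<bullet> (B (min u (r (Suc k))) w - B (min u (r k)) w))"
      proof (rule elem.rect[where c = "exp (v k) * norm l"])
        show "?h \<in> borel_measurable (F (r k))"
          by (intro borel_measurable_scaleR borel_measurable_times borel_measurable_const measurable_compose[OF \<phi>F])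
             (auto intro!: borel_measurable_continuous_onI continuous_intros)
        show "\<forall>w\<in>space M. norm (?h w) \<le> exp (v k) * norm l"
          by (simp add: abs_mult mult_right_mono mult_left_le)
      qed (use rk[OF that] in auto)
      from rep_spaceI[OF this, of 0] rk[OF that] have "J k \<in> rep_space"
        by (simp add: J_def[abs_def] min_absorb2 less_imp_le)
      then show ?thesis by (rule cl_incl[OF lin_space_rep])
    qed
    have gR: "(\<lambda>w. cos (\<theta> w) - (\<Sum>k<N. J k w)) \<in> cl M rep_space"
      using JR by (intro lin_space_diff[OF lin_space_cl[OF lin_space_rep] rep] lin_space_sum[OF lin_space_cl[OF lin_space_rep]]) auto
    have vV: "v k \<le> V" if "k < N" for k
      using rmono[of k N] that rN unfolding v_def V_def by (intro divide_right_mono mult_left_mono) auto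
    have dF: "exp_defect l (r k) (r (Suc k)) (\<phi> k) \<in> borel_measurable (F (r (Suc k)))" if "k < N" for k
      unfolding exp_defect_def using rk[OF that]
      by (intro borel_measurable_add borel_measurable_diff borel_measurable_times borel_measurable_const
          borel_measurable_inner measurable_B_F measurable_compose[OF _ borel_measurable_continuous_onI[of cos]]
          measurable_compose[OF _ borel_measurable_continuous_onI[of sin]] measurable_F_mono[OF \<phi>F]) (auto intro!: continuous_intros)
    have EF: "E k \<in> borel_measurable (F (r (Suc k)))" if "k < N" for k
      unfolding E_def by (intro borel_measurable_times borel_measurable_const dF that)
    have EM: "E k \<in> borel_measurable M" if "k < N" for k
      using rk[OF that] by (intro measurable_F_M[OF EF[OF that]]) auto
    have dM: "exp_defect l (r k) (r (Suc k)) (\<phi> k) \<in> borel_measurable M" if "k < N" for k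
      using rk[OF that] by (intro measurable_F_M[OF dF[OF that]]) auto
    have Esq: "sqn M (E k) \<le> ennreal (exp V * exp V * (defect_const l * \<Delta>\<^sup>2))" if "k < N" for k
    proof -
      have "sqn M (E k) = ennreal ((exp (v k))\<^sup>2) * sqn M (exp_defect l (r k) (r (Suc k)) (\<phi> k))"
        unfolding E_def using sqn_scale[OF dM[OF that], of "exp (v k)"] by simp
      also have "\<dots> \<le> ennreal (exp V * exp V) * ennreal (defect_const l * \<Delta>\<^sup>2)"
        using exp_defect_sqn[OF rk[OF that] \<phi>F, of l] vV[OF that]
        unfolding rS by (intro mult_mono ennreal_leI) (auto simp: power2_eq_square intro!: mult_mono)
      also have "\<dots> = ennreal (exp V * exp V * (defect_const l * \<Delta>\<^sup>2))"
        using dc by (subst ennreal_mult[symmetric]) auto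
      finally show ?thesis .
    qed
    have Efin: "sqn M (E k) < \<infinity>" if "k < N" for k
      using Esq[OF that] by (rule le_less_trans) simp
    have orth: "expectation (\<lambda>w. E i w * E j w) = 0" if ij: "i < j" "j < N" for i j
    proof -
      have i: "i < N" using ij by simp
      have "(\<lambda>w. E i w * exp (v j)) \<in> borel_measurable (F (r j))"
        using rmono[of "Suc i" j] ij by (intro borel_measurable_times borel_measurable_const measurable_F_mono[OF EF[OF i]]) auto
      moreover have "integrable M (\<lambda>w. E i w * exp (v j))" using integrable_L2[OF EM[OF i] Efin[OF i]] by simp
      ultimately have "expectation (\<lambda>w. (E i w * exp (v j)) * exp_defect l (r j) (r (Suc j)) (\<phi> j) w) = 0"
        by (rule exp_defect_orthogonal[OF rk[OF ij(2)] \<phi>F])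
      then show ?thesis by (simp add: E_def mult.assoc)
    qed
    have "sqn M (\<lambda>w. \<Sum>k<N. E k w) = (\<Sum>k<N. sqn M (E k))"
      using sqn_orthogonal_sum[of N E, OF EM Efin orth] by simp
    also have "\<dots> \<le> (\<Sum>k<N. ennreal (exp V * exp V * (defect_const l * \<Delta>\<^sup>2)))"
      using Esq by (intro sum_mono) auto
    also have "\<dots> = ennreal (real N * (exp V * exp V * (defect_const l * \<Delta>\<^sup>2)))"
      using dc by (subst sum_ennreal) auto
    also have "real N * (exp V * exp V * (defect_const l * \<Delta>\<^sup>2)) = K / real N"
    proof -
      have "real N \<noteq> 0" by (simp add: N_def)
      then show ?thesis unfolding K_def \<Delta>_def by (simp add: power_divide) (simp add: power2_eq_square)
    qed
    finally have "sqn M (\<lambda>w. ?G w - (cos (\<theta> w) - (\<Sum>k<N. J k w))) \<le> ennreal (K / real N)"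
      unfolding sumE .
    then have "sqn M (\<lambda>w. ?G w - (cos (\<theta> w) - (\<Sum>k<N. J k w))) \<le> ennreal (K / real (Suc n))"
      by (simp only: N_def[symmetric])
    then show ?thesis using gR by (rule bexI)
  qed
  then have "\<forall>n. \<exists>g. g \<in> cl M rep_space \<and> sqn M (\<lambda>w. ?G w - g w) \<le> ennreal (K / real (Suc n))" by blast
  from choice[OF this] obtain g where g: "\<forall>n. g n \<in> cl M rep_space \<and> sqn M (\<lambda>w. ?G w - g n w) \<le> ennreal (K / real (Suc n))"
    by (elim exE)
  have "?G \<in> cl M rep_space"
  proof (rule cl_limit[OF lin_space_rep GM, of g])
    show "g n \<in> cl M rep_space" for n using g by simp
    have "(\<lambda>n. K * (1 / real (Suc n))) \<longlonglongrightarrow> K * 0"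
      by (intro tendsto_mult tendsto_const LIMSEQ_Suc[OF lim_1_over_n])
    then have z: "(\<lambda>n. ennreal (K / real (Suc n))) \<longlonglongrightarrow> 0" using tendsto_ennrealI by fastforce
    show "(\<lambda>n. sqn M (\<lambda>w. ?G w - g n w)) \<longlonglongrightarrow> 0"
      by (rule tendsto_sandwich[OF always_eventually always_eventually tendsto_const z]) (use g in auto)
  qed
  \<comment> \<open>The deterministic exponential factor is divided out.\<close>
  from cl_scale[OF lin_space_rep this, of "exp (- V)"]
  show ?thesis by (simp add: exp_minus field_simps)
qed

text \<open>Induction on the largest time b. With s the largest remaining time, l_b . B_b is split
  into l_b . B_s, absorbed into the coefficient at s, and l_b . (B_b - B_s), which
  \<open>cos_increment_rep\<close> adjoins. A single time counts as an increment from time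
  0.\<close>

lemma cos_combination_rep:
  assumes "finite P" "P \<subseteq> {0..T}"
  shows "(\<lambda>w. cos ((\<Sum>t\<in>P. l t \<bullet> B t w) + \<phi>)) \<in> cl M rep_space"
  using assms
proof (induction P arbitrary: l \<phi> rule: finite_linorder_max_induct)
  case empty
  then show ?case using const_rep by simp
next
  case (insert b A)
  have bT: "b \<in> {0..T}" and AT: "A \<subseteq> {0..T}" using insert.prems by auto
  have bA: "b \<notin> A" using insert.hyps(2) by auto
  have WF: "(\<lambda>w. \<Sum>t\<in>P. l t \<bullet> B t w) \<in> borel_measurable (F s)" if "P \<subseteq> {0..s}" for P s l
    using that by (intro borel_measurable_sum borel_measurable_inner borel_measurable_const measurable_B_F) auto
  have WM: "(\<lambda>w. \<Sum>t\<in>insert b A. l t \<bullet> B t w) \<in> borel_measurable M"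
    by (rule measurable_F_M[OF WF[OF insert.prems]]) simp
  have cosM: "(\<lambda>w. cos ((\<Sum>t\<in>insert b A. l t \<bullet> B t w) + \<phi>)) \<in> borel_measurable M"
    using WM by measurable
  show ?case
  proof (cases "A = {}")
    case True
    show ?thesis
    proof (cases "b = 0")
      case b: True
      show ?thesis
        by (rule cl_cong_AE[OF lin_space_rep cosM const_rep[of "cos \<phi>"]])
           (use start_zero in eventually_elim, simp add: True b)
    next
      case False
      then have "(\<lambda>w. cos (\<phi> + l b \<bullet> (B b w - B 0 w))) \<in> cl M rep_space"
        using bT by (intro cos_increment_rep const_rep) auto
      then show ?thesis
        by (rule cl_cong_AE[OF lin_space_rep cosM])
           (use start_zero in eventually_elim, simp add: True add.commute)
    qed
  next
    case False
    define s where "s = Max A"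
    have s: "s \<in> A" using insert.hyps(1) False by (simp add: s_def)
    have As: "A \<subseteq> {0..s}" using insert.hyps(1) AT by (auto simp: s_def)
    have sb: "s < b" "0 \<le> s" using s insert.hyps(2) AT by auto
    define k where "k = l(s := l s + l b)"
    have eq: "(\<Sum>t\<in>A. k t \<bullet> B t w) + \<phi> + l b \<bullet> (B b w - B s w) = (\<Sum>t\<in>insert b A. l t \<bullet> B t w) + \<phi>" for w
    proof -
      have "(\<Sum>t\<in>A. k t \<bullet> B t w) = k s \<bullet> B s w + (\<Sum>t\<in>A - {s}. k t \<bullet> B t w)"
        using insert.hyps(1) s by (rule sum.remove)
      also have "(\<Sum>t\<in>A - {s}. k t \<bullet> B t w) = (\<Sum>t\<in>A - {s}. l t \<bullet> B t w)"
        by (intro sum.cong) (auto simp: k_def)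
      also have "k s \<bullet> B s w = l b \<bullet> B s w + l s \<bullet> B s w" by (simp add: k_def inner_add_left)
      finally have "(\<Sum>t\<in>A. k t \<bullet> B t w) = l b \<bullet> B s w + (\<Sum>t\<in>A. l t \<bullet> B t w)"
        using sum.remove[OF insert.hyps(1) s, of "\<lambda>t. l t \<bullet> B t w"] by simp
      then show ?thesis using insert.hyps(1) bA by (simp add: inner_diff_right)
    qed
    have "(\<lambda>w. cos (((\<Sum>t\<in>A. k t \<bullet> B t w) + \<phi>) + l b \<bullet> (B b w - B s w))) \<in> cl M rep_space"
      by (rule cos_increment_rep)
         (use sb bT insert.IH[OF AT] in \<open>auto intro!: borel_measurable_add WF[OF As]\<close>)
    then show ?thesis unfolding eq .
  qed
qed

text \<open>Real trigonometric polynomials in the path at finitely many times. Phases provide sines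
  and constants, and the product formula for cosines gives closure under multiplication, although
  only sums and multiples are constructors.\<close>

inductive_set trig_algebra :: "('a \<Rightarrow> real) set" where
  cos: "finite P \<Longrightarrow> P \<subseteq> {0..T} \<Longrightarrow> (\<lambda>w. cos ((\<Sum>t\<in>P. l t \<bullet> B t w) + \<phi>)) \<in> trig_algebra"
| scale: "f \<in> trig_algebra \<Longrightarrow> (\<lambda>w. c * f w) \<in> trig_algebra"
| add: "f \<in> trig_algebra \<Longrightarrow> g \<in> trig_algebra \<Longrightarrow> (\<lambda>w. f w + g w) \<in> trig_algebra"

lemma trig_algebra_rep: "f \<in> trig_algebra \<Longrightarrow> f \<in> cl M rep_space"
proof (induction rule: trig_algebra.induct)
  case (cos P l \<phi>)
  then show ?case by (rule cos_combination_rep)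
next
  case (scale f c)
  then show ?case using cl_scale[OF lin_space_rep, of f c] by simp
next
  case (add f g)
  then show ?case using cl_add[OF lin_space_rep] by blast
qed

lemma trig_algebra_times_cos:
  assumes "f \<in> trig_algebra" "finite Q" "Q \<subseteq> {0..T}"
  shows "(\<lambda>w. f w * cos ((\<Sum>t\<in>Q. k t \<bullet> B t w) + \<psi>)) \<in> trig_algebra"
  using assms(1)
proof induction
  case (cos P l \<phi>)
  define l' where "l' t = (if t \<in> P then l t else 0)" for t
  define k' where "k' t = (if t \<in> Q then k t else 0)" for t
  have l': "(\<Sum>t\<in>P. l t \<bullet> B t w) = (\<Sum>t\<in>P \<union> Q. l' t \<bullet> B t w)" for w
    using cos assms by (intro sum.mono_neutral_cong_left) (auto simp: l'_def)
  have k': "(\<Sum>t\<in>Q. k t \<bullet> B t w) = (\<Sum>t\<in>P \<union> Q. k' t \<bullet> B t w)" for w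
    using cos assms by (intro sum.mono_neutral_cong_left) (auto simp: k'_def)
  have PQ: "finite (P \<union> Q)" "P \<union> Q \<subseteq> {0..T}" using cos assms by auto
  have "(\<lambda>w. (1/2) * cos ((\<Sum>t\<in>P \<union> Q. (l' t - k' t) \<bullet> B t w) + (\<phi> - \<psi>)) + (1/2) * cos ((\<Sum>t\<in>P \<union> Q. (l' t + k' t) \<bullet> B t w) + (\<phi> + \<psi>))) \<in> trig_algebra"
    by (intro trig_algebra.add trig_algebra.scale trig_algebra.cos PQ)
  moreover have "(1/2) * cos ((\<Sum>t\<in>P \<union> Q. (l' t - k' t) \<bullet> B t w) + (\<phi> - \<psi>)) + (1/2) * cos ((\<Sum>t\<in>P \<union> Q. (l' t + k' t) \<bullet> B t w) + (\<phi> + \<psi>))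
      = cos ((\<Sum>t\<in>P. l t \<bullet> B t w) + \<phi>) * cos ((\<Sum>t\<in>Q. k t \<bullet> B t w) + \<psi>)" for w
    unfolding l' k' cos_times_cos by (simp add: inner_diff_left inner_add_left sum.distrib sum_subtractf algebra_simps add_divide_distrib)
  ultimately show ?case by simp
next
  case (scale f c)
  then show ?case using trig_algebra.scale[OF scale.IH, of c] by (simp add: mult.assoc)
next
  case (add f g)
  then show ?case using trig_algebra.add[OF add.IH] by (simp add: distrib_right)
qed

lemma trig_algebra_const: "(\<lambda>w. c) \<in> trig_algebra"
  using trig_algebra.scale[OF trig_algebra.cos[of "{}" _ 0], of c] by simp

lemma bounded_algebra_trig: "bounded_algebra (space M) trig_algebra"
  unfolding bounded_algebra_def
proof (intro conjI allI ballI)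
  show "(\<lambda>x. c) \<in> trig_algebra" for c by (rule trig_algebra_const)
  show "(\<lambda>x. f x + g x) \<in> trig_algebra" if "f \<in> trig_algebra" "g \<in> trig_algebra" for f g
    using that by (rule trig_algebra.add)
  show "(\<lambda>x. f x * g x) \<in> trig_algebra" if f: "f \<in> trig_algebra" and g: "g \<in> trig_algebra" for f g
    using g
  proof induction
    case (cos P l \<phi>)
    with f show ?case by (rule trig_algebra_times_cos)
  next
    case (scale g c)
    then show ?case using trig_algebra.scale[OF scale.IH, of c] by (simp add: mult.left_commute)
  next
    case (add g g')
    then show ?case using trig_algebra.add[OF add.IH] by (simp add: distrib_left)
  qed
  show "\<exists>c. \<forall>x\<in>space M. \<bar>f x\<bar> \<le> c" if "f \<in> trig_algebra" for f
    using that
  proof induction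
    case (cos P l \<phi>)
    show ?case by (intro exI[of _ 1]) auto
  next
    case (scale f c)
    then obtain d where "\<forall>x\<in>space M. \<bar>f x\<bar> \<le> d" by blast
    then show ?case by (intro exI[of _ "\<bar>c\<bar> * d"]) (auto simp: abs_mult intro!: mult_left_mono)
  next
    case (add f g)
    then obtain d e where "\<forall>x\<in>space M. \<bar>f x\<bar> \<le> d" "\<forall>x\<in>space M. \<bar>g x\<bar> \<le> e" by blast
    then show ?case by (intro exI[of _ "d + e"]) (auto intro!: order_trans[OF abs_triangle_ineq] add_mono)
  qed
qed

text \<open>Bounded functions recover the path: each coordinate x of B_s is the limit of n sin(x /
  n), and these sines are cosines with phase - pi / 2.\<close>

lemma path_events_trig:
  "path_events M B T \<subseteq> sigma_sets (space M) {{w \<in> space M. c < f w} | f c. f \<in> trig_algebra}"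
proof
  let ?G = "{{w \<in> space M. c < f w} | f c. f \<in> trig_algebra}"
  define S where "S = sigma (space M) ?G"
  have Pow: "?G \<subseteq> Pow (space M)" by auto
  have sp: "space S = space M" and se: "sets S = sigma_sets (space M) ?G"
    unfolding S_def using Pow by (auto simp: space_measure_of_conv)
  have fS: "f \<in> borel_measurable S" if "f \<in> trig_algebra" for f
  proof (rule borel_measurableI_greater)
    fix c
    show "{x \<in> space S. c < f x} \<in> sets S"
      unfolding se sp using that by (intro sigma_sets.Basic) blast
  qed
  fix E assume "E \<in> path_events M B T"
  then obtain s A where E: "E = B s -` A \<inter> space M" "s \<in> {0..T}" "A \<in> sets borel" unfolding path_events_def by auto
  have "B s \<in> borel_measurable S"
  proof (rule borel_measurable_euclidean_space[THEN iffD2], intro ballI)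
    fix i :: "real ^ 'd"
    have lim: "(\<lambda>n. real (Suc n) * sin (x / real (Suc n))) \<longlonglongrightarrow> x" for x :: real
    proof (cases "x = 0")
      case False
      have "(\<lambda>n. x * (1 / real (Suc n))) \<longlonglongrightarrow> x * 0"
        by (intro tendsto_mult tendsto_const LIMSEQ_Suc[OF lim_1_over_n])
      then have t0: "(\<lambda>n. x / real (Suc n)) \<longlonglongrightarrow> 0" by simp
      have "((\<lambda>y. sin y / y) \<longlongrightarrow> 1) (at (0::real))"
        using DERIV_sin[of "0::real"] by (simp add: DERIV_def)
      then have "(\<lambda>n. sin (x / real (Suc n)) / (x / real (Suc n))) \<longlonglongrightarrow> 1"
        by (rule filterlim_compose) (use t0 False in \<open>auto simp: filterlim_at intro!: always_eventually\<close>)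
      then have "(\<lambda>n. x * (sin (x / real (Suc n)) / (x / real (Suc n)))) \<longlonglongrightarrow> x * 1"
        by (intro tendsto_mult tendsto_const)
      moreover have "x * (sin (x / real (Suc n)) / (x / real (Suc n))) = real (Suc n) * sin (x / real (Suc n))" for n
        using False by (simp del: of_nat_Suc)
      ultimately show ?thesis by (simp only: mult_1_right)
    qed simp
    have tr: "(\<lambda>w. real (Suc n) * sin ((B s w \<bullet> i) / real (Suc n))) \<in> trig_algebra" for n
    proof -
      have "(\<lambda>w. real (Suc n) * cos ((\<Sum>t\<in>{s}. ((1 / real (Suc n)) *\<^sub>R i) \<bullet> B t w) + - pi / 2)) \<in> trig_algebra"
        by (intro trig_algebra.scale trig_algebra.cos) (use E in auto)
      moreover have "cos ((\<Sum>t\<in>{s}. ((1 / real (Suc n)) *\<^sub>R i) \<bullet> B t w) + - pi / 2) = sin ((B s w \<bullet> i) / real (Suc n))" for w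
        by (simp add: cos_diff inner_commute)
      ultimately show ?thesis by simp
    qed
    show "(\<lambda>w. B s w \<bullet> i) \<in> borel_measurable S"
      by (rule borel_measurable_LIMSEQ_real[OF lim fS[OF tr]])
  qed
  from measurable_sets[OF this E(3)] show "E \<in> sigma_sets (space M) ?G" unfolding E(1) se sp .
qed

lemma L2_rep:
  assumes \<zeta>: "\<zeta> \<in> borel_measurable (F T)" "sqn M \<zeta> < \<infinity>"
  shows "\<zeta> \<in> cl M rep_space"
proof (rule cl_indicator_imp_L2[OF lin_space_rep subalgebra_F _ \<zeta>])
  fix A and c :: real assume A: "A \<in> sets (F T)"
  have AM: "A \<in> sets M" using A sets_F_subset[of T] by auto
  obtain A' where A': "A' \<in> sets (natural_filtration M B T)" "A' \<in> sets M" "AE w in M. w \<in> A \<longleftrightarrow> w \<in> A'"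
    using F_modulo_null[OF A] by auto
  have "A' \<in> sigma_sets (space M) {{w \<in> space M. c < f w} | f c. f \<in> trig_algebra}"
    using A'(1) sigma_sets_mono[OF path_events_trig] unfolding sets_natural by blast
  then have "(\<lambda>x. indicat_real A' x *\<^sub>R c) \<in> cl M rep_space"
    using trig_algebra_rep by (intro algebra_cl_indicator[OF lin_space_rep bounded_algebra_trig]) auto
  then show "(\<lambda>x. indicat_real A x *\<^sub>R c) \<in> cl M rep_space"
  proof (rule cl_cong_AE[OF lin_space_rep, rotated])
    show "AE x in M. indicat_real A x *\<^sub>R c = indicat_real A' x *\<^sub>R c"
      using A'(3) by eventually_elim (simp add: indicator_def)
    show "(\<lambda>x. indicat_real A x *\<^sub>R c) \<in> borel_measurable M" using AM by measurable
  qed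
qed simp

text \<open>The mean is the closest constant in L^2. This removes unknown constants in the
  representation theorem and unknown reflection terms in the proof of minimality.\<close>

lemma sqn_center_le:
  assumes Y: "Y \<in> borel_measurable M" "sqn M Y < \<infinity>"
  shows "sqn M (\<lambda>w. Y w - expectation Y) \<le> sqn M (\<lambda>w. Y w - (c :: real))"
proof -
  have cfin: "sqn M (\<lambda>w. a) < \<infinity>" for a :: real by (rule sqn_bounded[of _ "\<bar>a\<bar>"]) simp
  have i: "integrable M Y" "integrable M (\<lambda>w. (Y w)\<^sup>2)"
    using integrable_L2[OF Y] sqn_integrable_iff[OF Y(1)] Y(2) by auto
  have sq: "integrable M (\<lambda>w. (Y w - a)\<^sup>2)" for a
    using sqn_integrable_iff[of "\<lambda>w. Y w - a" M] sqn_diff_finite[OF Y(1) _ Y(2) cfin, of a] Y(1) by simp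
  have e: "expectation (\<lambda>w. (Y w - a)\<^sup>2) = expectation (\<lambda>w. (Y w)\<^sup>2) - 2 * a * expectation Y + a\<^sup>2" for a
    using i by (simp add: power2_diff prob_space)
  have "expectation (\<lambda>w. (Y w - expectation Y)\<^sup>2) \<le> expectation (\<lambda>w. (Y w - c)\<^sup>2)"
  proof -
    have "0 \<le> (expectation Y)\<^sup>2 + c\<^sup>2 - 2 * expectation Y * c"
      using zero_le_power2[of "expectation Y - c"] by (simp only: power2_diff)
    then show ?thesis unfolding e by (simp add: power2_eq_square algebra_simps)
  qed
  then show ?thesis using sq by (simp add: sqn_eq_integral ennreal_leI)
qed

text \<open>Approximations c_k + I_k(T) of \<zeta> carry uncontrolled constants. Integrals have mean
  zero, so centring bounds the differences of the I_k(T) without them; by the isometry the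
  integrands are a Cauchy sequence of predictable functions, and the constant becomes the mean of
  \<zeta> - I_T.\<close>

theorem martingale_representation:
  assumes \<zeta>: "\<zeta> \<in> borel_measurable (F T)" "sqn M \<zeta> < \<infinity>"
  obtains c Z I where "(pz Z) \<in> borel_measurable pred" "sqn \<mu> (pz Z) < \<infinity>"
    "ito Z I" "AE w in M. \<zeta> w = c + I T w"
proof -
  have \<zeta>M: "\<zeta> \<in> borel_measurable M" by (rule measurable_F_M[OF \<zeta>(1)]) simp
  have "\<forall>k. \<exists>p. elem (fst (snd p)) (snd (snd p)) \<and> sqn M (\<lambda>w. \<zeta> w - (fst p + snd (snd p) T w)) < ennreal (1/4 * (1/16)^k)"
  proof
    fix k :: nat
    have "0 < 1/4 * (1/16::real)^k" by simp
    from cl_approx[OF L2_rep[OF \<zeta>] this] obtain e where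
      e: "e \<in> rep_space" "sqn M (\<lambda>w. \<zeta> w - e w) < ennreal (1/4 * (1/16)^k)" by blast
    obtain c Z I where Z: "elem Z I" "e = (\<lambda>w. c + I T w)" using e(1) by (rule rep_spaceE)
    show "\<exists>p. elem (fst (snd p)) (snd (snd p)) \<and> sqn M (\<lambda>w. \<zeta> w - (fst p + snd (snd p) T w)) < ennreal (1/4 * (1/16)^k)"
      using Z(1) e(2)[unfolded Z(2)] by (intro exI[of _ "(c, Z, I)"]) (simp only: fst_conv snd_conv simp_thms)
  qed
  from choice[OF this] obtain p where p: "\<forall>k. elem (fst (snd (p k))) (snd (snd (p k))) \<and>
    sqn M (\<lambda>w. \<zeta> w - (fst (p k) + snd (snd (p k)) T w)) < ennreal (1/4 * (1/16)^k)" by (elim exE)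
  define c Zk Ik where "c k = fst (p k)" and "Zk k = fst (snd (p k))" and "Ik k = snd (snd (p k))" for k
  have el: "elem (Zk k) (Ik k)" and ap: "sqn M (\<lambda>w. \<zeta> w - (c k + Ik k T w)) < ennreal (1/4 * (1/16)^k)" for k
    using p by (simp_all add: c_def Zk_def Ik_def)
  have IM [measurable]: "Ik k T \<in> borel_measurable M" for k by (rule elem_T_measurable[OF el])
  have If: "sqn M (Ik k T) < \<infinity>" for k by (rule elem_L2[OF el T_mem])
  have step: "sqn \<mu> (\<lambda>x. pz (Zk k) x - pz (Zk (Suc k)) x) \<le> ennreal (1 * (1/4)^k)" for k
  proof -
    let ?N = "\<lambda>w. Ik k T w - Ik (Suc k) T w"
    note eld = elem_diff[OF el[of k] el[of "Suc k"]]
    have N: "?N \<in> borel_measurable M" "sqn M ?N < \<infinity>" by (simp, intro sqn_diff_finite If IM)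
    have "expectation (\<lambda>w. 1 * (?N w - (Ik k 0 w - Ik (Suc k) 0 w))) = 0"
      using horizon_pos sqn_bounded[of "\<lambda>_. 1::real" 1]
      by (intro l2_martingale_orth[OF elem_l2_martingale[OF eld]]) auto
    then have E0: "expectation ?N = 0" by (simp add: elem_at_0[OF el])
    have "sqn \<mu> (\<lambda>x. pz (Zk k) x - pz (Zk (Suc k)) x) = sqn M ?N"
      by (rule elem_iso[OF eld, symmetric])
    also have "\<dots> \<le> sqn M (\<lambda>w. ?N w - (c (Suc k) - c k))"
      using sqn_center_le[OF N, of "c (Suc k) - c k"] E0 by simp
    also have "(\<lambda>w. ?N w - (c (Suc k) - c k)) = (\<lambda>w. (c k + Ik k T w) - (c (Suc k) + Ik (Suc k) T w))"
      by (simp add: algebra_simps)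
    also have "sqn M \<dots> \<le> 2 * sqn M (\<lambda>w. (c k + Ik k T w) - \<zeta> w) + 2 * sqn M (\<lambda>w. \<zeta> w - (c (Suc k) + Ik (Suc k) T w))"
      using \<zeta>M by (intro sqn_triangle) auto
    also have "\<dots> \<le> 2 * ennreal (1/4 * (1/16)^k) + 2 * ennreal (1/4 * (1/16)^Suc k)"
      using ap[of k] ap[of "Suc k"] by (intro add_mono mult_left_mono) (simp_all add: sqn_commute[of M "\<zeta>"] less_imp_le)
    also have "\<dots> \<le> ennreal ((1/16)^k)" by (rule ennreal_geometric_step) simp
    also have "\<dots> \<le> ennreal (1 * (1/4)^k)" by (intro ennreal_leI) (auto intro: power_mono)
    finally show ?thesis .
  qed
  obtain g where g: "g \<in> borel_measurable pred"
    "\<And>n. sqn \<mu> (\<lambda>x. pz (Zk n) x - g x) \<le> ennreal (4 * 1 * (1/4)^n)"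
    by (rule L2_complete[OF subalgebra_pred elem_pred[OF el] step]) auto
  define Z where "Z s w = g (w, s)" for s w
  have gZ: "(pz Z) = g" by (simp add: Z_def)
  have Zp: "(pz Z) \<in> borel_measurable pred" unfolding gZ by (rule g)
  note Zm = pred_mu[OF Zp]
  have d0: "sqn \<mu> (\<lambda>x. pz (Zk n) x - pz Z x) \<le> ennreal (4 * (1/4)^n)" for n
    using g(2)[of n] by (simp add: Z_def)
  have Zf: "sqn \<mu> (pz Z) < \<infinity>"
  proof -
    have "sqn \<mu> (\<lambda>x. pz (Zk 0) x - (pz (Zk 0) x - pz Z x)) < \<infinity>"
      by (intro sqn_diff_finite elem_fin[OF el] elem_mu[OF el] borel_measurable_diff Zm le_less_trans[OF d0[of 0]]) simp
    then show ?thesis by simp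
  qed
  obtain I where I: "ito Z I" using ito_exists[OF Zp Zf] by blast
  note mart = ito_properties(1)[OF Zm Zf I]
  have ITM [measurable]: "I T \<in> borel_measurable M" and ITf: "sqn M (I T) < \<infinity>"
    using l2_martingaleD(2,3)[OF mart T_mem] by auto
  let ?Y = "\<lambda>w. \<zeta> w - I T w"
  have Y: "?Y \<in> borel_measurable M" "sqn M ?Y < \<infinity>"
    using \<zeta>M ITM by (auto intro!: sqn_diff_finite[OF _ _ \<zeta>(2) ITf, simplified])
  have dI: "sqn M (\<lambda>w. Ik n T w - I T w) \<le> ennreal (4 * (1/4)^n)" for n
  proof -
    have fin: "sqn \<mu> (\<lambda>x. pz (Zk n) x - pz Z x) < \<infinity>" using d0[of n] by (rule le_less_trans) simp
    have "sqn M (\<lambda>w. Ik n T w - I T w) = sqn \<mu> (\<lambda>x. if snd x \<le> T then pz (Zk n) x - pz Z x else 0)"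
      by (rule ito_properties(2)[OF borel_measurable_diff[OF elem_mu[OF el] Zm] fin ito_diff[OF elem_mu[OF el] Zm elem_ito[OF el] I] T_mem])
    also have "\<dots> \<le> sqn \<mu> (\<lambda>x. pz (Zk n) x - pz Z x)" by (intro sqn_mono_AE AE_I2) simp
    finally show ?thesis using d0[of n] by (rule order_trans)
  qed
  have "sqn M (\<lambda>w. ?Y w - expectation ?Y) \<le> ennreal (10 * (1/4)^n)" for n
  proof -
    have "sqn M (\<lambda>w. ?Y w - expectation ?Y) \<le> sqn M (\<lambda>w. ?Y w - c n)" by (rule sqn_center_le[OF Y])
    also have "(\<lambda>w. ?Y w - c n) = (\<lambda>w. (\<zeta> w - (c n + Ik n T w)) + (Ik n T w - I T w))" by (simp add: algebra_simps)
    also have "sqn M \<dots> \<le> 2 * sqn M (\<lambda>w. \<zeta> w - (c n + Ik n T w)) + 2 * sqn M (\<lambda>w. Ik n T w - I T w)"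
      using \<zeta>M by (intro sqn_add) auto
    also have "\<dots> \<le> 2 * ennreal (1/4 * (1/16)^n) + 2 * ennreal (4 * (1/4)^n)"
      using ap[of n] dI[of n] by (intro add_mono mult_left_mono) (auto intro: less_imp_le)
    also have "\<dots> = ennreal (2 * (1/4 * (1/16)^n) + 2 * (4 * (1/4)^n))" by (rule ennreal_double_add) auto
    also have "\<dots> \<le> ennreal (10 * (1/4)^n)"
    proof (rule ennreal_leI)
      have "(1/16::real)^n \<le> (1/4)^n" by (intro power_mono) auto
      moreover have "0 \<le> (1/4::real)^n" by simp
      ultimately show "2 * (1/4 * (1/16)^n) + 2 * (4 * (1/4)^n) \<le> 10 * (1/4::real)^n" by linarith
    qed
    finally show ?thesis .
  qed
  moreover have "(\<lambda>n. ennreal (10 * (1/4)^n)) \<longlonglongrightarrow> 0"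
    using tendsto_ennrealI[OF tendsto_mult[OF tendsto_const[of 10] LIMSEQ_power_zero[of "1/4::real"]]] by simp
  ultimately have "sqn M (\<lambda>w. ?Y w - expectation ?Y) \<le> 0"
    by (intro LIMSEQ_le_const) auto
  then have "sqn M (\<lambda>w. ?Y w - expectation ?Y) = 0" by simp
  then have "AE w in M. ?Y w - expectation ?Y = 0"
    using sqn_zero_iff[of "\<lambda>w. ?Y w - expectation ?Y" M] Y(1) by simp
  then have "AE w in M. \<zeta> w = expectation ?Y + I T w" by eventually_elim simp
  with Zp Zf I show thesis by (rule that)
qed

end

section \<open>Linear equations\<close>

context brownian_motion
begin

section \<open>Progressive measurability\<close>

abbreviation "prog \<equiv> progressive_sigma M T F"

sublocale PS: pair_sigma_finite M L
  by unfold_locales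

lemma prog_sigma_algebra:
  "sigma_algebra (space M \<times> {0..T}) {A. A \<subseteq> space M \<times> {0..T} \<and>
     (\<forall>t\<in>{0..T}. A \<inter> (space M \<times> {0..t}) \<in> sets (F t \<Otimes>\<^sub>M restrict_space borel {0..t}))}" (is "sigma_algebra ?X ?P")
  unfolding sigma_algebra_iff2
proof (intro conjI ballI allI impI subsetI)
  have top: "space M \<times> {0..t} \<in> sets (F t \<Otimes>\<^sub>M restrict_space borel {0..t})" for t
    using sets.top[of "F t \<Otimes>\<^sub>M restrict_space borel {0..t}"] by (simp add: space_pair_measure space_restrict_space)
  show "x \<in> Pow ?X" if "x \<in> ?P" for x using that by simp
  show "{} \<in> ?P" by simp
  show "?X - s \<in> ?P" if s: "s \<in> ?P" for s
  proof (intro CollectI conjI ballI)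
    fix t assume t: "t \<in> {0..T}"
    have "(?X - s) \<inter> (space M \<times> {0..t}) = space M \<times> {0..t} - s \<inter> (space M \<times> {0..t})" using t by auto
    then show "(?X - s) \<inter> (space M \<times> {0..t}) \<in> sets (F t \<Otimes>\<^sub>M restrict_space borel {0..t})"
      using s t top[of t] by (auto intro: sets.Diff)
  qed simp
  show "\<Union>(range A) \<in> ?P" if A: "range A \<subseteq> ?P" for A :: "nat \<Rightarrow> ('a \<times> real) set"
  proof (intro CollectI conjI ballI)
    have An: "A n \<in> ?P" for n using A by auto
    show "\<Union>(range A) \<subseteq> ?X" using An by blast
    fix t assume t: "t \<in> {0..T}"
    have "\<Union>(range A) \<inter> (space M \<times> {0..t}) = (\<Union>n. A n \<inter> (space M \<times> {0..t}))" by auto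
    also have "\<dots> \<in> sets (F t \<Otimes>\<^sub>M restrict_space borel {0..t})"
      by (rule sets.countable_UN) (use An t in blast)
    finally show "\<Union>(range A) \<inter> (space M \<times> {0..t}) \<in> sets (F t \<Otimes>\<^sub>M restrict_space borel {0..t})" .
  qed
qed

lemma sets_prog: "sets prog = {A. A \<subseteq> space M \<times> {0..T} \<and>
     (\<forall>t\<in>{0..T}. A \<inter> (space M \<times> {0..t}) \<in> sets (F t \<Otimes>\<^sub>M restrict_space borel {0..t}))}"
  unfolding progressive_sigma_def
  using sigma_algebra.sigma_sets_eq[OF prog_sigma_algebra] by (subst sets_measure_of) auto

lemma space_prog [simp]: "space prog = space M \<times> {0..T}"
  unfolding progressive_sigma_def by (rule space_measure_of) auto

lemma prog_rect:
  assumes A: "A \<in> sets (F s)" and I: "I \<in> sets borel" "I \<subseteq> {s..T}" and s: "0 \<le> s"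
  shows "A \<times> I \<in> sets prog"
proof -
  have AM: "A \<subseteq> space M" using sets.sets_into_space[OF A] by simp
  have "(A \<times> I) \<inter> (space M \<times> {0..t}) \<in> sets (F t \<Otimes>\<^sub>M restrict_space borel {0..t})" for t
  proof (cases "s \<le> t")
    case True
    have "(A \<times> I) \<inter> (space M \<times> {0..t}) = A \<times> ({0..t} \<inter> I)" using AM by auto
    moreover have "A \<in> sets (F t)" using A sets_F_mono[OF True] by auto
    ultimately show ?thesis using I(1) by (auto intro!: pair_measureI simp: sets_restrict_space)
  next
    case False
    then have "(A \<times> I) \<inter> (space M \<times> {0..t}) = {}" using I(2) by auto
    then show ?thesis by simp
  qed
  then show ?thesis unfolding sets_prog using AM I s by auto
qed

lemma pred_prog: "f \<in> borel_measurable pred \<Longrightarrow> f \<in> borel_measurable prog"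
proof -
  have "{A \<times> {0} | A. A \<in> sets (F 0)} \<union> {A \<times> {s<..t} | A s t. 0 \<le> s \<and> s < t \<and> t \<le> T \<and> A \<in> sets (F s)} \<subseteq> sets prog"
  proof (intro Un_least subsetI; elim CollectE exE conjE; hypsubst)
    show "A \<times> {0} \<in> sets prog" if "A \<in> sets (F 0)" for A
      using horizon_pos by (intro prog_rect[OF that]) auto
    show "A \<times> {s<..t} \<in> sets prog" if "0 \<le> s" "s < t" "t \<le> T" "A \<in> sets (F s)" for A s t
      using that by (intro prog_rect[OF that(4)]) auto
  qed
  from sets.sigma_sets_subset[OF this] have "subalgebra prog pred"
    unfolding subalgebra_def sets_pred space_prog space_pred by (intro conjI refl)
  then show "f \<in> borel_measurable pred \<Longrightarrow> f \<in> borel_measurable prog" by (rule measurable_from_subalg)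
qed

lemma prog_restrict:
  assumes g: "g \<in> borel_measurable prog" and t: "t \<in> {0..T}"
  shows "g \<in> borel_measurable (F t \<Otimes>\<^sub>M restrict_space borel {0..t})"
proof (rule measurableI)
  fix A :: "'b set" assume "A \<in> sets borel"
  from measurable_sets[OF g this] have "(g -` A \<inter> space prog) \<inter> (space M \<times> {0..t}) \<in> sets (F t \<Otimes>\<^sub>M restrict_space borel {0..t})"
    using t unfolding sets_prog by blast
  moreover have "(g -` A \<inter> space prog) \<inter> (space M \<times> {0..t}) = g -` A \<inter> space (F t \<Otimes>\<^sub>M restrict_space borel {0..t})"
    using t by (auto simp: space_pair_measure space_restrict_space)
  ultimately show "g -` A \<inter> space (F t \<Otimes>\<^sub>M restrict_space borel {0..t}) \<in> sets (F t \<Otimes>\<^sub>M restrict_space borel {0..t})"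
    by simp
qed simp

lemma subalgebra_prog: "subalgebra \<mu> prog"
proof -
  have "A \<in> sets \<mu>" if A: "A \<in> sets prog" for A
  proof -
    have "A \<subseteq> space M \<times> {0..T}" "A \<inter> (space M \<times> {0..T}) \<in> sets (F T \<Otimes>\<^sub>M restrict_space borel {0..T})"
      using A T_mem unfolding sets_prog by blast+
    then have "A \<in> sets (F T \<Otimes>\<^sub>M restrict_space borel {0..T})" by (simp add: Int_absorb2)
    moreover have "sets (F T \<Otimes>\<^sub>M restrict_space borel {0..T}) \<subseteq> sets \<mu>"
    proof -
      have L: "sets (restrict_space borel {0..T}) = sets L" "space (restrict_space borel {0..T}) = space L"
        by (simp_all add: sets_restrict_space space_restrict_space)
      show ?thesis unfolding sets_pair_measure space_F L
        using sets_F_subset[of T] by (intro sigma_sets_mono') blast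
    qed
    ultimately show ?thesis by (rule rev_subsetD)
  qed
  then show ?thesis unfolding subalgebra_def by (simp add: subset_iff)
qed

lemma prog_mu: "f \<in> borel_measurable prog \<Longrightarrow> f \<in> borel_measurable \<mu>"
  by (rule measurable_from_subalg[OF subalgebra_prog])

lemma time_prog:
  fixes h :: "real \<Rightarrow> 'b::topological_space"
  shows "h \<in> borel_measurable borel \<Longrightarrow> (\<lambda>x. h (snd x)) \<in> borel_measurable prog"
proof (rule measurableI)
  fix A :: "'b set" assume h: "h \<in> borel_measurable borel" and A: "A \<in> sets borel"
  have "(\<lambda>x. h (snd x)) -` A \<inter> space prog = space M \<times> (h -` A \<inter> {0..T})" by auto
  also have "\<dots> \<in> sets prog"
    using measurable_sets[OF h A] sets.top[of "F 0"] by (intro prog_rect[of _ 0]) auto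
  finally show "(\<lambda>x. h (snd x)) -` A \<inter> space prog \<in> sets prog" .
qed simp

text \<open>The generator is to be composed with progressive functions, whereas members of
  \<open>S2\<close> are adapted with almost surely continuous paths. The exceptional paths are set
  to 0, which keeps adaptedness, and the resulting process is a limit of step functions in
  time.\<close>

lemma prog_modification:
  assumes Y: "adapted T F Y" "continuous_process M T Y"
  obtains Y' where "pz Y' \<in> borel_measurable prog" "AE w in M. \<forall>t\<in>{0..T}. Y' t w = Y t w"
proof -
  obtain N where N: "N \<in> null_sets M" "{w \<in> space M. \<not> continuous_on {0..T} (\<lambda>t. Y t w)} \<subseteq> N"
    using Y(2) unfolding continuous_process_def by (auto elim!: AE_E intro: null_setsI)
  define Y' where "Y' t w = (if w \<in> N then 0 else Y t w)" for t w
  have ae: "AE w in M. \<forall>t\<in>{0..T}. Y' t w = Y t w"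
    using AE_not_in[OF N(1)] by eventually_elim (simp add: Y'_def)
  have YF: "Y' t \<in> borel_measurable (F t)" if t: "t \<in> {0..T}" for t
  proof (rule measurable_F_AE)
    show "Y t \<in> borel_measurable (F t)" using Y(1) t by (simp add: adapted_def)
    show "AE w in M. Y t w = Y' t w" using ae by eventually_elim (use t in simp)
  qed
  have cont: "continuous_on {0..T} (\<lambda>t. Y' t w)" if "w \<in> space M" for w
    using N(2) that by (cases "w \<in> N") (auto simp: Y'_def)
  \<comment> \<open>Times are rounded down, never up, so that the value used at time s is already
    known at time s.\<close>
  define d where "d n s = real (nat \<lfloor>real (Suc n) * s\<rfloor>) / real (Suc n)" for n and s :: real
  have d: "0 \<le> d n s" "d n s \<le> s" "s - 1 / real (Suc n) \<le> d n s" if "0 \<le> s" for n s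
  proof -
    have fl: "real (nat \<lfloor>real (Suc n) * s\<rfloor>) = of_int \<lfloor>real (Suc n) * s\<rfloor>" using that by simp
    have "of_int \<lfloor>real (Suc n) * s\<rfloor> \<le> real (Suc n) * s" "real (Suc n) * s - 1 \<le> of_int \<lfloor>real (Suc n) * s\<rfloor>" by linarith+
    then show "0 \<le> d n s" "d n s \<le> s"
      unfolding d_def fl using that by (simp_all add: field_simps del: of_nat_Suc)
    have "s - 1 / real (Suc n) = (real (Suc n) * s - 1) / real (Suc n)" by (simp add: diff_divide_distrib del: of_nat_Suc)
    also have "\<dots> \<le> of_int \<lfloor>real (Suc n) * s\<rfloor> / real (Suc n)" by (intro divide_right_mono) linarith+
    finally show "s - 1 / real (Suc n) \<le> d n s" unfolding d_def fl .
  qed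
  have meas: "(\<lambda>x. Y' (d n (snd x)) (fst x)) \<in> borel_measurable prog" for n
  proof (rule measurableI)
    fix A :: "real set" assume A: "A \<in> sets borel"
    let ?R = "\<lambda>k. if real k / real (Suc n) \<le> T then (Y' (real k / real (Suc n)) -` A \<inter> space M) \<times>
      {s \<in> {0..T}. nat \<lfloor>real (Suc n) * s\<rfloor> = k} else {}"
    have R: "?R k \<in> sets prog" for k
    proof (cases "real k / real (Suc n) \<le> T")
      case True
      have I: "{s \<in> {0..T}. nat \<lfloor>real (Suc n) * s\<rfloor> = k} \<in> sets borel" by measurable
      have "{s \<in> {0..T}. nat \<lfloor>real (Suc n) * s\<rfloor> = k} \<subseteq> {real k / real (Suc n)..T}"
        using d(2)[of _ n] by (auto simp: d_def)
      moreover have "Y' (real k / real (Suc n)) -` A \<inter> space M \<in> sets (F (real k / real (Suc n)))"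
        using measurable_sets[OF YF A, of "real k / real (Suc n)"] True by simp
      ultimately show ?thesis using True I by (simp only: if_True) (intro prog_rect, auto)
    qed simp
    have "(\<lambda>x. Y' (d n (snd x)) (fst x)) -` A \<inter> space prog = (\<Union>k. ?R k)"
    proof (intro equalityI subsetI)
      fix x assume x: "x \<in> (\<lambda>x. Y' (d n (snd x)) (fst x)) -` A \<inter> space prog"
      then have s: "0 \<le> snd x" "snd x \<le> T" by auto
      with d(2)[OF s(1), of n] have "real (nat \<lfloor>real (Suc n) * snd x\<rfloor>) / real (Suc n) \<le> T" unfolding d_def by linarith
      then have "x \<in> ?R (nat \<lfloor>real (Suc n) * snd x\<rfloor>)" using x by (auto simp: d_def mem_Times_iff)
      then show "x \<in> (\<Union>k. ?R k)" by blast
    next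
      fix x assume "x \<in> (\<Union>k. ?R k)"
      then show "x \<in> (\<lambda>x. Y' (d n (snd x)) (fst x)) -` A \<inter> space prog"
        by (auto simp: d_def split: if_splits)
    qed
    also have "\<dots> \<in> sets prog" by (rule sets.countable_UN) (rule image_subsetI, rule R)
    finally show "(\<lambda>x. Y' (d n (snd x)) (fst x)) -` A \<inter> space prog \<in> sets prog" .
  qed simp
  have "pz Y' \<in> borel_measurable prog"
  proof (rule borel_measurable_LIMSEQ_real[OF _ meas])
    fix x assume "x \<in> space prog"
    then have x: "fst x \<in> space M" "snd x \<in> {0..T}" by auto
    then have s: "0 \<le> snd x" by simp
    have "(\<lambda>n. d n (snd x)) \<longlonglongrightarrow> snd x"
    proof (rule tendsto_sandwich[of "\<lambda>n. snd x - 1 / real (Suc n)" _ _ "\<lambda>_. snd x"])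
      have "(\<lambda>n. snd x - 1 / real (Suc n)) \<longlonglongrightarrow> snd x - 0"
        by (intro tendsto_diff tendsto_const LIMSEQ_Suc[OF lim_1_over_n])
      then show "(\<lambda>n. snd x - 1 / real (Suc n)) \<longlonglongrightarrow> snd x" by simp
    qed (use d(2,3)[OF s] in \<open>auto intro!: always_eventually\<close>)
    then show "(\<lambda>n. Y' (d n (snd x)) (fst x)) \<longlonglongrightarrow> pz Y' x"
      using d[OF s] x by (intro continuous_on_tendsto_compose[OF cont[OF x(1)]]) (auto intro!: always_eventually intro: order_trans)
  qed
  with ae show thesis by (rule that[rotated])
qed

lemma path_integrable:
  fixes g :: "'a \<times> real \<Rightarrow> real"
  assumes "g \<in> borel_measurable \<mu>" "sqn \<mu> g < \<infinity>"
  shows "AE w in M. set_integrable lborel {0..T} (\<lambda>s. g (w, s))"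
  using PS.AE_integrable_fst'[OF PL.integrable_L2[OF assms]]
  by (simp add: integrable_restrict_space set_integrable_def)

lemma integral_adapted:
  fixes g :: "'a \<times> real \<Rightarrow> real"
  assumes g: "g \<in> borel_measurable prog" and t: "t \<in> {0..T}"
  shows "(\<lambda>w. LBINT s:{0..t}. g (w, s)) \<in> borel_measurable (F t)"
proof -
  let ?L = "restrict_space lborel {0..t}"
  have "finite_measure ?L"
    by (rule finite_measureI) (simp add: emeasure_restrict_space space_restrict_space emeasure_lborel_Icc_eq)
  then interpret Lt: finite_measure ?L .
  have "sets (F t \<Otimes>\<^sub>M restrict_space borel {0..t}) = sets (F t \<Otimes>\<^sub>M ?L)"
    by (intro sets_pair_measure_cong) (auto simp: sets_restrict_space)
  then have "g \<in> borel_measurable (F t \<Otimes>\<^sub>M ?L)"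
    using prog_restrict[OF g t] by (simp cong: measurable_cong_sets)
  then have "(\<lambda>w. \<integral>s. g (w, s) \<partial>?L) \<in> borel_measurable (F t)"
    by (intro Lt.borel_measurable_lebesgue_integral) simp
  then show ?thesis
    by (simp add: integral_restrict_space set_lebesgue_integral_def)
qed

lemma set_integral_split:
  fixes g :: "real \<Rightarrow> real"
  assumes g: "set_integrable lborel {a..c} g" and ab: "a \<le> b" "b \<le> c"
  shows "(LBINT s:{a..c}. g s) = (LBINT s:{a..b}. g s) + (LBINT s:{b..c}. g s)"
proof -
  have i: "set_integrable lborel {a..b} g" "set_integrable lborel {b..c} g"
    using ab by (auto intro!: set_integrable_subset[OF g])
  show ?thesis
    using Henstock_Kurzweil_Integration.integral_combine[OF ab, of g] set_borel_integral_eq_integral[OF g]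
      set_borel_integral_eq_integral[OF i(1)] set_borel_integral_eq_integral[OF i(2)] by simp
qed

lemma set_integral_continuous:
  fixes g :: "real \<Rightarrow> real"
  assumes g: "set_integrable lborel {0..T} g"
  shows "continuous_on {0..T} (\<lambda>t. LBINT s:{0..t}. g s)"
proof -
  have "continuous_on {0..T} (\<lambda>t. Henstock_Kurzweil_Integration.integral {0..t} g)"
    by (rule indefinite_integral_continuous_1[OF set_borel_integral_eq_integral(1)[OF g]])
  then show ?thesis
    by (rule continuous_on_eq) (intro set_borel_integral_eq_integral(2)[symmetric] set_integrable_subset[OF g]; auto)
qed

definition lin_sol :: "('a \<Rightarrow> real) \<Rightarrow> ('a \<times> real \<Rightarrow> real) \<Rightarrow> (real \<Rightarrow> 'a \<Rightarrow> real) \<Rightarrow> (real \<Rightarrow> 'a \<Rightarrow> real ^ 'd) \<Rightarrow> (real \<Rightarrow> 'a \<Rightarrow> real) \<Rightarrow> bool" where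
  "lin_sol \<xi> g X Z I \<longleftrightarrow> g \<in> borel_measurable prog \<and> sqn \<mu> g < \<infinity> \<and> pz Z \<in> borel_measurable pred \<and> sqn \<mu> (pz Z) < \<infinity> \<and>
     ito Z I \<and> adapted T F X \<and>
     (AE w in M. \<forall>t\<in>{0..T}. X t w = \<xi> w + (LBINT s:{t..T}. g (w, s)) - (I T w - I t w))"

lemma lin_solD:
  assumes "lin_sol \<xi> g X Z I"
  shows "g \<in> borel_measurable prog" "sqn \<mu> g < \<infinity>" "pz Z \<in> borel_measurable pred" "sqn \<mu> (pz Z) < \<infinity>"
    "ito Z I" "adapted T F X" "AE w in M. \<forall>t\<in>{0..T}. X t w = \<xi> w + (LBINT s:{t..T}. g (w, s)) - (I T w - I t w)"
  using assms unfolding lin_sol_def by auto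

lemma lin_sol_diff:
  assumes "lin_sol \<xi> g X Z I" "lin_sol \<xi>' g' X' Z' I'"
  shows "lin_sol (\<lambda>w. \<xi> w - \<xi>' w) (\<lambda>x. g x - g' x) (\<lambda>t w. X t w - X' t w) (\<lambda>t w. Z t w - Z' t w) (\<lambda>t w. I t w - I' t w)"
proof -
  note d = lin_solD[OF assms(1)] and d' = lin_solD[OF assms(2)]
  note gm = prog_mu[OF d(1)] prog_mu[OF d'(1)] and Zm = pred_mu[OF d(3)] pred_mu[OF d'(3)]
  have "AE w in M. \<forall>t\<in>{0..T}. X t w - X' t w = \<xi> w - \<xi>' w + (LBINT s:{t..T}. g (w, s) - g' (w, s)) -
      (I T w - I' T w - (I t w - I' t w))"
    using d(7) d'(7) path_integrable[OF gm(1) d(2)] path_integrable[OF gm(2) d'(2)]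
  proof eventually_elim
    case (elim w)
    show ?case
    proof
      fix t assume t: "t \<in> {0..T}"
      have "set_integrable lborel {t..T} (\<lambda>s. g (w, s))" "set_integrable lborel {t..T} (\<lambda>s. g' (w, s))"
        using t by (auto intro!: set_integrable_subset[OF elim(3)] set_integrable_subset[OF elim(4)])
      then show "X t w - X' t w = \<xi> w - \<xi>' w + (LBINT s:{t..T}. g (w, s) - g' (w, s)) - (I T w - I' T w - (I t w - I' t w))"
        using elim(1,2) t by (simp add: set_integral_diff(2))
    qed
  qed
  moreover have "adapted T F (\<lambda>t w. X t w - X' t w)"
    using d(6) d'(6) unfolding adapted_def by (auto intro!: borel_measurable_diff)
  ultimately show ?thesis
    unfolding lin_sol_def using d d' gm Zm ito_diff[OF Zm d(5) d'(5)]
      sqn_diff_finite[OF gm d(2) d'(2)] sqn_diff_finite[OF Zm d(4) d'(4)]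
    by (simp add: borel_measurable_diff)
qed

lemma lin_sol_continuous:
  assumes "lin_sol \<xi> g X Z I" shows "continuous_process M T X"
  unfolding continuous_process_def
  using lin_solD(7)[OF assms] path_integrable[OF prog_mu[OF lin_solD(1)[OF assms]] lin_solD(2)[OF assms]]
    lin_solD(5)[OF assms, unfolded ito_def continuous_process_def, THEN conjunct2, THEN conjunct1]
proof eventually_elim
  case (elim w)
  have "continuous_on {0..T} (\<lambda>t. \<xi> w + ((LBINT s:{0..T}. g (w, s)) - (LBINT s:{0..t}. g (w, s))) - (I T w - I t w))"
    using elim(3) set_integral_continuous[OF elim(2)] by (intro continuous_intros)
  then show ?case
    by (rule continuous_on_eq) (use elim(1) set_integral_split[OF elim(2)] in auto)
qed

text \<open>Represent \<xi> plus the integral of g over [0, T] as c + I_T and let X_t be c + I_t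
  minus the integral of g over [0, t].\<close>

theorem lin_sol_exists:
  fixes \<xi> :: "'a \<Rightarrow> real"
  assumes \<xi>: "\<xi> \<in> borel_measurable (F T)" "sqn M \<xi> < \<infinity>" and g: "g \<in> borel_measurable prog" "sqn \<mu> g < \<infinity>"
  obtains X Z I where "lin_sol \<xi> g X Z I"
proof -
  let ?G = "\<lambda>t w. LBINT s:{0..t}. g (w, s)"
  note gm = prog_mu[OF g(1)]
  have \<xi>M: "\<xi> \<in> borel_measurable M" by (rule measurable_F_M[OF \<xi>(1)]) simp
  have GF: "?G T \<in> borel_measurable (F T)" by (rule integral_adapted[OF g(1) T_mem])
  have GM: "?G T \<in> borel_measurable M" by (rule measurable_F_M[OF GF]) simp
  \<comment> \<open>Cauchy-Schwarz in time makes the integral of g square-integrable, as the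
    representation theorem requires.\<close>
  have "sqn M (?G T) \<le> ennreal T * sqn \<mu> g"
  proof -
    have "sqn M (?G T) \<le> (\<integral>\<^sup>+w. ennreal T * (\<integral>\<^sup>+s. ennreal ((norm (g (w, s)))\<^sup>2) \<partial>L) \<partial>M)"
      unfolding sqn_def
    proof (intro nn_integral_mono_AE)
      show "AE w in M. ennreal ((norm (?G T w))\<^sup>2) \<le> ennreal T * (\<integral>\<^sup>+s. ennreal ((norm (g (w, s)))\<^sup>2) \<partial>L)"
        using path_integrable[OF gm g(2)]
      proof eventually_elim
        case (elim w)
        have gi: "integrable L (\<lambda>s. g (w, s))" using elim by (simp add: integrable_restrict_space set_integrable_def)
        have "ennreal (norm (?G T w)) = ennreal (norm (\<integral>s. g (w, s) \<partial>L))"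
          by (simp add: integral_restrict_space set_lebesgue_integral_def)
        also have "\<dots> \<le> (\<integral>\<^sup>+s. 1 * ennreal (norm (g (w, s))) \<partial>L)"
          using integral_norm_bound_ennreal[OF gi] by simp
        finally have "(ennreal (norm (?G T w)))\<^sup>2 \<le> (\<integral>\<^sup>+s. 1 * ennreal (norm (g (w, s))) \<partial>L)\<^sup>2" by (intro power_mono) auto
        also have "\<dots> \<le> (\<integral>\<^sup>+s. 1\<^sup>2 \<partial>L) * (\<integral>\<^sup>+s. (ennreal (norm (g (w, s))))\<^sup>2 \<partial>L)"
          using gi by (intro Cauchy_Schwarz_nn_integral) auto
        also have "(\<integral>\<^sup>+s. 1\<^sup>2 \<partial>L) = ennreal T"
          using horizon_pos by (simp add: emeasure_restrict_space emeasure_lborel_Icc_eq)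
        finally show ?case by (simp add: ennreal_power)
      qed
    qed
    also have "\<dots> = ennreal T * sqn \<mu> g"
    proof -
      have m: "(\<lambda>x. ennreal ((norm (g x))\<^sup>2)) \<in> borel_measurable \<mu>" using gm by measurable
      show ?thesis
        unfolding sqn_def L.nn_integral_fst[OF m, symmetric]
        by (rule nn_integral_cmult) (use L.borel_measurable_nn_integral_fst[OF m] in simp)
    qed
    finally show ?thesis .
  qed
  then have Gf: "sqn M (?G T) < \<infinity>" by (rule le_less_trans) (use g(2) in \<open>simp add: ennreal_mult_less_top\<close>)
  obtain c Z I where Z: "pz Z \<in> borel_measurable pred" "sqn \<mu> (pz Z) < \<infinity>" "ito Z I"
    "AE w in M. \<xi> w + ?G T w = c + I T w"
    by (rule martingale_representation[OF borel_measurable_add[OF \<xi>(1) GF] sqn_add_finite[OF \<xi>M GM \<xi>(2) Gf]])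
  define X where "X t w = c + I t w - ?G t w" for t w
  have "adapted T F X"
    using Z(3) integral_adapted[OF g(1)] unfolding X_def adapted_def ito_def
    by (auto intro!: borel_measurable_diff borel_measurable_add)
  moreover have "AE w in M. \<forall>t\<in>{0..T}. X t w = \<xi> w + (LBINT s:{t..T}. g (w, s)) - (I T w - I t w)"
    using Z(4) path_integrable[OF gm g(2)]
  proof eventually_elim
    case (elim w)
    show ?case
    proof
      fix t assume "t \<in> {0..T}"
      then have "?G T w = ?G t w + (LBINT s:{t..T}. g (w, s))" using set_integral_split[OF elim(2), of t] by simp
      with elim(1) show "X t w = \<xi> w + (LBINT s:{t..T}. g (w, s)) - (I T w - I t w)" by (simp add: X_def)
    qed
  qed
  ultimately have "lin_sol \<xi> g X Z I" unfolding lin_sol_def using Z g by blast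
  then show thesis by (rule that)
qed

end

lemma ennreal_mult_assoc: "0 \<le> a \<Longrightarrow> 0 \<le> b \<Longrightarrow> ennreal a * (ennreal b * W) = ennreal (a * b) * W"
  by (simp add: ennreal_mult mult.assoc)

context brownian_motion
begin

section \<open>Weighted estimates for the linear equation\<close>

lemma id_L: "(\<lambda>t. t) \<in> borel_measurable L"
  by (rule measurable_restrict_space1) simp

lemma snd_mu [measurable]: "snd \<in> borel_measurable \<mu>"
  by (rule measurable_compose[OF measurable_snd id_L])

text \<open>The squared norm on the product space with weight exp(\<gamma> t); the 1/2 in the
  exponent is undone by the squaring. For \<gamma> \<ge> 0 it is equivalent to \<open>sqn\<close>,
  by \<open>wn_ge\<close> and \<open>wn_le\<close>.\<close>

definition wn :: "real \<Rightarrow> ('a \<times> real \<Rightarrow> 'b::real_normed_vector) \<Rightarrow> ennreal" where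
  "wn \<gamma> g = sqn \<mu> (\<lambda>x. exp (\<gamma> / 2 * snd x) *\<^sub>R g x)"

lemma wn_eq: "wn \<gamma> g = (\<integral>\<^sup>+x. ennreal (exp (\<gamma> * snd x)) * ennreal ((norm (g x))\<^sup>2) \<partial>\<mu>)"
proof -
  have "(exp (\<gamma> / 2 * s))\<^sup>2 = exp (\<gamma> * s)" for s by (simp add: power2_eq_square flip: exp_add)
  then show ?thesis unfolding wn_def sqn_def by (simp add: power_mult_distrib ennreal_mult)
qed

lemma wn_mono_AE: "AE x in \<mu>. norm (f x) \<le> norm (g x) \<Longrightarrow> wn \<gamma> f \<le> wn \<gamma> g"
  unfolding wn_def by (rule sqn_mono_AE) (auto elim!: eventually_mono intro: mult_left_mono)

lemma wn_ge: assumes "0 \<le> \<gamma>" shows "sqn \<mu> g \<le> wn \<gamma> g"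
  unfolding wn_def
proof (intro sqn_mono_AE AE_I2)
  fix x assume "x \<in> space \<mu>"
  then have "1 \<le> exp (\<gamma> / 2 * snd x)" using assms by auto
  then have "1 * norm (g x) \<le> exp (\<gamma> / 2 * snd x) * norm (g x)" by (rule mult_right_mono) simp
  then show "norm (g x) \<le> norm (exp (\<gamma> / 2 * snd x) *\<^sub>R g x)" by simp
qed

lemma wn_le:
  fixes g :: "'a \<times> real \<Rightarrow> 'b::{second_countable_topology, real_normed_vector}"
  assumes "0 \<le> \<gamma>" and [measurable]: "g \<in> borel_measurable \<mu>"
  shows "wn \<gamma> g \<le> ennreal (exp (\<gamma> * T)) * sqn \<mu> g"
proof -
  have "wn \<gamma> g \<le> (\<integral>\<^sup>+x. ennreal (exp (\<gamma> * T)) * ennreal ((norm (g x))\<^sup>2) \<partial>\<mu>)"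
    unfolding wn_eq using assms(1)
    by (intro nn_integral_mono mult_right_mono ennreal_leI) (auto simp: space_pair_measure intro!: mult_left_mono)
  also have "\<dots> = ennreal (exp (\<gamma> * T)) * sqn \<mu> g"
    unfolding sqn_def by (rule nn_integral_cmult) measurable
  finally show ?thesis .
qed

lemma wn_finite:
  fixes g :: "'a \<times> real \<Rightarrow> 'b::{second_countable_topology, real_normed_vector}"
  assumes "0 \<le> \<gamma>" "g \<in> borel_measurable \<mu>" "sqn \<mu> g < \<infinity>"
  shows "wn \<gamma> g < \<infinity>"
  using wn_le[OF assms(1,2)] by (rule le_less_trans) (use assms(3) in \<open>simp add: ennreal_mult_less_top\<close>)

lemma wn_iterated:
  fixes g :: "'a \<times> real \<Rightarrow> 'b::{second_countable_topology, real_normed_vector}"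
  assumes [measurable]: "g \<in> borel_measurable \<mu>"
  shows "wn \<gamma> g = (\<integral>\<^sup>+s. ennreal (exp (\<gamma> * s)) * sqn M (\<lambda>w. g (w, s)) \<partial>L)"
proof -
  have "wn \<gamma> g = (\<integral>\<^sup>+s. (\<integral>\<^sup>+w. ennreal (exp (\<gamma> * s)) * ennreal ((norm (g (w, s)))\<^sup>2) \<partial>M) \<partial>L)"
    unfolding wn_eq by (subst PS.nn_integral_snd[symmetric]) auto
  also have "\<dots> = (\<integral>\<^sup>+s. ennreal (exp (\<gamma> * s)) * sqn M (\<lambda>w. g (w, s)) \<partial>L)"
    unfolding sqn_def by (intro nn_integral_cong nn_integral_cmult) measurable
  finally show ?thesis .
qed

lemma nn_integral_exp:
  assumes "\<gamma> \<noteq> 0" "a \<le> b"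
  shows "(\<integral>\<^sup>+t. ennreal (exp (\<gamma> * t)) * indicator {a..b} t \<partial>lborel) = ennreal (exp (\<gamma> * b) / \<gamma> - exp (\<gamma> * a) / \<gamma>)"
  using assms by (intro nn_integral_FTC_Icc) (auto intro!: derivative_eq_intros)

text \<open>Write 1 as exp(-\<gamma> s / 2) exp(\<gamma> s / 2) before applying Cauchy-Schwarz. The
  integral of exp(-\<gamma> s) from t on is at most exp(-\<gamma> t) / \<gamma>, and this is where
  the small factor of the contraction originates.\<close>

lemma path_Cauchy_Schwarz:
  fixes g :: "real \<Rightarrow> real"
  assumes g: "set_integrable lborel {0..T} g" and t: "t \<in> {0..T}" and \<gamma>: "0 < \<gamma>"
  shows "ennreal ((LBINT s:{t..T}. g s)\<^sup>2)
    \<le> ennreal (exp (- \<gamma> * t) / \<gamma>) * (\<integral>\<^sup>+s. ennreal (exp (\<gamma> * s)) * ennreal ((norm (if t \<le> s then g s else 0))\<^sup>2) \<partial>L)"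
proof -
  note id_L [measurable]
  let ?h = "\<lambda>s. if t \<le> s then g s else 0"
  have gL: "integrable L g" using g by (simp add: integrable_restrict_space set_integrable_def)
  then have [measurable]: "g \<in> borel_measurable L" by simp
  have hi: "integrable L ?h" by (rule Bochner_Integration.integrable_bound[OF gL]) auto
  have "(LBINT s:{t..T}. g s) = (\<integral>s. ?h s \<partial>L)"
    using t by (subst integral_restrict_space)
      (auto simp: set_lebesgue_integral_def indicator_def intro!: Bochner_Integration.integral_cong)
  then have "ennreal \<bar>LBINT s:{t..T}. g s\<bar> \<le> (\<integral>\<^sup>+s. ennreal (norm (?h s)) \<partial>L)"
    using integral_norm_bound_ennreal[OF hi] by simp
  also have "\<dots> = (\<integral>\<^sup>+s. ennreal (if t \<le> s then exp (- \<gamma> / 2 * s) else 0) * ennreal (exp (\<gamma> / 2 * s) * norm (?h s)) \<partial>L)"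
    by (intro nn_integral_cong) (auto simp: ennreal_mult[symmetric] mult.assoc[symmetric] exp_add[symmetric])
  finally have "(ennreal \<bar>LBINT s:{t..T}. g s\<bar>)\<^sup>2
    \<le> (\<integral>\<^sup>+s. ennreal (if t \<le> s then exp (- \<gamma> / 2 * s) else 0) * ennreal (exp (\<gamma> / 2 * s) * norm (?h s)) \<partial>L)\<^sup>2"
    by (intro power_mono) auto
  also have "\<dots> \<le> (\<integral>\<^sup>+s. (ennreal (if t \<le> s then exp (- \<gamma> / 2 * s) else 0))\<^sup>2 \<partial>L) * (\<integral>\<^sup>+s. (ennreal (exp (\<gamma> / 2 * s) * norm (?h s)))\<^sup>2 \<partial>L)"
    by (rule Cauchy_Schwarz_nn_integral) measurable
  also have "(\<integral>\<^sup>+s. (ennreal (exp (\<gamma> / 2 * s) * norm (?h s)))\<^sup>2 \<partial>L)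
      = (\<integral>\<^sup>+s. ennreal (exp (\<gamma> * s)) * ennreal ((norm (?h s))\<^sup>2) \<partial>L)"
  proof (intro nn_integral_cong)
    fix s
    have "(exp (\<gamma> / 2 * s))\<^sup>2 = exp (\<gamma> * s)" by (simp add: power2_eq_square flip: exp_add)
    then show "(ennreal (exp (\<gamma> / 2 * s) * norm (?h s)))\<^sup>2 = ennreal (exp (\<gamma> * s)) * ennreal ((norm (?h s))\<^sup>2)"
      by (simp add: ennreal_power power_mult_distrib ennreal_mult)
  qed
  also have "(\<integral>\<^sup>+s. (ennreal (if t \<le> s then exp (- \<gamma> / 2 * s) else 0))\<^sup>2 \<partial>L)
      = (\<integral>\<^sup>+s. ennreal (exp (- \<gamma> * s)) * indicator {t..T} s \<partial>lborel)"
  proof (subst nn_integral_restrict_space)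
    show "(\<integral>\<^sup>+s\<in>{0..T}. (ennreal (if t \<le> s then exp (- \<gamma> / 2 * s) else 0))\<^sup>2 \<partial>lborel)
      = (\<integral>\<^sup>+s. ennreal (exp (- \<gamma> * s)) * indicator {t..T} s \<partial>lborel)"
    proof (intro nn_integral_cong)
      fix s
      have "(exp (- \<gamma> / 2 * s))\<^sup>2 = exp (- \<gamma> * s)" by (simp add: power2_eq_square flip: exp_add)
      then show "(ennreal (if t \<le> s then exp (- \<gamma> / 2 * s) else 0))\<^sup>2 * indicator {0..T} s = ennreal (exp (- \<gamma> * s)) * indicator {t..T} s"
        using t by (auto simp: ennreal_power indicator_def simp del: exp_le_cancel_iff)
    qed
  qed simp
  also have "\<dots> = ennreal (exp (- \<gamma> * T) / - \<gamma> - exp (- \<gamma> * t) / - \<gamma>)"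
    using \<gamma> t by (intro nn_integral_exp) auto
  also have "\<dots> \<le> ennreal (exp (- \<gamma> * t) / \<gamma>)" using \<gamma> by (intro ennreal_leI) simp
  finally show ?thesis by (simp add: ennreal_power mult_right_mono)
qed

text \<open>With zero terminal value, X_t plus I_T - I_t is the integral of g over [t, T]. The two
  summands are orthogonal, as X_t belongs to the past, so their squared norms add up, and the
  isometry evaluates the second.\<close>

lemma lin_sol_energy:
  assumes S: "lin_sol (\<lambda>_. 0) g X Z I" and t: "t \<in> {0..T}" and \<gamma>: "0 < \<gamma>"
  shows "sqn M (X t) + sqn \<mu> (\<lambda>x. if t < snd x then pz Z x else 0)
    \<le> ennreal (exp (- \<gamma> * t) / \<gamma>) * wn \<gamma> (\<lambda>x. if t \<le> snd x then g x else 0)"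
proof -
  note d = lin_solD[OF S]
  note gm [measurable] = prog_mu[OF d(1)] and Zm [measurable] = pred_mu[OF d(3)]
  note ip = ito_properties[OF Zm d(4,5)]
  let ?N = "\<lambda>w. I T w - I t w" and ?\<Gamma> = "\<lambda>w. LBINT s:{t..T}. g (w, s)"
  have tT: "0 \<le> t" "t \<le> T" using t by auto
  have It: "I t \<in> borel_measurable M" "sqn M (I t) < \<infinity>" and IT: "I T \<in> borel_measurable M" "sqn M (I T) < \<infinity>"
    using l2_martingaleD(2,3)[OF ip(1)] t T_mem by auto
  have N: "?N \<in> borel_measurable M" "sqn M ?N < \<infinity>"
    using It(1) IT(1) sqn_diff_finite[OF IT(1) It(1) IT(2) It(2)] by (auto intro: borel_measurable_diff)
  have XF: "X t \<in> borel_measurable (F t)" using d(6) t by (simp add: adapted_def)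
  have XM: "X t \<in> borel_measurable M" by (rule measurable_F_M[OF XF tT(2)])
  have eq: "AE w in M. X t w + ?N w = ?\<Gamma> w" using d(7) by eventually_elim (use t in simp)
  have \<Gamma>bound: "sqn M (\<lambda>w. X t w + ?N w) \<le> ennreal (exp (- \<gamma> * t) / \<gamma>) * wn \<gamma> (\<lambda>x. if t \<le> snd x then g x else 0)"
  proof -
    let ?W = "\<lambda>x. ennreal (exp (\<gamma> * snd x)) * ennreal ((norm (if t \<le> snd x then g x else 0))\<^sup>2)"
    have wm: "?W \<in> borel_measurable \<mu>" by measurable
    have "sqn M (\<lambda>w. X t w + ?N w) = sqn M ?\<Gamma>" by (rule sqn_cong_AE[OF eq])
    also have "\<dots> \<le> (\<integral>\<^sup>+w. ennreal (exp (- \<gamma> * t) / \<gamma>) * (\<integral>\<^sup>+s. ?W (w, s) \<partial>L) \<partial>M)"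
      unfolding sqn_def
    proof (intro nn_integral_mono_AE)
      show "AE w in M. ennreal ((norm (?\<Gamma> w))\<^sup>2) \<le> ennreal (exp (- \<gamma> * t) / \<gamma>) * (\<integral>\<^sup>+s. ?W (w, s) \<partial>L)"
        using path_integrable[OF gm d(2)] by eventually_elim (use path_Cauchy_Schwarz[OF _ t \<gamma>] in simp)
    qed
    also have "\<dots> = ennreal (exp (- \<gamma> * t) / \<gamma>) * (\<integral>\<^sup>+w. (\<integral>\<^sup>+s. ?W (w, s) \<partial>L) \<partial>M)"
      by (rule nn_integral_cmult) (rule L.borel_measurable_nn_integral_fst[OF wm])
    also have "(\<integral>\<^sup>+w. (\<integral>\<^sup>+s. ?W (w, s) \<partial>L) \<partial>M) = wn \<gamma> (\<lambda>x. if t \<le> snd x then g x else 0)"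
      unfolding wn_eq by (rule L.nn_integral_fst[OF wm])
    finally show ?thesis .
  qed
  have wf: "wn \<gamma> (\<lambda>x. if t \<le> snd x then g x else 0) < \<infinity>"
  proof -
    have "wn \<gamma> (\<lambda>x. if t \<le> snd x then g x else 0) \<le> wn \<gamma> g" by (intro wn_mono_AE AE_I2) simp
    also have "\<dots> < \<infinity>" using \<gamma> by (intro wn_finite gm d(2)) simp
    finally show ?thesis .
  qed
  have Sf: "sqn M (\<lambda>w. X t w + ?N w) < \<infinity>"
    using \<Gamma>bound by (rule le_less_trans) (use wf in \<open>simp add: ennreal_mult_less_top\<close>)
  have Xf: "sqn M (X t) < \<infinity>"
    using sqn_diff_finite[OF borel_measurable_add[OF XM N(1)] N(1) Sf N(2)] by simp
  have orth: "expectation (\<lambda>w. X t w * ?N w) = 0"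
    by (rule l2_martingale_orth[OF ip(1) tT order_refl XF Xf])
  have i: "integrable M (\<lambda>w. (X t w)\<^sup>2)" "integrable M (\<lambda>w. (?N w)\<^sup>2)" "integrable M (\<lambda>w. X t w * ?N w)" "integrable M (\<lambda>w. (X t w + ?N w)\<^sup>2)"
    using sqn_integrable_iff[OF XM] sqn_integrable_iff[OF N(1)] sqn_integrable_iff[OF borel_measurable_add[OF XM N(1)]]
      integrable_mult_L2[OF XM N(1) Xf N(2)] Xf N(2) Sf by auto
  have "expectation (\<lambda>w. (X t w + ?N w)\<^sup>2) = expectation (\<lambda>w. (X t w)\<^sup>2 + (?N w)\<^sup>2 + 2 * (X t w * ?N w))"
    by (rule Bochner_Integration.integral_cong) (auto simp: power2_sum)
  also have "\<dots> = expectation (\<lambda>w. (X t w)\<^sup>2) + expectation (\<lambda>w. (?N w)\<^sup>2)"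
    using i orth by simp
  finally have "sqn M (\<lambda>w. X t w + ?N w) = sqn M (X t) + sqn M ?N"
    using i by (simp add: sqn_eq_integral ennreal_plus)
  moreover have "sqn M ?N = sqn \<mu> (\<lambda>x. if t < snd x then pz Z x else 0)"
  proof -
    have "sqn M (I t) + sqn M ?N = sqn M (I T)" by (rule l2_martingale_pythagoras[OF ip(1) tT order_refl, symmetric])
    also have "\<dots> = sqn \<mu> (pz Z)"
      unfolding ip(2)[OF T_mem] by (intro sqn_cong_AE AE_I2) (auto simp: space_pair_measure)
    also have "\<dots> = (\<integral>\<^sup>+x. ennreal ((norm (if snd x \<le> t then pz Z x else 0))\<^sup>2) + ennreal ((norm (if t < snd x then pz Z x else 0))\<^sup>2) \<partial>\<mu>)"
      unfolding sqn_def by (intro nn_integral_cong) auto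
    also have "\<dots> = sqn \<mu> (\<lambda>x. if snd x \<le> t then pz Z x else 0) + sqn \<mu> (\<lambda>x. if t < snd x then pz Z x else 0)"
      unfolding sqn_def by (rule nn_integral_add) measurable
    finally show ?thesis using It(2) by (auto simp: ip(2)[OF t] ennreal_add_left_cancel)
  qed
  ultimately show ?thesis using \<Gamma>bound by simp
qed

lemma lin_sol_estimate_X:
  assumes S: "lin_sol (\<lambda>_. 0) g X Z I" and t: "t \<in> {0..T}" and \<beta>: "0 < \<beta>"
  shows "ennreal (exp (\<beta> * t)) * sqn M (X t) \<le> ennreal (1 / \<beta>) * wn \<beta> g"
proof -
  have "ennreal (exp (\<beta> * t)) * sqn M (X t) \<le> ennreal (exp (\<beta> * t)) * (ennreal (exp (- \<beta> * t) / \<beta>) * wn \<beta> g)"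
  proof (intro mult_left_mono)
    have "sqn M (X t) \<le> sqn M (X t) + sqn \<mu> (\<lambda>x. if t < snd x then pz Z x else 0)" by simp
    also have "\<dots> \<le> ennreal (exp (- \<beta> * t) / \<beta>) * wn \<beta> (\<lambda>x. if t \<le> snd x then g x else 0)"
      by (rule lin_sol_energy[OF S t \<beta>])
    also have "\<dots> \<le> ennreal (exp (- \<beta> * t) / \<beta>) * wn \<beta> g"
      by (intro mult_left_mono wn_mono_AE AE_I2) auto
    finally show "sqn M (X t) \<le> ennreal (exp (- \<beta> * t) / \<beta>) * wn \<beta> g" .
  qed simp
  also have "\<dots> = ennreal (exp (\<beta> * t) * (exp (- \<beta> * t) / \<beta>)) * wn \<beta> g"
    using \<beta> by (intro ennreal_mult_assoc) auto
  also have "exp (\<beta> * t) * (exp (- \<beta> * t) / \<beta>) = 1 / \<beta>" by (simp flip: exp_add)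
  finally show ?thesis .
qed

text \<open>
  Write \<open>exp (\<beta> s) = 1 + \<integral>\<^sub>0\<^sup>s \<beta> exp (\<beta> t) dt\<close> and apply the energy estimate at time \<open>t\<close> with the smaller
  weight \<open>\<beta> / 2\<close>; this produces the factor \<open>1 / \<beta>\<close>.
\<close>

lemma lin_sol_estimate_Z:
  assumes S: "lin_sol (\<lambda>_. 0) g X Z I" and \<beta>: "0 < \<beta>"
  shows "wn \<beta> (pz Z) \<le> ennreal (5 / \<beta>) * wn \<beta> g"
proof -
  note id_L [measurable]
  note d = lin_solD[OF S]
  note gm [measurable] = prog_mu[OF d(1)] and Zm [measurable] = pred_mu[OF d(3)]
  define \<gamma> where "\<gamma> = \<beta> / 2"
  have \<gamma>: "0 < \<gamma>" "\<beta> = 2 * \<gamma>" using \<beta> by (auto simp: \<gamma>_def)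
  interpret QS: pair_sigma_finite \<mu> L by unfold_locales
  have expi: "ennreal (exp (\<beta> * s)) = 1 + (\<integral>\<^sup>+t. (if t < s then ennreal (\<beta> * exp (\<beta> * t)) else 0) \<partial>L)" if s: "s \<in> {0..T}" for s
  proof -
    have "(\<integral>\<^sup>+t. (if t < s then ennreal (\<beta> * exp (\<beta> * t)) else 0) \<partial>L)
        = (\<integral>\<^sup>+t. (if t < s then ennreal (\<beta> * exp (\<beta> * t)) else 0) * indicator {0..T} t \<partial>lborel)"
      by (rule nn_integral_restrict_space) simp
    also have "\<dots> = (\<integral>\<^sup>+t. ennreal (\<beta> * exp (\<beta> * t)) * indicator {0..s} t \<partial>lborel)"
    proof (intro nn_integral_cong_AE)
      show "AE t in lborel. (if t < s then ennreal (\<beta> * exp (\<beta> * t)) else 0) * indicator {0..T} t = ennreal (\<beta> * exp (\<beta> * t)) * indicator {0..s} t"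
        using AE_lborel_singleton[of s] by eventually_elim (use s in \<open>auto simp: indicator_def\<close>)
    qed
    also have "\<dots> = ennreal (exp (\<beta> * s) - exp (\<beta> * 0))"
      using s \<beta> by (intro nn_integral_FTC_Icc) (auto intro!: derivative_eq_intros)
    finally show ?thesis using s \<beta> ennreal_plus[of 1 "exp (\<beta> * s) - 1"] by simp
  qed
  \<comment> \<open>Exact integration gives at most (2 / \<gamma>) exp(\<gamma> s), and 2 / \<gamma>
    = 4 / \<beta>.\<close>
  have expg: "(\<integral>\<^sup>+t. (if t \<le> s then ennreal (2 * exp (\<gamma> * t)) else 0) \<partial>L) \<le> ennreal (4 / \<beta> * exp (\<gamma> * s))" if s: "s \<in> {0..T}" for s
  proof -
    have "(\<integral>\<^sup>+t. (if t \<le> s then ennreal (2 * exp (\<gamma> * t)) else 0) \<partial>L)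
        = (\<integral>\<^sup>+t. (if t \<le> s then ennreal (2 * exp (\<gamma> * t)) else 0) * indicator {0..T} t \<partial>lborel)"
      by (rule nn_integral_restrict_space) simp
    also have "\<dots> = (\<integral>\<^sup>+t. ennreal (2 * exp (\<gamma> * t)) * indicator {0..s} t \<partial>lborel)"
      using s by (intro nn_integral_cong) (auto simp: indicator_def)
    also have "\<dots> = ennreal (2 / \<gamma> * exp (\<gamma> * s) - 2 / \<gamma> * exp (\<gamma> * 0))"
      using s \<gamma> by (intro nn_integral_FTC_Icc) (auto intro!: derivative_eq_intros)
    also have "\<dots> \<le> ennreal (4 / \<beta> * exp (\<gamma> * s))" using \<gamma> by (intro ennreal_leI) simp
    finally show ?thesis .
  qed
  have "wn \<beta> (pz Z) = (\<integral>\<^sup>+x. ennreal ((norm (pz Z x))\<^sup>2) + (\<integral>\<^sup>+t. (if t < snd x then ennreal (\<beta> * exp (\<beta> * t)) * ennreal ((norm (pz Z x))\<^sup>2) else 0) \<partial>L) \<partial>\<mu>)"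
    unfolding wn_eq
  proof (intro nn_integral_cong)
    fix x assume "x \<in> space \<mu>"
    then have s: "snd x \<in> {0..T}" by auto
    have "(\<integral>\<^sup>+t. (if t < snd x then ennreal (\<beta> * exp (\<beta> * t)) * ennreal ((norm (pz Z x))\<^sup>2) else 0) \<partial>L)
      = (\<integral>\<^sup>+t. (if t < snd x then ennreal (\<beta> * exp (\<beta> * t)) else 0) \<partial>L) * ennreal ((norm (pz Z x))\<^sup>2)"
      by (subst nn_integral_multc[symmetric]) (auto intro!: nn_integral_cong)
    then show "ennreal (exp (\<beta> * snd x)) * ennreal ((norm (pz Z x))\<^sup>2)
      = ennreal ((norm (pz Z x))\<^sup>2) + (\<integral>\<^sup>+t. (if t < snd x then ennreal (\<beta> * exp (\<beta> * t)) * ennreal ((norm (pz Z x))\<^sup>2) else 0) \<partial>L)"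
      by (simp add: expi[OF s] distrib_right)
  qed
  also have "\<dots> = sqn \<mu> (pz Z) + (\<integral>\<^sup>+x. (\<integral>\<^sup>+t. (if t < snd x then ennreal (\<beta> * exp (\<beta> * t)) * ennreal ((norm (pz Z x))\<^sup>2) else 0) \<partial>L) \<partial>\<mu>)"
    unfolding sqn_def by (rule nn_integral_add) measurable
  finally have le: "wn \<beta> (pz Z) = sqn \<mu> (pz Z) + (\<integral>\<^sup>+x. (\<integral>\<^sup>+t. (if t < snd x then ennreal (\<beta> * exp (\<beta> * t)) * ennreal ((norm (pz Z x))\<^sup>2) else 0) \<partial>L) \<partial>\<mu>)" .
  have "(\<integral>\<^sup>+x. (\<integral>\<^sup>+t. (if t < snd x then ennreal (\<beta> * exp (\<beta> * t)) * ennreal ((norm (pz Z x))\<^sup>2) else 0) \<partial>L) \<partial>\<mu>)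
      = (\<integral>\<^sup>+t. (\<integral>\<^sup>+x. (if t < snd x then ennreal (\<beta> * exp (\<beta> * t)) * ennreal ((norm (pz Z x))\<^sup>2) else 0) \<partial>\<mu>) \<partial>L)"
    by (rule QS.Fubini'[symmetric]) measurable
  also have "\<dots> \<le> (\<integral>\<^sup>+t. (\<integral>\<^sup>+x. (if t \<le> snd x then ennreal (2 * exp (\<gamma> * t)) * (ennreal (exp (\<gamma> * snd x)) * ennreal ((norm (g x))\<^sup>2)) else 0) \<partial>\<mu>) \<partial>L)"
  proof (rule nn_integral_mono)
    fix t assume "t \<in> space L"
    then have t: "t \<in> {0..T}" by simp
    have "(\<integral>\<^sup>+x. (if t < snd x then ennreal (\<beta> * exp (\<beta> * t)) * ennreal ((norm (pz Z x))\<^sup>2) else 0) \<partial>\<mu>)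
        = ennreal (\<beta> * exp (\<beta> * t)) * sqn \<mu> (\<lambda>x. if t < snd x then pz Z x else 0)"
      unfolding sqn_def by (subst nn_integral_cmult[symmetric]) (auto intro!: nn_integral_cong)
    also have "\<dots> \<le> ennreal (\<beta> * exp (\<beta> * t)) * (ennreal (exp (- \<gamma> * t) / \<gamma>) * wn \<gamma> (\<lambda>x. if t \<le> snd x then g x else 0))"
    proof (intro mult_left_mono)
      show "sqn \<mu> (\<lambda>x. if t < snd x then pz Z x else 0) \<le> ennreal (exp (- \<gamma> * t) / \<gamma>) * wn \<gamma> (\<lambda>x. if t \<le> snd x then g x else 0)"
        by (rule order_trans[OF _ lin_sol_energy[OF S t \<gamma>(1)]]) simp
    qed simp
    \<comment> \<open>Here \<beta> / \<gamma> = 2 and exp(\<beta> t) exp(-\<gamma> t) = exp(\<gamma>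
      t): half of the weight is spent on the energy estimate, the other half is left for the
      integration in t.\<close>
    also have "\<dots> = ennreal (2 * exp (\<gamma> * t)) * wn \<gamma> (\<lambda>x. if t \<le> snd x then g x else 0)"
    proof -
      have "\<beta> * exp (\<beta> * t) * (exp (- \<gamma> * t) / \<gamma>) = 2 * exp (\<gamma> * t)" using \<gamma> by (simp flip: exp_add)
      then show ?thesis using \<gamma> \<beta> by (subst ennreal_mult_assoc) auto
    qed
    also have "\<dots>
      = (\<integral>\<^sup>+x. (if t \<le> snd x then ennreal (2 * exp (\<gamma> * t)) * (ennreal (exp (\<gamma> * snd x)) * ennreal ((norm (g x))\<^sup>2)) else 0) \<partial>\<mu>)"
      unfolding wn_eq by (subst nn_integral_cmult[symmetric]) (auto intro!: nn_integral_cong)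
    finally show "(\<integral>\<^sup>+x. (if t < snd x then ennreal (\<beta> * exp (\<beta> * t)) * ennreal ((norm (pz Z x))\<^sup>2) else 0) \<partial>\<mu>)
      \<le> (\<integral>\<^sup>+x. (if t \<le> snd x then ennreal (2 * exp (\<gamma> * t)) * (ennreal (exp (\<gamma> * snd x)) * ennreal ((norm (g x))\<^sup>2)) else 0) \<partial>\<mu>)" .
  qed
  also have "\<dots> = (\<integral>\<^sup>+x. (\<integral>\<^sup>+t. (if t \<le> snd x then ennreal (2 * exp (\<gamma> * t)) * (ennreal (exp (\<gamma> * snd x)) * ennreal ((norm (g x))\<^sup>2)) else 0) \<partial>L) \<partial>\<mu>)"
    by (rule QS.Fubini') measurable
  also have "\<dots> \<le> (\<integral>\<^sup>+x. ennreal (4 / \<beta>) * (ennreal (exp (\<beta> * snd x)) * ennreal ((norm (g x))\<^sup>2)) \<partial>\<mu>)"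
  proof (intro nn_integral_mono)
    fix x assume "x \<in> space \<mu>"
    then have s: "snd x \<in> {0..T}" by auto
    have "(\<integral>\<^sup>+t. (if t \<le> snd x then ennreal (2 * exp (\<gamma> * t)) * (ennreal (exp (\<gamma> * snd x)) * ennreal ((norm (g x))\<^sup>2)) else 0) \<partial>L)
      = (\<integral>\<^sup>+t. (if t \<le> snd x then ennreal (2 * exp (\<gamma> * t)) else 0) \<partial>L) * (ennreal (exp (\<gamma> * snd x)) * ennreal ((norm (g x))\<^sup>2))"
      by (subst nn_integral_multc[symmetric]) (auto intro!: nn_integral_cong)
    also have "\<dots> \<le> ennreal (4 / \<beta> * exp (\<gamma> * snd x)) * (ennreal (exp (\<gamma> * snd x)) * ennreal ((norm (g x))\<^sup>2))"
      by (intro mult_right_mono expg[OF s]) simp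
    also have "\<dots> = ennreal (4 / \<beta>) * (ennreal (exp (\<beta> * snd x)) * ennreal ((norm (g x))\<^sup>2))"
    proof -
      have "exp (\<gamma> * snd x) * exp (\<gamma> * snd x) = exp (\<beta> * snd x)" unfolding \<gamma>(2) by (simp flip: exp_add)
      then show ?thesis using \<beta> by (simp add: ennreal_mult_assoc mult.assoc)
    qed
    finally show "(\<integral>\<^sup>+t. (if t \<le> snd x then ennreal (2 * exp (\<gamma> * t)) * (ennreal (exp (\<gamma> * snd x)) * ennreal ((norm (g x))\<^sup>2)) else 0) \<partial>L)
      \<le> ennreal (4 / \<beta>) * (ennreal (exp (\<beta> * snd x)) * ennreal ((norm (g x))\<^sup>2))" .
  qed
  also have "\<dots> = ennreal (4 / \<beta>) * wn \<beta> g"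
    unfolding wn_eq by (rule nn_integral_cmult) measurable
  finally have le: "wn \<beta> (pz Z) \<le> sqn \<mu> (pz Z) + ennreal (4 / \<beta>) * wn \<beta> g"
    unfolding le by (rule add_left_mono)
  \<comment> \<open>The constant term in the expansion of the exponential is the unweighted norm,
    bounded by the energy estimate at time 0; together 4 / \<beta> + 1 / \<beta> = 5 /
    \<beta>.\<close>
  have "sqn \<mu> (pz Z) \<le> ennreal (1 / \<beta>) * wn \<beta> g"
  proof -
    have 0: "0 \<in> {0..T}" using horizon_pos by simp
    have "sqn \<mu> (pz Z) = sqn \<mu> (\<lambda>x. if 0 < snd x then pz Z x else 0)"
    proof (rule sqn_cong_AE)
      show "AE x in \<mu>. pz Z x = (if 0 < snd x then pz Z x else 0)"
        using AE_mu_time AE_space[of \<mu>] by eventually_elim auto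
    qed
    also have "\<dots> \<le> ennreal (exp (- \<beta> * 0) / \<beta>) * wn \<beta> (\<lambda>x. if 0 \<le> snd x then g x else 0)"
      by (rule order_trans[OF _ lin_sol_energy[OF S 0 \<beta>]]) simp
    also have "\<dots> \<le> ennreal (1 / \<beta>) * wn \<beta> g"
      by (intro mult_mono wn_mono_AE AE_I2) auto
    finally show ?thesis .
  qed
  then have "wn \<beta> (pz Z) \<le> ennreal (1 / \<beta>) * wn \<beta> g + ennreal (4 / \<beta>) * wn \<beta> g"
    by (intro order_trans[OF le] add_right_mono)
  also have "ennreal (1 / \<beta>) * wn \<beta> g + ennreal (4 / \<beta>) * wn \<beta> g = ennreal (5 / \<beta>) * wn \<beta> g"
    using \<beta> by (simp add: distrib_right[symmetric] ennreal_plus[symmetric] add_divide_distrib[symmetric] del: ennreal_plus)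
  finally show ?thesis .
qed

end

section \<open>The Skorokhod problem\<close>

definition skorokhod :: "real \<Rightarrow> (real \<Rightarrow> real) \<Rightarrow> real \<Rightarrow> real" where
  "skorokhod T \<psi> t = (SUP s\<in>{t..T}. max 0 (\<psi> s))"

context
  fixes T :: real and \<psi> :: "real \<Rightarrow> real"
  assumes \<psi>: "continuous_on {0..T} \<psi>"
begin

lemma skorokhod_attained:
  assumes t: "t \<in> {0..T}"
  obtains s where "s \<in> {t..T}" "skorokhod T \<psi> t = max 0 (\<psi> s)" "\<And>u. u \<in> {t..T} \<Longrightarrow> max 0 (\<psi> u) \<le> skorokhod T \<psi> t"
proof -
  have "continuous_on {t..T} (\<lambda>s. max 0 (\<psi> s))"
    using t by (intro continuous_on_max continuous_intros continuous_on_subset[OF \<psi>]) auto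
  then obtain s where s: "s \<in> {t..T}" "\<forall>u\<in>{t..T}. max 0 (\<psi> u) \<le> max 0 (\<psi> s)"
    using continuous_attains_sup[of "{t..T}" "\<lambda>s. max 0 (\<psi> s)"] t by auto
  have "skorokhod T \<psi> t = max 0 (\<psi> s)"
    unfolding skorokhod_def using s by (intro cSup_eq_maximum) auto
  with s show thesis by (intro that) auto
qed

lemma skorokhod_ge:
  assumes t: "t \<in> {0..T}" and u: "u \<in> {t..T}" shows "\<psi> u \<le> skorokhod T \<psi> t"
proof (rule skorokhod_attained[OF t])
  assume "\<And>u. u \<in> {t..T} \<Longrightarrow> max 0 (\<psi> u) \<le> skorokhod T \<psi> t"
  from this[OF u] show ?thesis by simp
qed

lemma skorokhod_nonneg:
  assumes t: "t \<in> {0..T}" shows "0 \<le> skorokhod T \<psi> t"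
  by (rule skorokhod_attained[OF t]) simp

lemma skorokhod_antimono:
  assumes s: "s \<in> {0..T}" and t: "t \<in> {s..T}" shows "skorokhod T \<psi> t \<le> skorokhod T \<psi> s"
proof (rule skorokhod_attained[of t])
  show "t \<in> {0..T}" using s t by auto
  fix u assume u: "u \<in> {t..T}" "skorokhod T \<psi> t = max 0 (\<psi> u)"
  have "u \<in> {s..T}" using u(1) t by auto
  from skorokhod_ge[OF s this] skorokhod_nonneg[OF s] show ?thesis by (simp add: u(2))
qed

lemma skorokhod_T: "0 \<le> T \<Longrightarrow> \<psi> T \<le> 0 \<Longrightarrow> skorokhod T \<psi> T = 0"
  by (simp add: skorokhod_def)

text \<open>From t back to s the running supremum can grow only through values of \<psi> on [s, t].
  Small e gives continuity; e = 0 gives constancy where \<psi> stays below the supremum.\<close>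

lemma skorokhod_local:
  assumes st: "s \<in> {0..T}" "t \<in> {s..T}" and e: "\<And>u. u \<in> {s..t} \<Longrightarrow> \<psi> u \<le> skorokhod T \<psi> t + e" and "0 \<le> e"
  shows "skorokhod T \<psi> s \<le> skorokhod T \<psi> t + e"
proof (rule skorokhod_attained[OF st(1)])
  fix u assume u: "u \<in> {s..T}" "skorokhod T \<psi> s = max 0 (\<psi> u)"
  have t: "t \<in> {0..T}" using st by auto
  have "\<psi> u \<le> skorokhod T \<psi> t + e"
    using e[of u] skorokhod_ge[OF t, of u] u(1) \<open>0 \<le> e\<close> by (cases "u \<le> t") auto
  then show ?thesis using u skorokhod_nonneg[OF t] \<open>0 \<le> e\<close> by auto
qed

lemma skorokhod_continuous: "continuous_on {0..T} (skorokhod T \<psi>)"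
proof -
  have uc: "uniformly_continuous_on {0..T} \<psi>" using \<psi> by (intro compact_uniformly_continuous) auto
  show ?thesis
  proof (rule uniformly_continuous_imp_continuous, unfold uniformly_continuous_on_def dist_real_def, intro allI impI)
    fix e :: real assume e: "0 < e"
    then obtain d where d: "0 < d" "\<forall>s\<in>{0..T}. \<forall>u\<in>{0..T}. \<bar>u - s\<bar> < d \<longrightarrow> \<bar>\<psi> u - \<psi> s\<bar> < e / 2"
      using uc[unfolded uniformly_continuous_on_def dist_real_def, rule_format, of "e / 2"] by auto
    have le: "\<bar>skorokhod T \<psi> s - skorokhod T \<psi> t\<bar> < e" if st: "s \<in> {0..T}" "t \<in> {s..T}" "t - s < d" for s t
    proof -
      have t: "t \<in> {0..T}" using st by auto
      have "\<psi> u \<le> skorokhod T \<psi> t + e / 2" if "u \<in> {s..t}" for u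
      proof -
        have "u \<in> {0..T}" "\<bar>u - t\<bar> < d" using that st by auto
        then have "\<bar>\<psi> u - \<psi> t\<bar> < e / 2" using d(2) t by blast
        moreover have "\<psi> t \<le> skorokhod T \<psi> t" using t by (intro skorokhod_ge) auto
        ultimately show ?thesis by linarith
      qed
      from skorokhod_local[OF st(1,2) this] e skorokhod_antimono[OF st(1,2)] show ?thesis by auto
    qed
    show "\<exists>d>0. \<forall>s\<in>{0..T}. \<forall>t\<in>{0..T}. \<bar>t - s\<bar> < d \<longrightarrow> \<bar>skorokhod T \<psi> t - skorokhod T \<psi> s\<bar> < e"
    proof (intro exI[of _ d] conjI d(1) ballI impI)
      fix s t assume "s \<in> {0..T}" "t \<in> {0..T}" "\<bar>t - s\<bar> < d"
      then show "\<bar>skorokhod T \<psi> t - skorokhod T \<psi> s\<bar> < e"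
        using le[of s t] le[of t s] by (cases "s \<le> t") (auto simp: abs_minus_commute)
    qed
  qed
qed

end

text \<open>Only times from t on enter, as the problem runs backward; a bound that decreases in t
  can therefore be applied at each t with its value there.\<close>

lemma skorokhod_Lipschitz:
  assumes "continuous_on {0..T} \<psi>" "continuous_on {0..T} \<phi>" and t: "t \<in> {0..T}"
    and D: "\<And>s. s \<in> {t..T} \<Longrightarrow> \<bar>\<psi> s - \<phi> s\<bar> \<le> D"
  shows "\<bar>skorokhod T \<psi> t - skorokhod T \<phi> t\<bar> \<le> D"
proof -
  have le: "skorokhod T \<psi> t \<le> skorokhod T \<phi> t + D"
    if c: "continuous_on {0..T} \<psi>" "continuous_on {0..T} \<phi>" and D: "\<And>s. s \<in> {t..T} \<Longrightarrow> \<bar>\<psi> s - \<phi> s\<bar> \<le> D" for \<psi> \<phi>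
  proof (rule skorokhod_attained[OF c(1) t])
    fix s assume s: "s \<in> {t..T}" "skorokhod T \<psi> t = max 0 (\<psi> s)"
    then show ?thesis
      using D[of s] skorokhod_ge[OF c(2) t s(1)] skorokhod_nonneg[OF c(2) t] by auto
  qed
  have "\<bar>\<phi> s - \<psi> s\<bar> \<le> D" if "s \<in> {t..T}" for s using D[OF that] by (simp add: abs_minus_commute)
  from le[OF assms(1,2) D] le[OF assms(2,1) this] show ?thesis by linarith
qed

text \<open>The condition \<open>flat\<close> for an abstract slack function \<delta>, which frees
  the Skorokhod problem from \<rho> and q.\<close>

definition flat_on :: "real \<Rightarrow> (real \<Rightarrow> real) \<Rightarrow> (real \<Rightarrow> real) \<Rightarrow> bool" where
  "flat_on T \<delta> K \<longleftrightarrow> set_integrable (stieltjes_measure T K) {0..T} \<delta> \<and> (LINT t:{0..T}|stieltjes_measure T K. \<delta> t) = 0"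

context
  fixes T :: real and K \<delta> :: "real \<Rightarrow> real"
  assumes T: "0 < T" and K: "continuous_on {0..T} K" "mono_on {0..T} K"
    and \<delta>: "continuous_on {0..T} \<delta>" "\<And>t. t \<in> {0..T} \<Longrightarrow> 0 \<le> \<delta> t"
begin

lemma stieltjes_Ioc: "s \<le> t \<Longrightarrow> emeasure (stieltjes_measure T K) {s<..t} = ennreal (K (max 0 (min T t)) - K (max 0 (min T s)))"
proof -
  have c: "continuous_on UNIV (\<lambda>t. K (max 0 (min T t)))"
    using T by (intro continuous_on_compose2[OF K(1)] continuous_intros) auto
  show "s \<le> t \<Longrightarrow> ?thesis"
    unfolding stieltjes_measure_def
  proof (rule emeasure_interval_measure_Ioc)
    show "continuous (at_right a) (\<lambda>t. K (max 0 (min T t)))" for a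
      using c by (metis continuous_on_eq_continuous_within UNIV_I continuous_within_subset subset_UNIV)
  qed (use T in \<open>auto intro!: mono_onD[OF K(2)]\<close>)
qed

lemma sets_stieltjes [measurable_cong]: "sets (stieltjes_measure T K) = sets borel"
  by (simp add: stieltjes_measure_def)

lemma flat_on_iff: "flat_on T \<delta> K \<longleftrightarrow> (AE t in stieltjes_measure T K. t \<in> {0..T} \<longrightarrow> \<delta> t = 0)"
proof -
  let ?\<delta> = "\<lambda>t. indicator {0..T} t *\<^sub>R \<delta> t"
  have m: "?\<delta> \<in> borel_measurable (stieltjes_measure T K)"
    using borel_measurable_continuous_on_indicator[OF _ \<delta>(1)] by (simp cong: measurable_cong_sets add: sets_stieltjes)
  have ae: "(AE t in stieltjes_measure T K. t \<in> {0..T} \<longrightarrow> \<delta> t = 0) \<longleftrightarrow> (AE t in stieltjes_measure T K. ?\<delta> t = 0)"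
    by (intro AE_cong) (auto simp: indicator_def)
  show ?thesis
    unfolding ae flat_on_def set_integrable_def set_lebesgue_integral_def
  proof
    assume "AE t in stieltjes_measure T K. ?\<delta> t = 0"
    then show "integrable (stieltjes_measure T K) ?\<delta> \<and> integral\<^sup>L (stieltjes_measure T K) ?\<delta> = 0"
      using integrable_cong_AE[OF m, of "\<lambda>_. 0"] integral_cong_AE[OF m, of "\<lambda>_. 0"] by simp
  next
    assume i: "integrable (stieltjes_measure T K) ?\<delta> \<and> integral\<^sup>L (stieltjes_measure T K) ?\<delta> = 0"
    then show "AE t in stieltjes_measure T K. ?\<delta> t = 0"
      using \<delta>(2) integral_nonneg_eq_0_iff_AE[of "stieltjes_measure T K" ?\<delta>] by (auto simp: indicator_def)
  qed
qed

text \<open>Where the slack is positive there is no mass, so K does not grow on (t, v] for v < u;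
  continuity carries this to u, where the slack may vanish.\<close>

lemma flat_on_const:
  assumes f: "flat_on T \<delta> K" and tu: "0 \<le> t" "t < u" "u \<le> T" and pos: "\<And>s. s \<in> {t<..<u} \<Longrightarrow> 0 < \<delta> s"
  shows "K u = K t"
proof -
  have const: "K v = K t" if v: "v \<in> {t..<u}" for v
  proof -
    have "AE s in stieltjes_measure T K. s \<notin> {t<..v}"
      using f[unfolded flat_on_iff]
    proof eventually_elim
      case (elim s)
      then show ?case using pos[of s] v tu by auto
    qed
    then have "emeasure (stieltjes_measure T K) {t<..v} = 0"
      by (subst (asm) AE_iff_measurable[of "{t<..v}"]) (auto simp: stieltjes_measure_def)
    then have "K v \<le> K t" using v tu by (simp add: stieltjes_Ioc ennreal_eq_0_iff)
    moreover have "K t \<le> K v" using v tu by (intro mono_onD[OF K(2)]) auto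
    ultimately show ?thesis by simp
  qed
  have c: "continuous_on (closure {t..<u}) K"
    using tu by (auto intro: continuous_on_subset[OF K(1)])
  have u: "u \<in> closure {t..<u}" using tu by simp
  show ?thesis by (rule continuous_constant_on_closure[OF c const u])
qed

text \<open>Points of positive slack lie inside intervals of constancy of K. Intervals with rational
  end points suffice to cover them, and a countable union of null sets is null.\<close>

lemma flat_onI:
  assumes loc: "\<And>t. t \<in> {0..T} \<Longrightarrow> 0 < \<delta> t \<Longrightarrow> \<exists>e>0. \<forall>u\<in>{0..T}. \<forall>v\<in>{0..T}. \<bar>u - t\<bar> < e \<longrightarrow> \<bar>v - t\<bar> < e \<longrightarrow> K u = K v"
  shows "flat_on T \<delta> K"
proof -
  let ?c = "\<lambda>t. max 0 (min T t)"
  define N where "N = (\<Union>a\<in>\<rat>. \<Union>b\<in>\<rat>. if a \<le> b \<and> K (?c a) = K (?c b) then {a<..b} else {})"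
  have "N \<in> null_sets (stieltjes_measure T K)"
    unfolding N_def by (intro null_sets_UN' countable_rat) (auto simp: stieltjes_Ioc sets_stieltjes null_sets_def)
  then have "AE t in stieltjes_measure T K. t \<notin> N" by (rule AE_not_in)
  then show ?thesis
    unfolding flat_on_iff
  proof eventually_elim
    case (elim t)
    show ?case
    proof (intro impI, rule ccontr)
      assume t: "t \<in> {0..T}" and "\<delta> t \<noteq> 0"
      with \<delta>(2)[OF t] have "0 < \<delta> t" by simp
      from loc[OF t this] obtain e where e: "e > 0" "\<forall>u\<in>{0..T}. \<forall>v\<in>{0..T}. \<bar>u - t\<bar> < e \<longrightarrow> \<bar>v - t\<bar> < e \<longrightarrow> K u = K v"
        by blast
      obtain a where a: "a \<in> \<rat>" "t - e < a" "a < t" using Rats_dense_in_real[of "t - e" t] e(1) by auto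
      obtain b where b: "b \<in> \<rat>" "t < b" "b < t + e" using Rats_dense_in_real[of t "t + e"] e(1) by auto
      have "?c a \<in> {0..T}" "?c b \<in> {0..T}" "\<bar>?c a - t\<bar> < e" "\<bar>?c b - t\<bar> < e" using a b t T e(1) by (auto simp: max_def min_def)
      then have "K (?c a) = K (?c b)" using e(2) by blast
      then have "t \<in> (if a \<le> b \<and> K (?c a) = K (?c b) then {a<..b} else {})" using a b by simp
      then have "t \<in> N" unfolding N_def using a(1) b(1) by (intro UN_I)
      with elim show False by simp
    qed
  qed
qed

end

lemma skorokhod_flat:
  assumes T: "0 < T" and \<psi>: "continuous_on {0..T} \<psi>"
  shows "flat_on T (\<lambda>t. skorokhod T \<psi> t - \<psi> t) (\<lambda>t. skorokhod T \<psi> 0 - skorokhod T \<psi> t)"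
proof (rule flat_onI[OF T])
  let ?R = "skorokhod T \<psi>"
  note Rc = skorokhod_continuous[OF \<psi>]
  show "continuous_on {0..T} (\<lambda>t. ?R 0 - ?R t)" "continuous_on {0..T} (\<lambda>t. ?R t - \<psi> t)"
    by (intro continuous_intros Rc \<psi>)+
  show "mono_on {0..T} (\<lambda>t. ?R 0 - ?R t)"
    by (intro mono_onI) (auto intro!: skorokhod_antimono[OF \<psi>])
  show "0 \<le> ?R t - \<psi> t" if "t \<in> {0..T}" for t using skorokhod_ge[OF \<psi> that, of t] that by simp
  fix t assume t: "t \<in> {0..T}" and pos: "0 < ?R t - \<psi> t"
  \<comment> \<open>Half the slack: while R and \<psi> each move by less than m, \<psi> remains
    below R nearby and \<open>skorokhod_local\<close> applies with e = 0.\<close>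
  define m where "m = (?R t - \<psi> t) / 2"
  have m: "0 < m" using pos by (simp add: m_def)
  obtain d where d: "0 < d" "\<And>s. s \<in> {0..T} \<Longrightarrow> \<bar>s - t\<bar> < d \<Longrightarrow> \<bar>?R s - ?R t\<bar> < m"
    using Rc[unfolded continuous_on_iff dist_real_def, rule_format, OF t m] by auto
  obtain d' where d': "0 < d'" "\<And>s. s \<in> {0..T} \<Longrightarrow> \<bar>s - t\<bar> < d' \<Longrightarrow> \<bar>\<psi> s - \<psi> t\<bar> < m"
    using \<psi>[unfolded continuous_on_iff dist_real_def, rule_format, OF t m] by auto
  have eq: "?R u = ?R v" if uv: "u \<in> {0..T}" "v \<in> {u..T}" "\<bar>u - t\<bar> < min d d'" "\<bar>v - t\<bar> < min d d'" for u v
  proof (rule antisym)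
    have "?R u \<le> ?R v + 0"
    proof (rule skorokhod_local[OF \<psi> uv(1,2)])
      fix s assume s: "s \<in> {u..v}"
      have "\<bar>\<psi> s - \<psi> t\<bar> < m" "\<bar>?R v - ?R t\<bar> < m" using s uv by (intro d'(2) d(2); auto)+
      moreover have "2 * m = ?R t - \<psi> t" by (simp add: m_def)
      ultimately show "\<psi> s \<le> ?R v + 0" by linarith
    qed simp
    then show "?R u \<le> ?R v" by simp
  qed (rule skorokhod_antimono[OF \<psi> uv(1,2)])
  show "\<exists>e>0. \<forall>u\<in>{0..T}. \<forall>v\<in>{0..T}. \<bar>u - t\<bar> < e \<longrightarrow> \<bar>v - t\<bar> < e \<longrightarrow> ?R 0 - ?R u = ?R 0 - ?R v"
  proof (intro exI[of _ "min d d'"] conjI ballI impI)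
    fix u v assume uv: "u \<in> {0..T}" "v \<in> {0..T}" "\<bar>u - t\<bar> < min d d'" "\<bar>v - t\<bar> < min d d'"
    show "?R 0 - ?R u = ?R 0 - ?R v"
    proof (cases "u \<le> v")
      case True
      with uv have "v \<in> {u..T}" by simp
      from eq[OF uv(1) this uv(3,4)] show ?thesis by simp
    next
      case False
      with uv have "u \<in> {v..T}" by simp
      from eq[OF uv(2) this uv(4,3)] show ?thesis by simp
    qed
  qed (use d(1) d'(1) in simp)
qed

text \<open>Admissibility and monotonicity force K_T - K_t to be at least the running supremum. If
  it were larger at t, let u be the first later time at which K_T - K_u has dropped to the value of
  the supremum at t; before u the slack is positive, so flatness makes K constant on [t, u], a
  contradiction.\<close>

lemma skorokhod_unique:
  assumes T: "0 < T" and \<psi>: "continuous_on {0..T} \<psi>" and K: "continuous_on {0..T} K" "mono_on {0..T} K"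
    and le: "\<And>t. t \<in> {0..T} \<Longrightarrow> \<psi> t \<le> K T - K t" and f: "flat_on T (\<lambda>t. K T - K t - \<psi> t) K" and t: "t \<in> {0..T}"
  shows "K T - K t = skorokhod T \<psi> t"
proof (rule antisym)
  let ?r = "skorokhod T \<psi> t"
  show "?r \<le> K T - K t"
  proof (rule skorokhod_attained[OF \<psi> t])
    fix s assume s: "s \<in> {t..T}" "skorokhod T \<psi> t = max 0 (\<psi> s)"
    have "K t \<le> K s" "K t \<le> K T" using s t by (auto intro!: mono_onD[OF K(2)])
    with s le[of s] t show ?thesis by auto
  qed
  show "K T - K t \<le> ?r"
  proof (rule ccontr)
    assume n: "\<not> K T - K t \<le> ?r"
    let ?S = "{s \<in> {t..T}. K T - K s \<le> ?r}"
    have "closed ({t..T} \<inter> (\<lambda>s. K T - K s) -` {..?r})"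
      using t by (intro continuous_closed_preimage continuous_intros continuous_on_subset[OF K(1)]) auto
    moreover have "{t..T} \<inter> (\<lambda>s. K T - K s) -` {..?r} = ?S" by auto
    ultimately have "closed ?S" by simp
    moreover have "bounded ?S" by (rule bounded_subset[of "{t..T}"]) auto
    moreover have "T \<in> ?S" using t skorokhod_nonneg[OF \<psi> t] by simp
    ultimately have "\<exists>u\<in>?S. \<forall>s\<in>?S. u \<le> s"
      by (intro compact_attains_inf) (auto simp: compact_eq_bounded_closed)
    then obtain u where u: "u \<in> ?S" "\<And>s. s \<in> ?S \<Longrightarrow> u \<le> s" by blast
    have ut: "t < u" using u(1) n by (auto simp: less_le)
    have "K u = K t"
    proof (rule flat_on_const[OF T K _ _ f _ ut])
      fix s assume s: "s \<in> {t<..<u}"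
      then have "s \<notin> ?S" using u(2)[of s] by auto
      moreover have "s \<in> {t..T}" using s u(1) by auto
      ultimately show "0 < K T - K s - \<psi> s" using skorokhod_ge[OF \<psi> t, of s] by simp
    qed (use t u(1) le in \<open>auto intro!: continuous_intros K \<psi>\<close>)
    then show False using u(1) n by simp
  qed
qed

context brownian_motion
begin

section \<open>The spaces of the problem and dominated convergence in them\<close>

lemma L2_iff:
  assumes "t \<le> T" shows "X \<in> L2 M (F t) \<longleftrightarrow> X \<in> borel_measurable (F t) \<and> sqn M X < \<infinity>"
proof (cases "X \<in> borel_measurable (F t)")
  case True
  from sqn_integrable_iff[OF measurable_F_M[OF this assms]] True show ?thesis by (simp add: L2_def)
qed (simp add: L2_def)

lemma L2_D:
  assumes X: "X \<in> L2 M (F t)" and t: "t \<le> T"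
  shows "X \<in> borel_measurable (F t)" "X \<in> borel_measurable M" "sqn M X < \<infinity>" "integrable M X"
proof -
  show XF: "X \<in> borel_measurable (F t)" and f: "sqn M X < \<infinity>" using X L2_iff[OF t, of X] by blast+
  show XM: "X \<in> borel_measurable M" by (rule measurable_F_M[OF XF t])
  show "integrable M X" by (rule integrable_L2[OF XM f])
qed

lemma L2_mono:
  assumes "X \<in> L2 M (F s)" "s \<le> t" shows "X \<in> L2 M (F t)"
proof -
  have X: "X \<in> borel_measurable (F s)" "integrable M (\<lambda>w. (X w)\<^sup>2)" using assms(1) by (simp_all add: L2_def)
  from measurable_F_mono[OF X(1) assms(2)] X(2) show ?thesis by (simp add: L2_def)
qed

lemma S2I:
  assumes Y: "adapted T F Y" "continuous_process M T Y" and G: "G \<in> borel_measurable M" "sqn M G < \<infinity>"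
    and bd: "AE w in M. \<forall>t\<in>{0..T}. \<bar>Y t w\<bar> \<le> G w"
  shows "Y \<in> S2 M T F"
proof -
  have "(\<integral>\<^sup>+w. (SUP t\<in>{0..T}. ennreal \<bar>Y t w\<bar>)\<^sup>2 \<partial>M) \<le> sqn M G"
    unfolding sqn_def
  proof (intro nn_integral_mono_AE)
    show "AE w in M. (SUP t\<in>{0..T}. ennreal \<bar>Y t w\<bar>)\<^sup>2 \<le> ennreal ((norm (G w))\<^sup>2)"
      using bd
    proof eventually_elim
      case (elim w)
      have "(SUP t\<in>{0..T}. ennreal \<bar>Y t w\<bar>) \<le> ennreal (norm (G w))"
        using elim by (intro SUP_least ennreal_leI) (force intro: order_trans[OF _ abs_ge_self])
      then have "(SUP t\<in>{0..T}. ennreal \<bar>Y t w\<bar>)\<^sup>2 \<le> (ennreal (norm (G w)))\<^sup>2" by (intro power_mono) auto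
      then show ?case by (simp add: ennreal_power)
    qed
  qed
  also note G(2)
  finally show ?thesis using Y unfolding S2_def by simp
qed

text \<open>The supremum over the countable dense set of times is a measurable, square-integrable
  majorant of almost every path; it makes dominated convergence available.\<close>

lemma S2_dominated:
  assumes "Y \<in> S2 M T F"
  obtains G where "G \<in> borel_measurable M" "sqn M G < \<infinity>" "AE w in M. \<forall>t\<in>{0..T}. \<bar>Y t w\<bar> \<le> G w"
proof -
  from assms have Y: "adapted T F Y" "AE w in M. continuous_on {0..T} (\<lambda>t. Y t w)"
    and fin: "(\<integral>\<^sup>+w. (SUP t\<in>{0..T}. ennreal \<bar>Y t w\<bar>)\<^sup>2 \<partial>M) < \<infinity>"
    by (auto simp: S2_def continuous_process_def)
  let ?G = "\<lambda>w. SUP t\<in>dense_times. ennreal \<bar>Y t w\<bar>"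
  have YM: "Y t \<in> borel_measurable M" if "t \<in> dense_times" for t
    using Y(1) that dense_times(2) by (intro measurable_F_M[of _ t]) (auto simp: adapted_def)
  have G: "?G \<in> borel_measurable M"
    using YM by (intro borel_measurable_SUP dense_times(1) measurable_compose[OF _ measurable_ennreal] borel_measurable_abs)
  have eq: "(\<integral>\<^sup>+w. (SUP t\<in>{0..T}. ennreal \<bar>Y t w\<bar>)\<^sup>2 \<partial>M) = (\<integral>\<^sup>+w. (?G w)\<^sup>2 \<partial>M)"
    using Y(2) by (intro nn_integral_cong_AE) (auto elim!: eventually_mono simp: SUP_dense_times)
  have "AE w in M. (?G w)\<^sup>2 \<noteq> \<infinity>"
    using G fin unfolding eq by (intro nn_integral_PInf_AE borel_measurable_power_ennreal) auto
  then have Gfin: "AE w in M. ?G w < top"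
  proof eventually_elim
    case (elim w)
    show ?case
    proof (rule ccontr)
      assume "\<not> ?G w < top"
      then have "?G w = top" by (simp only: less_top[symmetric] not_not)
      with elim show False by (simp add: power2_eq_square)
    qed
  qed
  show thesis
  proof (rule that)
    show "(\<lambda>w. enn2real (?G w)) \<in> borel_measurable M" using G by measurable
    have "sqn M (\<lambda>w. enn2real (?G w)) = (\<integral>\<^sup>+w. (?G w)\<^sup>2 \<partial>M)"
      unfolding sqn_def using Gfin by (intro nn_integral_cong_AE) (auto elim!: eventually_mono simp: ennreal_power[symmetric])
    then show "sqn M (\<lambda>w. enn2real (?G w)) < \<infinity>" using fin eq by simp
    show "AE w in M. \<forall>t\<in>{0..T}. \<bar>Y t w\<bar> \<le> enn2real (?G w)"
      using Gfin Y(2)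
    proof eventually_elim
      case (elim w)
      show ?case
      proof
        fix t assume "t \<in> {0..T}"
        then have "ennreal \<bar>Y t w\<bar> \<le> ?G w" unfolding SUP_dense_times[OF elim(2), symmetric] by (rule SUP_upper)
        then show "\<bar>Y t w\<bar> \<le> enn2real (?G w)"
          using enn2real_mono[of "ennreal \<bar>Y t w\<bar>" "?G w"] elim(1) by simp
      qed
    qed
  qed
qed

lemma S2_D:
  assumes "Y \<in> S2 M T F"
  shows "adapted T F Y" "continuous_process M T Y" "t \<in> {0..T} \<Longrightarrow> Y t \<in> L2 M (F t)"
proof -
  show ad: "adapted T F Y" and "continuous_process M T Y" using assms by (auto simp: S2_def)
  assume t: "t \<in> {0..T}"
  obtain G where G: "G \<in> borel_measurable M" "sqn M G < \<infinity>" "AE w in M. \<forall>t\<in>{0..T}. \<bar>Y t w\<bar> \<le> G w"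
    using S2_dominated[OF assms] .
  have "sqn M (Y t) \<le> sqn M G"
    by (rule sqn_mono_AE) (use G(3) in eventually_elim, use t in \<open>force intro: order_trans[OF _ abs_ge_self]\<close>)
  then show "Y t \<in> L2 M (F t)" using t ad G(2) by (simp add: L2_iff adapted_def le_less_trans)
qed

lemma S2_add:
  assumes "Y \<in> S2 M T F" "Y' \<in> S2 M T F"
  shows "(\<lambda>t w. Y t w + Y' t w) \<in> S2 M T F"
proof -
  obtain G where G: "G \<in> borel_measurable M" "sqn M G < \<infinity>" "AE w in M. \<forall>t\<in>{0..T}. \<bar>Y t w\<bar> \<le> G w"
    using S2_dominated[OF assms(1)] .
  obtain G' where G': "G' \<in> borel_measurable M" "sqn M G' < \<infinity>" "AE w in M. \<forall>t\<in>{0..T}. \<bar>Y' t w\<bar> \<le> G' w"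
    using S2_dominated[OF assms(2)] .
  note d = S2_D(1,2)[OF assms(1)] S2_D(1,2)[OF assms(2)]
  show ?thesis
  proof (rule S2I[of _ "\<lambda>w. G w + G' w"])
    show "adapted T F (\<lambda>t w. Y t w + Y' t w)" using d(1,3) by (auto simp: adapted_def intro!: borel_measurable_add)
    show "continuous_process M T (\<lambda>t w. Y t w + Y' t w)"
      using d(2,4) unfolding continuous_process_def by eventually_elim (rule continuous_on_add)
    show "(\<lambda>w. G w + G' w) \<in> borel_measurable M" using G(1) G'(1) by (rule borel_measurable_add)
    show "sqn M (\<lambda>w. G w + G' w) < \<infinity>" by (rule sqn_add_finite[OF G(1) G'(1) G(2) G'(2)])
    show "AE w in M. \<forall>t\<in>{0..T}. \<bar>Y t w + Y' t w\<bar> \<le> G w + G' w"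
      using G(3) G'(3) by eventually_elim (force intro: order_trans[OF abs_triangle_ineq] add_mono)
  qed
qed

lemma S2_deterministic:
  assumes "continuous_on {0..T} k" shows "(\<lambda>t w. k t) \<in> S2 M T F"
proof -
  have "compact (k ` {0..T})" using assms by (intro compact_continuous_image) auto
  then obtain c where c: "\<forall>x\<in>k ` {0..T}. norm x \<le> c" using compact_imp_bounded bounded_iff by blast
  have "sqn M (\<lambda>_. c) < \<infinity>" by (rule sqn_bounded[of _ "\<bar>c\<bar>"]) simp
  then show ?thesis
    by (intro S2I[of _ "\<lambda>_. c"]) (use assms c in \<open>auto simp: adapted_def continuous_process_def\<close>)
qed

text \<open>An almost-sure statement about a nonrandom path holds outright, since the measure is a
  probability.\<close>

lemma A2D_iff: "k \<in> A2D M T F \<longleftrightarrow> continuous_on {0..T} k \<and> k 0 = 0 \<and> mono_on {0..T} k"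
proof
  assume "k \<in> A2D M T F"
  then have S: "(\<lambda>t w. k t) \<in> S2 M T F" and "AE w in M. k 0 = 0 \<and> mono_on {0..T} k"
    by (auto simp: A2D_def A2_def)
  moreover have "AE w in M. continuous_on {0..T} k" using S2_D(2)[OF S] by (simp only: continuous_process_def)
  ultimately show "continuous_on {0..T} k \<and> k 0 = 0 \<and> mono_on {0..T} k" by simp
next
  assume "continuous_on {0..T} k \<and> k 0 = 0 \<and> mono_on {0..T} k"
  then show "k \<in> A2D M T F" unfolding A2D_def A2_def using S2_deterministic[of k] by simp
qed

lemma S2_tendsto_L1:
  assumes Y: "Y \<in> S2 M T F" and t: "t \<in> {0..T}"
  shows "((\<lambda>s. expectation (\<lambda>w. \<bar>Y s w - Y t w\<bar>)) \<longlongrightarrow> 0) (at t within {0..T})"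
  unfolding tendsto_at_iff_sequentially comp_def
proof (intro allI impI)
  fix s assume s: "\<forall>n. s n \<in> {0..T} - {t}" "s \<longlonglongrightarrow> t"
  obtain G where G: "G \<in> borel_measurable M" "sqn M G < \<infinity>" "AE w in M. \<forall>t\<in>{0..T}. \<bar>Y t w\<bar> \<le> G w"
    using S2_dominated[OF Y] .
  have YM: "Y s \<in> borel_measurable M" if "s \<in> {0..T}" for s
    using L2_D(2)[OF S2_D(3)[OF Y that]] that by simp
  have "(\<lambda>n. expectation (\<lambda>w. \<bar>Y (s n) w - Y t w\<bar>)) \<longlonglongrightarrow> expectation (\<lambda>w. 0)"
  proof (rule integral_dominated_convergence[where w = "\<lambda>w. 2 * G w"])
    show "integrable M (\<lambda>w. 2 * G w)" using integrable_L2[OF G(1,2)] by simp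
    show "(\<lambda>w. \<bar>Y (s n) w - Y t w\<bar>) \<in> borel_measurable M" for n
      using YM[of "s n"] YM[OF t] s(1) by auto
    show "AE w in M. norm \<bar>Y (s n) w - Y t w\<bar> \<le> 2 * G w" for n
      using G(3)
    proof eventually_elim
      case (elim w)
      have "\<bar>Y (s n) w\<bar> \<le> G w" "\<bar>Y t w\<bar> \<le> G w" using elim s(1) t by auto
      then show ?case by simp
    qed
    show "AE w in M. (\<lambda>n. \<bar>Y (s n) w - Y t w\<bar>) \<longlonglongrightarrow> 0"
      using S2_D(2)[OF Y, unfolded continuous_process_def]
    proof eventually_elim
      case (elim w)
      have "(\<lambda>n. Y (s n) w) \<longlonglongrightarrow> Y t w"
        using s by (intro continuous_on_tendsto_compose[OF elim _ t]) auto
      then have "(\<lambda>n. \<bar>Y (s n) w - Y t w\<bar>) \<longlonglongrightarrow> \<bar>Y t w - Y t w\<bar>" by (intro tendsto_intros)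
      then show ?case by simp
    qed
  qed simp
  then show "(\<lambda>n. expectation (\<lambda>w. \<bar>Y (s n) w - Y t w\<bar>)) \<longlonglongrightarrow> 0" by simp
qed

lemma lin_sol_S2:
  assumes S: "lin_sol \<xi> g X Z I" and \<xi>: "\<xi> \<in> borel_measurable M" "sqn M \<xi> < \<infinity>"
  shows "X \<in> S2 M T F"
proof -
  note d = lin_solD[OF S]
  note gm = prog_mu[OF d(1)]
  note mart = ito_properties(1)[OF pred_mu[OF d(3)] d(4,5)]
  have IS: "I \<in> S2 M T F"
  proof -
    have "adapted T F I" "continuous_process M T I" using d(5) by (auto simp: ito_def)
    moreover from l2_martingale_sup[OF mart this(2)] have "(\<integral>\<^sup>+w. (SUP t\<in>{0..T}. ennreal \<bar>I t w\<bar>)\<^sup>2 \<partial>M) < \<infinity>"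
      by (rule le_less_trans) (use l2_martingaleD(3)[OF mart T_mem] in \<open>simp add: ennreal_mult_less_top\<close>)
    ultimately show ?thesis by (simp add: S2_def)
  qed
  obtain G where G: "G \<in> borel_measurable M" "sqn M G < \<infinity>" "AE w in M. \<forall>t\<in>{0..T}. \<bar>I t w\<bar> \<le> G w"
    using S2_dominated[OF IS] .
  let ?H = "\<lambda>w. \<integral>s. \<bar>g (w, s)\<bar> \<partial>L"
  have H: "?H \<in> borel_measurable M" using gm by measurable
  have HS: "sqn M ?H < \<infinity>"
  proof -
    have "AE w in M. norm (?H w) \<le> norm (LBINT s:{0..T}. \<bar>g (w, s)\<bar>)"
      by (simp add: integral_restrict_space set_lebesgue_integral_def)
    then have "sqn M ?H \<le> sqn M (\<lambda>w. LBINT s:{0..T}. \<bar>g (w, s)\<bar>)" by (rule sqn_mono_AE)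
    also have "\<dots> \<le> (\<integral>\<^sup>+w. ennreal (exp (- 1 * 0) / 1) * (\<integral>\<^sup>+s. ennreal (exp (1 * s)) * ennreal ((norm (if 0 \<le> s then \<bar>g (w, s)\<bar> else 0))\<^sup>2) \<partial>L) \<partial>M)"
      unfolding sqn_def
    proof (intro nn_integral_mono_AE)
      show "AE w in M. ennreal ((norm (LBINT s:{0..T}. \<bar>g (w, s)\<bar>))\<^sup>2)
        \<le> ennreal (exp (- 1 * 0) / 1) * (\<integral>\<^sup>+s. ennreal (exp (1 * s)) * ennreal ((norm (if 0 \<le> s then \<bar>g (w, s)\<bar> else 0))\<^sup>2) \<partial>L)"
        using path_integrable[OF gm d(2)]
      proof eventually_elim
        case (elim w)
        have "0 \<in> {0..T}" using horizon_pos by simp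
        \<comment> \<open>Applied with weight \<gamma> = 1 at time 0; only finiteness of the bound
          matters.\<close>
        from path_Cauchy_Schwarz[OF set_integrable_abs[OF elim] this zero_less_one] show ?case by simp
      qed
    qed
    also have "\<dots> \<le> (\<integral>\<^sup>+w. (\<integral>\<^sup>+s. ennreal (exp (1 * s)) * ennreal ((norm (g (w, s)))\<^sup>2) \<partial>L) \<partial>M)"
      by (intro nn_integral_mono) (auto intro!: nn_integral_mono mult_left_mono)
    also have "\<dots> = wn 1 g"
    proof -
      have "(\<lambda>x. ennreal (exp (1 * snd x)) * ennreal ((norm (g x))\<^sup>2)) \<in> borel_measurable \<mu>" using gm by measurable
      from L.nn_integral_fst[OF this] show ?thesis unfolding wn_eq by simp
    qed
    also have "\<dots> < \<infinity>" using wn_finite[OF _ gm d(2), of 1] by simp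
    finally show ?thesis .
  qed
  show ?thesis
  proof (rule S2I[OF d(6) lin_sol_continuous[OF S]])
    let ?B = "\<lambda>w. \<bar>\<xi> w\<bar> + (?H w + (G w + G w))"
    show "?B \<in> borel_measurable M" using \<xi>(1) H G(1) by measurable
    have "sqn M (\<lambda>w. \<bar>\<xi> w\<bar>) < \<infinity>" using \<xi>(2) by (simp add: sqn_def)
    then show "sqn M ?B < \<infinity>"
      using \<xi>(1) H HS G by (intro sqn_add_finite borel_measurable_add borel_measurable_abs)
    show "AE w in M. \<forall>t\<in>{0..T}. \<bar>X t w\<bar> \<le> ?B w"
      using d(7) G(3) path_integrable[OF gm d(2)]
    proof eventually_elim
      case (elim w)
      show ?case
      proof
        fix t assume t: "t \<in> {0..T}"
        have "\<bar>LBINT s:{t..T}. g (w, s)\<bar> \<le> (LBINT s:{t..T}. \<bar>g (w, s)\<bar>)"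
          using set_integral_norm_bound[OF set_integrable_subset[OF elim(3), of "{t..T}"]] t by simp
        also have "\<dots> \<le> (LBINT s:{0..t}. \<bar>g (w, s)\<bar>) + (LBINT s:{t..T}. \<bar>g (w, s)\<bar>)"
          by (simp add: set_lebesgue_integral_def)
        also have "\<dots> = (LBINT s:{0..T}. \<bar>g (w, s)\<bar>)"
          using t by (intro set_integral_split[OF set_integrable_abs[OF elim(3)], symmetric]) auto
        also have "\<dots> = ?H w" by (simp add: integral_restrict_space set_lebesgue_integral_def)
        finally have "\<bar>LBINT s:{t..T}. g (w, s)\<bar> \<le> ?H w" .
        moreover have "\<bar>I T w\<bar> \<le> G w" "\<bar>I t w\<bar> \<le> G w" using elim(2) t T_mem by auto
        moreover have "X t w = \<xi> w + (LBINT s:{t..T}. g (w, s)) - (I T w - I t w)" using elim(1) t by blast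
        ultimately show "\<bar>X t w\<bar> \<le> ?B w" by linarith
      qed
    qed
  qed
qed

lemma AE_mu_iterated:
  assumes "AE x in \<mu>. P x" shows "AE w in M. AE s in L. P (w, s)"
  using PS.AE_pair[OF assms] .

lemma AE_mu_const:
  assumes "AE w in M. P w" shows "AE x in \<mu>. P (fst x)"
proof -
  obtain N where N: "N \<in> null_sets M" "{w \<in> space M. \<not> P w} \<subseteq> N"
    using assms by (auto elim!: AE_E intro: null_setsI)
  have "N \<times> {0..T} \<in> null_sets \<mu>"
    using N(1) by (auto simp: null_sets_def L.emeasure_pair_measure_Times sets_L intro!: pair_measureI)
  then show ?thesis
    by (rule AE_I') (use N(2) in \<open>auto simp: space_pair_measure\<close>)
qed

lemma sqn_mu_fst:
  assumes "G \<in> borel_measurable M" "sqn M G < \<infinity>"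
  shows "sqn \<mu> (\<lambda>x. G (fst x)) < \<infinity>"
proof -
  have "sqn \<mu> (\<lambda>x. G (fst x)) = (\<integral>\<^sup>+w. (\<integral>\<^sup>+s. ennreal ((norm (G w))\<^sup>2) \<partial>L) \<partial>M)"
    unfolding sqn_def using assms(1) by (subst L.nn_integral_fst[symmetric]) auto
  also have "\<dots> = sqn M G * emeasure L (space L)"
    unfolding sqn_def using assms(1) by (simp add: nn_integral_multc)
  also have "\<dots> < \<infinity>" using ennreal_mult_eq_top_iff[of "sqn M G" "emeasure L (space L)"] L.emeasure_finite[of "space L"] assms(2)
    by (auto simp only: less_top[symmetric] infinity_ennreal_def)
  finally show ?thesis .
qed

lemma S2_sqn_mu:
  assumes Y: "Y \<in> S2 M T F" and Y': "AE w in M. \<forall>t\<in>{0..T}. Y' t w = Y t w"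
  shows "sqn \<mu> (pz Y') < \<infinity>"
proof -
  obtain G where G: "G \<in> borel_measurable M" "sqn M G < \<infinity>" "AE w in M. \<forall>t\<in>{0..T}. \<bar>Y t w\<bar> \<le> G w"
    using S2_dominated[OF Y] .
  have "sqn \<mu> (pz Y') \<le> sqn \<mu> (\<lambda>x. G (fst x))"
  proof (rule sqn_mono_AE)
    show "AE x in \<mu>. norm (pz Y' x) \<le> norm (G (fst x))"
      using AE_mu_const[OF Y'] AE_mu_const[OF G(3)] AE_space[of \<mu>]
    proof eventually_elim
      case (elim x)
      then have "snd x \<in> {0..T}" by auto
      with elim(1,2) have "\<bar>pz Y' x\<bar> \<le> G (fst x)" by simp
      then show ?case by simp
    qed
  qed
  also have "\<dots> < \<infinity>" by (rule sqn_mu_fst[OF G(1,2)])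
  finally show ?thesis .
qed

end

section \<open>Existence and uniqueness\<close>

lemma (in prob_space) expectation_abs_le_sqrt:
  fixes X :: "'a \<Rightarrow> real"
  assumes X: "X \<in> borel_measurable M" and e: "0 \<le> e" "sqn M X \<le> ennreal e"
  shows "expectation (\<lambda>w. \<bar>X w\<bar>) \<le> sqrt e"
proof -
  have fin: "sqn M X < \<infinity>" using e(2) by (rule le_less_trans) simp
  have i: "integrable M (\<lambda>w. \<bar>X w\<bar>)" "integrable M (\<lambda>w. (X w)\<^sup>2)"
    using integrable_L2[OF X fin] sqn_integrable_iff[OF X] fin by auto
  let ?m = "expectation (\<lambda>w. \<bar>X w\<bar>)"
  have "0 \<le> expectation (\<lambda>w. (\<bar>X w\<bar> - ?m)\<^sup>2)" by simp
  also have "\<dots> = expectation (\<lambda>w. (X w)\<^sup>2 - 2 * ?m * \<bar>X w\<bar> + ?m\<^sup>2)"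
    by (rule Bochner_Integration.integral_cong) (auto simp: power2_diff)
  also have "\<dots> = expectation (\<lambda>w. (X w)\<^sup>2) - 2 * ?m * ?m + ?m\<^sup>2"
    using i by (simp add: prob_space)
  finally have "?m\<^sup>2 \<le> expectation (\<lambda>w. (X w)\<^sup>2)" by (simp add: power2_eq_square)
  also have "\<dots> \<le> e" using e i(2) sqn_eq_integral[of M X] by simp
  finally show ?thesis by (rule real_le_rsqrt)
qed

locale reflected_bsde = brownian_motion M T B
  for M :: "'a measure" and T :: real and B :: "real \<Rightarrow> 'a \<Rightarrow> real ^ 'd" +
  fixes C :: real and \<rho> :: "real \<Rightarrow> ('a \<Rightarrow> real) \<Rightarrow> real" and q :: "real \<Rightarrow> real"
    and f :: "'a \<Rightarrow> real \<Rightarrow> real \<Rightarrow> real ^ 'd \<Rightarrow> real" and \<xi> :: "'a \<Rightarrow> real"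
  assumes rho_static: "\<And>t. t \<in> {0..T} \<Longrightarrow> static_risk_measure M (F t) (\<rho> t)"
    and rho_time: "\<And>X. X \<in> L2 M (F T) \<Longrightarrow> continuous_on {0..T} (\<lambda>t. \<rho> t X)"
    and rho_Lip: "\<And>t X X'. t \<in> {0..T} \<Longrightarrow> X \<in> L2 M (F t) \<Longrightarrow> X' \<in> L2 M (F t) \<Longrightarrow>
      \<bar>\<rho> t X - \<rho> t X'\<bar> \<le> C * (\<integral>w. \<bar>X w - X' w\<bar> \<partial>M)"
    and q_continuous: "continuous_on {0..T} q"
    and generator: "generator_assumption M T F f"
    and xi: "\<xi> \<in> L2 M (F T)"
    and terminal: "\<rho> T \<xi> \<le> q T"
begin

lemma rho_add_const: "t \<in> {0..T} \<Longrightarrow> X \<in> L2 M (F t) \<Longrightarrow> \<rho> t (\<lambda>w. X w + m) = \<rho> t X - m"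
  using rho_static[of t] by (simp add: static_risk_measure_def)

text \<open>\<rho> acts on functions, not on classes; monotonicity in both directions makes it blind
  to null sets.\<close>

lemma rho_cong_AE:
  assumes "t \<in> {0..T}" "X \<in> L2 M (F t)" "X' \<in> L2 M (F t)" "AE w in M. X w = X' w"
  shows "\<rho> t X = \<rho> t X'"
proof -
  have "AE w in M. X w \<le> X' w" "AE w in M. X' w \<le> X w" using assms(4) by auto
  with assms(2,3) rho_static[OF assms(1)] have "\<rho> t X' \<le> \<rho> t X" "\<rho> t X \<le> \<rho> t X'"
    unfolding static_risk_measure_def by blast+
  then show ?thesis by simp
qed

text \<open>A nonnegative Lipschitz constant, so that inequalities can be multiplied by it; no sign
  is prescribed for \<open>C\<close>.\<close>

definition C' :: real where "C' = max C 0"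

lemma C'_nonneg: "0 \<le> C'" by (simp add: C'_def)

lemma rho_dist:
  assumes "t \<in> {0..T}" "X \<in> L2 M (F t)" "X' \<in> L2 M (F t)"
  shows "\<bar>\<rho> t X - \<rho> t X'\<bar> \<le> C' * expectation (\<lambda>w. \<bar>X w - X' w\<bar>)"
proof -
  have "C * expectation (\<lambda>w. \<bar>X w - X' w\<bar>) \<le> C' * expectation (\<lambda>w. \<bar>X w - X' w\<bar>)"
    by (intro mult_right_mono) (auto simp: C'_def)
  with rho_Lip[OF assms] show ?thesis by linarith
qed

text \<open>
  To compare \<open>\<rho> s (Y s)\<close> with \<open>\<rho> t (Y t)\<close> for \<open>s < t\<close> one cannot use \<open>\<rho> s (Y t)\<close>, because \<open>Y t\<close> need not be
  \<open>F s\<close>-measurable; the comparison goes through \<open>Y r\<close> for a time \<open>r < t\<close> that stays below \<open>s\<close>.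
\<close>

lemma rho_continuous:
  assumes Y: "Y \<in> S2 M T F" shows "continuous_on {0..T} (\<lambda>t. \<rho> t (Y t))"
proof -
  have Y2: "Y s \<in> L2 M (F u)" if "s \<in> {0..T}" "s \<le> u" for s u
    using L2_mono[OF S2_D(3)[OF Y that(1)] that(2)] .
  let ?e = "\<lambda>s t. expectation (\<lambda>w. \<bar>Y s w - Y t w\<bar>)"
  have tri: "?e s r \<le> ?e s t + ?e r t" if "s \<in> {0..T}" "r \<in> {0..T}" "t \<in> {0..T}" for s r t
  proof -
    have i: "integrable M (Y u)" if "u \<in> {0..T}" for u using L2_D(4)[OF S2_D(3)[OF Y that]] that by simp
    have "?e s r \<le> expectation (\<lambda>w. \<bar>Y s w - Y t w\<bar> + \<bar>Y r w - Y t w\<bar>)"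
      using i that by (intro integral_mono) auto
    also have "\<dots> = ?e s t + ?e r t" using i that by (intro Bochner_Integration.integral_add) auto
    finally show ?thesis .
  qed
  show ?thesis
    unfolding continuous_on_def
  proof (intro ballI tendstoI)
    fix t and e :: real assume t: "t \<in> {0..T}" and e: "0 < e"
    \<comment> \<open>Chosen so that the errors 2 C' \<eta> at time s, C' \<eta> at time t and e / 4
      for the fixed variable Y_r sum up to less than e.\<close>
    define \<eta> where "\<eta> = e / (4 * (C' + 1))"
    have \<eta>: "0 < \<eta>" "C' * \<eta> < e / 4" using e C'_nonneg by (auto simp: \<eta>_def field_simps)
    have ev: "eventually (\<lambda>s. ?e s t < \<eta>) (at t within {0..T})"
      using order_tendstoD(2)[OF S2_tendsto_L1[OF Y t] \<eta>(1)] .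
    then obtain d where d0: "0 < d" "\<forall>s\<in>{0..T}. s \<noteq> t \<and> dist s t < d \<longrightarrow> ?e s t < \<eta>"
      unfolding eventually_at by (elim exE conjE)
    have d: "?e s t < \<eta>" if "s \<in> {0..T}" "\<bar>s - t\<bar> < d" for s
      using d0 that \<eta>(1) by (cases "s = t") (simp_all add: dist_real_def)
    \<comment> \<open>Half the radius to the left of t, or 0: every s in the interval with |s - t| <
      d / 2 satisfies r \<le> s, so Y_r may be inserted into \<rho> at time s as well as at time
      t.\<close>
    define r where "r = max 0 (t - d / 2)"
    have r: "r \<in> {0..T}" "r \<le> t" "\<bar>r - t\<bar> < d" using t d0(1) by (auto simp: r_def)
    have "((\<lambda>s. \<rho> s (Y r)) \<longlongrightarrow> \<rho> t (Y r)) (at t within {0..T})"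
      using rho_time[OF Y2[of r T]] r t by (auto simp: continuous_on_def)
    then have "eventually (\<lambda>s. \<bar>\<rho> s (Y r) - \<rho> t (Y r)\<bar> < e / 4) (at t within {0..T})"
      using e by (auto dest!: tendstoD[of _ _ _ "e / 4"] simp: dist_real_def)
    moreover have "eventually (\<lambda>s. s \<in> {0..T} \<and> \<bar>s - t\<bar> < d / 2) (at t within {0..T})"
      using d0(1) by (auto simp: eventually_at dist_real_def intro!: exI[of _ "d / 2"])
    ultimately show "eventually (\<lambda>s. dist (\<rho> s (Y s)) (\<rho> t (Y t)) < e) (at t within {0..T})"
    proof eventually_elim
      case (elim s)
      have "0 \<le> s" "\<bar>s - t\<bar> < d / 2" using elim(2) by auto
      then have "t - d / 2 \<le> s" "0 \<le> s" by linarith+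
      then have rs: "r \<le> s" by (simp add: r_def)
      have s: "s \<in> {0..T}" "\<bar>s - t\<bar> < d" using elim(2) d0(1) by auto
      have "\<bar>\<rho> s (Y s) - \<rho> s (Y r)\<bar> \<le> C' * ?e s r"
        by (rule rho_dist[OF s(1) Y2[OF s(1) order_refl] Y2[OF r(1) rs]])
      also have "\<dots> \<le> C' * (\<eta> + \<eta>)"
        using tri[OF s(1) r(1) t] d[OF s] d[OF r(1,3)] by (intro mult_left_mono C'_nonneg) linarith
      finally have 1: "\<bar>\<rho> s (Y s) - \<rho> s (Y r)\<bar> < e / 2" using \<eta>(2) by (simp add: distrib_left)
      have "\<bar>\<rho> t (Y r) - \<rho> t (Y t)\<bar> \<le> C' * ?e r t"
        by (rule rho_dist[OF t Y2[OF r(1,2)] Y2[OF t order_refl]])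
      also have "\<dots> \<le> C' * \<eta>" using d[OF r(1,3)] by (intro mult_left_mono C'_nonneg) simp
      finally have "\<bar>\<rho> t (Y r) - \<rho> t (Y t)\<bar> < e / 4" using \<eta>(2) by simp
      with 1 elim(1) show ?case unfolding dist_real_def by linarith
    qed
  qed
qed

definition gap :: "(real \<Rightarrow> 'a \<Rightarrow> real) \<Rightarrow> real \<Rightarrow> real" where
  "gap X t = \<rho> t (X t) - q t"

definition refl :: "(real \<Rightarrow> 'a \<Rightarrow> real) \<Rightarrow> real \<Rightarrow> real" where
  "refl X = skorokhod T (gap X)"

lemma gap_continuous: "X \<in> S2 M T F \<Longrightarrow> continuous_on {0..T} (gap X)"
  unfolding gap_def by (intro continuous_on_diff rho_continuous q_continuous)

lemma refl_continuous: "X \<in> S2 M T F \<Longrightarrow> continuous_on {0..T} (refl X)"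
  unfolding refl_def by (intro skorokhod_continuous gap_continuous)

lemma refl_dist:
  assumes X: "X \<in> S2 M T F" and X': "X' \<in> S2 M T F" and t: "t \<in> {0..T}" and e: "0 \<le> e"
    and le: "\<And>s. s \<in> {t..T} \<Longrightarrow> sqn M (\<lambda>w. X s w - X' s w) \<le> ennreal e"
  shows "\<bar>refl X t - refl X' t\<bar> \<le> C' * sqrt e"
  unfolding refl_def
proof (rule skorokhod_Lipschitz[OF gap_continuous[OF X] gap_continuous[OF X'] t])
  fix s assume s: "s \<in> {t..T}"
  then have s0: "s \<in> {0..T}" using t by auto
  note Xs = S2_D(3)[OF X s0] S2_D(3)[OF X' s0]
  have "X s \<in> borel_measurable M" "X' s \<in> borel_measurable M" using L2_D(2)[OF Xs(1)] L2_D(2)[OF Xs(2)] s0 by auto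
  then have "expectation (\<lambda>w. \<bar>X s w - X' s w\<bar>) \<le> sqrt e"
    by (intro expectation_abs_le_sqrt borel_measurable_diff e le s)
  then have "C' * expectation (\<lambda>w. \<bar>X s w - X' s w\<bar>) \<le> C' * sqrt e" by (rule mult_left_mono[OF _ C'_nonneg])
  with rho_dist[OF s0 Xs] show "\<bar>gap X s - gap X' s\<bar> \<le> C' * sqrt e" by (simp add: gap_def)
qed

section \<open>The fixed point map on drivers\<close>

definition drv :: "(real \<Rightarrow> 'a \<Rightarrow> real) \<Rightarrow> (real \<Rightarrow> 'a \<Rightarrow> real ^ 'd) \<Rightarrow> 'a \<times> real \<Rightarrow> real" where
  "drv Y Z x = f (fst x) (snd x) (pz Y x) (pz Z x)"

lemma drv_measurable:
  assumes "pz Y \<in> borel_measurable prog" "pz Z \<in> borel_measurable prog"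
  shows "drv Y Z \<in> borel_measurable prog"
proof -
  have f: "(\<lambda>((w, t), y, z). f w t y z) \<in> borel_measurable (prog \<Otimes>\<^sub>M (borel \<Otimes>\<^sub>M borel))"
    using generator by (simp add: generator_assumption_def)
  have "(\<lambda>x. (x, pz Y x, pz Z x)) \<in> prog \<rightarrow>\<^sub>M prog \<Otimes>\<^sub>M (borel \<Otimes>\<^sub>M borel)"
    by (intro measurable_Pair measurable_ident_sets[OF refl] assms)
  from measurable_compose[OF this f] show ?thesis
    by (simp add: drv_def[abs_def] case_prod_beta)
qed

definition lip :: real where
  "lip = (SOME l. 0 \<le> l \<and> (AE w in M. \<forall>t\<in>{0..T}. \<forall>y p z q. \<bar>f w t y z - f w t p q\<bar> \<le> l * (\<bar>y - p\<bar> + norm (z - q))))"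

lemma lip: "0 \<le> lip" "AE w in M. \<forall>t\<in>{0..T}. \<forall>y p z q. \<bar>f w t y z - f w t p q\<bar> \<le> lip * (\<bar>y - p\<bar> + norm (z - q))"
proof -
  have "\<exists>l. 0 \<le> l \<and> (AE w in M. \<forall>t\<in>{0..T}. \<forall>y p z q. \<bar>f w t y z - f w t p q\<bar> \<le> l * (\<bar>y - p\<bar> + norm (z - q)))"
    using generator unfolding generator_assumption_def by blast
  from someI_ex[OF this] show "0 \<le> lip" "AE w in M. \<forall>t\<in>{0..T}. \<forall>y p z q. \<bar>f w t y z - f w t p q\<bar> \<le> lip * (\<bar>y - p\<bar> + norm (z - q))"
    unfolding lip_def by blast+
qed

lemma drv_Lipschitz: "AE x in \<mu>. \<bar>drv Y Z x - drv Y' Z' x\<bar> \<le> lip * (\<bar>pz Y x - pz Y' x\<bar> + norm (pz Z x - pz Z' x))"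
  using AE_mu_const[OF lip(2)] AE_space[of \<mu>]
proof eventually_elim
  case (elim x)
  then have "snd x \<in> {0..T}" by auto
  with elim(1) show ?case by (simp add: drv_def)
qed

lemma drv_sqn_le:
  assumes "pz Y \<in> borel_measurable prog" "pz Z \<in> borel_measurable prog"
    and "pz Y' \<in> borel_measurable prog" "pz Z' \<in> borel_measurable prog"
  shows "wn \<gamma> (\<lambda>x. drv Y Z x - drv Y' Z' x) \<le> ennreal (2 * lip\<^sup>2) * (wn \<gamma> (\<lambda>x. pz Y x - pz Y' x) + wn \<gamma> (\<lambda>x. pz Z x - pz Z' x))"
proof -
  note [measurable] = assms[THEN prog_mu]
  let ?W = "\<lambda>x. ennreal (exp (\<gamma> * snd x))"
  have "wn \<gamma> (\<lambda>x. drv Y Z x - drv Y' Z' x)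
    \<le> (\<integral>\<^sup>+x. ennreal (2 * lip\<^sup>2) * (?W x * ennreal ((norm (pz Y x - pz Y' x))\<^sup>2) + ?W x * ennreal ((norm (pz Z x - pz Z' x))\<^sup>2)) \<partial>\<mu>)"
    unfolding wn_eq
  proof (intro nn_integral_mono_AE)
    show "AE x in \<mu>. ?W x * ennreal ((norm (drv Y Z x - drv Y' Z' x))\<^sup>2)
      \<le> ennreal (2 * lip\<^sup>2) * (?W x * ennreal ((norm (pz Y x - pz Y' x))\<^sup>2) + ?W x * ennreal ((norm (pz Z x - pz Z' x))\<^sup>2))"
      using drv_Lipschitz[of Y Z Y' Z']
    proof eventually_elim
      case (elim x)
      let ?y = "\<bar>pz Y x - pz Y' x\<bar>" and ?z = "norm (pz Z x - pz Z' x)"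
      have "(norm (drv Y Z x - drv Y' Z' x))\<^sup>2 \<le> (lip * (?y + ?z))\<^sup>2" using elim by (intro power_mono) auto
      also have "\<dots> \<le> lip\<^sup>2 * (2 * (?y\<^sup>2 + ?z\<^sup>2))"
        unfolding power_mult_distrib using sum_squares_bound[of ?y ?z]
        by (intro mult_left_mono) (auto simp: power2_sum)
      also have "\<dots> = 2 * lip\<^sup>2 * (?y\<^sup>2 + ?z\<^sup>2)" by simp
      finally have "ennreal ((norm (drv Y Z x - drv Y' Z' x))\<^sup>2) \<le> ennreal (2 * lip\<^sup>2 * (?y\<^sup>2 + ?z\<^sup>2))"
        by (rule ennreal_leI)
      also have "\<dots> = ennreal (2 * lip\<^sup>2) * (ennreal (?y\<^sup>2) + ennreal (?z\<^sup>2))"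
        by (simp add: ennreal_mult ennreal_plus)
      finally have "?W x * ennreal ((norm (drv Y Z x - drv Y' Z' x))\<^sup>2) \<le> ?W x * (ennreal (2 * lip\<^sup>2) * (ennreal (?y\<^sup>2) + ennreal (?z\<^sup>2)))"
        by (rule mult_left_mono) simp
      then show ?case by (simp add: distrib_left mult.left_commute)
    qed
  qed
  also have "\<dots> = ennreal (2 * lip\<^sup>2) * (\<integral>\<^sup>+x. (?W x * ennreal ((norm (pz Y x - pz Y' x))\<^sup>2) + ?W x * ennreal ((norm (pz Z x - pz Z' x))\<^sup>2)) \<partial>\<mu>)"
    by (rule nn_integral_cmult) measurable
  also have "(\<integral>\<^sup>+x. (?W x * ennreal ((norm (pz Y x - pz Y' x))\<^sup>2) + ?W x * ennreal ((norm (pz Z x - pz Z' x))\<^sup>2)) \<partial>\<mu>)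
    = wn \<gamma> (\<lambda>x. pz Y x - pz Y' x) + wn \<gamma> (\<lambda>x. pz Z x - pz Z' x)"
    unfolding wn_eq by (rule nn_integral_add) measurable
  finally show ?thesis .
qed

lemma wn_0: "wn 0 g = sqn \<mu> g" by (simp add: wn_def)

lemma drv_sqn:
  assumes Y: "pz Y \<in> borel_measurable prog" "sqn \<mu> (pz Y) < \<infinity>" and Z: "pz Z \<in> borel_measurable prog" "sqn \<mu> (pz Z) < \<infinity>"
  shows "sqn \<mu> (drv Y Z) < \<infinity>"
proof -
  have 0: "pz (\<lambda>_ _. 0 :: real) \<in> borel_measurable prog" "pz (\<lambda>_ _. 0 :: real ^ 'd) \<in> borel_measurable prog" by auto
  have "sqn \<mu> (\<lambda>x. drv Y Z x - drv (\<lambda>_ _. 0) (\<lambda>_ _. 0) x) \<le> ennreal (2 * lip\<^sup>2) * (sqn \<mu> (pz Y) + sqn \<mu> (pz Z))"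
    using drv_sqn_le[OF Y(1) Z(1) 0, of 0] by (simp add: wn_0)
  also have "\<dots> < \<infinity>" using Y(2) Z(2) by (simp add: ennreal_mult_less_top)
  finally have 1: "sqn \<mu> (\<lambda>x. drv Y Z x - drv (\<lambda>_ _. 0) (\<lambda>_ _. 0) x) < \<infinity>" .
  have 2: "sqn \<mu> (drv (\<lambda>_ _. 0) (\<lambda>_ _. 0)) < \<infinity>"
    using generator sqn_mu[of "\<lambda>t w. f w t 0 0"] prog_mu[OF drv_measurable[OF 0]]
    by (simp add: generator_assumption_def drv_def[abs_def] case_prod_beta')
  have m: "drv Y Z \<in> borel_measurable \<mu>" "drv (\<lambda>_ _. 0) (\<lambda>_ _. 0) \<in> borel_measurable \<mu>"
    by (rule prog_mu[OF drv_measurable[OF Y(1) Z(1)]], rule prog_mu[OF drv_measurable[OF 0]])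
  from sqn_add_finite[OF borel_measurable_diff[OF m] m(2) 1 2] show ?thesis by simp
qed

text \<open>One application of the map, from driver \<open>g\<close> to driver \<open>h\<close>. It
  is a relation because X, Z, I and Y are determined only up to null sets; Y is a progressive
  version of X + R, as composition with f requires.\<close>

definition step :: "('a \<times> real \<Rightarrow> real) \<Rightarrow> (real \<Rightarrow> 'a \<Rightarrow> real) \<Rightarrow> (real \<Rightarrow> 'a \<Rightarrow> real ^ 'd) \<Rightarrow> (real \<Rightarrow> 'a \<Rightarrow> real) \<Rightarrow> (real \<Rightarrow> 'a \<Rightarrow> real) \<Rightarrow> ('a \<times> real \<Rightarrow> real) \<Rightarrow> bool" where
  "step g X Z I Y h \<longleftrightarrow> lin_sol \<xi> g X Z I \<and> pz Y \<in> borel_measurable prog \<and>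
     (AE w in M. \<forall>t\<in>{0..T}. Y t w = X t w + refl X t) \<and> h = drv Y Z"

lemma lin_sol_xi_S2: "lin_sol \<xi> g X Z I \<Longrightarrow> X \<in> S2 M T F"
  using lin_sol_S2 L2_D(2,3)[OF xi] by simp

lemma step_D:
  assumes "step g X Z I Y h"
  shows "lin_sol \<xi> g X Z I" "X \<in> S2 M T F" "pz Y \<in> borel_measurable prog" "pz Z \<in> borel_measurable prog"
    "AE w in M. \<forall>t\<in>{0..T}. Y t w = X t w + refl X t" "h = drv Y Z"
    "(\<lambda>t w. X t w + refl X t) \<in> S2 M T F" "h \<in> borel_measurable prog" "sqn \<mu> h < \<infinity>"
proof -
  show S: "lin_sol \<xi> g X Z I" and Y: "pz Y \<in> borel_measurable prog"
    and YX: "AE w in M. \<forall>t\<in>{0..T}. Y t w = X t w + refl X t" and h: "h = drv Y Z"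
    using assms by (auto simp: step_def)
  show X: "X \<in> S2 M T F" by (rule lin_sol_xi_S2[OF S])
  show Z: "pz Z \<in> borel_measurable prog" by (rule pred_prog[OF lin_solD(3)[OF S]])
  show XR: "(\<lambda>t w. X t w + refl X t) \<in> S2 M T F"
    by (rule S2_add[OF X S2_deterministic[OF refl_continuous[OF X]]])
  show "h \<in> borel_measurable prog" unfolding h by (rule drv_measurable[OF Y Z])
  show "sqn \<mu> h < \<infinity>" unfolding h
    by (rule drv_sqn[OF Y S2_sqn_mu[OF XR YX] Z lin_solD(4)[OF S]])
qed

lemma step_exists:
  assumes "g \<in> borel_measurable prog" "sqn \<mu> g < \<infinity>"
  shows "\<exists>X Z I Y h. step g X Z I Y h"
proof -
  have "\<xi> \<in> borel_measurable (F T)" "sqn M \<xi> < \<infinity>" using L2_D(1,3)[OF xi] by auto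
  from lin_sol_exists[OF this assms] obtain X Z I where S: "lin_sol \<xi> g X Z I" .
  note X = lin_sol_xi_S2[OF S]
  have XR: "(\<lambda>t w. X t w + refl X t) \<in> S2 M T F"
    by (rule S2_add[OF X S2_deterministic[OF refl_continuous[OF X]]])
  from prog_modification[OF S2_D(1,2)[OF XR]] obtain Y where
    "pz Y \<in> borel_measurable prog" "AE w in M. \<forall>t\<in>{0..T}. Y t w = X t w + refl X t" .
  with S show ?thesis unfolding step_def by blast
qed

text \<open>The map multiplies squared weighted distances by at most 2 \<open>lip\<close>^2 (2 T (1
  + C'^2) + 5) / \<beta>, where 5 comes from Z and the other term from Y. The choice of \<beta>
  makes this at most 1/16, and the final 1 keeps \<beta> positive when \<open>lip\<close> is
  0.\<close>

definition \<beta> :: real where "\<beta> = 32 * lip\<^sup>2 * (2 * T * (1 + C'\<^sup>2) + 5) + 1"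

lemma \<beta>_pos: "0 < \<beta>" unfolding \<beta>_def using horizon_pos by (intro add_nonneg_pos mult_nonneg_nonneg add_nonneg_nonneg) auto

lemma step_contraction:
  assumes "step g X Z I Y h" "step g' X' Z' I' Y' h'"
  shows "wn \<beta> (\<lambda>x. h x - h' x) \<le> ennreal (1/16) * wn \<beta> (\<lambda>x. g x - g' x)"
proof -
  note s = step_D[OF assms(1)] and s' = step_D[OF assms(2)]
  note g = lin_solD(1,2)[OF s(1)] and g' = lin_solD(1,2)[OF s'(1)]
  have D: "lin_sol (\<lambda>_. 0) (\<lambda>x. g x - g' x) (\<lambda>t w. X t w - X' t w) (\<lambda>t w. Z t w - Z' t w) (\<lambda>t w. I t w - I' t w)"
    using lin_sol_diff[OF s(1) s'(1)] by simp
  have "wn \<beta> (\<lambda>x. g x - g' x) < \<infinity>"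
    using \<beta>_pos by (intro wn_finite borel_measurable_diff prog_mu g(1) g'(1) sqn_diff_finite g(2) g'(2)) auto
  then obtain W where W: "0 \<le> W" "wn \<beta> (\<lambda>x. g x - g' x) = ennreal W"
    by (cases "wn \<beta> (\<lambda>x. g x - g' x)") auto
  \<comment> \<open>Decreasing in t: the value at t bounds the squared L^2 distances at all later
    times, as \<open>refl_dist\<close> requires.\<close>
  let ?e = "\<lambda>t. exp (- \<beta> * t) * W / \<beta>"
  have e0: "0 \<le> ?e t" for t using W(1) \<beta>_pos by simp
  have dX: "sqn M (\<lambda>w. X t w - X' t w) \<le> ennreal (?e t)" if t: "t \<in> {0..T}" for t
  proof -
    have "ennreal (exp (- \<beta> * t)) * (ennreal (exp (\<beta> * t)) * sqn M (\<lambda>w. X t w - X' t w)) \<le> ennreal (exp (- \<beta> * t)) * (ennreal (1 / \<beta>) * ennreal W)"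
      using lin_sol_estimate_X[OF D t \<beta>_pos] unfolding W(2) by (intro mult_left_mono) auto
    also have "ennreal (exp (- \<beta> * t)) * (ennreal (exp (\<beta> * t)) * sqn M (\<lambda>w. X t w - X' t w)) = sqn M (\<lambda>w. X t w - X' t w)"
      by (subst ennreal_mult_assoc) (auto simp flip: exp_add)
    also have "ennreal (exp (- \<beta> * t)) * (ennreal (1 / \<beta>) * ennreal W) = ennreal (?e t)"
      using W(1) \<beta>_pos by (simp add: ennreal_mult[symmetric] del: ennreal_mult)
    finally show ?thesis .
  qed
  have dR: "\<bar>refl X t - refl X' t\<bar> \<le> C' * sqrt (?e t)" if t: "t \<in> {0..T}" for t
  proof (rule refl_dist[OF s(2) s'(2) t e0])
    fix u assume u: "u \<in> {t..T}"
    then have "ennreal (?e u) \<le> ennreal (?e t)"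
      using \<beta>_pos W(1) by (intro ennreal_leI divide_right_mono mult_right_mono) auto
    moreover have "u \<in> {0..T}" using u t by auto
    ultimately show "sqn M (\<lambda>w. X u w - X' u w) \<le> ennreal (?e t)" using dX by (blast intro: order_trans)
  qed
  have dY: "ennreal (exp (\<beta> * t)) * sqn M (\<lambda>w. Y t w - Y' t w) \<le> ennreal (2 * (1 + C'\<^sup>2) * (W / \<beta>))" if t: "t \<in> {0..T}" for t
  proof -
    have Xm: "X t \<in> borel_measurable M" "X' t \<in> borel_measurable M"
      using L2_D(2)[OF S2_D(3)[OF s(2) t]] L2_D(2)[OF S2_D(3)[OF s'(2) t]] t by auto
    have "sqn M (\<lambda>w. Y t w - Y' t w) = sqn M (\<lambda>w. (X t w - X' t w) + (refl X t - refl X' t))"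
      by (rule sqn_cong_AE) (use s(5) s'(5) in eventually_elim, use t in simp)
    also have "\<dots> \<le> 2 * sqn M (\<lambda>w. X t w - X' t w) + 2 * sqn M (\<lambda>w. refl X t - refl X' t)"
      using Xm by (intro sqn_add) auto
    also have "\<dots> \<le> 2 * ennreal (?e t) + 2 * ennreal (C'\<^sup>2 * ?e t)"
    proof (intro add_mono mult_left_mono dX t)
      have "(refl X t - refl X' t)\<^sup>2 \<le> (C' * sqrt (?e t))\<^sup>2" using power_mono[OF dR[OF t], of 2] by simp
      also have "(C' * sqrt (?e t))\<^sup>2 = C'\<^sup>2 * ?e t" by (simp only: power_mult_distrib real_sqrt_pow2[OF e0])
      finally show "sqn M (\<lambda>w. refl X t - refl X' t) \<le> ennreal (C'\<^sup>2 * ?e t)"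
        unfolding sqn_real by (simp only: nn_integral_const emeasure_space_1 mult_1_right) (rule ennreal_leI)
    qed auto
    also have "\<dots> = ennreal (2 * ?e t + 2 * (C'\<^sup>2 * ?e t))" by (intro ennreal_double_add mult_nonneg_nonneg[OF _ e0] e0) simp
    also have "2 * ?e t + 2 * (C'\<^sup>2 * ?e t) = exp (- \<beta> * t) * (2 * (1 + C'\<^sup>2) * (W / \<beta>))" by (simp add: algebra_simps)
    finally have "ennreal (exp (\<beta> * t)) * sqn M (\<lambda>w. Y t w - Y' t w) \<le> ennreal (exp (\<beta> * t)) * ennreal (exp (- \<beta> * t) * (2 * (1 + C'\<^sup>2) * (W / \<beta>)))"
      by (rule mult_left_mono) simp
    also have "\<dots> = ennreal (exp (\<beta> * t) * (exp (- \<beta> * t) * (2 * (1 + C'\<^sup>2) * (W / \<beta>))))"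
      using W(1) \<beta>_pos by (intro ennreal_mult[symmetric]) auto
    also have "exp (\<beta> * t) * (exp (- \<beta> * t) * (2 * (1 + C'\<^sup>2) * (W / \<beta>))) = 2 * (1 + C'\<^sup>2) * (W / \<beta>)"
      by (simp add: mult.assoc[symmetric] flip: exp_add)
    finally show ?thesis .
  qed
  have wY: "wn \<beta> (\<lambda>x. pz Y x - pz Y' x) \<le> ennreal (2 * (1 + C'\<^sup>2) * (W / \<beta>) * T)"
  proof -
    have m: "(\<lambda>x. pz Y x - pz Y' x) \<in> borel_measurable \<mu>" by (intro borel_measurable_diff prog_mu s(3) s'(3))
    have "wn \<beta> (\<lambda>x. pz Y x - pz Y' x) \<le> (\<integral>\<^sup>+s. ennreal (2 * (1 + C'\<^sup>2) * (W / \<beta>)) \<partial>L)"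
      unfolding wn_iterated[OF m] using dY by (intro nn_integral_mono) simp
    also have "\<dots> = ennreal (2 * (1 + C'\<^sup>2) * (W / \<beta>)) * ennreal T"
      using horizon_pos by (simp add: emeasure_restrict_space)
    also have "\<dots> = ennreal (2 * (1 + C'\<^sup>2) * (W / \<beta>) * T)"
      using W(1) \<beta>_pos horizon_pos by (intro ennreal_mult[symmetric]) auto
    finally show ?thesis .
  qed
  have wZ: "wn \<beta> (\<lambda>x. pz Z x - pz Z' x) \<le> ennreal (5 / \<beta> * W)"
    using lin_sol_estimate_Z[OF D \<beta>_pos] W \<beta>_pos by (simp add: ennreal_mult[symmetric] del: ennreal_mult)
  have "wn \<beta> (\<lambda>x. h x - h' x) \<le> ennreal (2 * lip\<^sup>2) * (wn \<beta> (\<lambda>x. pz Y x - pz Y' x) + wn \<beta> (\<lambda>x. pz Z x - pz Z' x))"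
    unfolding s(6) s'(6) by (rule drv_sqn_le[OF s(3,4) s'(3,4)])
  also have "\<dots> \<le> ennreal (2 * lip\<^sup>2) * (ennreal (2 * (1 + C'\<^sup>2) * (W / \<beta>) * T) + ennreal (5 / \<beta> * W))"
    by (intro mult_left_mono add_mono wY wZ) simp
  also have "\<dots> = ennreal (2 * lip\<^sup>2 * (2 * (1 + C'\<^sup>2) * (W / \<beta>) * T + 5 / \<beta> * W))"
  proof -
    have "ennreal c * (ennreal a + ennreal b) = ennreal (c * (a + b))" if "0 \<le> a" "0 \<le> b" "0 \<le> c" for a b c
      using that by (simp add: ennreal_mult ennreal_plus)
    then show ?thesis using W(1) \<beta>_pos horizon_pos by simp
  qed
  also have "\<dots> \<le> ennreal (1/16 * W)"
  proof (rule ennreal_leI)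
    have "2 * lip\<^sup>2 * (2 * (1 + C'\<^sup>2) * (W / \<beta>) * T + 5 / \<beta> * W) = 32 * lip\<^sup>2 * (2 * T * (1 + C'\<^sup>2) + 5) * (W / (16 * \<beta>))"
      using \<beta>_pos by (simp add: field_simps)
    also have "\<dots> \<le> \<beta> * (W / (16 * \<beta>))" using W(1) \<beta>_pos by (intro mult_right_mono) (auto simp: \<beta>_def)
    also have "\<dots> = 1/16 * W" using \<beta>_pos by simp
    finally show "2 * lip\<^sup>2 * (2 * (1 + C'\<^sup>2) * (W / \<beta>) * T + 5 / \<beta> * W) \<le> 1/16 * W" .
  qed
  also have "\<dots> = ennreal (1/16) * wn \<beta> (\<lambda>x. g x - g' x)" unfolding W(2) using W(1) by (intro ennreal_mult) auto
  finally show ?thesis .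
qed

lemma H2_iff: "Z \<in> H2 M T F \<longleftrightarrow> pz Z \<in> borel_measurable pred \<and> sqn \<mu> (pz Z) < \<infinity>"
proof (cases "pz Z \<in> borel_measurable pred")
  case True
  from pred_mu[OF this] sqn_mu[of Z] True show ?thesis by (simp add: H2_def case_prod_beta')
next
  case False
  then show ?thesis by (simp add: H2_def case_prod_beta')
qed

lemma set_integral_cong_AE_L:
  fixes g h :: "real \<Rightarrow> real"
  assumes "g \<in> borel_measurable L" "h \<in> borel_measurable L" "AE s in L. g s = h s" and t: "t \<in> {0..T}"
  shows "(LBINT s:{t..T}. g s) = (LBINT s:{t..T}. h s)"
proof -
  have eq: "(LBINT s:{t..T}. u s) = (\<integral>s. indicator {t..T} s * u s \<partial>L)" for u :: "real \<Rightarrow> real"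
    using t by (subst integral_restrict_space)
      (auto simp: set_lebesgue_integral_def indicator_def intro!: Bochner_Integration.integral_cong)
  have i: "(\<lambda>s. indicator {t..T} s :: real) \<in> borel_measurable L" by (rule measurable_restrict_space1) simp
  show ?thesis unfolding eq
  proof (rule integral_cong_AE)
    show "AE s in L. indicator {t..T} s * g s = indicator {t..T} s * h s" using assms(3) by eventually_elim simp
  qed (intro borel_measurable_times i assms)+
qed

lemma indistinguishable:
  assumes Y: "continuous_process M T Y" "continuous_process M T Y'" and eq: "\<And>t. t \<in> {0..T} \<Longrightarrow> AE w in M. Y t w = Y' t w"
  shows "AE w in M. \<forall>t\<in>{0..T}. Y t w = Y' t w"
proof -
  have "AE w in M. \<forall>t\<in>dense_times. Y t w = Y' t w"
    using eq dense_times(2) by (subst AE_ball_countable[OF dense_times(1)]) auto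
  then show ?thesis
    using Y unfolding continuous_process_def
  proof eventually_elim
    case (elim w)
    show ?case
    proof
      fix t assume t: "t \<in> {0..T}"
      have "\<bar>Y t w - Y' t w\<bar> \<le> 0"
        by (rule dense_bound[OF continuous_on_diff[OF elim(2,3)] dense_times(2,3) _ t]) (use elim(1) in simp)
      then show "Y t w = Y' t w" by simp
    qed
  qed
qed

end

lemma flat_on_cong:
  assumes "\<And>t. t \<in> {0..T} \<Longrightarrow> \<delta> t = \<delta>' t" shows "flat_on T \<delta> K \<longleftrightarrow> flat_on T \<delta>' K"
proof -
  have "(\<lambda>t. indicator {0..T} t *\<^sub>R \<delta> t) = (\<lambda>t. indicator {0..T} t *\<^sub>R \<delta>' t)"
    using assms by (intro ext) (simp add: indicator_def)
  then show ?thesis by (simp only: flat_on_def set_integrable_def set_lebesgue_integral_def)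
qed

context reflected_bsde
begin

text \<open>Picard iteration from the zero driver. Drivers are compared in L^2, so the limit is
  reproduced almost everywhere, and the conclusion keeps g and h apart.\<close>

lemma fixed_driver_exists: "\<exists>g X Z I Y h. step g X Z I Y h \<and> (AE x in \<mu>. h x = g x)"
proof -
  \<comment> \<open>A choice of output turns the relation \<open>step\<close> into a map that can be
    iterated.\<close>
  define nxt where "nxt g = (SOME h. \<exists>X Z I Y. step g X Z I Y h)" for g
  define G where "G n = (nxt ^^ n) (\<lambda>_. 0)" for n
  have st: "\<exists>X Z I Y. step g X Z I Y (nxt g)" if "g \<in> borel_measurable prog" "sqn \<mu> g < \<infinity>" for g
  proof -
    have "\<exists>h X Z I Y. step g X Z I Y h" using step_exists[OF that] by blast
    from someI_ex[OF this] show ?thesis by (simp add: nxt_def)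
  qed
  have G: "G n \<in> borel_measurable prog \<and> sqn \<mu> (G n) < \<infinity>" for n
  proof (induction n)
    case (Suc n)
    then obtain X Z I Y where "step (G n) X Z I Y (nxt (G n))" using st by blast
    from step_D(8,9)[OF this] show ?case by (simp add: G_def)
  qed (simp add: G_def)
  have Gs: "\<exists>X Z I Y. step (G n) X Z I Y (G (Suc n))" for n
    using st G[of n] by (simp add: G_def)
  note Gm = prog_mu[OF conjunct1[OF G]]
  have fin: "wn \<beta> (\<lambda>x. G 0 x - G 1 x) < \<infinity>"
    using \<beta>_pos G by (intro wn_finite borel_measurable_diff Gm sqn_diff_finite) auto
  then obtain c where c: "0 \<le> c" "wn \<beta> (\<lambda>x. G 0 x - G 1 x) = ennreal c"
    by (cases "wn \<beta> (\<lambda>x. G 0 x - G 1 x)") auto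
  have dec: "wn \<beta> (\<lambda>x. G n x - G (Suc n) x) \<le> ennreal (c * (1/16)^n)" for n
  proof (induction n)
    case (Suc n)
    obtain X Z I Y where s: "step (G n) X Z I Y (G (Suc n))" using Gs by blast
    obtain X' Z' I' Y' where s': "step (G (Suc n)) X' Z' I' Y' (G (Suc (Suc n)))" using Gs by blast
    have "wn \<beta> (\<lambda>x. G (Suc n) x - G (Suc (Suc n)) x) \<le> ennreal (1/16) * wn \<beta> (\<lambda>x. G n x - G (Suc n) x)"
      by (rule step_contraction[OF s s'])
    also have "\<dots> \<le> ennreal (1/16) * ennreal (c * (1/16)^n)" by (rule mult_left_mono[OF Suc]) simp
    also have "\<dots> = ennreal (1/16 * (c * (1/16)^n))" using c(1) by (intro ennreal_mult[symmetric]) auto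
    also have "1/16 * (c * (1/16)^n) = c * (1/16)^Suc n" by simp
    finally show ?case .
  qed (use c in simp)
  have dec': "sqn \<mu> (\<lambda>x. G n x - G (Suc n) x) \<le> ennreal (c * (1/4)^n)" for n
  proof -
    have "sqn \<mu> (\<lambda>x. G n x - G (Suc n) x) \<le> wn \<beta> (\<lambda>x. G n x - G (Suc n) x)" using \<beta>_pos by (intro wn_ge) simp
    also note dec
    also have "ennreal (c * (1/16)^n) \<le> ennreal (c * (1/4)^n)"
      using c(1) by (intro ennreal_leI mult_left_mono power_mono) auto
    finally show ?thesis .
  qed
  obtain g where g: "g \<in> borel_measurable prog" "\<And>n. sqn \<mu> (\<lambda>x. G n x - g x) \<le> ennreal (4 * c * (1/4)^n)"
    by (rule L2_complete[OF subalgebra_prog conjunct1[OF G] dec' c(1)]) auto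
  note gm = prog_mu[OF g(1)]
  have lim: "(\<lambda>n. ennreal (a * (1/4)^n)) \<longlonglongrightarrow> 0" for a
    using tendsto_ennrealI[OF tendsto_mult[OF tendsto_const[of a] LIMSEQ_power_zero[of "1/4::real"]]] by simp
  have gfin: "sqn \<mu> g < \<infinity>"
  proof -
    have "sqn \<mu> (\<lambda>x. G 0 x - g x) < \<infinity>" using g(2)[of 0] by (rule le_less_trans) simp
    from sqn_diff_finite[OF Gm[of 0] borel_measurable_diff[OF Gm[of 0] gm] conjunct2[OF G] this] show ?thesis by simp
  qed
  obtain X Z I Y h where s: "step g X Z I Y h" using step_exists[OF g(1) gfin] by blast
  note hm = prog_mu[OF step_D(8)[OF s]]
  have "sqn \<mu> (\<lambda>x. h x - g x) \<le> ennreal (2 * (exp (\<beta> * T) * (4 * c) * (1/4)^n) + 2 * (4 * c * (1/4)^n))" for n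
  proof -
    obtain X' Z' I' Y' where s': "step (G n) X' Z' I' Y' (G (Suc n))" using Gs by blast
    have "sqn \<mu> (\<lambda>x. h x - G (Suc n) x) \<le> wn \<beta> (\<lambda>x. h x - G (Suc n) x)" using \<beta>_pos by (intro wn_ge) simp
    also have "\<dots> \<le> ennreal (1/16) * wn \<beta> (\<lambda>x. g x - G n x)" by (rule step_contraction[OF s s'])
    \<comment> \<open>Convergence of the iterates is known in the unweighted norm; passing to it
      costs exp(\<beta> T), and the factor 1/16 is relaxed to 1.\<close>
    also have "\<dots> \<le> 1 * (ennreal (exp (\<beta> * T)) * sqn \<mu> (\<lambda>x. g x - G n x))"
      using \<beta>_pos gm Gm by (intro mult_mono wn_le borel_measurable_diff) (auto simp: ennreal_le_1)
    also have "\<dots> \<le> 1 * (ennreal (exp (\<beta> * T)) * ennreal (4 * c * (1/4)^n))"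
      using g(2)[of n] unfolding sqn_commute[of \<mu> g] by (intro mult_left_mono) auto
    also have "\<dots> = ennreal (exp (\<beta> * T) * (4 * c) * (1/4)^n)" using c(1) by (simp add: ennreal_mult[symmetric] mult.assoc)
    finally have 1: "sqn \<mu> (\<lambda>x. h x - G (Suc n) x) \<le> ennreal (exp (\<beta> * T) * (4 * c) * (1/4)^n)" .
    have 2: "sqn \<mu> (\<lambda>x. G (Suc n) x - g x) \<le> ennreal (4 * c * (1/4)^n)"
      by (rule order_trans[OF g(2)]) (use c(1) in \<open>auto intro!: ennreal_leI mult_left_mono\<close>)
    have "sqn \<mu> (\<lambda>x. h x - g x) \<le> 2 * sqn \<mu> (\<lambda>x. h x - G (Suc n) x) + 2 * sqn \<mu> (\<lambda>x. G (Suc n) x - g x)"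
      by (rule sqn_triangle[OF hm Gm gm])
    also have "\<dots> \<le> 2 * ennreal (exp (\<beta> * T) * (4 * c) * (1/4)^n) + 2 * ennreal (4 * c * (1/4)^n)"
      by (intro add_mono mult_left_mono 1 2) auto
    also have "\<dots> = ennreal (2 * (exp (\<beta> * T) * (4 * c) * (1/4)^n) + 2 * (4 * c * (1/4)^n))"
      using c(1) by (intro ennreal_double_add) auto
    finally show ?thesis .
  qed
  also have "2 * (exp (\<beta> * T) * (4 * c) * (1/4)^n) + 2 * (4 * c * (1/4)^n) = (2 * exp (\<beta> * T) * 4 * c + 8 * c) * (1/4)^n" for n
    by (simp add: algebra_simps)
  finally have "sqn \<mu> (\<lambda>x. h x - g x) \<le> 0"
    by (intro LIMSEQ_le_const[OF lim[of "2 * exp (\<beta> * T) * 4 * c + 8 * c"]]) auto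
  then have "AE x in \<mu>. h x - g x = 0" using sqn_zero_iff[OF borel_measurable_diff[OF hm gm]] by simp
  then have "AE x in \<mu>. h x = g x" by eventually_elim simp
  with s show ?thesis by blast
qed

text \<open>X_T = \<xi> almost surely, so this is the assumption on the terminal value. It makes R
  vanish at T, and X + R then has terminal value \<xi>.\<close>

lemma gap_T_nonpos:
  assumes "lin_sol \<xi> g X Z I" shows "gap X T \<le> 0"
proof -
  have "AE w in M. X T w = \<xi> w"
    using lin_solD(7)[OF assms]
  proof eventually_elim
    case (elim w)
    have "(LBINT s:{T..T}. g (w, s)) = 0"
      unfolding set_lebesgue_integral_def
      by (intro integral_eq_zero_AE) (use AE_lborel_singleton[of T] in eventually_elim, simp)
    with bspec[OF elim T_mem] show ?case by simp
  qed
  from rho_cong_AE[OF T_mem S2_D(3)[OF lin_sol_xi_S2[OF assms] T_mem] xi this] terminal show ?thesis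
    by (simp add: gap_def)
qed

lemma rho_diff_const: "t \<in> {0..T} \<Longrightarrow> X \<in> L2 M (F t) \<Longrightarrow> \<rho> t (\<lambda>w. X w - m) = \<rho> t X + m"
  using rho_add_const[of t X "- m"] by simp

lemma flat_iff: "flat T \<rho> q Y K \<longleftrightarrow> flat_on T (\<lambda>t. q t - \<rho> t (Y t)) K"
  by (simp add: flat_def flat_on_def)

lemma flat_solution_of_step:
  assumes s: "step g X Z I Y h" and gh: "AE x in \<mu>. h x = g x"
  shows "deterministic_flat_solution M T B \<rho> q f \<xi> (\<lambda>t w. X t w + refl X t) Z (\<lambda>t. refl X 0 - refl X t)"
proof -
  note d = step_D[OF s] and l = lin_solD[OF step_D(1)[OF s]]
  note gc = gap_continuous[OF d(2)] and rc = refl_continuous[OF d(2)]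
  have rT: "refl X T = 0" unfolding refl_def using gap_T_nonpos[OF d(1)] horizon_pos by (intro skorokhod_T gc) auto
  have rho: "\<rho> t (\<lambda>w. X t w + refl X t) = \<rho> t (X t) - refl X t" if "t \<in> {0..T}" for t
    by (rule rho_add_const[OF that S2_D(3)[OF d(2) that]])
  \<comment> \<open>Off one null set the version I may be exchanged for \<open>ito_integral\<close>
    and, by Fubini, h for g under the time integral.\<close>
  have "AE w in M. \<forall>t\<in>{0..T}. X t w + refl X t = \<xi> w + (LBINT s:{t..T}. f w s (X s w + refl X s) (Z s w))
      - (ito_integral M T B Z T w - ito_integral M T B Z t w) + (refl X 0 - refl X T) - (refl X 0 - refl X t)"
    using l(7) d(5) ito_AE_eq[OF pred_mu[OF l(3)] pred_mu[OF l(3)] l(5) ito_integral_ito[OF l(3,4)] AE_I2[OF HOL.refl]] AE_mu_iterated[OF gh] AE_space[of M]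
  proof eventually_elim
    case (elim w)
    note gL = measurable_compose[OF measurable_Pair1'[OF elim(5)] prog_mu[OF l(1)]]
      and hL = measurable_compose[OF measurable_Pair1'[OF elim(5)] prog_mu[OF d(8)]]
    show ?case
    proof
      fix t assume t: "t \<in> {0..T}"
      have "(LBINT s:{t..T}. f w s (X s w + refl X s) (Z s w)) = (LBINT s:{t..T}. h (w, s))"
        by (rule set_lebesgue_integral_cong) (use t elim(2) in \<open>auto simp: d(6) drv_def\<close>)
      also have "\<dots> = (LBINT s:{t..T}. g (w, s))"
        by (rule set_integral_cong_AE_L[OF hL gL _ t]) (rule elim(4))
      finally show "X t w + refl X t = \<xi> w + (LBINT s:{t..T}. f w s (X s w + refl X s) (Z s w))
        - (ito_integral M T B Z T w - ito_integral M T B Z t w) + (refl X 0 - refl X T) - (refl X 0 - refl X t)"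
        using bspec[OF elim(1) t] bspec[OF elim(3) t] bspec[OF elim(3) T_mem] rT by simp
    qed
  qed
  moreover have "(\<lambda>t. refl X 0 - refl X t) \<in> A2D M T F"
    unfolding A2D_iff
  proof (intro conjI continuous_on_diff continuous_on_const rc mono_onI)
    fix s t assume "s \<in> {0..T}" "t \<in> {0..T}" "s \<le> t"
    then show "refl X 0 - refl X s \<le> refl X 0 - refl X t"
      using skorokhod_antimono[OF gc, of s t] by (simp add: refl_def)
  qed simp
  moreover have "\<forall>t\<in>{0..T}. \<rho> t (\<lambda>w. X t w + refl X t) \<le> q t"
  proof
    fix t assume t: "t \<in> {0..T}"
    have "gap X t \<le> refl X t" unfolding refl_def using t by (intro skorokhod_ge[OF gc]) auto
    then show "\<rho> t (\<lambda>w. X t w + refl X t) \<le> q t" by (simp add: rho[OF t] gap_def)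
  qed
  moreover have "flat T \<rho> q (\<lambda>t w. X t w + refl X t) (\<lambda>t. refl X 0 - refl X t)"
  proof -
    have "flat_on T (\<lambda>t. refl X t - gap X t) (\<lambda>t. refl X 0 - refl X t)"
      unfolding refl_def by (rule skorokhod_flat[OF horizon_pos gc])
    then show ?thesis
      unfolding flat_iff by (subst flat_on_cong[where \<delta>' = "\<lambda>t. refl X t - gap X t"]) (simp_all add: rho gap_def)
  qed
  ultimately show ?thesis
    unfolding deterministic_flat_solution_def deterministic_solution_def H2_iff using d(7) l(3,4) by simp
qed

text \<open>Moving the deterministic K_T - K_t to the left leaves a linear equation. Stated for all
  deterministic solutions, it also serves the competitors in the minimality statement; Y' makes the
  driver progressively measurable.\<close>

lemma solution_lin_sol:
  assumes "deterministic_solution M T B \<rho> q f \<xi> Y Z K"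
  obtains Y' where "pz Y' \<in> borel_measurable prog" "AE w in M. \<forall>t\<in>{0..T}. Y' t w = Y t w"
    "lin_sol \<xi> (drv Y' Z) (\<lambda>t w. Y t w - (K T - K t)) Z (ito_integral M T B Z)"
    "continuous_on {0..T} K" "K 0 = 0" "mono_on {0..T} K" "Y \<in> S2 M T F"
proof -
  have Y: "Y \<in> S2 M T F" and Z: "pz Z \<in> borel_measurable pred" "sqn \<mu> (pz Z) < \<infinity>"
    and K: "continuous_on {0..T} K" "K 0 = 0" "mono_on {0..T} K"
    and eq: "AE w in M. \<forall>t\<in>{0..T}. Y t w = \<xi> w + (LBINT s:{t..T}. f w s (Y s w) (Z s w))
          - (ito_integral M T B Z T w - ito_integral M T B Z t w) + K T - K t"
    using assms unfolding deterministic_solution_def H2_iff A2D_iff by auto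
  obtain Y' where Y': "pz Y' \<in> borel_measurable prog" "AE w in M. \<forall>t\<in>{0..T}. Y' t w = Y t w"
    using prog_modification[OF S2_D(1,2)[OF Y]] .
  have "AE w in M. \<forall>t\<in>{0..T}. Y t w - (K T - K t) = \<xi> w + (LBINT s:{t..T}. drv Y' Z (w, s))
          - (ito_integral M T B Z T w - ito_integral M T B Z t w)"
    using eq Y'(2)
  proof eventually_elim
    case (elim w)
    show ?case
    proof
      fix t assume t: "t \<in> {0..T}"
      have "(LBINT s:{t..T}. f w s (Y s w) (Z s w)) = (LBINT s:{t..T}. drv Y' Z (w, s))"
        by (rule set_lebesgue_integral_cong) (use t elim(2) in \<open>auto simp: drv_def\<close>)
      then show "Y t w - (K T - K t) = \<xi> w + (LBINT s:{t..T}. drv Y' Z (w, s))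
          - (ito_integral M T B Z T w - ito_integral M T B Z t w)"
        using bspec[OF elim(1) t] by simp
    qed
  qed
  moreover have "adapted T F (\<lambda>t w. Y t w - (K T - K t))"
    using S2_D(1)[OF Y] by (simp add: adapted_def borel_measurable_diff)
  moreover have "drv Y' Z \<in> borel_measurable prog" by (rule drv_measurable[OF Y'(1) pred_prog[OF Z(1)]])
  moreover have "sqn \<mu> (drv Y' Z) < \<infinity>" by (rule drv_sqn[OF Y'(1) S2_sqn_mu[OF Y Y'(2)] pred_prog[OF Z(1)] Z(2)])
  ultimately have "lin_sol \<xi> (drv Y' Z) (\<lambda>t w. Y t w - (K T - K t)) Z (ito_integral M T B Z)"
    unfolding lin_sol_def using Z ito_integral_ito[OF Z] by simp
  from that[OF Y' this K Y] show thesis .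
qed

text \<open>Uniqueness in the Skorokhod problem identifies K_T - K_t with the reflection term. A
  flat solution is thus a fixed point whose input and output drivers coincide everywhere.\<close>

lemma step_of_flat_solution:
  assumes s: "deterministic_flat_solution M T B \<rho> q f \<xi> Y Z K"
  obtains g Y' where "step g (\<lambda>t w. Y t w - (K T - K t)) Z (ito_integral M T B Z) Y' g"
    "\<forall>t\<in>{0..T}. refl (\<lambda>t w. Y t w - (K T - K t)) t = K T - K t"
    "K 0 = 0" "Y \<in> S2 M T F"
proof -
  have ds: "deterministic_solution M T B \<rho> q f \<xi> Y Z K" and fl: "flat T \<rho> q Y K"
    using s by (auto simp: deterministic_flat_solution_def)
  obtain Y' where d: "pz Y' \<in> borel_measurable prog" "AE w in M. \<forall>t\<in>{0..T}. Y' t w = Y t w"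
    "lin_sol \<xi> (drv Y' Z) (\<lambda>t w. Y t w - (K T - K t)) Z (ito_integral M T B Z)"
    "continuous_on {0..T} K" "K 0 = 0" "mono_on {0..T} K" "Y \<in> S2 M T F"
    by (rule solution_lin_sol[OF ds])
  let ?X = "\<lambda>t w. Y t w - (K T - K t)"
  note X = lin_sol_xi_S2[OF d(3)]
  have gap: "gap ?X t = \<rho> t (Y t) + (K T - K t) - q t" if t: "t \<in> {0..T}" for t
    using rho_diff_const[OF t S2_D(3)[OF d(7) t]] by (simp add: gap_def)
  have r: "refl ?X t = K T - K t" if t: "t \<in> {0..T}" for t
    unfolding refl_def
  proof (rule skorokhod_unique[OF horizon_pos gap_continuous[OF X] d(4,6) _ _ t, symmetric])
    show "gap ?X t \<le> K T - K t" if "t \<in> {0..T}" for t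
      using ds that by (simp add: gap deterministic_solution_def)
    show "flat_on T (\<lambda>t. K T - K t - gap ?X t) K"
      using fl unfolding flat_iff by (subst flat_on_cong[where \<delta>' = "\<lambda>t. q t - \<rho> t (Y t)"]) (simp_all add: gap)
  qed
  have "step (drv Y' Z) ?X Z (ito_integral M T B Z) Y' (drv Y' Z)"
    unfolding step_def using d(1-3) by (auto simp: r elim!: eventually_mono)
  moreover have "\<forall>t\<in>{0..T}. refl ?X t = K T - K t" using r by blast
  ultimately show thesis using d(5,7) by (rule that)
qed

lemma flat_solution_unique:
  assumes "deterministic_flat_solution M T B \<rho> q f \<xi> Y Z K" "deterministic_flat_solution M T B \<rho> q f \<xi> Y' Z' K'"
  shows "same_solution M T Y Z K Y' Z' K'"
proof -
  obtain g V where s: "step g (\<lambda>t w. Y t w - (K T - K t)) Z (ito_integral M T B Z) V g"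
    "\<forall>t\<in>{0..T}. refl (\<lambda>t w. Y t w - (K T - K t)) t = K T - K t" "K 0 = 0" "Y \<in> S2 M T F"
    by (rule step_of_flat_solution[OF assms(1)])
  obtain g' V' where s': "step g' (\<lambda>t w. Y' t w - (K' T - K' t)) Z' (ito_integral M T B Z') V' g'"
    "\<forall>t\<in>{0..T}. refl (\<lambda>t w. Y' t w - (K' T - K' t)) t = K' T - K' t" "K' 0 = 0" "Y' \<in> S2 M T F"
    by (rule step_of_flat_solution[OF assms(2)])
  let ?X = "\<lambda>t w. Y t w - (K T - K t)" and ?X' = "\<lambda>t w. Y' t w - (K' T - K' t)"
  note d = step_D[OF s(1)] and d' = step_D[OF s'(1)]
  have "wn \<beta> (\<lambda>x. g x - g' x) < \<infinity>"
    using \<beta>_pos by (intro wn_finite borel_measurable_diff prog_mu d(8) d'(8) sqn_diff_finite d(9) d'(9)) auto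
  \<comment> \<open>A finite quantity that is at most a sixteenth of itself is zero.\<close>
  then have W: "wn \<beta> (\<lambda>x. g x - g' x) = 0"
    using step_contraction[OF s(1) s'(1)]
    by (cases "wn \<beta> (\<lambda>x. g x - g' x)") (auto simp: ennreal_mult[symmetric] simp del: ennreal_mult)
  have D: "lin_sol (\<lambda>_. 0) (\<lambda>x. g x - g' x) (\<lambda>t w. ?X t w - ?X' t w) (\<lambda>t w. Z t w - Z' t w)
    (\<lambda>t w. ito_integral M T B Z t w - ito_integral M T B Z' t w)"
    using lin_sol_diff[OF d(1) d'(1)] by simp
  have X0: "sqn M (\<lambda>w. ?X t w - ?X' t w) = 0" if "t \<in> {0..T}" for t
    using lin_sol_estimate_X[OF D that \<beta>_pos] by (simp add: W)
  have r: "refl ?X t = refl ?X' t" if t: "t \<in> {0..T}" for t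
  proof -
    have "\<bar>refl ?X t - refl ?X' t\<bar> \<le> C' * sqrt 0"
      by (rule refl_dist[OF d(2) d'(2) t order_refl]) (use t X0 in auto)
    then show ?thesis by simp
  qed
  have KK: "K T - K t = K' T - K' t" if "t \<in> {0..T}" for t using r[OF that] bspec[OF s(2) that] bspec[OF s'(2) that] by simp
  \<comment> \<open>The reflection terms determine only K_T - K_t; the normalisation K_0 = 0 fixes
    the constant.\<close>
  have KT: "K T = K' T" using KK[of 0] s(3) s'(3) horizon_pos by simp
  have "\<forall>t\<in>{0..T}. K t = K' t" using KK KT by simp
  moreover have "AE w in M. \<forall>t\<in>{0..T}. Y t w = Y' t w"
  proof (rule indistinguishable[OF S2_D(2)[OF s(4)] S2_D(2)[OF s'(4)]])
    fix t assume t: "t \<in> {0..T}"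
    have m: "?X t \<in> borel_measurable M" "?X' t \<in> borel_measurable M"
      using L2_D(2)[OF S2_D(3)[OF d(2) t]] L2_D(2)[OF S2_D(3)[OF d'(2) t]] t by auto
    have "AE w in M. ?X t w - ?X' t w = 0" using X0[OF t] sqn_zero_iff[OF borel_measurable_diff[OF m]] by simp
    then show "AE w in M. Y t w = Y' t w" by eventually_elim (use KK[OF t] in simp)
  qed
  moreover have "AE (w, t) in \<mu>. Z t w = Z' t w"
  proof -
    have "sqn \<mu> (\<lambda>x. pz Z x - pz Z' x) = 0"
      using order_trans[OF wn_ge lin_sol_estimate_Z[OF D \<beta>_pos]] \<beta>_pos by (simp add: W)
    then have "AE x in \<mu>. pz Z x - pz Z' x = 0"
      using sqn_zero_iff[OF borel_measurable_diff[OF prog_mu[OF d(4)] prog_mu[OF d'(4)]]] by simp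
    then show ?thesis by eventually_elim auto
  qed
  ultimately show ?thesis by (simp add: same_solution_def)
qed

section \<open>Minimality\<close>

text \<open>
  If \<open>m t > 0\<close>, then \<open>K\<close> is constant up to the first later zero \<open>u\<close> of \<open>m\<close>, so that
  \<open>m s \<le> A \<integral>\<^sub>s\<^sup>u m\<close> on \<open>[t, u]\<close>; this is impossible at the maximum of \<open>exp (A s) m s\<close>.
\<close>

lemma deterministic_comparison:
  fixes m a K K' \<delta> :: "real \<Rightarrow> real"
  assumes m: "continuous_on {0..T} m" and K: "continuous_on {0..T} K" "mono_on {0..T} K" and K': "mono_on {0..T} K'"
    and a: "a \<in> borel_measurable L" "\<And>s. s \<in> {0..T} \<Longrightarrow> \<bar>a s\<bar> \<le> A"
    and eq: "\<And>t. t \<in> {0..T} \<Longrightarrow> m t = (LBINT s:{t..T}. a s * m s) + ((K T - K t) - (K' T - K' t))"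
    and \<delta>: "continuous_on {0..T} \<delta>" "\<And>t. t \<in> {0..T} \<Longrightarrow> 0 \<le> \<delta> t" and fl: "flat_on T \<delta> K"
    and pos: "\<And>t. t \<in> {0..T} \<Longrightarrow> 0 < m t \<Longrightarrow> 0 < \<delta> t"
    and t: "t \<in> {0..T}"
  shows "m t \<le> 0"
proof (rule ccontr)
  assume mt: "\<not> m t \<le> 0"
  have am: "set_integrable lborel {0..T} (\<lambda>s. a s * m s)"
  proof -
    have "compact (m ` {0..T})" using m by (intro compact_continuous_image) auto
    then obtain c where c: "\<forall>x\<in>m ` {0..T}. norm x \<le> c" using compact_imp_bounded bounded_iff by blast
    have "integrable L (\<lambda>s. a s * m s)"
    proof (rule L.integrable_const_bound[of _ "A * c"])
      show "AE s in L. norm (a s * m s) \<le> A * c"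
      proof (rule AE_I2)
        fix s assume "s \<in> space L"
        then have s: "s \<in> {0..T}" by simp
        show "norm (a s * m s) \<le> A * c"
          unfolding real_norm_def abs_mult using a(2)[OF s] c s by (intro mult_mono) auto
      qed
      have "m \<in> borel_measurable L"
        using borel_measurable_continuous_on_restrict[OF m] by (simp cong: measurable_cong_sets add: sets_L)
      then show "(\<lambda>s. a s * m s) \<in> borel_measurable L" using a(1) by (rule borel_measurable_times[rotated])
    qed
    then show ?thesis by (simp add: integrable_restrict_space set_integrable_def)
  qed
  let ?S = "{s \<in> {t..T}. m s \<le> 0}"
  have "closed ({t..T} \<inter> m -` {..0})"
    using t by (intro continuous_closed_preimage continuous_on_subset[OF m]) auto
  moreover have "{t..T} \<inter> m -` {..0} = ?S" by auto
  ultimately have "closed ?S" by simp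
  moreover have "bounded ?S" by (rule bounded_subset[of "{t..T}"]) auto
  \<comment> \<open>At T both the integral and the K terms vanish, so a first later time with m
    \<le> 0 exists.\<close>
  moreover have "m T = 0" using eq[OF T_mem]
    by (simp add: set_lebesgue_integral_def) (intro integral_eq_zero_AE, use AE_lborel_singleton[of T] in eventually_elim, simp)
  then have "T \<in> ?S" using t by simp
  ultimately have "\<exists>u\<in>?S. \<forall>s\<in>?S. u \<le> s"
    by (intro compact_attains_inf) (auto simp: compact_eq_bounded_closed)
  then obtain u where u: "u \<in> ?S" "\<And>s. s \<in> ?S \<Longrightarrow> u \<le> s" by blast
  have ut: "t < u" using u(1) mt by (auto simp: less_le)
  have mpos: "0 < m s" if "s \<in> {t..<u}" for s
  proof -
    have "s \<notin> ?S" using u(2)[of s] that by auto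
    then show ?thesis using that u(1) by auto
  qed
  have KK: "K u = K s" if s: "s \<in> {t..<u}" for s
  proof (rule flat_on_const[OF horizon_pos K \<delta> fl])
    show "0 < \<delta> r" if "r \<in> {s<..<u}" for r using that s t u(1) by (intro pos mpos) auto
  qed (use s t u(1) in auto)
  have le: "m s \<le> (LBINT r:{s..u}. a r * m r)" if s: "s \<in> {t..<u}" for s
  proof -
    have su: "s \<in> {0..T}" "u \<in> {0..T}" "s \<le> u" using s t u(1) by auto
    have "set_integrable lborel {s..T} (\<lambda>r. a r * m r)" by (rule set_integrable_subset[OF am]) (use su in auto)
    then have "(LBINT r:{s..T}. a r * m r) = (LBINT r:{s..u}. a r * m r) + (LBINT r:{u..T}. a r * m r)"
      by (rule set_integral_split) (use su in auto)
    moreover have "K' s \<le> K' u" using su by (intro mono_onD[OF K']) auto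
    ultimately show ?thesis using eq[OF su(1)] eq[OF su(2)] KK[OF s] u(1) by simp
  qed
  have "continuous_on {t..u} (\<lambda>s. exp (A * s) * m s)"
    using t u(1) by (intro continuous_intros continuous_on_subset[OF m]) auto
  then obtain s where s: "s \<in> {t..u}" "\<forall>r\<in>{t..u}. exp (A * r) * m r \<le> exp (A * s) * m s"
    using continuous_attains_sup[of "{t..u}" "\<lambda>s. exp (A * s) * m s"] ut by auto
  \<comment> \<open>The maximum is positive because t competes, and it is not attained at u, where m
    \<le> 0; hence the inequality \<open>le\<close> is available at s.\<close>
  define P where "P = exp (A * s) * m s"
  have "exp (A * t) * m t \<le> P" unfolding P_def using s(2) ut by auto
  then have P: "0 < P" using mt by (smt (verit) exp_gt_zero mult_pos_pos)
  have "s \<noteq> u"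
  proof
    assume "s = u"
    then have "P \<le> 0" unfolding P_def using u(1) by (simp add: mult_le_0_iff)
    with P show False by simp
  qed
  then have su: "s \<in> {t..<u}" using s(1) by auto
  \<comment> \<open>Maximality gives m r \<le> P exp(-A r). Replacing a by A uses m r \<ge> 0; at
    the end point this is m u = 0, by the intermediate value theorem.\<close>
  have bd: "a r * m r \<le> A * (P * exp (- A * r))" if r: "r \<in> {s..u}" for r
  proof -
    have r0: "r \<in> {0..T}" "r \<in> {t..u}" using r s(1) t u(1) by auto
    have "m r = exp (- A * r) * (exp (A * r) * m r)" by (simp add: mult.assoc[symmetric] flip: exp_add)
    also have "\<dots> \<le> exp (- A * r) * P" unfolding P_def using s(2) r0 by (intro mult_left_mono) auto
    finally have mr: "m r \<le> P * exp (- A * r)" by (simp add: mult.commute)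
    show ?thesis
    proof (cases "r = u")
      case False
      then have "0 \<le> m r" using mpos[of r] r0 by auto
      then have "a r * m r \<le> A * m r" using a(2)[OF r0(1)] by (intro mult_right_mono) auto
      also have "\<dots> \<le> A * (P * exp (- A * r))" using mr a(2)[OF r0(1)] by (intro mult_left_mono) auto
      finally show ?thesis .
    next
      case True
      have "0 \<le> m u"
      proof (rule ccontr)
        assume n: "\<not> 0 \<le> m u"
        have "\<exists>r. t \<le> r \<and> r \<le> u \<and> m r = 0"
          using n mt ut t u(1) by (intro IVT2' continuous_on_subset[OF m]) auto
        then obtain r where "t \<le> r" "r \<le> u" "m r = 0" by blast
        then show False using mpos[of r] n by (cases "r = u") auto
      qed
      then have "m r = 0" using u(1) True by simp
      then show ?thesis using P a(2)[OF r0(1)] by simp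
    qed
  qed
  have "m s \<le> (LBINT r:{s..u}. a r * m r)" by (rule le[OF su])
  also have "\<dots> \<le> (LBINT r:{s..u}. A * (P * exp (- A * r)))"
  proof (rule set_integral_mono)
    show "set_integrable lborel {s..u} (\<lambda>r. a r * m r)" by (rule set_integrable_subset[OF am]) (use su t u(1) in auto)
    show "set_integrable lborel {s..u} (\<lambda>r. A * (P * exp (- A * r)))"
      by (rule borel_integrable_atLeastAtMost') (intro continuous_intros)
  qed (rule bd)
  also have "\<dots> = (\<integral>r. A * (P * exp (- A * r)) * indicator {s..u} r \<partial>lborel)"
    by (simp only: set_lebesgue_integral_def real_scaleR_def mult.commute[of "indicator _ _"])
  \<comment> \<open>The bound integrates to P exp(-A s) - P exp(-A u), which is strictly less than P
    exp(-A s) = m s.\<close>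
  also have "\<dots> = - P * exp (- A * u) - - P * exp (- A * s)"
    using s(1) by (intro integral_FTC_Icc_real) (auto intro!: derivative_eq_intros)
  also have "\<dots> < P * exp (- A * s)" using P by simp
  also have "\<dots> = (exp (A * s) * exp (- A * s)) * m s" by (simp only: P_def mult_ac)
  also have "exp (A * s) * exp (- A * s) = 1" by (simp flip: exp_add)
  finally show False by simp
qed

section \<open>Centred linear equations\<close>

lemma mean_measurable:
  fixes g :: "'a \<times> real \<Rightarrow> real"
  assumes g: "g \<in> borel_measurable \<mu>"
  shows "(\<lambda>s. expectation (\<lambda>w. g (w, s))) \<in> borel_measurable L"
proof -
  have "(\<lambda>(s, w). g (w, s)) \<in> borel_measurable (L \<Otimes>\<^sub>M M)"
    using measurable_compose[OF measurable_pair_swap' g] by (simp add: case_prod_beta')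
  then show ?thesis by (rule borel_measurable_lebesgue_integral)
qed

lemma sqn_section_measurable:
  fixes g :: "'a \<times> real \<Rightarrow> real"
  assumes g: "g \<in> borel_measurable \<mu>"
  shows "(\<lambda>s. sqn M (\<lambda>w. g (w, s))) \<in> borel_measurable L"
  unfolding sqn_def
  by (rule borel_measurable_nn_integral) (use measurable_compose[OF measurable_pair_swap' g] in \<open>simp add: case_prod_beta'\<close>)

text \<open>Set to 0 outside [0, T] so that it is Borel on the whole line, which
  \<open>time_prog\<close> asks for.\<close>

definition mean :: "('a \<times> real \<Rightarrow> real) \<Rightarrow> real \<Rightarrow> real" where
  "mean g s = (if s \<in> {0..T} then expectation (\<lambda>w. g (w, s)) else 0)"

text \<open>Taking expectations removes the martingale part and leaves, by Fubini, the time integral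
  of the mean of g. Subtracting this deterministic equation changes X and g but not Z.\<close>

lemma lin_sol_center:
  assumes S: "lin_sol (\<lambda>_. 0) g X Z I"
  shows "lin_sol (\<lambda>_. 0) (\<lambda>x. g x - mean g (snd x))
    (\<lambda>t w. X t w - expectation (X t)) Z I"
proof -
  note d = lin_solD[OF S]
  note gm = prog_mu[OF d(1)]
  let ?m = "\<lambda>s. expectation (\<lambda>w. g (w, s))"
  have mL: "?m \<in> borel_measurable L" by (rule mean_measurable[OF gm])
  have MB: "mean g \<in> borel_measurable borel"
  proof -
    have "?m \<in> borel_measurable (restrict_space borel {0..T})" using mL by (simp cong: measurable_cong_sets add: sets_L)
    then show ?thesis unfolding mean_def[abs_def] by (subst (asm) measurable_restrict_space_iff) auto
  qed
  have hp: "(\<lambda>x. g x - mean g (snd x)) \<in> borel_measurable prog" by (intro borel_measurable_diff d(1) time_prog[OF MB])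
  note hm = prog_mu[OF hp]
  have gi: "integrable \<mu> g" by (rule PL.integrable_L2[OF gm d(2)])
  have fin: "sqn \<mu> (\<lambda>x. g x - mean g (snd x)) < \<infinity>"
  proof -
    have fs: "AE s in L. sqn M (\<lambda>w. g (w, s)) \<noteq> \<infinity>"
    proof (rule nn_integral_PInf_AE[OF sqn_section_measurable[OF gm]])
      show "(\<integral>\<^sup>+s. sqn M (\<lambda>w. g (w, s)) \<partial>L) \<noteq> \<infinity>"
        using wn_iterated[OF gm, of 0] d(2) by (simp add: wn_def)
    qed
    have "sqn \<mu> (\<lambda>x. g x - mean g (snd x)) = (\<integral>\<^sup>+s. sqn M (\<lambda>w. g (w, s) - mean g s) \<partial>L)"
      using wn_iterated[OF hm, of 0] by (simp add: wn_def)
    also have "\<dots> \<le> (\<integral>\<^sup>+s. sqn M (\<lambda>w. g (w, s)) \<partial>L)"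
    proof (rule nn_integral_mono_AE)
      show "AE s in L. sqn M (\<lambda>w. g (w, s) - mean g s) \<le> sqn M (\<lambda>w. g (w, s))"
        using fs AE_space[of L]
      proof eventually_elim
        case (elim s)
        then have "s \<in> {0..T}" by simp
        moreover have "sqn M (\<lambda>w. g (w, s) - ?m s) \<le> sqn M (\<lambda>w. g (w, s) - 0)"
          by (rule sqn_center_le[OF measurable_compose[OF measurable_Pair2'[OF elim(2)] gm]]) (use elim(1) in \<open>simp add: less_top\<close>)
        ultimately show ?case by (simp add: mean_def)
      qed
    qed
    also have "\<dots> = sqn \<mu> g" using wn_iterated[OF gm, of 0] by (simp add: wn_def)
    finally show ?thesis using d(2) by (rule le_less_trans)
  qed
  have mi: "integrable L ?m" using PS.integrable_snd[of "\<lambda>w s. g (w, s)"] gi by simp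
  then have mi': "set_integrable lborel {0..T} (mean g)"
    by (subst set_integrable_cong[where f' = ?m, OF HOL.refl]) (auto simp: mean_def integrable_restrict_space set_integrable_def)
  note mart = ito_properties(1)[OF pred_mu[OF d(3)] d(4,5)]
  have mn: "expectation (X t) = (LBINT s:{t..T}. mean g s)" if t: "t \<in> {0..T}" for t
  proof -
    have tT: "0 \<le> t" "t \<le> T" using t by auto
    have It: "integrable M (\<lambda>w. I T w - I t w)"
      using integrable_L2[OF l2_martingaleD(2,3)[OF mart T_mem]] integrable_L2[OF l2_martingaleD(2,3)[OF mart t]] by simp
    have I0: "expectation (\<lambda>w. I T w - I t w) = 0"
      using l2_martingale_orth[OF mart tT order_refl, of "\<lambda>_. 1"] by (simp add: sqn_def emeasure_space_1)
    let ?i = "\<lambda>s. indicator {t..T} s :: real"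
    have iL: "?i \<in> borel_measurable L" by (rule measurable_restrict_space1) simp
    have gti: "integrable \<mu> (\<lambda>(w, s). ?i s * g (w, s))"
      unfolding case_prod_beta'
      by (rule Bochner_Integration.integrable_bound[OF gi])
        (use measurable_compose[OF measurable_snd iL] gm in \<open>auto simp: indicator_def intro!: borel_measurable_times\<close>)
    have sL: "(LBINT s:{t..T}. u s) = (\<integral>s. ?i s * u s \<partial>L)" for u :: "real \<Rightarrow> real"
      using t by (subst integral_restrict_space)
        (auto simp: set_lebesgue_integral_def indicator_def intro!: Bochner_Integration.integral_cong)
    have gI: "integrable M (\<lambda>w. LBINT s:{t..T}. g (w, s))"
      unfolding sL using PS.integrable_fst[OF gti] by simp
    have "expectation (X t) = expectation (\<lambda>w. (LBINT s:{t..T}. g (w, s)) - (I T w - I t w))"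
    proof (rule integral_cong_AE)
      show "X t \<in> borel_measurable M" using d(6) t by (intro measurable_F_M[of _ t]) (auto simp: adapted_def)
      show "(\<lambda>w. (LBINT s:{t..T}. g (w, s)) - (I T w - I t w)) \<in> borel_measurable M"
        by (rule borel_measurable_diff[OF borel_measurable_integrable[OF gI] borel_measurable_integrable[OF It]])
      show "AE w in M. X t w = (LBINT s:{t..T}. g (w, s)) - (I T w - I t w)"
        using d(7) by eventually_elim (use t in simp)
    qed
    also have "\<dots> = expectation (\<lambda>w. \<integral>s. ?i s * g (w, s) \<partial>L)"
      using gI It I0 by (simp add: sL)
    also have "\<dots> = (\<integral>s. expectation (\<lambda>w. ?i s * g (w, s)) \<partial>L)"
      by (rule PS.Fubini_integral[OF gti, symmetric])
    also have "\<dots> = (\<integral>s. ?i s * mean g s \<partial>L)" by (rule Bochner_Integration.integral_cong) (auto simp: mean_def)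
    finally show ?thesis by (simp only: sL)
  qed
  have "AE w in M. \<forall>t\<in>{0..T}. X t w - expectation (X t) = 0 + (LBINT s:{t..T}. g (w, s) - mean g s) - (I T w - I t w)"
    using d(7) path_integrable[OF gm d(2)]
  proof eventually_elim
    case (elim w)
    show ?case
    proof
      fix t assume t: "t \<in> {0..T}"
      have "set_integrable lborel {t..T} (\<lambda>s. g (w, s))" "set_integrable lborel {t..T} (mean g)"
        by (rule set_integrable_subset[OF elim(2)], use t in auto)(rule set_integrable_subset[OF mi'], use t in auto)
      from set_integral_diff(2)[OF this] bspec[OF elim(1) t] mn[OF t]
      show "X t w - expectation (X t) = 0 + (LBINT s:{t..T}. g (w, s) - mean g s) - (I T w - I t w)" by simp
    qed
  qed
  moreover have "adapted T F (\<lambda>t w. X t w - expectation (X t))" using d(6) by (simp add: adapted_def borel_measurable_diff)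
  ultimately show ?thesis unfolding lin_sol_def using hp fin d(3-5) by simp
qed

text \<open>
  Centring the driver of the difference of two solutions removes the (deterministic) difference of the
  reflection terms, so the contraction argument applies and the difference of the solutions is deterministic.
\<close>

lemma flat_solution_minimal:
  assumes a: "a \<in> borel_measurable (restrict_space borel {0..T})" "bounded (a ` {0..T})"
    and f: "\<And>w t y z. w \<in> space M \<Longrightarrow> t \<in> {0..T} \<Longrightarrow> f w t y z = a t * y + h w t z"
    and fs: "deterministic_flat_solution M T B \<rho> q f \<xi> Y Z K"
    and ds': "deterministic_solution M T B \<rho> q f \<xi> Y' Z' K'"
  shows "AE w in M. \<forall>t\<in>{0..T}. Y t w \<le> Y' t w"
proof -
  have ds: "deterministic_solution M T B \<rho> q f \<xi> Y Z K" and fl: "flat T \<rho> q Y K"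
    using fs by (auto simp: deterministic_flat_solution_def)
  obtain A where "\<forall>s\<in>{0..T}. \<bar>a s\<bar> \<le> A" using a(2) by (auto simp: bounded_iff)
  then have A: "\<bar>a s\<bar> \<le> A" if "s \<in> {0..T}" for s using that by blast
  have aL: "a \<in> borel_measurable L" using a(1) by (simp cong: measurable_cong_sets add: sets_L)
  obtain V where V: "pz V \<in> borel_measurable prog" "AE w in M. \<forall>t\<in>{0..T}. V t w = Y t w"
    "lin_sol \<xi> (drv V Z) (\<lambda>t w. Y t w - (K T - K t)) Z (ito_integral M T B Z)"
    "continuous_on {0..T} K" "K 0 = 0" "mono_on {0..T} K" "Y \<in> S2 M T F"
    by (rule solution_lin_sol[OF ds])
  obtain V' where V': "pz V' \<in> borel_measurable prog" "AE w in M. \<forall>t\<in>{0..T}. V' t w = Y' t w"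
    "lin_sol \<xi> (drv V' Z') (\<lambda>t w. Y' t w - (K' T - K' t)) Z' (ito_integral M T B Z')"
    "continuous_on {0..T} K'" "K' 0 = 0" "mono_on {0..T} K'" "Y' \<in> S2 M T F"
    by (rule solution_lin_sol[OF ds'])
  note l = lin_solD[OF V(3)] and l' = lin_solD[OF V'(3)]
  define k where "k t = (K T - K t) - (K' T - K' t)" for t
  define dX where "dX t w = Y t w - (K T - K t) - (Y' t w - (K' T - K' t))" for t w
  define dg where "dg x = drv V Z x - drv V' Z' x" for x
  \<comment> \<open>At y = 0 the generator reduces to h, so the part of the driver that comes from Z
    inherits measurability and the Lipschitz bound from f.\<close>
  define dh where "dh x = drv (\<lambda>_ _. 0) Z x - drv (\<lambda>_ _. 0) Z' x" for x
  define dZ where "dZ t w = Z t w - Z' t w" for t w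
  define dI where "dI t w = ito_integral M T B Z t w - ito_integral M T B Z' t w" for t w
  \<comment> \<open>Y - Y' equals dX + k, so m is its mean and the candidate for the deterministic
    difference.\<close>
  define m where "m t = expectation (dX t) + k t" for t
  have D: "lin_sol (\<lambda>_. 0) dg dX dZ dI"
    using lin_sol_diff[OF V(3) V'(3)] by (simp add: dg_def[abs_def] dX_def[abs_def] dZ_def[abs_def] dI_def[abs_def])
  note dl = lin_solD[OF D]
  let ?X = "\<lambda>t w. dX t w - expectation (dX t)" and ?g = "\<lambda>x. dg x - mean dg (snd x)"
  have E: "lin_sol (\<lambda>_. 0) ?g ?X dZ dI" by (rule lin_sol_center[OF D])
  note gm = prog_mu[OF lin_solD(1)[OF E]] and dgm = prog_mu[OF dl(1)]
  have Zp: "pz Z \<in> borel_measurable prog" "pz Z' \<in> borel_measurable prog" by (intro pred_prog l(3) l'(3))+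
  have zp: "pz (\<lambda>_ _. 0 :: real) \<in> borel_measurable prog" by simp
  have dhm: "dh \<in> borel_measurable \<mu>"
    unfolding dh_def by (intro borel_measurable_diff prog_mu drv_measurable zp Zp)
  have split: "dg x = a (snd x) * (pz V x - pz V' x) + dh x" if "x \<in> space \<mu>" for x
  proof -
    have "fst x \<in> space M" "snd x \<in> {0..T}" using that by (auto simp: space_pair_measure)
    then show ?thesis unfolding dg_def dh_def drv_def by (simp add: f algebra_simps)
  qed
  have Xm: "?X t \<in> borel_measurable M" "dX t \<in> borel_measurable M" if "t \<in> {0..T}" for t
    using dl(6) that measurable_F_M[of "dX t" t] by (auto simp: adapted_def)
  \<comment> \<open>The estimate below reads W \<le> (2 A^2 T + 20 lip^2) W / b; this b makes the
    factor at most 1/2, and the summand 1 keeps it positive.\<close>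
  define b where "b = 4 * A\<^sup>2 * T + 40 * lip\<^sup>2 + 1"
  have b: "0 < b" unfolding b_def using horizon_pos by (intro add_nonneg_pos add_nonneg_nonneg mult_nonneg_nonneg) auto
  have "wn b ?g < \<infinity>" using b by (intro wn_finite gm lin_solD(2)[OF E]) simp
  then obtain W where W: "0 \<le> W" "wn b ?g = ennreal W" by (cases "wn b ?g") auto
  have bound: "sqn M (\<lambda>w. ?g (w, s)) \<le> ennreal (2 * A\<^sup>2) * sqn M (?X s) + 2 * sqn M (\<lambda>w. dh (w, s))"
    if s: "s \<in> {0..T}" and fin: "sqn M (\<lambda>w. dg (w, s)) < \<infinity>" for s
  proof -
    have sL: "s \<in> space L" using s by simp
    note dgs = measurable_compose[OF measurable_Pair2'[OF sL] dgm] and dhs = measurable_compose[OF measurable_Pair2'[OF sL] dhm]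
    \<comment> \<open>Among constants the mean is the best one, so it may be replaced by a_s m_s. As
      a_s is deterministic, a_s (Y - Y') - a_s m_s = a_s (dX - E dX), and the reflection terms are
      gone.\<close>
    have "sqn M (\<lambda>w. ?g (w, s)) \<le> sqn M (\<lambda>w. dg (w, s) - a s * m s)"
      using sqn_center_le[OF dgs fin] s by (simp add: mean_def)
    also have "\<dots> = sqn M (\<lambda>w. a s * ?X s w + dh (w, s))"
    proof (rule sqn_cong_AE)
      show "AE w in M. dg (w, s) - a s * m s = a s * ?X s w + dh (w, s)"
        using V(2) V'(2) AE_space[of M]
      proof eventually_elim
        case (elim w)
        have "(w, s) \<in> space \<mu>" using elim(3) s by (simp add: space_pair_measure)
        from split[OF this] bspec[OF elim(1) s] bspec[OF elim(2) s] show ?case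
          by (simp add: m_def k_def dX_def algebra_simps)
      qed
    qed
    also have "\<dots> \<le> 2 * sqn M (\<lambda>w. a s * ?X s w) + 2 * sqn M (\<lambda>w. dh (w, s))"
      using Xm(1)[OF s] dhs by (intro sqn_add) auto
    also have "\<dots> \<le> ennreal (2 * A\<^sup>2) * sqn M (?X s) + 2 * sqn M (\<lambda>w. dh (w, s))"
    proof (intro add_right_mono)
      have "sqn M (\<lambda>w. a s * ?X s w) = ennreal ((a s)\<^sup>2) * sqn M (?X s)"
        using sqn_scale[OF Xm(1)[OF s], of "a s"] by simp
      also have "\<dots> \<le> ennreal (A\<^sup>2) * sqn M (?X s)"
        using power_mono[OF A[OF s], of 2] by (intro mult_right_mono ennreal_leI) auto
      finally have "2 * sqn M (\<lambda>w. a s * ?X s w) \<le> 2 * (ennreal (A\<^sup>2) * sqn M (?X s))" by (rule mult_left_mono) simp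
      also have "\<dots> = ennreal (2 * A\<^sup>2) * sqn M (?X s)" by (simp add: ennreal_mult mult.assoc)
      finally show "2 * sqn M (\<lambda>w. a s * ?X s w) \<le> ennreal (2 * A\<^sup>2) * sqn M (?X s)" .
    qed
    finally show ?thesis .
  qed
  have wh: "wn b dh \<le> ennreal (10 * lip\<^sup>2 / b * W)"
  proof -
    have "wn b dh \<le> ennreal (2 * lip\<^sup>2) * wn b (pz dZ)"
      using drv_sqn_le[OF zp Zp(1) zp Zp(2), of b] by (simp add: dh_def[abs_def] dZ_def wn_def)
    also have "\<dots> \<le> ennreal (2 * lip\<^sup>2) * (ennreal (5 / b) * ennreal W)"
      using lin_sol_estimate_Z[OF E b] unfolding W(2) by (intro mult_left_mono) auto
    also have "\<dots> = ennreal (2 * lip\<^sup>2 * (5 / b)) * ennreal W" using b by (intro ennreal_mult_assoc) auto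
    also have "\<dots> = ennreal (10 * lip\<^sup>2 / b * W)" using b W(1) by (subst ennreal_mult[symmetric]) auto
    finally show ?thesis .
  qed
  have "ennreal W \<le> ennreal (1/2 * W)"
  proof -
    have em: "(\<lambda>s. ennreal (exp (b * s))) \<in> borel_measurable L" by (rule measurable_restrict_space1) simp
    have fs: "AE s in L. sqn M (\<lambda>w. dg (w, s)) \<noteq> \<infinity>"
      using wn_iterated[OF dgm, of 0] dl(2)
      by (intro nn_integral_PInf_AE sqn_section_measurable dgm) (simp add: wn_def)
    have "ennreal W = (\<integral>\<^sup>+s. ennreal (exp (b * s)) * sqn M (\<lambda>w. ?g (w, s)) \<partial>L)"
      unfolding W(2)[symmetric] by (rule wn_iterated[OF gm])
    also have "\<dots> \<le> (\<integral>\<^sup>+s. ennreal (2 * A\<^sup>2 / b * W) + 2 * (ennreal (exp (b * s)) * sqn M (\<lambda>w. dh (w, s))) \<partial>L)"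
    proof (rule nn_integral_mono_AE)
      show "AE s in L. ennreal (exp (b * s)) * sqn M (\<lambda>w. ?g (w, s)) \<le> ennreal (2 * A\<^sup>2 / b * W) + 2 * (ennreal (exp (b * s)) * sqn M (\<lambda>w. dh (w, s)))"
        using fs AE_space[of L]
      proof eventually_elim
        case (elim s)
        then have s: "s \<in> {0..T}" and fin: "sqn M (\<lambda>w. dg (w, s)) < \<infinity>" by (auto simp: less_top)
        have "ennreal (exp (b * s)) * sqn M (\<lambda>w. ?g (w, s))
          \<le> ennreal (exp (b * s)) * (ennreal (2 * A\<^sup>2) * sqn M (?X s) + 2 * sqn M (\<lambda>w. dh (w, s)))"
          by (intro mult_left_mono bound s fin) simp
        also have "\<dots> = ennreal (2 * A\<^sup>2) * (ennreal (exp (b * s)) * sqn M (?X s)) + 2 * (ennreal (exp (b * s)) * sqn M (\<lambda>w. dh (w, s)))"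
          by (simp only: distrib_left mult_ac)
        also have "\<dots> \<le> ennreal (2 * A\<^sup>2) * (ennreal (1 / b) * ennreal W) + 2 * (ennreal (exp (b * s)) * sqn M (\<lambda>w. dh (w, s)))"
          using lin_sol_estimate_X[OF E s b] unfolding W(2) by (intro add_right_mono mult_left_mono) auto
        also have "ennreal (2 * A\<^sup>2) * (ennreal (1 / b) * ennreal W) = ennreal (2 * A\<^sup>2 * (1 / b)) * ennreal W"
          using b by (intro ennreal_mult_assoc) auto
        also have "\<dots> = ennreal (2 * A\<^sup>2 / b * W)" using b W(1) by (subst ennreal_mult[symmetric]) auto
        finally show ?case .
      qed
    qed
    also have "\<dots> = (\<integral>\<^sup>+s. ennreal (2 * A\<^sup>2 / b * W) \<partial>L) + (\<integral>\<^sup>+s. 2 * (ennreal (exp (b * s)) * sqn M (\<lambda>w. dh (w, s))) \<partial>L)"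
      by (intro nn_integral_add borel_measurable_times_ennreal em sqn_section_measurable dhm) auto
    also have "(\<integral>\<^sup>+s. 2 * (ennreal (exp (b * s)) * sqn M (\<lambda>w. dh (w, s))) \<partial>L) = 2 * wn b dh"
      unfolding wn_iterated[OF dhm] by (intro nn_integral_cmult borel_measurable_times_ennreal em sqn_section_measurable dhm)
    also have "(\<integral>\<^sup>+s. ennreal (2 * A\<^sup>2 / b * W) \<partial>L) = ennreal (2 * A\<^sup>2 / b * W * T)"
      using horizon_pos b W(1) by (simp add: emeasure_restrict_space ennreal_mult[symmetric] del: ennreal_mult)
    also have "ennreal (2 * A\<^sup>2 / b * W * T) + 2 * wn b dh \<le> ennreal (2 * A\<^sup>2 / b * W * T) + 2 * ennreal (10 * lip\<^sup>2 / b * W)"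
      by (intro add_left_mono mult_left_mono wh) simp
    also have "\<dots> = ennreal (2 * A\<^sup>2 / b * W * T + 2 * (10 * lip\<^sup>2 / b * W))"
    proof -
      have 2: "2 * ennreal x = ennreal (2 * x)" if "0 \<le> x" for x using that by (simp add: ennreal_mult)
      have "0 \<le> 10 * lip\<^sup>2 / b * W" "0 \<le> 2 * A\<^sup>2 / b * W * T" using b W(1) horizon_pos by simp_all
      then show ?thesis by (subst 2; simp del: ennreal_plus add: ennreal_plus[symmetric])
    qed
    also have "2 * A\<^sup>2 / b * W * T + 2 * (10 * lip\<^sup>2 / b * W) = (4 * A\<^sup>2 * T + 40 * lip\<^sup>2) * (W / (2 * b))"
      using b by (simp add: field_simps)
    also have "ennreal \<dots> \<le> ennreal (b * (W / (2 * b)))"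
      using b W(1) by (intro ennreal_leI mult_right_mono) (auto simp: b_def)
    also have "b * (W / (2 * b)) = 1/2 * W" using b by simp
    finally show ?thesis .
  qed
  then have "W = 0" using W(1) by (simp add: ennreal_le_iff)
  then have w0: "wn b ?g = 0" using W(2) by simp
  have dX_eq: "AE w in M. dX t w = expectation (dX t)" if t: "t \<in> {0..T}" for t
  proof -
    have "sqn M (?X t) = 0" using lin_sol_estimate_X[OF E t b] by (simp add: w0)
    then have "AE w in M. ?X t w = 0" using sqn_zero_iff[OF Xm(1)[OF t]] by simp
    then show ?thesis by eventually_elim simp
  qed
  have Zeq: "AE x in \<mu>. pz Z x = pz Z' x"
  proof -
    have "sqn \<mu> (pz dZ) = 0" using order_trans[OF wn_ge lin_sol_estimate_Z[OF E b]] b by (simp add: w0)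
    then have "AE x in \<mu>. pz dZ x = 0" using sqn_zero_iff[OF pred_mu[OF dl(3)]] by simp
    then show ?thesis by eventually_elim (simp add: dZ_def)
  qed
  have dXS: "dX \<in> S2 M T F" by (rule lin_sol_S2[OF D]) auto
  have kc: "continuous_on {0..T} k" unfolding k_def by (intro continuous_intros V(4) V'(4))
  have ec: "continuous_on {0..T} (\<lambda>t. expectation (dX t))"
    unfolding continuous_on_def
  proof
    fix t assume t: "t \<in> {0..T}"
    have i: "integrable M (dX s)" if "s \<in> {0..T}" for s using L2_D(4)[OF S2_D(3)[OF dXS that]] that by simp
    show "((\<lambda>t. expectation (dX t)) \<longlongrightarrow> expectation (dX t)) (at t within {0..T})"
    proof (rule LIM_zero_cancel, rule Lim_null_comparison[rotated])
      show "((\<lambda>s. expectation (\<lambda>w. \<bar>dX s w - dX t w\<bar>)) \<longlongrightarrow> 0) (at t within {0..T})"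
        by (rule S2_tendsto_L1[OF dXS t])
      have "eventually (\<lambda>s. s \<in> {0..T}) (at t within {0..T})" by (auto simp: eventually_at intro!: exI[of _ 1])
      then show "eventually (\<lambda>s. norm (expectation (dX s) - expectation (dX t)) \<le> expectation (\<lambda>w. \<bar>dX s w - dX t w\<bar>)) (at t within {0..T})"
      proof eventually_elim
        case (elim s)
        have "expectation (dX s) - expectation (dX t) = expectation (\<lambda>w. dX s w - dX t w)" using i[OF elim] i[OF t] by simp
        then show ?case using integral_abs_bound[of M "\<lambda>w. dX s w - dX t w"] by simp
      qed
    qed
  qed
  have mc: "continuous_on {0..T} m" unfolding m_def by (intro continuous_on_add ec kc)
  have "AE w in M. \<forall>t\<in>{0..T}. dX t w = expectation (dX t)"
    by (rule indistinguishable[OF S2_D(2)[OF dXS]]) (use ec dX_eq in \<open>auto simp: continuous_process_def\<close>)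
  then have Yeq: "AE w in M. \<forall>t\<in>{0..T}. Y t w = Y' t w + m t"
    by eventually_elim (auto simp: m_def dX_def k_def)
  have dgeq: "AE x in \<mu>. dg x = a (snd x) * m (snd x)"
    using AE_mu_const[OF V(2)] AE_mu_const[OF V'(2)] AE_mu_const[OF Yeq] Zeq AE_space[of \<mu>]
  proof eventually_elim
    case (elim x)
    have "snd x \<in> {0..T}" using elim(5) by auto
    then have "pz V x - pz V' x = m (snd x)" using elim(1-3) by simp
    moreover have "dh x = 0" by (simp add: dh_def drv_def elim(4))
    ultimately show ?case using split[OF elim(5)] by simp
  qed
  have mL: "m \<in> borel_measurable L"
    using borel_measurable_continuous_on_restrict[OF mc] by (simp cong: measurable_cong_sets add: sets_L)
  have "AE w in M. \<forall>t\<in>{0..T}. m t = (LBINT s:{t..T}. a s * m s) + k t"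
    using dl(7) Yeq AE_mu_iterated[OF dgeq] AE_space[of M]
      ito_AE_eq[OF pred_mu[OF l(3)] pred_mu[OF l'(3)] l(5) l'(5) Zeq]
  proof eventually_elim
    case (elim w)
    note gL = measurable_compose[OF measurable_Pair1'[OF elim(4)] dgm]
    show ?case
    proof
      fix t assume t: "t \<in> {0..T}"
      have "(LBINT s:{t..T}. dg (w, s)) = (LBINT s:{t..T}. a s * m s)"
        by (rule set_integral_cong_AE_L[OF gL borel_measurable_times[OF aL mL] _ t]) (use elim(3) in simp)
      moreover have "dI T w = 0" "dI t w = 0" using elim(5) t T_mem by (simp_all add: dI_def)
      moreover have "dX t w = m t - k t" using bspec[OF elim(2) t] by (simp add: dX_def k_def)
      ultimately show "m t = (LBINT s:{t..T}. a s * m s) + k t" using bspec[OF elim(1) t] by simp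
    qed
  qed
  then have meq: "m t = (LBINT s:{t..T}. a s * m s) + ((K T - K t) - (K' T - K' t))" if "t \<in> {0..T}" for t
    using that by (simp add: k_def)
  have m0: "m t \<le> 0" if t: "t \<in> {0..T}" for t
  proof (rule deterministic_comparison[OF mc V(4,6) V'(6) aL A meq, where \<delta> = "\<lambda>t. q t - \<rho> t (Y t)"])
    show "continuous_on {0..T} (\<lambda>t. q t - \<rho> t (Y t))"
      by (intro continuous_on_diff q_continuous rho_continuous V(7))
    show "0 \<le> q t - \<rho> t (Y t)" if "t \<in> {0..T}" for t using ds that by (simp add: deterministic_solution_def)
    show "flat_on T (\<lambda>t. q t - \<rho> t (Y t)) K" using fl by (simp add: flat_iff)
    \<comment> \<open>Where m_t > 0, translation invariance gives \<rho>(t, Y_t) = \<rho>(t, Y'_t) -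
      m_t < q_t: the flat solution has positive slack there, so its K cannot be growing.\<close>
    show "0 < q t - \<rho> t (Y t)" if t: "t \<in> {0..T}" and pos: "0 < m t" for t
    proof -
      have "AE w in M. Y t w = Y' t w + m t" using Yeq by eventually_elim (use t in simp)
      moreover have "(\<lambda>w. Y' t w + m t) \<in> L2 M (F t)"
        using S2_D(3)[OF S2_add[OF V'(7) S2_deterministic[OF mc]] t] by simp
      ultimately have "\<rho> t (Y t) = \<rho> t (\<lambda>w. Y' t w + m t)" using S2_D(3)[OF V(7) t] t by (intro rho_cong_AE)
      also have "\<dots> = \<rho> t (Y' t) - m t" by (rule rho_add_const[OF t S2_D(3)[OF V'(7) t]])
      finally show ?thesis using ds' t pos by (force simp: deterministic_solution_def)
    qed
  qed (use t in auto)
  show ?thesis using Yeq by eventually_elim (use m0 in fastforce)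
qed

end

theorem theorem13:
  fixes M :: "'a measure" and T C :: real and B :: "real \<Rightarrow> 'a \<Rightarrow> real ^ 'd"
    and \<rho> :: "real \<Rightarrow> ('a \<Rightarrow> real) \<Rightarrow> real" and q :: "real \<Rightarrow> real"
    and f :: "'a \<Rightarrow> real \<Rightarrow> real \<Rightarrow> real ^ 'd \<Rightarrow> real" and \<xi> :: "'a \<Rightarrow> real"
  assumes "brownian_motion M T B"
    and "\<And>t. t \<in> {0..T} \<Longrightarrow> static_risk_measure M (augmented_filtration M B t) (\<rho> t)"
    and "\<And>X. X \<in> L2 M (augmented_filtration M B T) \<Longrightarrow> continuous_on {0..T} (\<lambda>t. \<rho> t X)"
    and "\<And>t X X'. t \<in> {0..T} \<Longrightarrow>
      X \<in> L2 M (augmented_filtration M B t) \<Longrightarrow> X' \<in> L2 M (augmented_filtration M B t) \<Longrightarrow>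
      \<bar>\<rho> t X - \<rho> t X'\<bar> \<le> C * (\<integral>\<omega>. \<bar>X \<omega> - X' \<omega>\<bar> \<partial>M)"
    and "continuous_on {0..T} q"
    and "generator_assumption M T (augmented_filtration M B) f"
    and "\<xi> \<in> L2 M (augmented_filtration M B T)"
    and "\<rho> T \<xi> \<le> q T"
  shows "(\<exists>Y Z K. deterministic_flat_solution M T B \<rho> q f \<xi> Y Z K \<and>
      (\<forall>Y' Z' K'. deterministic_flat_solution M T B \<rho> q f \<xi> Y' Z' K' \<longrightarrow>
         same_solution M T Y Z K Y' Z' K')) \<and>
    (\<forall>(a :: real \<Rightarrow> real) (h :: 'a \<Rightarrow> real \<Rightarrow> real ^ 'd \<Rightarrow> real).
      a \<in> borel_measurable (restrict_space borel {0..T}) \<longrightarrow> bounded (a ` {0..T}) \<longrightarrow>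
      (\<forall>\<omega>\<in>space M. \<forall>t\<in>{0..T}. \<forall>y z. f \<omega> t y z = a t * y + h \<omega> t z) \<longrightarrow>
      (\<forall>Y Z K Y' Z' K'.
        deterministic_flat_solution M T B \<rho> q f \<xi> Y Z K \<longrightarrow>
        deterministic_solution M T B \<rho> q f \<xi> Y' Z' K' \<longrightarrow>
        (AE \<omega> in M. \<forall>t\<in>{0..T}. Y t \<omega> \<le> Y' t \<omega>)))"
proof -
  interpret reflected_bsde M T B C \<rho> q f \<xi>
    by (intro reflected_bsde.intro reflected_bsde_axioms.intro) (fact assms)+
  obtain g X Z I Y h where "step g X Z I Y h" "AE x in M \<Otimes>\<^sub>M restrict_space lborel {0..T}. h x = g x"
    using fixed_driver_exists by blast
  then have "deterministic_flat_solution M T B \<rho> q f \<xi> (\<lambda>t \<omega>. X t \<omega> + refl X t) Z (\<lambda>t. refl X 0 - refl X t)"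
    by (rule flat_solution_of_step)
  then show ?thesis
    by (intro conjI allI impI exI) (assumption | erule flat_solution_unique, assumption | rule flat_solution_minimal, assumption+, blast)+
qed

end
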